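(* Let $H$ be a quasitriangular Hopf algebra over a field $k$ with invertible antipode, and $g,n\ge0$. There is a morphism of algebras $$\Phi_{g,n}:\mathcal L_{g,n}(H)\to\mathcal{HH}(H^\circ)^{\otimes g}\otimes H^{\otimes n}$$ defined by $$\Phi_{g,n}\bigl(j_{g+l}(\varphi)\bigr)=\sum_{(R)}1^{\otimes g}\otimes1^{\otimes(l-1)}\otimes\Phi_{0,1}\bigl(\mathrm{coad}^r(R_{(1)})(\varphi)\bigr)\otimes\mathsf D_{0,n-l}(R_{(2)}),$$ $$\Phi_{g,n}\bigl(j_k(x)\bigr)=\sum_{(R)}1^{\otimes(k-1)}\otimes\Phi_{1,0}\bigl(\mathrm{coad}^r(R_{(1)})(x)\bigr)\otimes\mathsf D_{g-k,n}(R_{(2)})$$ for all $\varphi\in\mathcal L_{0,1}(H)$, $1\le l\le n$, $x\in\mathcal L_{1,0}(H)$, $1\le k\le g$.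
   Context: **Notation.** $R=\sum R_{(1)}\otimes R_{(2)}\in H^{\otimes2}$ is the $R$-matrix (copies $R^1,R^2,\dots$), $S$ the antipode, $\Delta(h)=\sum h_{(1)}\otimes h_{(2)}$. $H^\circ\subset H^*$ is the span of matrix coefficients of finite-dimensional $H$-modules, with product $\varphi\star\psi=(\varphi\otimes\psi)\Delta$ and unit $\varepsilon$. $(x\rhd\varphi)(h)=\varphi(hx)$, $(\varphi\lhd x)(h)=\varphi(xh)$. **Graph algebra.** $\mathcal L_{0,1}(H)$ is $H^\circ$ with product $\varphi\psi=\sum\bigl(R^2_{(2)}S(R^1_{(2)})\rhd\varphi\bigr)\star\bigl(R^2_{(1)}\rhd\psi\lhd R^1_{(1)}\bigr)$. $\mathcal L_{1,0}(H)$ is $H^\circ\otimes H^\circ$ with product $(\beta\otimes\alpha)(\beta'\otimes\alpha')=\sum\beta\bigl(R^4_{(2)}R^3_{(1)}\rhd\beta'\lhd R^1_{(1)}R^2_{(1)}\bigr)\otimes\bigl(R^3_{(2)}S(R^1_{(2)})\rhd\alpha\lhd R^2_{(2)}R^4_{(1)}\bigr)\alpha'$ (products in each factor in $\mathcal L_{0,1}(H)$). Right action: $\mathrm{coad}^r(h)(\varphi)=\sum S(h_{(2)})\rhd\varphi\lhd h_{(1)}$ on $\mathcal L_{0,1}(H)$, $\mathrm{coad}^r(h)(\beta\otimes\alpha)=\sum\mathrm{coad}^r(h_{(1)})(\beta)\otimes\mathrm{coad}^r(h_{(2)})(\alpha)$ on $\mathcal L_{1,0}(H)$, and similarly on further tensor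 products. $\mathcal L_{g,n}(H)=\mathcal L_{1,0}(H)^{\widetilde\otimes g}\widetilde\otimes\mathcal L_{0,1}(H)^{\widetilde\otimes n}$, where $M\widetilde\otimes N$ is $M\otimes N$ with product $(m\widetilde\otimes n)(m'\widetilde\otimes n')=\sum m\,\mathrm{coad}^r(R_{(1)})(m')\widetilde\otimes\mathrm{coad}^r(R_{(2)})(n)\,n'$. The maps $j_k:\mathcal L_{1,0}(H)\to\mathcal L_{g,n}(H)$ ($1\le k\le g$) and $j_{g+l}:\mathcal L_{0,1}(H)\to\mathcal L_{g,n}(H)$ ($1\le l\le n$) are the algebra embeddings $j_i(x)=1^{\widetilde\otimes(i-1)}\widetilde\otimes x\widetilde\otimes1^{\widetilde\otimes(g+n-i)}$; every element of $\mathcal L_{g,n}(H)$ is a linear combination of ordered products $j_1(x_1)\cdots j_g(x_g)j_{g+1}(\varphi_1)\cdots j_{g+n}(\varphi_n)=x_1\widetilde\otimes\cdots\widetilde\otimes x_g\widetilde\otimes\varphi_1\widetilde\otimes\cdots\widetilde\otimes\varphi_n$. **Two-sided Heisenberg double.** $\mathcal{HH}(H^\circ)=H^\circ\#(H\otimes H^{\mathrm{cop}})$ is the vector space $H^\circ\otimes(H\otimes H)$ with product $$(\varphi\#(x\otimes y))(\psi\#(z\otimes t))=\sum\varphi\star\bigl(x_{(1)}\rhd\psi\lhd S^{-1}(y_{(2)})\bigr)\#(x_{(2)}z\otimes y_{(1)}t).$$ Write $\varphi,h,\widetilde h$ for $\varphi\#(1\otimes1)$, $\varepsilon\#(h\otimes1)$,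 $\varepsilon\#(1\otimes h)$. The Heisenberg double $\mathcal H(H^\circ)=H^\circ\#H$, with product $(\varphi\#x)(\psi\#y)=\sum\varphi\star(x_{(1)}\rhd\psi)\#x_{(2)}y$, is the subalgebra $H^\circ\#(H\otimes1)$. $\mathcal{HH}(H^\circ)^{\otimes g}\otimes H^{\otimes n}$ has the usual tensor product algebra structure. **Maps.** $\Phi_{0,1}:\mathcal L_{0,1}(H)\to H$, $\Phi_{0,1}(\varphi)=\sum\varphi(R^1_{(1)}R^2_{(2)})R^1_{(2)}R^2_{(1)}$; $\Phi_{1,0}:\mathcal L_{1,0}(H)\to\mathcal H(H^\circ)\subset\mathcal{HH}(H^\circ)$, $\Phi_{1,0}(\beta\otimes\alpha)=\sum\bigl(R^1_{(2)}R^2_{(2)}\rhd\beta\lhd R^3_{(1)}R^1_{(1)}\bigr)\#\bigl(R^3_{(2)}R^2_{(1)}\Phi_{0,1}(\alpha)\bigr)$. $\mathsf D_{g,n}:H\to\mathcal{HH}(H^\circ)^{\otimes g}\otimes H^{\otimes n}$, $\mathsf D_{g,n}(h)=\sum\widetilde{h_{(1)}}h_{(2)}\otimes\cdots\otimes\widetilde{h_{(2g-1)}}h_{(2g)}\otimes h_{(2g+1)}\otimes\cdots\otimes h_{(2g+n)}$, with $\mathsf D_{0,0}=\varepsilon$. *)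

theory Defs
  imports "Jordan_Normal_Form.Matrix" "HOL-Library.Function_Algebras"
begin

section \<open>Vector spaces, tensor products and algebras\<close>

text \<open>
  A vector space over the field \<open>'k\<close> is a carrier inside an abelian group type together with a
  scalar multiplication; an algebra carries in addition a product and a unit. Spaces of
  \<open>'k\<close>-valued functions use pointwise addition (from \<open>Function_Algebras\<close>) and \<open>fscale\<close>.
\<close>

record ('k, 'v) vspace =
  vscale :: "'k \<Rightarrow> 'v \<Rightarrow> 'v"
  vcarrier :: "'v set"

record ('k, 'v) kalg = "('k, 'v) vspace" +
  amult :: "'v \<Rightarrow> 'v \<Rightarrow> 'v"
  aone :: "'v"

definition fscale :: "'k::times \<Rightarrow> ('x \<Rightarrow> 'k) \<Rightarrow> ('x \<Rightarrow> 'k)"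
  where "fscale c f = (\<lambda>x. c * f x)"

definition linear_on ::
    "('k, 'v::plus, 'm) vspace_scheme \<Rightarrow> ('k \<Rightarrow> 'u::plus \<Rightarrow> 'u) \<Rightarrow> ('v \<Rightarrow> 'u) \<Rightarrow> bool"
  where "linear_on V s L \<longleftrightarrow>
    (\<forall>x\<in>vcarrier V. \<forall>y\<in>vcarrier V. L (x + y) = L x + L y) \<and>
    (\<forall>c. \<forall>x\<in>vcarrier V. L (vscale V c x) = s c (L x))"

definition alg_hom ::
    "('k, 'v::plus, 'm) kalg_scheme \<Rightarrow> ('k, 'u::plus, 'l) kalg_scheme \<Rightarrow> ('v \<Rightarrow> 'u) \<Rightarrow> bool"
  where "alg_hom A B f \<longleftrightarrow>
    (\<forall>x\<in>vcarrier A. f x \<in> vcarrier B) \<and>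
    linear_on A (vscale B) f \<and>
    (\<forall>x\<in>vcarrier A. \<forall>y\<in>vcarrier A. f (amult A x y) = amult B (f x) (f y)) \<and>
    f (aone A) = aone B"

text \<open>
  All tensor products below have the form \<open>A\<^sup>g \<otimes> B\<^sup>n\<close> (tensor powers of two spaces). A word
  \<open>(as, bs)\<close> with \<open>g\<close> letters in \<open>A\<close> and \<open>n\<close> letters in \<open>B\<close> stands for the pure tensor
  \<open>a\<^sub>1 \<otimes> \<dots> \<otimes> a\<^sub>g \<otimes> b\<^sub>1 \<otimes> \<dots> \<otimes> b\<^sub>n\<close>. This pure tensor is realised as evaluation at the word on
  the space of multilinear forms, and the tensor product is the span of the pure tensors.
  Over a field this is the usual tensor product: lemma \<open>tensor_universal\<close> below is its universal
  property.
\<close>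

type_synonym ('k, 'a, 'b) tensor = "('a list \<times> 'b list \<Rightarrow> 'k) \<Rightarrow> 'k"

definition words ::
    "('k, 'a, 'm) vspace_scheme \<Rightarrow> ('k, 'b, 'l) vspace_scheme \<Rightarrow> nat \<Rightarrow> nat \<Rightarrow> ('a list \<times> 'b list) set"
  where "words A B g n =
    {(as, bs). length as = g \<and> set as \<subseteq> vcarrier A \<and> length bs = n \<and> set bs \<subseteq> vcarrier B}"

definition multilinear ::
    "('k, 'a::plus, 'm) vspace_scheme \<Rightarrow> ('k, 'b::plus, 'l) vspace_scheme \<Rightarrow> nat \<Rightarrow> nat \<Rightarrow>
     ('k \<Rightarrow> 'u::plus \<Rightarrow> 'u) \<Rightarrow> ('a list \<times> 'b list \<Rightarrow> 'u) \<Rightarrow> bool"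
  where "multilinear A B g n s F \<longleftrightarrow> (\<forall>(as, bs)\<in>words A B g n.
    (\<forall>i<g. \<forall>x\<in>vcarrier A. \<forall>y\<in>vcarrier A.
       F (as[i := x + y], bs) = F (as[i := x], bs) + F (as[i := y], bs)) \<and>
    (\<forall>i<g. \<forall>c. \<forall>x\<in>vcarrier A. F (as[i := vscale A c x], bs) = s c (F (as[i := x], bs))) \<and>
    (\<forall>i<n. \<forall>x\<in>vcarrier B. \<forall>y\<in>vcarrier B.
       F (as, bs[i := x + y]) = F (as, bs[i := x]) + F (as, bs[i := y])) \<and>
    (\<forall>i<n. \<forall>c. \<forall>x\<in>vcarrier B. F (as, bs[i := vscale B c x]) = s c (F (as, bs[i := x]))))"

definition pure ::
    "('k::field, 'a::plus, 'm) vspace_scheme \<Rightarrow> ('k, 'b::plus, 'l) vspace_scheme \<Rightarrow> nat \<Rightarrow> nat \<Rightarrow>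
     'a list \<times> 'b list \<Rightarrow> ('k, 'a, 'b) tensor"
  where "pure A B g n w = (\<lambda>f. if multilinear A B g n (*) f then f w else 0)"

definition tensor ::
    "('k::field, 'a::plus, 'm) vspace_scheme \<Rightarrow> ('k, 'b::plus, 'l) vspace_scheme \<Rightarrow> nat \<Rightarrow> nat \<Rightarrow>
     ('k, ('k, 'a, 'b) tensor) vspace"
  where "tensor A B g n =
    \<lparr>vscale = fscale, vcarrier = module.span fscale (pure A B g n ` words A B g n)\<rparr>"

text \<open>
  The linear map on \<open>A\<^sup>g \<otimes> B\<^sup>n\<close> induced by a multilinear map \<open>F\<close> with values in a type with scalar
  multiplication \<open>s\<close>.
\<close>

definition tlift ::
    "('k::field, 'a::plus, 'm) vspace_scheme \<Rightarrow> ('k, 'b::plus, 'l) vspace_scheme \<Rightarrow> nat \<Rightarrow> nat \<Rightarrow>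
     ('k \<Rightarrow> 'u::plus \<Rightarrow> 'u) \<Rightarrow> ('a list \<times> 'b list \<Rightarrow> 'u) \<Rightarrow> ('k, 'a, 'b) tensor \<Rightarrow> 'u"
  where "tlift A B g n s F =
    (SOME L. linear_on (tensor A B g n) s L \<and> (\<forall>w\<in>words A B g n. L (pure A B g n w) = F w))"

lemma vector_space_fscale: "vector_space (fscale :: 'k::field \<Rightarrow> ('x \<Rightarrow> 'k) \<Rightarrow> _)"
  by standard (auto simp: fscale_def fun_eq_iff algebra_simps)

lemma vector_space_mult: "vector_space ((*) :: 'k::field \<Rightarrow> 'k \<Rightarrow> 'k)"
  by standard (auto simp: algebra_simps)

lemma functionals_separate:
  fixes s :: "'k::field \<Rightarrow> 'u::ab_group_add \<Rightarrow> 'u"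
  assumes "vector_space s" and "\<And>l. Vector_Spaces.linear s (*) l \<Longrightarrow> l u = l v"
  shows "u = v"
proof (rule ccontr)
  assume "u \<noteq> v"
  interpret s: vector_space s by fact
  interpret k: vector_space "(*) :: 'k \<Rightarrow> 'k \<Rightarrow> 'k" by (rule vector_space_mult)
  interpret vector_space_pair s "(*) :: 'k \<Rightarrow> 'k \<Rightarrow> 'k" ..
  have "s.independent {u - v}" using \<open>u \<noteq> v\<close> by simp
  from linear_independent_extend[OF this, of "\<lambda>_. 1"]
  obtain l where l: "Vector_Spaces.linear s (*) l" "l (u - v) = 1" by auto
  then have "l u - l v = 1"
    using module_hom.diff[of s "(*)" l u v] by (simp add: Vector_Spaces.linear_def)
  with assms(2)[OF l(1)] show False by simp
qed

lemma tensor_universal: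
  fixes A :: "('k::field, 'a::plus, 'm) vspace_scheme" and B :: "('k, 'b::plus, 'l) vspace_scheme"
    and s :: "'k \<Rightarrow> 'u::ab_group_add \<Rightarrow> 'u"
  assumes s: "vector_space s" and F: "multilinear A B g n s F"
  shows "linear_on (tensor A B g n) s (tlift A B g n s F)"
    and "\<And>w. w \<in> words A B g n \<Longrightarrow> tlift A B g n s F (pure A B g n w) = F w"
    and "\<And>L X. linear_on (tensor A B g n) s L \<Longrightarrow>
           (\<And>w. w \<in> words A B g n \<Longrightarrow> L (pure A B g n w) = F w) \<Longrightarrow>
           X \<in> vcarrier (tensor A B g n) \<Longrightarrow> L X = tlift A B g n s F X"
proof -
  interpret s: vector_space s by fact
  interpret f: vector_space "fscale :: 'k \<Rightarrow> (('a list \<times> 'b list \<Rightarrow> 'k) \<Rightarrow> 'k) \<Rightarrow> _"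
    by (rule vector_space_fscale)
  let ?T = "f.span (pure A B g n ` words A B g n)"
  define P where "P t u \<longleftrightarrow> (\<forall>l. Vector_Spaces.linear s (*) l \<longrightarrow> l u = t (l \<circ> F))" for t u
  have add: "l (x + y) = l x + l y" and scl: "l (s c x) = c * l x"
    if "Vector_Spaces.linear s (*) l" for l c x y
    using that module_hom.add[of s "(*)" l x y] module_hom.scale[of s "(*)" l c x]
    by (simp_all add: Vector_Spaces.linear_def)
  have uniq: "u = v" if "P t u" "P t v" for t u v
  proof (rule functionals_separate[OF s])
    fix l assume l: "Vector_Spaces.linear s (*) l"
    have "l u = t (l \<circ> F)" using that(1) l unfolding P_def by blast
    moreover have "l v = t (l \<circ> F)" using that(2) l unfolding P_def by blast
    ultimately show "l u = l v" by (rule trans[OF _ sym])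
  qed
  have P_add: "P (t + t') (u + u')" if "P t u" "P t' u'" for t t' u u'
    using that by (simp add: P_def add)
  have P_scale: "P (fscale c t) (s c u)" if "P t u" for c t u
    using that by (simp add: P_def scl fscale_def)
  have P_pure: "P (pure A B g n w) (F w)" if "w \<in> words A B g n" for w
    unfolding P_def
  proof (intro allI impI)
    fix l assume l: "Vector_Spaces.linear s (*) l"
    have "multilinear A B g n (*) (l \<circ> F)"
      using F unfolding multilinear_def by (auto simp: add[OF l] scl[OF l])
    then show "l (F w) = pure A B g n w (l \<circ> F)" by (simp add: pure_def)
  qed
  have P_ex: "\<exists>u. P t u" if "t \<in> ?T" for t
    using that
  proof (induction rule: f.span_induct_alt)
    case base
    have "P 0 0" unfolding P_def
      using scl[of _ 0 0] by (auto simp: s.scale_zero_left)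
    then show ?case by blast
  next
    case (step c x y)
    then show ?case using P_add P_scale P_pure by blast
  qed
  define M where "M t = (THE u. P t u)" for t
  have M: "M t = u" if "P t u" for t u
    unfolding M_def using that uniq by blast
  have PM: "P t (M t)" if "t \<in> ?T" for t using P_ex[OF that] M by blast
  have "linear_on (tensor A B g n) s M"
    unfolding linear_on_def tensor_def
    by (auto intro!: M P_add P_scale PM)
  moreover have "\<forall>w\<in>words A B g n. M (pure A B g n w) = F w"
    using P_pure M by blast
  ultimately have "\<exists>L. linear_on (tensor A B g n) s L \<and>
      (\<forall>w\<in>words A B g n. L (pure A B g n w) = F w)" by blast
  from someI_ex[OF this] have "linear_on (tensor A B g n) s (tlift A B g n s F) \<and>
      (\<forall>w\<in>words A B g n. tlift A B g n s F (pure A B g n w) = F w)"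
    unfolding tlift_def .
  then show lin: "linear_on (tensor A B g n) s (tlift A B g n s F)"
    and pur: "\<And>w. w \<in> words A B g n \<Longrightarrow> tlift A B g n s F (pure A B g n w) = F w" by auto
  fix L X
  assume L: "linear_on (tensor A B g n) s L"
    and Lp: "\<And>w. w \<in> words A B g n \<Longrightarrow> L (pure A B g n w) = F w"
    and X: "X \<in> vcarrier (tensor A B g n)"
  have zero: "K 0 = 0" if "linear_on (tensor A B g n) s K" for K
  proof -
    have "0 \<in> vcarrier (tensor A B g n)" by (simp add: tensor_def f.span_zero)
    then have "K (0 + 0) = K 0 + K 0" using that unfolding linear_on_def by blast
    then show ?thesis by simp
  qed
  from X have "X \<in> ?T" by (simp add: tensor_def)
  then have "X \<in> ?T \<and> L X = tlift A B g n s F X"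
  proof (induction rule: f.span_induct_alt)
    case base
    then show ?case
      using zero[OF L] zero[OF lin] f.span_zero[of "pure A B g n ` words A B g n"]
      unfolding zero_fun_def by simp
  next
    case (step c x y)
    from step(1) have x: "x \<in> ?T" "L x = tlift A B g n s F x"
      using Lp pur by (auto intro: f.span_base)
    then have cx: "fscale c x \<in> ?T" by (simp add: f.span_scale)
    have "fscale c x + y \<in> ?T \<and> L (fscale c x + y) = tlift A B g n s F (fscale c x + y)"
      using step L lin x cx f.span_add[OF cx] by (simp add: linear_on_def tensor_def)
    then show ?case unfolding plus_fun_def .
  qed
  then show "L X = tlift A B g n s F X" by simp
qed

definition pair ::
    "('k::field, 'a::plus, 'm) vspace_scheme \<Rightarrow> ('k, 'b::plus, 'l) vspace_scheme \<Rightarrow>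
     'a \<Rightarrow> 'b \<Rightarrow> ('k, 'a, 'b) tensor"
  where "pair A B a b = pure A B 1 1 ([a], [b])"

definition tlift2 ::
    "('k::field, 'a::plus, 'm) vspace_scheme \<Rightarrow> ('k, 'b::plus, 'l) vspace_scheme \<Rightarrow>
     ('k \<Rightarrow> 'u::plus \<Rightarrow> 'u) \<Rightarrow> ('a \<Rightarrow> 'b \<Rightarrow> 'u) \<Rightarrow> ('k, 'a, 'b) tensor \<Rightarrow> 'u"
  where "tlift2 A B s F = tlift A B 1 1 s (\<lambda>(as, bs). F (hd as) (hd bs))"

definition tensor_alg ::
    "('k::field, 'a::plus, 'm) kalg_scheme \<Rightarrow> ('k, 'b::plus, 'l) kalg_scheme \<Rightarrow> nat \<Rightarrow> nat \<Rightarrow>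
     ('k, ('k, 'a, 'b) tensor) kalg"
  where "tensor_alg A B g n =
    \<lparr>vscale = fscale,
     vcarrier = vcarrier (tensor A B g n),
     amult = (\<lambda>X Y.
       tlift A B g n fscale (\<lambda>(as, bs).
         tlift A B g n fscale (\<lambda>(as', bs').
           pure A B g n (map2 (amult A) as as', map2 (amult B) bs bs')) Y) X),
     aone = pure A B g n (replicate g (aone A), replicate n (aone B))\<rparr>"


section \<open>Quasitriangular Hopf algebras\<close>

text \<open>
  The underlying ring of the Hopf algebra is the type \<open>'h\<close>. The class \<open>ring_1\<close> excludes only the
  zero ring, which has no counit over a field. The powers of \<open>H\<close> are the
  tensor products above with no letters of the first kind.
\<close>

record ('k, 'h) qthopf =
  hscale :: "'k \<Rightarrow> 'h \<Rightarrow> 'h"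
  comul :: "'h \<Rightarrow> ('k, 'h, 'h) tensor"
  counit :: "'h \<Rightarrow> 'k"
  antipode :: "'h \<Rightarrow> 'h"
  rmat :: "('k, 'h, 'h) tensor"

definition Halg :: "('k::field, 'h::ring_1) qthopf \<Rightarrow> ('k, 'h) kalg"
  where "Halg H = \<lparr>vscale = hscale H, vcarrier = UNIV, amult = (*), aone = 1\<rparr>"

definition hpow :: "('k::field, 'h::ring_1) qthopf \<Rightarrow> nat \<Rightarrow> ('k, ('k, 'h, 'h) tensor) kalg"
  where "hpow H m = tensor_alg (Halg H) (Halg H) 0 m"

definition hpure :: "('k::field, 'h::ring_1) qthopf \<Rightarrow> 'h list \<Rightarrow> ('k, 'h, 'h) tensor"
  where "hpure H hs = pure (Halg H) (Halg H) 0 (length hs) ([], hs)"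

definition hlift ::
    "('k::field, 'h::ring_1) qthopf \<Rightarrow> nat \<Rightarrow> ('k \<Rightarrow> 'u::plus \<Rightarrow> 'u) \<Rightarrow> ('h list \<Rightarrow> 'u) \<Rightarrow>
     ('k, 'h, 'h) tensor \<Rightarrow> 'u"
  where "hlift H m s F = tlift (Halg H) (Halg H) 0 m s (\<lambda>(_, hs). F hs)"

text \<open>
  Sweedler sums: for \<open>t = \<Sum> t\<^sub>1 \<otimes> t\<^sub>2\<close> in \<open>H \<otimes> H\<close>, \<open>sw H s t F\<close> is \<open>\<Sum> F t\<^sub>1 t\<^sub>2\<close>, where \<open>s\<close> is the scalar
  multiplication of the target of the bilinear map \<open>F\<close>.
\<close>

definition sw ::
    "('k::field, 'h::ring_1) qthopf \<Rightarrow> ('k \<Rightarrow> 'u::plus \<Rightarrow> 'u) \<Rightarrow> ('k, 'h, 'h) tensor \<Rightarrow>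
     ('h \<Rightarrow> 'h \<Rightarrow> 'u) \<Rightarrow> 'u"
  where "sw H s t F = hlift H 2 s (\<lambda>hs. F (hs ! 0) (hs ! 1)) t"

abbreviation sumD ::
    "('k::field, 'h::ring_1) qthopf \<Rightarrow> ('k \<Rightarrow> 'u::plus \<Rightarrow> 'u) \<Rightarrow> 'h \<Rightarrow> ('h \<Rightarrow> 'h \<Rightarrow> 'u) \<Rightarrow> 'u"
  where "sumD H s h F \<equiv> sw H s (comul H h) F"

abbreviation sumR ::
    "('k::field, 'h::ring_1) qthopf \<Rightarrow> ('k \<Rightarrow> 'u::plus \<Rightarrow> 'u) \<Rightarrow> ('h \<Rightarrow> 'h \<Rightarrow> 'u) \<Rightarrow> 'u"
  where "sumR H s F \<equiv> sw H s (rmat H) F"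

locale hopf_algebra = vector_space "hscale H" for H :: "('k::field, 'h::ring_1) qthopf" +
  assumes scale_mult_left: "hscale H c (x * y) = hscale H c x * y"
    and scale_mult_right: "hscale H c (x * y) = x * hscale H c y"
    and comul_closed: "comul H x \<in> vcarrier (hpow H 2)"
    and comul_linear: "Vector_Spaces.linear (hscale H) fscale (comul H)"
    and counit_linear: "Vector_Spaces.linear (hscale H) (*) (counit H)"
    and antipode_linear: "Vector_Spaces.linear (hscale H) (hscale H) (antipode H)"
    and coassoc:
      "sumD H fscale x (\<lambda>a b. sumD H fscale a (\<lambda>a1 a2. hpure H [a1, a2, b])) =
       sumD H fscale x (\<lambda>a b. sumD H fscale b (\<lambda>b1 b2. hpure H [a, b1, b2]))"
    and counit_left: "sumD H (hscale H) x (\<lambda>a b. hscale H (counit H a) b) = x"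
    and counit_right: "sumD H (hscale H) x (\<lambda>a b. hscale H (counit H b) a) = x"
    and comul_mult: "comul H (x * y) = amult (hpow H 2) (comul H x) (comul H y)"
    and comul_one: "comul H 1 = aone (hpow H 2)"
    and counit_mult: "counit H (x * y) = counit H x * counit H y"
    and counit_one: "counit H 1 = 1"
    and antipode_left: "sumD H (hscale H) x (\<lambda>a b. antipode H a * b) = hscale H (counit H x) 1"
    and antipode_right: "sumD H (hscale H) x (\<lambda>a b. a * antipode H b) = hscale H (counit H x) 1"

definition R12 :: "('k::field, 'h::ring_1) qthopf \<Rightarrow> ('k, 'h, 'h) tensor"
  where "R12 H = sumR H fscale (\<lambda>a b. hpure H [a, b, 1])"

definition R13 :: "('k::field, 'h::ring_1) qthopf \<Rightarrow> ('k, 'h, 'h) tensor"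
  where "R13 H = sumR H fscale (\<lambda>a b. hpure H [a, 1, b])"

definition R23 :: "('k::field, 'h::ring_1) qthopf \<Rightarrow> ('k, 'h, 'h) tensor"
  where "R23 H = sumR H fscale (\<lambda>a b. hpure H [1, a, b])"

locale quasitriangular_hopf_algebra = hopf_algebra H
  for H :: "('k::field, 'h::ring_1) qthopf" +
  assumes rmat_closed: "rmat H \<in> vcarrier (hpow H 2)"
    and rmat_invertible:
      "\<exists>Q\<in>vcarrier (hpow H 2). amult (hpow H 2) (rmat H) Q = aone (hpow H 2) \<and>
                               amult (hpow H 2) Q (rmat H) = aone (hpow H 2)"
    and rmat_comul:
      "amult (hpow H 2) (rmat H) (comul H x) =
       amult (hpow H 2) (sumD H fscale x (\<lambda>a b. hpure H [b, a])) (rmat H)"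
    and rmat_comul_left:
      "sumR H fscale (\<lambda>a b. sumD H fscale a (\<lambda>a1 a2. hpure H [a1, a2, b])) =
       amult (hpow H 3) (R13 H) (R23 H)"
    and rmat_comul_right:
      "sumR H fscale (\<lambda>a b. sumD H fscale b (\<lambda>b1 b2. hpure H [a, b1, b2])) =
       amult (hpow H 3) (R13 H) (R12 H)"

text \<open>
  \<open>itcomul H m h = \<Sum> h\<^sub>1 \<otimes> \<dots> \<otimes> h\<^sub>m\<close>; for \<open>m = 0\<close> this is the counit, with values in \<open>H\<^sup>0 = k\<close>.
\<close>

primrec itcomul :: "('k::field, 'h::ring_1) qthopf \<Rightarrow> nat \<Rightarrow> 'h \<Rightarrow> ('k, 'h, 'h) tensor"
  where
    "itcomul H 0 h = fscale (counit H h) (hpure H [])"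
  | "itcomul H (Suc m) h =
       sumD H fscale h (\<lambda>a b. hlift H m fscale (\<lambda>hs. hpure H (a # hs)) (itcomul H m b))"


section \<open>The restricted dual\<close>

text \<open>
  A finite-dimensional module, in coordinates: an algebra morphism into the \<open>d \<times> d\<close> matrices.
\<close>

definition matrix_rep :: "('k::field, 'h::ring_1) qthopf \<Rightarrow> nat \<Rightarrow> ('h \<Rightarrow> 'k mat) \<Rightarrow> bool"
  where "matrix_rep H d \<rho> \<longleftrightarrow>
    (\<forall>x. \<rho> x \<in> carrier_mat d d) \<and>
    (\<forall>x y. \<rho> (x + y) = \<rho> x + \<rho> y) \<and>
    (\<forall>c x. \<rho> (hscale H c x) = c \<cdot>\<^sub>m \<rho> x) \<and>
    (\<forall>x y. \<rho> (x * y) = \<rho> x * \<rho> y) \<and>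
    \<rho> 1 = 1\<^sub>m d"

definition matrix_coefficients :: "('k::field, 'h::ring_1) qthopf \<Rightarrow> ('h \<Rightarrow> 'k) set"
  where "matrix_coefficients H =
    {\<phi>. \<exists>d \<rho> u v. matrix_rep H d \<rho> \<and> u \<in> carrier_vec d \<and> v \<in> carrier_vec d \<and>
        \<phi> = (\<lambda>x. u \<bullet> (\<rho> x *\<^sub>v v))}"

definition Hdual :: "('k::field, 'h::ring_1) qthopf \<Rightarrow> ('k, 'h \<Rightarrow> 'k) vspace"
  where "Hdual H =
    \<lparr>vscale = fscale, vcarrier = module.span fscale (matrix_coefficients H)\<rparr>"

definition star :: "('k::field, 'h::ring_1) qthopf \<Rightarrow> ('h \<Rightarrow> 'k) \<Rightarrow> ('h \<Rightarrow> 'k) \<Rightarrow> ('h \<Rightarrow> 'k)"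
  where "star H \<phi> \<psi> = (\<lambda>h. sumD H (*) h (\<lambda>a b. \<phi> a * \<psi> b))"

definition lact :: "'h::times \<Rightarrow> ('h \<Rightarrow> 'k) \<Rightarrow> ('h \<Rightarrow> 'k)" (infixr \<open>\<triangleright>\<close> 67)
  where "x \<triangleright> \<phi> = (\<lambda>h. \<phi> (h * x))"

definition ract :: "('h::times \<Rightarrow> 'k) \<Rightarrow> 'h \<Rightarrow> ('h \<Rightarrow> 'k)" (infixl \<open>\<triangleleft>\<close> 66)
  where "\<phi> \<triangleleft> x = (\<lambda>h. \<phi> (x * h))"


section \<open>Graph algebras\<close>

definition L01 :: "('k::field, 'h::ring_1) qthopf \<Rightarrow> ('k, 'h \<Rightarrow> 'k) kalg"
  where "L01 H =
    \<lparr>vscale = fscale,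
     vcarrier = vcarrier (Hdual H),
     amult = (\<lambda>\<phi> \<psi>.
       sumR H fscale (\<lambda>a1 a2. sumR H fscale (\<lambda>b1 b2.
         star H (b2 * antipode H a2 \<triangleright> \<phi>) (b1 \<triangleright> \<psi> \<triangleleft> a1)))),
     aone = counit H\<rparr>"

text \<open>
  In sums over several copies of the R-matrix, \<open>a\<close>, \<open>b\<close>, \<open>c\<close>, \<open>d\<close> are the copies
  \<open>R\<^sup>1\<close>, \<open>R\<^sup>2\<close>, \<open>R\<^sup>3\<close>, \<open>R\<^sup>4\<close>.
\<close>

type_synonym ('k, 'h) L10_elt = "('k, 'h \<Rightarrow> 'k, 'h \<Rightarrow> 'k) tensor"

definition L10 :: "('k::field, 'h::ring_1) qthopf \<Rightarrow> ('k, ('k, 'h) L10_elt) kalg"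
  where "L10 H =
    \<lparr>vscale = fscale,
     vcarrier = vcarrier (tensor (Hdual H) (Hdual H) 1 1),
     amult = (\<lambda>X Y.
       tlift2 (Hdual H) (Hdual H) fscale (\<lambda>\<beta> \<alpha>.
         tlift2 (Hdual H) (Hdual H) fscale (\<lambda>\<beta>' \<alpha>'.
           sumR H fscale (\<lambda>a1 a2. sumR H fscale (\<lambda>b1 b2.
           sumR H fscale (\<lambda>c1 c2. sumR H fscale (\<lambda>d1 d2.
             pair (Hdual H) (Hdual H)
               (amult (L01 H) \<beta> (d2 * c1 \<triangleright> \<beta>' \<triangleleft> a1 * b1))
               (amult (L01 H) (c2 * antipode H a2 \<triangleright> \<alpha> \<triangleleft> b2 * d1) \<alpha>')))))) Y) X),
     aone = pair (Hdual H) (Hdual H) (counit H) (counit H)\<rparr>"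

definition coad01 :: "('k::field, 'h::ring_1) qthopf \<Rightarrow> 'h \<Rightarrow> ('h \<Rightarrow> 'k) \<Rightarrow> ('h \<Rightarrow> 'k)"
  where "coad01 H h \<phi> = sumD H fscale h (\<lambda>h1 h2. antipode H h2 \<triangleright> \<phi> \<triangleleft> h1)"

definition coad10 ::
    "('k::field, 'h::ring_1) qthopf \<Rightarrow> 'h \<Rightarrow> ('k, 'h) L10_elt \<Rightarrow> ('k, 'h) L10_elt"
  where "coad10 H h =
    tlift2 (Hdual H) (Hdual H) fscale (\<lambda>\<beta> \<alpha>.
      sumD H fscale h (\<lambda>h1 h2. pair (Hdual H) (Hdual H) (coad01 H h1 \<beta>) (coad01 H h2 \<alpha>)))"

type_synonym ('k, 'h) graph_elt = "('k, ('k, 'h) L10_elt, 'h \<Rightarrow> 'k) tensor"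

abbreviation Lpure ::
    "('k::field, 'h::ring_1) qthopf \<Rightarrow> nat \<Rightarrow> nat \<Rightarrow> ('k, 'h) L10_elt list \<times> ('h \<Rightarrow> 'k) list \<Rightarrow>
     ('k, 'h) graph_elt"
  where "Lpure H \<equiv> pure (L10 H) (L01 H)"

abbreviation Llift ::
    "('k::field, 'h::ring_1) qthopf \<Rightarrow> nat \<Rightarrow> nat \<Rightarrow>
     (('k, 'h) L10_elt list \<times> ('h \<Rightarrow> 'k) list \<Rightarrow> 'x \<Rightarrow> 'k) \<Rightarrow> ('k, 'h) graph_elt \<Rightarrow> 'x \<Rightarrow> 'k"
  where "Llift H g n \<equiv> tlift (L10 H) (L01 H) g n fscale"

definition coad ::
    "('k::field, 'h::ring_1) qthopf \<Rightarrow> nat \<Rightarrow> nat \<Rightarrow> 'h \<Rightarrow> ('k, 'h) graph_elt \<Rightarrow> ('k, 'h) graph_elt"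
  where "coad H g n h =
    Llift H g n (\<lambda>(xs, \<phi>s).
      hlift H (g + n) fscale (\<lambda>hs.
        Lpure H g n (map2 (coad10 H) (take g hs) xs, map2 (coad01 H) (drop g hs) \<phi>s))
      (itcomul H (g + n) h))"

text \<open>
  The product of the iterated braided tensor product, by splitting off the first tensor factor:
  \<open>(m \<otimes> t) (m' \<otimes> t') = \<Sum> m coad(R\<^sub>1)(m') \<otimes> coad(R\<^sub>2)(t) t'\<close>, where \<open>t\<close>, \<open>t'\<close> are in the
  braided tensor product of the remaining factors.
\<close>

fun graph_mult ::
    "('k::field, 'h::ring_1) qthopf \<Rightarrow> nat \<Rightarrow> nat \<Rightarrow>
     ('k, 'h) graph_elt \<Rightarrow> ('k, 'h) graph_elt \<Rightarrow> ('k, 'h) graph_elt"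
  where
    "graph_mult H 0 0 X Y =
       Llift H 0 0 (\<lambda>_. Llift H 0 0 (\<lambda>_. Lpure H 0 0 ([], [])) Y) X"
  | "graph_mult H 0 (Suc n) X Y =
       Llift H 0 (Suc n) (\<lambda>(_, \<phi>s).
         Llift H 0 (Suc n) (\<lambda>(_, \<psi>s).
           sumR H fscale (\<lambda>a b.
             Llift H 0 n (\<lambda>(_, \<chi>s).
               Lpure H 0 (Suc n) ([], amult (L01 H) (hd \<phi>s) (coad01 H a (hd \<psi>s)) # \<chi>s))
             (graph_mult H 0 n (coad H 0 n b (Lpure H 0 n ([], tl \<phi>s)))
                               (Lpure H 0 n ([], tl \<psi>s))))) Y) X"
  | "graph_mult H (Suc g) n X Y =
       Llift H (Suc g) n (\<lambda>(xs, \<phi>s).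
         Llift H (Suc g) n (\<lambda>(ys, \<psi>s).
           sumR H fscale (\<lambda>a b.
             Llift H g n (\<lambda>(zs, \<chi>s).
               Lpure H (Suc g) n (amult (L10 H) (hd xs) (coad10 H a (hd ys)) # zs, \<chi>s))
             (graph_mult H g n (coad H g n b (Lpure H g n (tl xs, \<phi>s)))
                               (Lpure H g n (tl ys, \<psi>s))))) Y) X"

definition graph_alg ::
    "('k::field, 'h::ring_1) qthopf \<Rightarrow> nat \<Rightarrow> nat \<Rightarrow> ('k, ('k, 'h) graph_elt) kalg"
  where "graph_alg H g n =
    \<lparr>vscale = fscale,
     vcarrier = vcarrier (tensor (L10 H) (L01 H) g n),
     amult = graph_mult H g n,
     aone = Lpure H g n (replicate g (aone (L10 H)), replicate n (aone (L01 H)))\<rparr>"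

text \<open>\<open>j_handle\<close> is \<open>j\<^sub>k\<close> for \<open>1 \<le> k \<le> g\<close>, and \<open>j_puncture\<close> is \<open>j\<^sub>g\<^sub>+\<^sub>l\<close> for \<open>1 \<le> l \<le> n\<close>.\<close>

definition j_handle ::
    "('k::field, 'h::ring_1) qthopf \<Rightarrow> nat \<Rightarrow> nat \<Rightarrow> nat \<Rightarrow> ('k, 'h) L10_elt \<Rightarrow> ('k, 'h) graph_elt"
  where "j_handle H g n k x =
    Lpure H g n (replicate (k - 1) (aone (L10 H)) @ x # replicate (g - k) (aone (L10 H)),
                 replicate n (aone (L01 H)))"

definition j_puncture ::
    "('k::field, 'h::ring_1) qthopf \<Rightarrow> nat \<Rightarrow> nat \<Rightarrow> nat \<Rightarrow> ('h \<Rightarrow> 'k) \<Rightarrow> ('k, 'h) graph_elt"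
  where "j_puncture H g n l \<phi> =
    Lpure H g n (replicate g (aone (L10 H)),
                 replicate (l - 1) (aone (L01 H)) @ \<phi> # replicate (n - l) (aone (L01 H)))"


section \<open>The two-sided Heisenberg double\<close>

type_synonym ('k, 'h) HH_elt = "('k, 'h \<Rightarrow> 'k, 'h) tensor"

definition HHpure :: "('k::field, 'h::ring_1) qthopf \<Rightarrow> ('h \<Rightarrow> 'k) \<Rightarrow> 'h \<Rightarrow> 'h \<Rightarrow> ('k, 'h) HH_elt"
  where "HHpure H \<phi> x y = pure (Hdual H) (Halg H) 1 2 ([\<phi>], [x, y])"

definition HHlift ::
    "('k::field, 'h::ring_1) qthopf \<Rightarrow> (('h \<Rightarrow> 'k) \<Rightarrow> 'h \<Rightarrow> 'h \<Rightarrow> 'x \<Rightarrow> 'k) \<Rightarrow> ('k, 'h) HH_elt \<Rightarrow> 'x \<Rightarrow> 'k"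
  where "HHlift H F =
    tlift (Hdual H) (Halg H) 1 2 fscale (\<lambda>(\<phi>s, xs). F (hd \<phi>s) (xs ! 0) (xs ! 1))"

definition HH :: "('k::field, 'h::ring_1) qthopf \<Rightarrow> ('k, ('k, 'h) HH_elt) kalg"
  where "HH H =
    \<lparr>vscale = fscale,
     vcarrier = vcarrier (tensor (Hdual H) (Halg H) 1 2),
     amult = (\<lambda>X Y.
       HHlift H (\<lambda>\<phi> x y. HHlift H (\<lambda>\<psi> z t.
         sumD H fscale x (\<lambda>x1 x2. sumD H fscale y (\<lambda>y1 y2.
           HHpure H (star H \<phi> (x1 \<triangleright> \<psi> \<triangleleft> inv_into UNIV (antipode H) y2)) (x2 * z) (y1 * t)))) Y) X),
     aone = HHpure H (counit H) 1 1\<rparr>"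

abbreviation Tpure ::
    "('k::field, 'h::ring_1) qthopf \<Rightarrow> nat \<Rightarrow> nat \<Rightarrow> ('k, 'h) HH_elt list \<times> 'h list \<Rightarrow>
     ('k, ('k, 'h) HH_elt, 'h) tensor"
  where "Tpure H \<equiv> pure (HH H) (Halg H)"

abbreviation Tlift ::
    "('k::field, 'h::ring_1) qthopf \<Rightarrow> nat \<Rightarrow> nat \<Rightarrow> (('k, 'h) HH_elt list \<times> 'h list \<Rightarrow> 'x \<Rightarrow> 'k) \<Rightarrow>
     ('k, ('k, 'h) HH_elt, 'h) tensor \<Rightarrow> 'x \<Rightarrow> 'k"
  where "Tlift H g n \<equiv> tlift (HH H) (Halg H) g n fscale"

definition Phi01 :: "('k::field, 'h::ring_1) qthopf \<Rightarrow> ('h \<Rightarrow> 'k) \<Rightarrow> 'h"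
  where "Phi01 H \<phi> =
    sumR H (hscale H) (\<lambda>a1 a2. sumR H (hscale H) (\<lambda>b1 b2.
      hscale H (\<phi> (a1 * b2)) (a2 * b1)))"

text \<open>The Heisenberg double is embedded in the two-sided one by \<open>\<phi> # x \<mapsto> \<phi> # (x \<otimes> 1)\<close>.\<close>

definition Phi10 :: "('k::field, 'h::ring_1) qthopf \<Rightarrow> ('k, 'h) L10_elt \<Rightarrow> ('k, 'h) HH_elt"
  where "Phi10 H =
    tlift2 (Hdual H) (Hdual H) fscale (\<lambda>\<beta> \<alpha>.
      sumR H fscale (\<lambda>a1 a2. sumR H fscale (\<lambda>b1 b2. sumR H fscale (\<lambda>c1 c2.
        HHpure H (a2 * b2 \<triangleright> \<beta> \<triangleleft> c1 * a1) (c2 * b1 * Phi01 H \<alpha>) 1))))"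

text \<open>
  With 0-based list indices, \<open>hs ! (2 * i)\<close> and \<open>hs ! (2 * i + 1)\<close> are the Sweedler components
  numbered \<open>2i + 1\<close> and \<open>2i + 2\<close>.
\<close>

definition Dmap ::
    "('k::field, 'h::ring_1) qthopf \<Rightarrow> nat \<Rightarrow> nat \<Rightarrow> 'h \<Rightarrow> ('k, ('k, 'h) HH_elt, 'h) tensor"
  where "Dmap H g n h =
    hlift H (2 * g + n) fscale (\<lambda>hs.
      Tpure H g n
        (map (\<lambda>i. amult (HH H) (HHpure H (counit H) 1 (hs ! (2 * i)))
                                (HHpure H (counit H) (hs ! (2 * i + 1)) 1)) [0..<g],
         drop (2 * g) hs))
    (itcomul H (2 * g + n) h)"

text \<open>
  \<open>place_handle H g n k y t = 1\<^sup>k\<^sup>-\<^sup>1 \<otimes> y \<otimes> t\<close> for \<open>t\<close> in the target with parameters \<open>g - k, n\<close>, and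
  \<open>place_puncture H g n l y t = 1\<^sup>g \<otimes> 1\<^sup>l\<^sup>-\<^sup>1 \<otimes> y \<otimes> t\<close> for \<open>t\<close> in the target with parameters \<open>0, n - l\<close>.
\<close>

definition place_handle ::
    "('k::field, 'h::ring_1) qthopf \<Rightarrow> nat \<Rightarrow> nat \<Rightarrow> nat \<Rightarrow> ('k, 'h) HH_elt \<Rightarrow>
     ('k, ('k, 'h) HH_elt, 'h) tensor \<Rightarrow> ('k, ('k, 'h) HH_elt, 'h) tensor"
  where "place_handle H g n k y =
    Tlift H (g - k) n (\<lambda>(ys, hs). Tpure H g n (replicate (k - 1) (aone (HH H)) @ y # ys, hs))"

definition place_puncture ::
    "('k::field, 'h::ring_1) qthopf \<Rightarrow> nat \<Rightarrow> nat \<Rightarrow> nat \<Rightarrow> 'h \<Rightarrow>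
     ('k, ('k, 'h) HH_elt, 'h) tensor \<Rightarrow> ('k, ('k, 'h) HH_elt, 'h) tensor"
  where "place_puncture H g n l y =
    Tlift H 0 (n - l) (\<lambda>(_, hs).
      Tpure H g n (replicate g (aone (HH H)), replicate (l - 1) 1 @ y # hs))"

end

theory Submission
 imports Defs
begin

text \<open>
 Write \<open>R'\<close>, \<open>R''\<close> for the legs of the R-matrix. The morphism is built by splitting off the leftmost braided
 tensor factor \<open>M\<close> from the rest \<open>N\<close>:
 \<open>\<Phi>(m \<otimes> n) = \<Sum> \<Phi>\<^sub>M(coad(R')(m)) \<otimes> D\<^sub>N(R'') \<Phi>\<^sub>N(n)\<close>.
 Multiplicativity alone does not pass to the next factor, but together with the moment map identity
 \<open>\<Sum> D(h\<^sub>1) \<Phi>(coad(h\<^sub>2)(x)) = \<Phi>(x) D(h)\<close> it does: the coproduct rules for \<open>R\<close> merge the two R-matrices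
 coming from the braided product and from \<open>\<Phi>\<close>, and the identity moves \<open>D\<^sub>N(R'')\<close> past \<open>\<Phi>\<^sub>N(n)\<close>.
 For one puncture (\<open>D = id\<close>) and for one handle, both properties are identities between multilinear
 expressions in copies of \<open>H\<close>; regarding an R-matrix in two of the slots as an operator on such expressions
 reduces them to the Yang-Baxter equation and to quasi-cocommutativity.
 The counit rules for \<open>R\<close> give the prescribed values on generators, and these determine the morphism since
 \<open>m \<otimes> n = j\<^sub>1(m) (1 \<otimes> n)\<close>.
\<close>

text \<open>Handle multiplicativity rests on a factorisation: in the two-sided Heisenberg double,
  the image of \<beta> \<otimes> \<alpha> is P(\<beta>) Q(\<alpha>), with P(\<beta>) the image of
  \<beta> \<otimes> 1 and Q(\<alpha>) the image of \<alpha> under the puncture map, placed in the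
  first copy of H. P and Q are both multiplicative for the product of \<open>L01\<close>, and the
  four R-matrices in the product of \<open>L10\<close> say exactly how Q(\<alpha>) P(\<beta>') is
  rewritten with P to the left of Q. The obstacle in the formalisation is that \<open>tlift\<close>
  and \<open>sw\<close> choose linear extensions that mean nothing before multilinearity is known,
  whereas products, actions and the morphism are nested extensions. So linearity in every parameter
  has to be available before anything can be evaluated on pure tensors, and it is often proved in
  the same induction. In the moment map identity of a handle, the antipode cancels the Sweedler
  components acting on \<beta> from the left, and its inverse, which comes from the product of the
  double, those acting from the right.\<close>

abbreviation in_carrier (infix "\<in>:" 50)
 where "x \<in>: V \<equiv> x \<in> vcarrier V"

section \<open>Subspaces and tensor products\<close>

text \<open>The scaling is a vector space structure on the whole ambient type, with the carrier as a
  subspace. Library notions such as span then apply directly, while linearity is demanded on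
  carriers only.\<close>

definition is_vspace :: "('k::field, 'v::ab_group_add, 'm) vspace_scheme => bool"
 where "is_vspace A \<longleftrightarrow> vector_space (vscale A) \<and> module.subspace (vscale A) (vcarrier A)"

definition bilinear_on ::
  "('k, 'v::plus, 'm) vspace_scheme => ('k, 'w::plus, 'n) vspace_scheme =>
   ('k => 'u::plus => 'u) => ('v => 'w => 'u) => bool"
 where "bilinear_on V W s F \<longleftrightarrow>
  (\<forall>v\<in>vcarrier V. linear_on W s (F v)) \<and> (\<forall>w\<in>vcarrier W. linear_on V s (%v. F v w))"

lemma linear_onI:
 "(\<And>x y. x \<in>: V ==> y \<in>: V ==> L (x + y) = L x + L y) ==>
  (\<And>c x. x \<in>: V ==> L (vscale V c x) = s c (L x)) ==> linear_on V s L"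
 by (simp add: linear_on_def)

lemma linear_on_add:
 "linear_on V s L ==> x \<in>: V ==> y \<in>: V ==> L (x + y) = L x + L y"
 by (simp add: linear_on_def)

lemma linear_on_scale:
 "linear_on V s L ==> x \<in>: V ==> L (vscale V c x) = s c (L x)"
 by (simp add: linear_on_def)

lemma bilinear_onI:
 "(\<And>v. v \<in>: V ==> linear_on W s (F v)) ==>
  (\<And>w. w \<in>: W ==> linear_on V s (%v. F v w)) ==> bilinear_on V W s F"
 by (simp add: bilinear_on_def)

lemma bilinear_onD:
 assumes "bilinear_on V W s F"
 shows "v \<in>: V ==> linear_on W s (F v)"
  and "w \<in>: W ==> linear_on V s (%v. F v w)"
 using assms by (auto simp: bilinear_on_def)

lemma is_vspaceI:
 assumes "vector_space (vscale A)" "0 \<in>: A"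
  "\<And>x y. x \<in>: A ==> y \<in>: A ==> x + y \<in>: A"
  "\<And>c x. x \<in>: A ==> vscale A c x \<in>: A"
 shows "is_vspace A"
proof -
 interpret vector_space "vscale A" by fact
 show ?thesis using assms by (simp add: is_vspace_def subspace_def)
qed

lemma
 assumes "is_vspace A"
 shows is_vspace_vector_space: "vector_space (vscale A)"
  and is_vspace_zero: "0 \<in>: A"
  and is_vspace_add: "x \<in>: A ==> y \<in>: A ==> x + y \<in>: A"
  and is_vspace_scale: "x \<in>: A ==> vscale A c x \<in>: A"
proof -
 interpret vector_space "vscale A" using assms by (simp add: is_vspace_def)
 show "vector_space (vscale A)" ..
 have s: "subspace (vcarrier A)" using assms by (simp add: is_vspace_def)
 show "0 \<in>: A" by (rule subspace_0[OF s])
 show "x \<in>: A ==> y \<in>: A ==> x + y \<in>: A" by (rule subspace_add[OF s])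
 show "x \<in>: A ==> vscale A c x \<in>: A" by (rule subspace_scale[OF s])
qed

lemma is_vspace_sum_list:
 "is_vspace A ==> (\<And>x. x \<in> set xs ==> f x \<in>: A) ==> (\<Sum>x\<leftarrow>xs. f x) \<in>: A"
 by (induction xs) (auto intro: is_vspace_zero is_vspace_add)

lemma linear_on_0:
 assumes "is_vspace V" "linear_on V s (L :: 'v::ab_group_add => 'u::ab_group_add)"
 shows "L 0 = 0"
 using linear_on_add[OF assms(2) is_vspace_zero is_vspace_zero, OF assms(1) assms(1)] by simp

lemma linear_on_sum_list:
 assumes "is_vspace V" "linear_on V s (L :: 'v::ab_group_add => 'u::ab_group_add)"
  "\<And>x. x \<in> set xs ==> f x \<in>: V"
 shows "L (\<Sum>x\<leftarrow>xs. f x) = (\<Sum>x\<leftarrow>xs. L (f x))"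
 using assms(3)
 by (induction xs) (auto simp: linear_on_0[OF assms(1,2)] linear_on_add[OF assms(2)]
   is_vspace_sum_list[OF assms(1)])

lemma linear_on_compose:
 "linear_on V (vscale W) L ==> (\<And>x. x \<in>: V ==> L x \<in>: W) ==>
  linear_on W s K ==> linear_on V s (%x. K (L x))"
 by (auto simp: linear_on_def)

lemma linear_on_via:
 "linear_on W s K ==> linear_on V (vscale W) F ==> (\<And>v. v \<in>: V ==> F v \<in>: W) ==>
  linear_on V s (%v. K (F v))"
 by (auto simp: linear_on_def)

lemma linear_on_sum_list_fun:
 assumes "vector_space (s :: 'k::field => 'u::ab_group_add => 'u)"
  "\<And>x. x \<in> set xs ==> linear_on V s (%v. f v x)"
 shows "linear_on V s (%v. \<Sum>x\<leftarrow>xs. f v x)"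
proof -
 interpret vector_space s by fact
 show ?thesis
  using assms(2) by (induction xs) (auto simp: linear_on_def scale_right_distrib algebra_simps)
qed

lemma linear_on_cong:
 "is_vspace V ==> linear_on V s f ==> (\<And>x. x \<in>: V ==> f x = h x) ==> linear_on V s h"
 by (simp add: linear_on_def is_vspace_add is_vspace_scale)

lemma linear_on_fun_add:
 assumes "vector_space (s :: 'k::field => 'u::ab_group_add => 'u)" "linear_on V s K" "linear_on V s L"
 shows "linear_on V s (%x. K x + L x)"
proof -
 interpret vector_space s by fact
 show ?thesis using assms(2,3) by (simp add: linear_on_def scale_right_distrib)
qed

lemma linear_on_fun_scale:
 assumes "vector_space (s :: 'k::field => 'u::ab_group_add => 'u)" "linear_on V s K"
 shows "linear_on V s (%x. s c (K x))"
proof -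
 interpret vector_space s by fact
 show ?thesis using assms(2) by (simp add: linear_on_def scale_right_distrib mult.commute)
qed

text \<open>Reduces identities to a spanning set that need not be a basis: matrix coefficients for
  the restricted dual, pure tensors for tensor products, and elements \<open>C v w\<close> once a
  tensor factor has been split off.\<close>

lemma span_linear_eq:
 assumes "is_vspace U" "vcarrier U = module.span (vscale U) S"
  "vector_space (s :: 'k::field => 'u::ab_group_add => 'u)"
  "linear_on U s K" "linear_on U s L"
  "\<And>x. x \<in> S ==> K x = L x" "X \<in>: U"
 shows "K X = L X"
proof -
 interpret U: vector_space "vscale U" using assms(1) by (rule is_vspace_vector_space)
 have "X \<in>: U \<and> K X = L X"
  using assms(7) unfolding assms(2)
 proof (induction rule: U.span_induct_alt)
  case base
  show ?case using linear_on_0[OF assms(1,4)] linear_on_0[OF assms(1,5)] U.span_zero by simp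
 next
  case (step c x y)
  have "x \<in>: U" unfolding assms(2) using step(1) by (rule U.span_base)
  moreover have "y \<in>: U" unfolding assms(2) using step by simp
  moreover note cx = is_vspace_scale[OF assms(1) calculation(1), of c]
  moreover have "vscale U c x + y \<in>: U" by (rule is_vspace_add[OF assms(1)]) fact+
  ultimately show ?case using step assms(6)
   by (simp add: linear_on_add[OF assms(4)] linear_on_add[OF assms(5)]
     linear_on_scale[OF assms(4)] linear_on_scale[OF assms(5)] assms(2)[symmetric])
 qed
 then show ?thesis by simp
qed

lemma span_bilinear_eq:
 assumes V: "is_vspace V" "vcarrier V = module.span (vscale V) S"
  and W: "is_vspace W" "vcarrier W = module.span (vscale W) T"
  and s: "vector_space (s :: 'k::field => 'u::ab_group_add => 'u)"
  and "bilinear_on V W s F" "bilinear_on V W s G"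
  and eq: "\<And>v w. v \<in> S ==> w \<in> T ==> F v w = G v w"
  and "v \<in>: V" "w \<in>: W"
 shows "F v w = G v w"
proof -
 interpret V: vector_space "vscale V" using V(1) by (rule is_vspace_vector_space)
 interpret W: vector_space "vscale W" using W(1) by (rule is_vspace_vector_space)
 have 1: "F v w = G v w" if "v \<in> S" "w \<in>: W" for v w
  using span_linear_eq[OF W s bilinear_onD(1)[OF assms(6)] bilinear_onD(1)[OF assms(7)] eq]
   that V.span_base[of v S] V(2) by auto
 show ?thesis
  by (rule span_linear_eq[OF V s bilinear_onD(2)[OF assms(6)] bilinear_onD(2)[OF assms(7)] 1])
   (use assms in auto)
qed

section \<open>Spanning, induction and multilinear maps on tensor products\<close>

lemma is_vspace_tensor:
 fixes A :: "('k::field, 'a::plus, 'm) vspace_scheme" and B :: "('k, 'b::plus, 'l) vspace_scheme"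
 shows "is_vspace (tensor A B g n)"
proof -
 interpret f: vector_space "fscale :: 'k::field => (('a list \<times> 'b list => 'k) => 'k) => _"
  by (rule vector_space_fscale)
 show ?thesis
  by (simp add: is_vspace_def tensor_def f.vector_space_axioms f.subspace_span)
qed

lemma vscale_tensor [simp]: "vscale (tensor A B g n) = fscale"
 by (simp add: tensor_def)

lemma vcarrier_tensor_span:
 "vcarrier (tensor A B g n) = module.span fscale (pure A B g n ` words A B g n)"
 by (simp add: tensor_def)

lemma pure_closed:
 fixes A :: "('k::field, 'a::plus, 'm) vspace_scheme" and B :: "('k, 'b::plus, 'l) vspace_scheme"
 assumes "w \<in> words A B g n"
 shows "pure A B g n w \<in>: tensor A B g n"
proof -
 interpret f: vector_space "fscale :: 'k => (('a list \<times> 'b list => 'k) => 'k) => _"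
  by (rule vector_space_fscale)
 show ?thesis unfolding vcarrier_tensor_span using assms by (intro f.span_base) auto
qed

lemma tensor_linear_eq:
 assumes "vector_space (s :: 'k::field => 'u::ab_group_add => 'u)"
  "linear_on (tensor A B g n) s K" "linear_on (tensor A B g n) s L"
  "\<And>w. w \<in> words A B g n ==> K (pure A B g n w) = L (pure A B g n w)"
  "X \<in>: tensor A B g n"
 shows "K X = L X"
 by (rule span_linear_eq[OF is_vspace_tensor _ assms(1-3) _ assms(5),
    of "pure A B g n ` words A B g n"])
  (use assms(4) in \<open>auto simp: vcarrier_tensor_span\<close>)

lemma tensor_induct:
 fixes A :: "('k::field, 'a::plus, 'm) vspace_scheme" and B :: "('k, 'b::plus, 'l) vspace_scheme"
 assumes "X \<in>: tensor A B g n" "P 0"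
  "\<And>c w Y. w \<in> words A B g n ==> Y \<in>: tensor A B g n ==> P Y ==>
    P (fscale c (pure A B g n w) + Y)"
 shows "P X"
proof -
 interpret f: vector_space "fscale :: 'k::field => (('a list \<times> 'b list => 'k) => 'k) => _"
  by (rule vector_space_fscale)
 have "X \<in>: tensor A B g n \<and> P X"
 proof (rule f.span_induct_alt[OF assms(1)[unfolded vcarrier_tensor_span]])
  show "0 \<in>: tensor A B g n \<and> P 0"
   using assms(2) is_vspace_zero[OF is_vspace_tensor] by blast
 next
  fix c x y
  assume x: "x \<in> pure A B g n ` words A B g n" and y: "y \<in>: tensor A B g n \<and> P y"
  then obtain w where w: "w \<in> words A B g n" "x = pure A B g n w" by blast
  have "fscale c x + y \<in>: tensor A B g n"
   using y w is_vspace_scale[OF is_vspace_tensor pure_closed[OF w(1)], of c]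
   by (auto intro: is_vspace_add[OF is_vspace_tensor])
  then show "fscale c x + y \<in>: tensor A B g n \<and> P (fscale c x + y)"
   using y assms(3)[OF w(1), of y c] w(2) by blast
 qed
 then show ?thesis ..
qed

lemma linear_on_closed:
 assumes "linear_on (tensor A B g n) (vscale U) L" "is_vspace U"
  "\<And>w. w \<in> words A B g n ==> L (pure A B g n w) \<in>: U"
  "X \<in>: tensor A B g n"
 shows "L X \<in>: U"
proof (rule tensor_induct[OF assms(4)])
 show "L 0 \<in>: U"
  by (subst linear_on_0[OF is_vspace_tensor assms(1)]) (rule is_vspace_zero[OF assms(2)])
next
 fix c w Y
 assume w: "w \<in> words A B g n" and Y: "Y \<in>: tensor A B g n" "L Y \<in>: U"
 have p: "pure A B g n w \<in>: tensor A B g n" using w by (rule pure_closed)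
 have cp: "fscale c (pure A B g n w) \<in>: tensor A B g n"
  using is_vspace_scale[OF is_vspace_tensor p] by simp
 have "L (fscale c (pure A B g n w)) = vscale U c (L (pure A B g n w))"
  using linear_on_scale[OF assms(1) p, of c] by simp
 then have "L (fscale c (pure A B g n w) + Y) = vscale U c (L (pure A B g n w)) + L Y"
  using linear_on_add[OF assms(1) cp Y(1)] by simp
 moreover have "vscale U c (L (pure A B g n w)) + L Y \<in>: U"
  by (rule is_vspace_add[OF assms(2) is_vspace_scale[OF assms(2) assms(3)[OF w]] Y(2)])
 ultimately show "L (fscale c (pure A B g n w) + Y) \<in>: U" by simp
qed

lemmas tlift_linear = tensor_universal(1)
lemmas tlift_pure = tensor_universal(2)

lemma wordsI:
 "length as = g ==> set as \<subseteq> vcarrier A ==> length bs = n ==> set bs \<subseteq> vcarrier B ==>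
  (as, bs) \<in> words A B g n"
 by (simp add: words_def)

lemma words_updateA:
 "(as, bs) \<in> words A B g n ==> x \<in>: A ==> (as[i := x], bs) \<in> words A B g n"
 by (auto simp: words_def dest: set_update_subset_insert[THEN subsetD])

lemma words_updateB:
 "(as, bs) \<in> words A B g n ==> x \<in>: B ==> (as, bs[i := x]) \<in> words A B g n"
 by (auto simp: words_def dest: set_update_subset_insert[THEN subsetD])

text \<open>Linearity one slot at a time: in this form multilinearity follows by composing linear
  maps in each slot.\<close>

lemma multilinear_iff:
 "multilinear A B g n s F \<longleftrightarrow> (\<forall>as bs. (as, bs) \<in> words A B g n \<longrightarrow>
   (\<forall>i<g. linear_on A s (%x. F (as[i := x], bs))) \<and>
   (\<forall>i<n. linear_on B s (%x. F (as, bs[i := x]))))"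
 unfolding multilinear_def linear_on_def Ball_def split_paired_All prod.case
 by (intro iff_allI imp_cong refl) (simp only: imp_conjR all_conj_distrib conj_assoc)

text \<open>A pure tensor is evaluation at a word, set to 0 on functions that are not multilinear.
  So each test function either contributes its own multilinearity or makes both sides
  vanish.\<close>

lemma multilinear_pure: "multilinear A B g n fscale (pure A B g n)"
 unfolding multilinear_iff linear_on_def
proof (intro allI impI conjI ballI ext)
 fix as bs i x y c f
 assume w: "(as, bs) \<in> words A B g n"
 note m = multilinear_iff[of A B g n "(*)" f, unfolded linear_on_def, THEN iffD1, rule_format, OF _ w]
 show "pure A B g n (as[i := x + y], bs) f = (pure A B g n (as[i := x], bs) + pure A B g n (as[i := y], bs)) f"
  if "i < g" "x \<in>: A" "y \<in>: A" for x y
  using m[THEN conjunct1, rule_format, OF _ that(1), THEN conjunct1, rule_format, OF _ that(2,3)]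
  by (simp add: pure_def)
 show "pure A B g n (as[i := vscale A c x], bs) f = fscale c (pure A B g n (as[i := x], bs)) f"
  if "i < g" "x \<in>: A" for x
  using m[THEN conjunct1, rule_format, OF _ that(1), THEN conjunct2, rule_format, OF _ that(2)]
  by (simp add: pure_def fscale_def)
 show "pure A B g n (as, bs[i := x + y]) f = (pure A B g n (as, bs[i := x]) + pure A B g n (as, bs[i := y])) f"
  if "i < n" "x \<in>: B" "y \<in>: B" for x y
  using m[THEN conjunct2, rule_format, OF _ that(1), THEN conjunct1, rule_format, OF _ that(2,3)]
  by (simp add: pure_def)
 show "pure A B g n (as, bs[i := vscale B c x]) f = fscale c (pure A B g n (as, bs[i := x])) f"
  if "i < n" "x \<in>: B" for x
  using m[THEN conjunct2, rule_format, OF _ that(1), THEN conjunct2, rule_format, OF _ that(2)]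
  by (simp add: pure_def fscale_def)
qed

lemma multilinear_linear:
 assumes "multilinear A B g n (vscale V) F" "linear_on V s L"
  "\<And>w. w \<in> words A B g n ==> F w \<in>: V"
 shows "multilinear A B g n s (%w. L (F w))"
 unfolding multilinear_iff
proof (intro allI impI conjI)
 fix as bs i assume w: "(as, bs) \<in> words A B g n"
 show "linear_on A s (%x. L (F (as[i := x], bs)))" if "i < g"
  by (rule linear_on_compose[OF _ assms(3)[OF words_updateA[OF w]] assms(2)])
   (use w that assms(1) in \<open>auto simp: multilinear_iff\<close>)
 show "linear_on B s (%x. L (F (as, bs[i := x])))" if "i < n"
  by (rule linear_on_compose[OF _ assms(3)[OF words_updateB[OF w]] assms(2)])
   (use w that assms(1) in \<open>auto simp: multilinear_iff\<close>)
qed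

lemma multilinear_cong:
 assumes "multilinear A B g n s F" "\<And>w. w \<in> words A B g n ==> F w = G w"
  "is_vspace A" "is_vspace B"
 shows "multilinear A B g n s G"
 unfolding multilinear_iff
proof (intro allI impI conjI)
 fix as bs i assume w: "(as, bs) \<in> words A B g n"
 note m = multilinear_iff[of A B g n s F, THEN iffD1, OF assms(1), rule_format, OF w]
 show "linear_on A s (%x. G (as[i := x], bs))" if "i < g"
  by (rule linear_on_cong[OF assms(3) m[THEN conjunct1, rule_format, OF that]])
   (rule assms(2)[OF words_updateA[OF w]])
 show "linear_on B s (%x. G (as, bs[i := x]))" if "i < n"
  by (rule linear_on_cong[OF assms(4) m[THEN conjunct2, rule_format, OF that]])
   (rule assms(2)[OF words_updateB[OF w]])
qed

text \<open>For fixed \<open>X\<close>, additivity and homogeneity in \<open>v\<close> are equations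
  between maps that are linear in \<open>X\<close>, so they can be checked on pure tensors.\<close>

lemma linear_on_tensor_param:
 assumes s: "vector_space (s :: 'k::field => 'u::ab_group_add => 'u)" and V: "is_vspace V"
  and 1: "\<And>v. v \<in>: V ==> linear_on (tensor A B g n) s (F v)"
  and 2: "\<And>w. w \<in> words A B g n ==> linear_on V s (%v. F v (pure A B g n w))"
 shows "bilinear_on V (tensor A B g n) s F"
proof (rule bilinear_onI)
 fix X assume X: "X \<in>: tensor A B g n"
 show "linear_on V s (%v. F v X)"
 proof (rule linear_onI)
  fix x y assume xy: "x \<in>: V" "y \<in>: V"
  show "F (x + y) X = F x X + F y X"
   by (rule tensor_linear_eq[OF s 1[OF is_vspace_add[OF V xy]]
      linear_on_fun_add[OF s 1[OF xy(1)] 1[OF xy(2)]] linear_on_add[OF 2 xy] X])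
 next
  fix c x assume x: "x \<in>: V"
  show "F (vscale V c x) X = s c (F x X)"
   by (rule tensor_linear_eq[OF s 1[OF is_vspace_scale[OF V x]]
      linear_on_fun_scale[OF s 1[OF x]] linear_on_scale[OF 2 x] X])
 qed
qed (rule 1)

lemma multilinear_tlift:
 assumes s: "vector_space (s :: 'k::field => 'u::ab_group_add => 'u)"
  and 1: "\<And>w'. w' \<in> words A' B' g' n' ==> multilinear A B g n s (%w. F w w')"
  and 2: "\<And>w. w \<in> words A B g n ==> multilinear A' B' g' n' s (F w)"
  and Y: "Y \<in>: tensor A' B' g' n'" and A: "is_vspace A" and B: "is_vspace B"
 shows "multilinear A B g n s (%w. tlift A' B' g' n' s (F w) Y)"
 unfolding multilinear_iff
proof (intro allI impI conjI)
 fix as bs i assume w: "(as, bs) \<in> words A B g n"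
 show "linear_on A s (%x. tlift A' B' g' n' s (F (as[i := x], bs)) Y)" if i: "i < g"
 proof (rule bilinear_onD(2)[OF linear_on_tensor_param[OF s A] Y])
  show "linear_on (tensor A' B' g' n') s (tlift A' B' g' n' s (F (as[i := v], bs)))"
   if "v \<in>: A" for v by (rule tlift_linear[OF s 2[OF words_updateA[OF w that]]])
  show "linear_on A s (%v. tlift A' B' g' n' s (F (as[i := v], bs)) (pure A' B' g' n' w'))"
   if w': "w' \<in> words A' B' g' n'" for w'
   by (rule linear_on_cong[OF A 1[OF w', unfolded multilinear_iff, rule_format, OF w,
       THEN conjunct1, rule_format, OF i]])
    (rule tlift_pure[OF s 2[OF words_updateA[OF w]] w', symmetric])
 qed
 show "linear_on B s (%x. tlift A' B' g' n' s (F (as, bs[i := x])) Y)" if i: "i < n"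
 proof (rule bilinear_onD(2)[OF linear_on_tensor_param[OF s B] Y])
  show "linear_on (tensor A' B' g' n') s (tlift A' B' g' n' s (F (as, bs[i := v])))"
   if "v \<in>: B" for v by (rule tlift_linear[OF s 2[OF words_updateB[OF w that]]])
  show "linear_on B s (%v. tlift A' B' g' n' s (F (as, bs[i := v])) (pure A' B' g' n' w'))"
   if w': "w' \<in> words A' B' g' n'" for w'
   by (rule linear_on_cong[OF B 1[OF w', unfolded multilinear_iff, rule_format, OF w,
       THEN conjunct2, rule_format, OF i]])
    (rule tlift_pure[OF s 2[OF words_updateB[OF w]] w', symmetric])
 qed
qed

lemma bilinear_on_swap: "bilinear_on V W s (%v w. F w v) ==> bilinear_on W V s F"
 by (simp add: bilinear_on_def)

text \<open>Products are defined by two nested extensions, the second argument being a parameter of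
  the inner one. The outer extension has a meaning only because the inner one is multilinear in the
  outer word, by \<open>multilinear_tlift\<close>.\<close>

lemma tlift_tlift:
 assumes s: "vector_space (s :: 'k::field => 'u::ab_group_add => 'u)"
  and 1: "\<And>w'. w' \<in> words A' B' g' n' ==> multilinear A B g n s (%w. F w w')"
  and 2: "\<And>w. w \<in> words A B g n ==> multilinear A' B' g' n' s (F w)"
  and A: "is_vspace A" and B: "is_vspace B"
 shows "bilinear_on (tensor A B g n) (tensor A' B' g' n') s
      (%X Y. tlift A B g n s (%w. tlift A' B' g' n' s (F w) Y) X)"
  and "w \<in> words A B g n ==> w' \<in> words A' B' g' n' ==>
     tlift A B g n s (%w. tlift A' B' g' n' s (F w) (pure A' B' g' n' w')) (pure A B g n w) = F w w'"
proof -
 have ml: "multilinear A B g n s (%w. tlift A' B' g' n' s (F w) Y)"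
  if "Y \<in>: tensor A' B' g' n'" for Y
  by (rule multilinear_tlift[OF s 1 2 that A B])
 note lin = tlift_linear[OF s ml] and val = tlift_pure[OF s ml]
 note lin' = tlift_linear[OF s 2] and val' = tlift_pure[OF s 2]
 show "w \<in> words A B g n ==> w' \<in> words A' B' g' n' ==>
     tlift A B g n s (%w. tlift A' B' g' n' s (F w) (pure A' B' g' n' w')) (pure A B g n w) = F w w'"
  by (simp only: val val' pure_closed)
 show "bilinear_on (tensor A B g n) (tensor A' B' g' n') s
      (%X Y. tlift A B g n s (%w. tlift A' B' g' n' s (F w) Y) X)"
 proof (rule bilinear_on_swap, rule linear_on_tensor_param[OF s is_vspace_tensor lin])
  show "linear_on (tensor A' B' g' n') s
    (%v. tlift A B g n s (%w. tlift A' B' g' n' s (F w) v) (pure A B g n w))"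
   if "w \<in> words A B g n" for w
   by (rule linear_on_cong[OF is_vspace_tensor lin'[OF that]]) (rule val[OF _ that, symmetric])
 qed
qed

subsection \<open>Splitting off the first tensor factor\<close>

definition consA ::
  "('k::field, 'a::plus, 'm) vspace_scheme => ('k, 'b::plus, 'l) vspace_scheme => nat => nat =>
   'a => ('k, 'a, 'b) tensor => ('k, 'a, 'b) tensor"
 where "consA A B g n a = tlift A B g n fscale (%(as, bs). pure A B (Suc g) n (a # as, bs))"

text \<open>Letters of the second kind stand after those of the first kind, so such a letter can be
  split off in front only when \<open>g\<close> is 0.\<close>

definition consB ::
  "('k::field, 'a::plus, 'm) vspace_scheme => ('k, 'b::plus, 'l) vspace_scheme => nat =>
   'b => ('k, 'a, 'b) tensor => ('k, 'a, 'b) tensor"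
 where "consB A B n b = tlift A B 0 n fscale (%(_, bs). pure A B 0 (Suc n) ([], b # bs))"

lemma words_ConsA: "(as, bs) \<in> words A B g n ==> a \<in>: A ==> (a # as, bs) \<in> words A B (Suc g) n"
 by (auto simp: words_def)

lemma words_ConsB: "(as, bs) \<in> words A B g n ==> b \<in>: B ==> (as, b # bs) \<in> words A B g (Suc n)"
 by (auto simp: words_def)

lemma words_SucA:
 "w \<in> words A B (Suc g) n \<longleftrightarrow>
  (\<exists>a as bs. w = (a # as, bs) \<and> a \<in>: A \<and> (as, bs) \<in> words A B g n)"
 by (cases w) (auto simp: words_def length_Suc_conv)

lemma words_SucB:
 "w \<in> words A B 0 (Suc n) \<longleftrightarrow>
  (\<exists>b bs. w = ([], b # bs) \<and> b \<in>: B \<and> ([], bs) \<in> words A B 0 n)"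
 by (cases w) (auto simp: words_def length_Suc_conv)

lemma words_0: "w \<in> words A B 0 0 \<longleftrightarrow> w = ([], [])"
 by (cases w) (auto simp: words_def)

lemma words_0D: "w \<in> words A B 0 n ==> \<exists>bs. w = ([], bs)"
 by (cases w) (simp add: words_def)

lemma multilinear_ConsA:
 assumes "a \<in>: A"
 shows "multilinear A B g n fscale (%(as, bs). pure A B (Suc g) n (a # as, bs))"
proof -
 have m: "multilinear A B (Suc g) n fscale (pure A B (Suc g) n)" by (rule multilinear_pure)
 show ?thesis
  unfolding multilinear_iff
 proof (intro allI impI conjI)
  fix as bs i assume w: "(as, bs) \<in> words A B g n"
  note w' = words_ConsA[OF w assms]
  show "linear_on A fscale (%x. case (as[i := x], bs) of (as, bs) => pure A B (Suc g) n (a # as, bs))"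
   if "i < g"
   using m[unfolded multilinear_iff, rule_format, OF w', THEN conjunct1, rule_format, of "Suc i"] that by simp
  show "linear_on B fscale (%x. case (as, bs[i := x]) of (as, bs) => pure A B (Suc g) n (a # as, bs))"
   if "i < n"
   using m[unfolded multilinear_iff, rule_format, OF w', THEN conjunct2, rule_format, of "i"] that by simp
 qed
qed

lemma multilinear_ConsB:
 assumes "b \<in>: B"
 shows "multilinear A B 0 n fscale (%(_, bs). pure A B 0 (Suc n) ([], b # bs))"
proof -
 have m: "multilinear A B 0 (Suc n) fscale (pure A B 0 (Suc n))" by (rule multilinear_pure)
 show ?thesis
  unfolding multilinear_iff
 proof (intro allI impI conjI)
  fix as bs i assume w: "(as, bs) \<in> words A B 0 n"
  then have w': "([], b # bs) \<in> words A B 0 (Suc n)" using assms by (auto simp: words_def)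
  show "linear_on B fscale (%x. case (as, bs[i := x]) of (_, bs) => pure A B 0 (Suc n) ([], b # bs))"
   if "i < n"
   using m[unfolded multilinear_iff, rule_format, OF w', THEN conjunct2, rule_format, of "Suc i"] that by simp
 qed simp
qed

lemma consA_pure:
 "a \<in>: A ==> (as, bs) \<in> words A B g n ==>
  consA A B g n a (pure A B g n (as, bs)) = pure A B (Suc g) n (a # as, bs)"
 unfolding consA_def by (subst tlift_pure[OF vector_space_fscale multilinear_ConsA]) auto

lemma consB_pure:
 "b \<in>: B ==> ([], bs) \<in> words A B 0 n ==>
  consB A B n b (pure A B 0 n ([], bs)) = pure A B 0 (Suc n) ([], b # bs)"
 unfolding consB_def by (subst tlift_pure[OF vector_space_fscale multilinear_ConsB]) auto

lemma pure_linear_slot0A: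
 assumes "(as, bs) \<in> words A B g n" "is_vspace A"
 shows "linear_on A fscale (%a. pure A B (Suc g) n (a # as, bs))"
 using multilinear_pure[of A B "Suc g" n, unfolded multilinear_iff, rule_format,
   OF words_ConsA[OF assms(1) is_vspace_zero[OF assms(2)]], THEN conjunct1, rule_format, of 0] by simp

lemma pure_linear_slot0B:
 assumes "([], bs) \<in> words A B 0 n" "is_vspace B"
 shows "linear_on B fscale (%b. pure A B 0 (Suc n) ([], b # bs))"
 using multilinear_pure[of A B 0 "Suc n", unfolded multilinear_iff, rule_format,
   OF words_ConsB[OF assms(1) is_vspace_zero[OF assms(2)]], THEN conjunct2, rule_format, of 0] by simp

lemma bilinear_consA:
 assumes "is_vspace A"
 shows "bilinear_on A (tensor A B g n) fscale (consA A B g n)"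
proof (rule linear_on_tensor_param[OF vector_space_fscale assms])
 show "linear_on (tensor A B g n) fscale (consA A B g n v)" if "v \<in>: A" for v
  unfolding consA_def by (rule tlift_linear[OF vector_space_fscale multilinear_ConsA[OF that]])
 show "linear_on A fscale (%v. consA A B g n v (pure A B g n w))" if "w \<in> words A B g n" for w
  using that pure_linear_slot0A[of "fst w" "snd w"] assms
   consA_pure[of _ A "fst w" "snd w" B g n]
  by (simp add: linear_on_def is_vspace_add is_vspace_scale)
qed

lemma bilinear_consB:
 assumes "is_vspace B"
 shows "bilinear_on B (tensor A B 0 n) fscale (consB A B n)"
proof (rule linear_on_tensor_param[OF vector_space_fscale assms])
 show "linear_on (tensor A B 0 n) fscale (consB A B n v)" if "v \<in>: B" for v
  unfolding consB_def by (rule tlift_linear[OF vector_space_fscale multilinear_ConsB[OF that]])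
 show "linear_on B fscale (%v. consB A B n v (pure A B 0 n w))" if w: "w \<in> words A B 0 n" for w
 proof -
  obtain bs where [simp]: "w = ([], bs)" using words_0D[OF w] by blast
  show ?thesis using w pure_linear_slot0B[of "bs"] assms consB_pure[of _ B "bs" A n]
   by (simp add: linear_on_def is_vspace_add is_vspace_scale)
 qed
qed

text \<open>Abstracts one splitting of a tensor product to bilinearity and spanning. Splitting off a
  handle, or a puncture when no handle is left, on the source or on the target side, are all
  instances, so the inductive constructions are carried out once.\<close>

definition tensor_step ::
  "('k::field, 'v::ab_group_add, 'm) vspace_scheme => ('k, 'w::ab_group_add, 'n) vspace_scheme =>
   ('k, 'u::ab_group_add, 'l) vspace_scheme => ('v => 'w => 'u) => bool"
 where "tensor_step V W U C \<longleftrightarrow>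
  is_vspace V \<and> is_vspace W \<and> is_vspace U \<and> bilinear_on V W (vscale U) C \<and>
  vcarrier U = module.span (vscale U) {C v w |v w. v \<in>: V \<and> w \<in>: W}"

lemma tensor_stepD:
 assumes "tensor_step V W U C"
 shows "is_vspace V" "is_vspace W" "is_vspace U" "bilinear_on V W (vscale U) C"
  and "vcarrier U = module.span (vscale U) {C v w |v w. v \<in>: V \<and> w \<in>: W}"
 using assms by (simp_all add: tensor_step_def)

lemma tensor_step_closed:
 assumes "tensor_step V W U C" "v \<in>: V" "w \<in>: W"
 shows "C v w \<in>: U"
proof -
 interpret vector_space "vscale U"
  using assms by (auto simp: tensor_step_def intro: is_vspace_vector_space)
 have "C v w \<in> span {C v w |v w. v \<in>: V \<and> w \<in>: W}"
  using assms by (intro span_base) auto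
 then show ?thesis using assms(1) by (simp add: tensor_step_def)
qed

lemma tensor_step_consA:
 fixes A :: "('k::field, 'a::ab_group_add, 'm) vspace_scheme"
  and B :: "('k, 'b::ab_group_add, 'l) vspace_scheme"
 assumes "is_vspace A"
 shows "tensor_step A (tensor A B g n) (tensor A B (Suc g) n) (consA A B g n)"
proof -
 interpret f: vector_space "fscale :: 'k::field => (('a list \<times> 'b list => 'k) => 'k) => _"
  by (rule vector_space_fscale)
 let ?S = "{consA A B g n v w |v w. v \<in>: A \<and> w \<in>: tensor A B g n}"
 have cl: "consA A B g n v w \<in>: tensor A B (Suc g) n"
  if "v \<in>: A" "w \<in>: tensor A B g n" for v w
 proof (rule linear_on_closed[where L="consA A B g n v" and A=A and B=B and g=g and n=n])
  show "linear_on (tensor A B g n) (vscale (tensor A B (Suc g) n)) (consA A B g n v)"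
   using bilinear_onD(1)[OF bilinear_consA[OF assms] that(1)] by simp
  show "consA A B g n v (pure A B g n w) \<in>: tensor A B (Suc g) n" if "w \<in> words A B g n" for w
   using that \<open>v \<in>: A\<close> by (cases w) (simp add: consA_pure pure_closed words_ConsA)
 qed (use that is_vspace_tensor in auto)
 have "vcarrier (tensor A B (Suc g) n) \<subseteq> f.span ?S"
  unfolding vcarrier_tensor_span[of A B "Suc g"]
 proof (intro f.span_minimal f.subspace_span image_subsetI)
  fix w assume "w \<in> words A B (Suc g) n"
  then obtain a as bs where w: "w = (a # as, bs)" "a \<in>: A" "(as, bs) \<in> words A B g n"
   by (auto simp: words_SucA)
  have "consA A B g n a (pure A B g n (as, bs)) \<in> f.span ?S"
   using w by (intro f.span_base) (auto intro: pure_closed)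
  then show "pure A B (Suc g) n w \<in> f.span ?S"
   using w by (simp add: consA_pure)
 qed
 moreover have "f.span ?S \<subseteq> vcarrier (tensor A B (Suc g) n)"
  using is_vspace_tensor[of A B "Suc g" n] cl
  by (intro f.span_minimal) (auto simp: is_vspace_def)
 ultimately show ?thesis
  using assms bilinear_consA[OF assms, of B g n] by (simp add: tensor_step_def is_vspace_tensor)
qed

lemma tensor_step_consB:
 fixes A :: "('k::field, 'a::ab_group_add, 'm) vspace_scheme"
  and B :: "('k, 'b::ab_group_add, 'l) vspace_scheme"
 assumes "is_vspace B"
 shows "tensor_step B (tensor A B 0 n) (tensor A B 0 (Suc n)) (consB A B n)"
proof -
 interpret f: vector_space "fscale :: 'k::field => (('a list \<times> 'b list => 'k) => 'k) => _"
  by (rule vector_space_fscale)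
 let ?S = "{consB A B n v w |v w. v \<in>: B \<and> w \<in>: tensor A B 0 n}"
 have cl: "consB A B n v w \<in>: tensor A B 0 (Suc n)"
  if "v \<in>: B" "w \<in>: tensor A B 0 n" for v w
 proof (rule linear_on_closed[where L="consB A B n v" and A=A and B=B and g=0 and n=n])
  show "linear_on (tensor A B 0 n) (vscale (tensor A B 0 (Suc n))) (consB A B n v)"
   using bilinear_onD(1)[OF bilinear_consB[OF assms] that(1)] by simp
  fix w assume w: "w \<in> words A B 0 n"
  then obtain bs where "w = ([], bs)" by (auto dest: words_0D)
  then show "consB A B n v (pure A B 0 n w) \<in>: tensor A B 0 (Suc n)"
   using w that by (auto simp: consB_pure intro!: pure_closed words_ConsB)
 qed (use that is_vspace_tensor in auto)
 have "vcarrier (tensor A B 0 (Suc n)) \<subseteq> f.span ?S"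
  unfolding vcarrier_tensor_span[of A B 0 "Suc n"]
 proof (intro f.span_minimal f.subspace_span image_subsetI)
  fix w assume "w \<in> words A B 0 (Suc n)"
  then obtain b bs where w: "w = ([], b # bs)" "b \<in>: B" "([], bs) \<in> words A B 0 n"
   by (auto simp: words_SucB)
  have "consB A B n b (pure A B 0 n ([], bs)) \<in> f.span ?S"
   using w by (intro f.span_base) (auto intro: pure_closed)
  then show "pure A B 0 (Suc n) w \<in> f.span ?S"
   using w by (simp add: consB_pure)
 qed
 moreover have "f.span ?S \<subseteq> vcarrier (tensor A B 0 (Suc n))"
  using is_vspace_tensor[of A B 0 "Suc n"] cl
  by (intro f.span_minimal) (auto simp: is_vspace_def)
 ultimately show ?thesis
  using assms bilinear_consB[OF assms, of A n] by (simp add: tensor_step_def is_vspace_tensor)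
qed

lemma multilinear_hdA:
 assumes G: "bilinear_on A (tensor A B g n) s G"
 shows "multilinear A B (Suc g) n s (%(as, bs). G (hd as) (pure A B g n (tl as, bs)))"
 unfolding multilinear_iff
proof (intro allI impI conjI)
 fix as bs i assume "(as, bs) \<in> words A B (Suc g) n"
 then obtain a as' where as: "as = a # as'" "a \<in>: A" and w: "(as', bs) \<in> words A B g n"
  by (auto simp: words_SucA)
 have m: "multilinear A B g n s (%w. G a (pure A B g n w))"
  by (rule multilinear_linear[where V="tensor A B g n", OF _ bilinear_onD(1)[OF G as(2)] pure_closed])
   (simp_all add: multilinear_pure)
 show "linear_on A s (%x. case (as[i := x], bs) of (as, bs) => G (hd as) (pure A B g n (tl as, bs)))"
  if "i < Suc g"
  using m[unfolded multilinear_iff, rule_format, OF w, THEN conjunct1, rule_format, of "i - 1"] that as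
   bilinear_onD(2)[OF G pure_closed[OF w]]
  by (cases i) auto
 show "linear_on B s (%x. case (as, bs[i := x]) of (as, bs) => G (hd as) (pure A B g n (tl as, bs)))"
  if "i < n"
  using m[unfolded multilinear_iff, rule_format, OF w, THEN conjunct2, rule_format, of "i"] that as by simp
qed

lemma multilinear_hdB:
 assumes G: "bilinear_on B (tensor A B 0 n) s G"
 shows "multilinear A B 0 (Suc n) s (%(_, bs). G (hd bs) (pure A B 0 n ([], tl bs)))"
 unfolding multilinear_iff
proof (intro allI impI conjI)
 fix as bs i assume "(as, bs) \<in> words A B 0 (Suc n)"
 then obtain b bs' where bs: "as = []" "bs = b # bs'" "b \<in>: B" and w: "([], bs') \<in> words A B 0 n"
  by (auto simp: words_SucB)
 have m: "multilinear A B 0 n s (%w. G b (pure A B 0 n w))"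
  by (rule multilinear_linear[where V="tensor A B 0 n", OF _ bilinear_onD(1)[OF G bs(3)] pure_closed])
   (simp_all add: multilinear_pure)
 show "linear_on B s (%x. case (as, bs[i := x]) of (_, bs) => G (hd bs) (pure A B 0 n ([], tl bs)))"
  if "i < Suc n"
  using m[unfolded multilinear_iff, rule_format, OF w, THEN conjunct2, rule_format, of "i - 1"] that bs
   bilinear_onD(2)[OF G pure_closed[OF w]]
  by (cases i) auto
qed simp

text \<open>The universal property of the splitting, phrased with \<open>hd\<close> and
  \<open>tl\<close> because the product of the graph algebra is defined by recursion in this
  shape.\<close>

lemma tlift_consA:
 assumes s: "vector_space (s :: 'k::field => 'u::ab_group_add => 'u)"
  and A: "is_vspace (A :: ('k, 'a::ab_group_add, 'm) vspace_scheme)"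
  and G: "bilinear_on A (tensor A (B :: ('k, 'b::ab_group_add, 'l) vspace_scheme) g n) s G"
  and "a \<in>: A" "t \<in>: tensor A B g n"
 shows "tlift A B (Suc g) n s (%(as, bs). G (hd as) (pure A B g n (tl as, bs))) (consA A B g n a t) = G a t"
proof -
 let ?L = "tlift A B (Suc g) n s (%(as, bs). G (hd as) (pure A B g n (tl as, bs)))"
 note ml = multilinear_hdA[OF G]
 have cl: "linear_on (tensor A B g n) s (%t. ?L (consA A B g n a t))"
 proof (rule linear_on_compose[OF _ _ tlift_linear[OF s ml]])
  show "linear_on (tensor A B g n) (vscale (tensor A B (Suc g) n)) (consA A B g n a)"
   using bilinear_onD(1)[OF bilinear_consA[OF A] assms(4)] by simp
 qed (rule tensor_step_closed[OF tensor_step_consA[OF A] assms(4)])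
 show ?thesis
  by (rule tensor_linear_eq[OF s cl bilinear_onD(1)[OF G assms(4)] _ assms(5)])
   (use assms(4) in \<open>auto simp: consA_pure tlift_pure[OF s ml] words_ConsA\<close>)
qed

lemma tlift_consB:
 assumes s: "vector_space (s :: 'k::field => 'u::ab_group_add => 'u)"
  and B: "is_vspace (B :: ('k, 'b::ab_group_add, 'm) vspace_scheme)"
  and G: "bilinear_on B (tensor (A :: ('k, 'a::ab_group_add, 'l) vspace_scheme) B 0 n) s G"
  and "b \<in>: B" "t \<in>: tensor A B 0 n"
 shows "tlift A B 0 (Suc n) s (%(_, bs). G (hd bs) (pure A B 0 n ([], tl bs))) (consB A B n b t) = G b t"
proof -
 let ?L = "tlift A B 0 (Suc n) s (%(_, bs). G (hd bs) (pure A B 0 n ([], tl bs)))"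
 note ml = multilinear_hdB[OF G]
 have cl: "linear_on (tensor A B 0 n) s (%t. ?L (consB A B n b t))"
 proof (rule linear_on_compose[OF _ _ tlift_linear[OF s ml]])
  show "linear_on (tensor A B 0 n) (vscale (tensor A B 0 (Suc n))) (consB A B n b)"
   using bilinear_onD(1)[OF bilinear_consB[OF B] assms(4)] by simp
 qed (rule tensor_step_closed[OF tensor_step_consB[OF B] assms(4)])
 show ?thesis
 proof (rule tensor_linear_eq[OF s cl bilinear_onD(1)[OF G assms(4)] _ assms(5)])
  fix w assume w: "w \<in> words A B 0 n"
  then obtain bs where "w = ([], bs)" by (auto dest: words_0D)
  then show "?L (consB A B n b (pure A B 0 n w)) = G b (pure A B 0 n w)"
   using w assms(4) by (simp add: consB_pure tlift_pure[OF s ml] words_ConsB)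
 qed
qed

lemma linear_consA_tlift:
 assumes s: "vector_space (s :: 'k::field => 'u::ab_group_add => 'u)"
  and G: "bilinear_on A (tensor A B g n) s G"
 shows "linear_on (tensor A B (Suc g) n) s
  (tlift A B (Suc g) n s (%(as, bs). G (hd as) (pure A B g n (tl as, bs))))"
 by (rule tlift_linear[OF s multilinear_hdA[OF G]])

lemma linear_consB_tlift:
 assumes s: "vector_space (s :: 'k::field => 'u::ab_group_add => 'u)"
  and G: "bilinear_on B (tensor A B 0 n) s G"
 shows "linear_on (tensor A B 0 (Suc n)) s
  (tlift A B 0 (Suc n) s (%(_, bs). G (hd bs) (pure A B 0 n ([], tl bs))))"
 by (rule tlift_linear[OF s multilinear_hdB[OF G]])

subsection \<open>Algebras and their tensor products\<close>

text \<open>Closure and bilinearity are kept apart from associativity and unit laws: the target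
  algebras satisfy \<open>is_assoc_alg\<close>, while the braided products are handled through
  \<open>is_alg\<close>.\<close>

definition is_alg :: "('k::field, 'v::ab_group_add, 'm) kalg_scheme => bool"
 where "is_alg A \<longleftrightarrow> is_vspace A \<and> bilinear_on A A (vscale A) (amult A) \<and>
  (\<forall>x\<in>vcarrier A. \<forall>y\<in>vcarrier A. amult A x y \<in>: A) \<and> aone A \<in>: A"

definition is_assoc_alg :: "('k::field, 'v::ab_group_add, 'm) kalg_scheme => bool"
 where "is_assoc_alg A \<longleftrightarrow> is_alg A \<and>
  (\<forall>x\<in>vcarrier A. \<forall>y\<in>vcarrier A. \<forall>z\<in>vcarrier A. amult A (amult A x y) z = amult A x (amult A y z)) \<and>
  (\<forall>x\<in>vcarrier A. amult A (aone A) x = x \<and> amult A x (aone A) = x)"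

lemma
 assumes "is_alg A"
 shows is_alg_vspace: "is_vspace A"
  and is_alg_bilinear: "bilinear_on A A (vscale A) (amult A)"
  and is_alg_closed: "x \<in>: A ==> y \<in>: A ==> amult A x y \<in>: A"
  and is_alg_one: "aone A \<in>: A"
 using assms by (auto simp: is_alg_def)

lemma is_assoc_algD:
 assumes "is_assoc_alg A"
 shows "x \<in>: A ==> y \<in>: A ==> z \<in>: A ==> amult A (amult A x y) z = amult A x (amult A y z)"
  and "x \<in>: A ==> amult A (aone A) x = x" and "x \<in>: A ==> amult A x (aone A) = x"
  and "is_alg A"
 using assms by (auto simp: is_assoc_alg_def)

lemma map2_update2:
 assumes "i < length xs"
 shows "map2 f xs (ys[i := y]) = (map2 f xs ys)[i := f (xs ! i) y]"
 using zip_update[of xs i "xs ! i" ys y] assms by (simp add: map_update)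

lemma map2_flip: "map2 f xs ys = map2 (%y x. f x y) ys xs"
 by (induction xs ys rule: list_induct2') auto

lemma set_map2: "length xs = length ys ==> (\<And>x y. x \<in> set xs ==> y \<in> set ys ==> f x y \<in> U) ==>
 set (map2 f xs ys) \<subseteq> U"
 by (auto dest: set_zip_leftD set_zip_rightD)

lemma multilinear_map2:
 assumes F: "multilinear A' B' g n s F"
  and "length cs = g" "length ds = n"
  and f: "\<And>c. c \<in> set cs ==> linear_on A (vscale A') (f c)"
   "\<And>c a. c \<in> set cs ==> a \<in>: A ==> f c a \<in>: A'"
  and h: "\<And>d. d \<in> set ds ==> linear_on B (vscale B') (h d)"
   "\<And>d b. d \<in> set ds ==> b \<in>: B ==> h d b \<in>: B'"
 shows "multilinear A B g n s (%(as, bs). F (map2 f cs as, map2 h ds bs))"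
 unfolding multilinear_iff
proof (intro allI impI conjI)
 fix as bs i assume w: "(as, bs) \<in> words A B g n"
 then have w': "(map2 f cs as, map2 h ds bs) \<in> words A' B' g n"
  using assms(2,3) f(2) h(2)
  by (intro wordsI set_map2) (auto simp: words_def)
 note m = F[unfolded multilinear_iff, rule_format, OF w']
 show "linear_on A s (%x. case (as[i := x], bs) of (as, bs) => F (map2 f cs as, map2 h ds bs))"
  if "i < g"
  unfolding prod.case map2_update2[OF that[folded assms(2)]]
  by (rule linear_on_compose[OF f(1) f(2) m[THEN conjunct1, rule_format, OF that]])
   (use that assms(2) in auto)
 show "linear_on B s (%x. case (as, bs[i := x]) of (as, bs) => F (map2 f cs as, map2 h ds bs))"
  if "i < n"
  unfolding prod.case map2_update2[OF that[folded assms(3)]]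
  by (rule linear_on_compose[OF h(1) h(2) m[THEN conjunct2, rule_format, OF that]])
   (use that assms(3) in auto)
qed

lemma vcarrier_tensor_alg [simp]: "vcarrier (tensor_alg A B g n) = vcarrier (tensor A B g n)"
 and vscale_tensor_alg [simp]: "vscale (tensor_alg A B g n) = fscale"
 and aone_tensor_alg:
  "aone (tensor_alg A B g n) = pure A B g n (replicate g (aone A), replicate n (aone B))"
 by (simp_all add: tensor_alg_def)

lemma linear_on_tensor_alg [simp]:
 "linear_on (tensor_alg A B g n) s L \<longleftrightarrow> linear_on (tensor A B g n) s L"
 by (simp add: linear_on_def)

text \<open>Associativity is trilinear and is extended from \<open>S\<close> to the carrier one
  argument at a time, the last argument first.\<close>

lemma is_assoc_algI:
 assumes A: "is_alg A" and S: "vcarrier A = module.span (vscale A) S"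
  and assoc: "\<And>x y z. x \<in> S ==> y \<in> S ==> z \<in> S ==> amult A (amult A x y) z = amult A x (amult A y z)"
  and one: "\<And>x. x \<in> S ==> amult A (aone A) x = x" "\<And>x. x \<in> S ==> amult A x (aone A) = x"
 shows "is_assoc_alg A"
proof -
 let ?m = "amult A"
 note V = is_alg_vspace[OF A] and cl = is_alg_closed[OF A]
 note m1 = bilinear_onD(1)[OF is_alg_bilinear[OF A]] and m2 = bilinear_onD(2)[OF is_alg_bilinear[OF A]]
 note eq = span_linear_eq[OF V S is_vspace_vector_space[OF V]]
 interpret A: vector_space "vscale A" using V by (rule is_vspace_vector_space)
 have S': "x \<in> S ==> x \<in>: A" for x unfolding S by (rule A.span_base)
 have id: "linear_on A (vscale A) (%x. x)" by (simp add: linear_on_def)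
 have 1: "?m (?m x y) z = ?m x (?m y z)" if "x \<in> S" "y \<in> S" "z \<in>: A" for x y z
  by (rule eq[OF m1[OF cl] linear_on_via[OF m1 m1 cl] assoc that(3)]) (use that S' in auto)
 have 2: "?m (?m x y) z = ?m x (?m y z)" if "x \<in> S" "y \<in>: A" "z \<in>: A" for x y z
  by (rule eq[OF linear_on_via[OF m2 m1 cl] linear_on_via[OF m1 m2 cl] 1 that(2)]) (use that S' in auto)
 have 3: "?m (?m x y) z = ?m x (?m y z)" if "x \<in>: A" "y \<in>: A" "z \<in>: A" for x y z
  by (rule eq[OF linear_on_via[OF m2 m2 cl] m2[OF cl] 2 that(1)]) (use that in auto)
 have "?m (aone A) x = x" if "x \<in>: A" for x
  by (rule eq[OF m1[OF is_alg_one[OF A]] id one(1) that])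
 moreover have "?m x (aone A) = x" if "x \<in>: A" for x
  by (rule eq[OF m2[OF is_alg_one[OF A]] id one(2) that])
 ultimately show ?thesis using A 3 by (simp add: is_assoc_alg_def)
qed

lemma tensor_step_mult:
 assumes C: "tensor_step V W U C" and W: "is_alg W" and U: "is_alg U" and S: "vcarrier W = module.span (vscale W) S"
  and v: "v \<in>: V" "v' \<in>: V" "v'' \<in>: V"
  and eq: "\<And>t t'. t \<in> S ==> t' \<in> S ==> amult U (C v t) (C v' t') = C v'' (amult W t t')"
  and t: "t \<in>: W" "t' \<in>: W"
 shows "amult U (C v t) (C v' t') = C v'' (amult W t t')"
proof -
 have bC: "bilinear_on V W (vscale U) C" using C by (simp add: tensor_step_def)
 note l = bilinear_onD(1)[OF bC] and cl = tensor_step_closed[OF C] and V = is_alg_vspace[OF W]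
 note mU = bilinear_onD[OF is_alg_bilinear[OF U]] and mW = bilinear_onD[OF is_alg_bilinear[OF W]]
 show ?thesis
 proof (rule span_bilinear_eq[OF V S V S is_vspace_vector_space[OF is_alg_vspace[OF U]] _ _ eq t]; (rule bilinear_onI)?)
  fix t assume t: "t \<in>: W"
  show "linear_on W (vscale U) (%t'. amult U (C v t) (C v' t'))"
   by (rule linear_on_via[OF mU(1)[OF cl[OF v(1) t]] l[OF v(2)] cl[OF v(2)]])
  show "linear_on W (vscale U) (%t'. amult U (C v t') (C v' t))"
   by (rule linear_on_via[OF mU(2)[OF cl[OF v(2) t]] l[OF v(1)] cl[OF v(1)]])
  show "linear_on W (vscale U) (%t'. C v'' (amult W t t'))"
   by (rule linear_on_via[OF l[OF v(3)] mW(1)[OF t] is_alg_closed[OF W t]])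
  show "linear_on W (vscale U) (%t'. C v'' (amult W t' t))"
   by (rule linear_on_via[OF l[OF v(3)] mW(2)[OF t] is_alg_closed[OF W _ t]])
 qed
qed

context
 fixes A :: "('k::field, 'a::ab_group_add, 'm) kalg_scheme"
  and B :: "('k, 'b::ab_group_add, 'l) kalg_scheme"
 assumes A: "is_alg A" and B: "is_alg B"
begin

lemma tensor_alg_mult:
 shows "bilinear_on (tensor A B g n) (tensor A B g n) fscale (amult (tensor_alg A B g n))"
  and "(as, bs) \<in> words A B g n ==> (as', bs') \<in> words A B g n ==>
   amult (tensor_alg A B g n) (pure A B g n (as, bs)) (pure A B g n (as', bs')) =
   pure A B g n (map2 (amult A) as as', map2 (amult B) bs bs')"
proof -
 define F where "F = (%(as, bs). %(as', bs'). pure A B g n (map2 (amult A) as as', map2 (amult B) bs bs'))"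
 have eq: "amult (tensor_alg A B g n) =
  (%X Y. tlift A B g n fscale (%w. tlift A B g n fscale (F w) Y) X)"
  by (simp add: tensor_alg_def F_def case_prod_unfold)
 have 2: "multilinear A B g n fscale (F w)" if "w \<in> words A B g n" for w
 proof -
  obtain as bs where w: "w = (as, bs)" by (cases w)
  have *: "c \<in>: A" if "c \<in> set as" for c using that \<open>w \<in> _\<close> w by (auto simp: words_def)
  have **: "c \<in>: B" if "c \<in> set bs" for c using that \<open>w \<in> _\<close> w by (auto simp: words_def)
  show ?thesis unfolding F_def w prod.case
   by (rule multilinear_map2[OF multilinear_pure])
    (use that w in \<open>auto simp: words_def intro: bilinear_onD[OF is_alg_bilinear[OF A] *]
     bilinear_onD[OF is_alg_bilinear[OF B] **] is_alg_closed[OF A *] is_alg_closed[OF B **]\<close>)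
 qed
 have 1: "multilinear A B g n fscale (%w. F w w')" if "w' \<in> words A B g n" for w'
 proof -
  obtain as bs where w: "w' = (as, bs)" by (cases w')
  have *: "c \<in>: A" if "c \<in> set as" for c using that \<open>w' \<in> _\<close> w by (auto simp: words_def)
  have **: "c \<in>: B" if "c \<in> set bs" for c using that \<open>w' \<in> _\<close> w by (auto simp: words_def)
  have "multilinear A B g n fscale (%(as', bs'). pure A B g n
   (map2 (%x y. amult A y x) as as', map2 (%x y. amult B y x) bs bs'))"
   by (rule multilinear_map2[OF multilinear_pure])
    (use that w in \<open>auto simp: words_def intro: bilinear_onD(2)[OF is_alg_bilinear[OF A] *]
     bilinear_onD(2)[OF is_alg_bilinear[OF B] **] is_alg_closed[OF A _ *] is_alg_closed[OF B _ **]\<close>)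
  then show ?thesis unfolding F_def w
   by (subst (asm) (1 2) map2_flip) (simp add: case_prod_unfold)
 qed
 show "bilinear_on (tensor A B g n) (tensor A B g n) fscale (amult (tensor_alg A B g n))"
  unfolding eq by (rule tlift_tlift(1)[OF vector_space_fscale 1 2 is_alg_vspace[OF A] is_alg_vspace[OF B]])
 assume "(as, bs) \<in> words A B g n" "(as', bs') \<in> words A B g n"
 then show "amult (tensor_alg A B g n) (pure A B g n (as, bs)) (pure A B g n (as', bs')) =
   pure A B g n (map2 (amult A) as as', map2 (amult B) bs bs')"
  unfolding eq
  by (subst tlift_tlift(2)[OF vector_space_fscale 1 2 is_alg_vspace[OF A] is_alg_vspace[OF B]])
   (auto simp: F_def)
qed

lemma words_map2:
 "(as, bs) \<in> words A B g n ==> (as', bs') \<in> words A B g n ==>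
  (map2 (amult A) as as', map2 (amult B) bs bs') \<in> words A B g n"
 by (auto simp: words_def subset_iff dest!: set_zip_leftD[of _ _ "_ :: 'a list"] set_zip_rightD in_set_zipE
   intro!: is_alg_closed[OF A] is_alg_closed[OF B] elim!: in_set_zipE)

lemma is_alg_tensor_alg: "is_alg (tensor_alg A B g n)"
 unfolding is_alg_def
proof (intro conjI ballI)
 let ?T = "tensor A B g n"
 show "is_vspace (tensor_alg A B g n)"
  using is_vspace_tensor[of A B g n] by (simp add: is_vspace_def)
 show "bilinear_on (tensor_alg A B g n) (tensor_alg A B g n) (vscale (tensor_alg A B g n)) (amult (tensor_alg A B g n))"
  using tensor_alg_mult(1) by (simp add: bilinear_on_def)
 show "aone (tensor_alg A B g n) \<in>: tensor_alg A B g n"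
  using is_alg_one[OF A] is_alg_one[OF B]
  by (auto simp: aone_tensor_alg intro!: pure_closed wordsI)
 fix X Y assume "X \<in>: tensor_alg A B g n" "Y \<in>: tensor_alg A B g n"
 then have X: "X \<in>: ?T" and Y: "Y \<in>: ?T" by simp_all
 have "amult (tensor_alg A B g n) X Y \<in>: ?T"
 proof (rule linear_on_closed[OF _ is_vspace_tensor _ X])
  show "linear_on ?T (vscale ?T) (%X. amult (tensor_alg A B g n) X Y)"
   using bilinear_onD(2)[OF tensor_alg_mult(1) Y] by simp
  fix w assume w: "w \<in> words A B g n"
  then have p: "pure A B g n w \<in>: ?T" by (rule pure_closed)
  show "amult (tensor_alg A B g n) (pure A B g n w) Y \<in>: ?T"
  proof (rule linear_on_closed[OF _ is_vspace_tensor _ Y])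
   show "linear_on ?T (vscale ?T) (amult (tensor_alg A B g n) (pure A B g n w))"
    using bilinear_onD(1)[OF tensor_alg_mult(1) p] by simp
   fix w' assume "w' \<in> words A B g n"
   with w show "amult (tensor_alg A B g n) (pure A B g n w) (pure A B g n w') \<in>: ?T"
    by (cases w; cases w') (simp add: tensor_alg_mult(2) pure_closed words_map2)
  qed
 qed
 then show "amult (tensor_alg A B g n) X Y \<in>: tensor_alg A B g n" by simp
qed

lemma is_assoc_tensor_alg:
 assumes "is_assoc_alg A" "is_assoc_alg B"
 shows "is_assoc_alg (tensor_alg A B g n)"
proof (rule is_assoc_algI[OF is_alg_tensor_alg, where S = "pure A B g n ` words A B g n"])
 have Aa: "map2 (amult A) (map2 (amult A) as bs) cs = map2 (amult A) as (map2 (amult A) bs cs)"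
  if "set as \<subseteq> vcarrier A" "set bs \<subseteq> vcarrier A" "set cs \<subseteq> vcarrier A"
   "length as = g" "length bs = g" "length cs = g" for as bs cs
  using assms(1) that by (intro nth_equalityI) (auto simp: is_assoc_alg_def subset_iff)
 have Ba: "map2 (amult B) (map2 (amult B) as bs) cs = map2 (amult B) as (map2 (amult B) bs cs)"
  if "set as \<subseteq> vcarrier B" "set bs \<subseteq> vcarrier B" "set cs \<subseteq> vcarrier B"
   "length as = n" "length bs = n" "length cs = n" for as bs cs
  using assms(2) that by (intro nth_equalityI) (auto simp: is_assoc_alg_def subset_iff)
 have ow: "(replicate g (aone A), replicate n (aone B)) \<in> words A B g n"
  using is_alg_one[OF A] is_alg_one[OF B] by (auto intro!: wordsI)
 have mr: "map2 f (replicate m u) as = as" if "\<And>a. a \<in> set as ==> f u a = a" "length as = m"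
  for f and u :: 'c and as :: "'c list" and m
  using that by (intro nth_equalityI) auto
 have mr': "map2 f as (replicate m u) = as" if "\<And>a. a \<in> set as ==> f a u = a" "length as = m"
  for f and u :: 'c and as :: "'c list" and m
  using that by (intro nth_equalityI) auto
 let ?m = "amult (tensor_alg A B g n)" and ?S = "pure A B g n ` words A B g n"
 show "vcarrier (tensor_alg A B g n) = module.span (vscale (tensor_alg A B g n)) ?S"
  by (simp add: vcarrier_tensor_span)
 fix x assume "x \<in> ?S"
 then obtain as bs where x: "x = pure A B g n (as, bs)" "(as, bs) \<in> words A B g n" by auto
 show "?m (aone (tensor_alg A B g n)) x = x" "?m x (aone (tensor_alg A B g n)) = x"
  using x ow assms unfolding aone_tensor_alg
  by (auto simp: tensor_alg_mult(2) words_def subset_iff is_assoc_alg_def mr mr')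
 fix y z assume "y \<in> ?S" "z \<in> ?S"
 then obtain as' bs' as'' bs'' where "y = pure A B g n (as', bs')" "(as', bs') \<in> words A B g n"
  "z = pure A B g n (as'', bs'')" "(as'', bs'') \<in> words A B g n" by auto
 then show "?m (?m x y) z = ?m x (?m y z)"
  using x words_map2[of as bs g n as' bs'] words_map2[of as' bs' g n as'' bs'']
  by (simp add: tensor_alg_mult(2)) (simp add: words_def Aa Ba)
qed

lemma step_tensor_alg:
 "tensor_step A (tensor_alg A B g n) (tensor_alg A B (Suc g) n) (consA A B g n)"
 "tensor_step B (tensor_alg A B 0 n) (tensor_alg A B 0 (Suc n)) (consB A B n)"
 using tensor_step_consA[OF is_alg_vspace[OF A], of B g n] tensor_step_consB[OF is_alg_vspace[OF B], of A n]
  is_alg_vspace[OF is_alg_tensor_alg]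
 by (simp_all add: tensor_step_def bilinear_on_def linear_on_def)

lemma tensor_alg_consA:
 assumes "a \<in>: A" "a' \<in>: A" "t \<in>: tensor A B g n" "t' \<in>: tensor A B g n"
 shows "amult (tensor_alg A B (Suc g) n) (consA A B g n a t) (consA A B g n a' t') =
  consA A B g n (amult A a a') (amult (tensor_alg A B g n) t t')"
proof (rule tensor_step_mult[OF step_tensor_alg(1) is_alg_tensor_alg is_alg_tensor_alg _ assms(1,2) is_alg_closed[OF A assms(1,2)]])
 fix t t' assume "t \<in> pure A B g n ` words A B g n" "t' \<in> pure A B g n ` words A B g n"
 then obtain as bs as' bs' where t: "t = pure A B g n (as, bs)" "t' = pure A B g n (as', bs')"
  and w: "(as, bs) \<in> words A B g n" "(as', bs') \<in> words A B g n" by auto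
 show "amult (tensor_alg A B (Suc g) n) (consA A B g n a t) (consA A B g n a' t') =
   consA A B g n (amult A a a') (amult (tensor_alg A B g n) t t')"
  unfolding t using assms(1,2) w is_alg_closed[OF A assms(1,2)] words_map2[OF w]
  by (simp add: consA_pure tensor_alg_mult(2) words_ConsA)
qed (use assms in \<open>simp_all add: vcarrier_tensor_span\<close>)

lemma tensor_alg_consB:
 assumes "b \<in>: B" "b' \<in>: B" "t \<in>: tensor A B 0 n" "t' \<in>: tensor A B 0 n"
 shows "amult (tensor_alg A B 0 (Suc n)) (consB A B n b t) (consB A B n b' t') =
  consB A B n (amult B b b') (amult (tensor_alg A B 0 n) t t')"
proof (rule tensor_step_mult[OF step_tensor_alg(2) is_alg_tensor_alg is_alg_tensor_alg _ assms(1,2) is_alg_closed[OF B assms(1,2)]])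
 fix t t' assume "t \<in> pure A B 0 n ` words A B 0 n" "t' \<in> pure A B 0 n ` words A B 0 n"
 then obtain bs bs' where t: "t = pure A B 0 n ([], bs)" "t' = pure A B 0 n ([], bs')"
  and w: "([], bs) \<in> words A B 0 n" "([], bs') \<in> words A B 0 n" using words_0D[of _ A B n] by blast
 show "amult (tensor_alg A B 0 (Suc n)) (consB A B n b t) (consB A B n b' t') =
   consB A B n (amult B b b') (amult (tensor_alg A B 0 n) t t')"
  unfolding t using assms(1,2) w is_alg_closed[OF B assms(1,2)] words_map2[OF w]
  by (simp add: consB_pure tensor_alg_mult(2) words_ConsB)
qed (use assms in \<open>simp_all add: vcarrier_tensor_span\<close>)

end

section \<open>Sweedler calculus\<close>

text \<open>Linearity on all of H, with the scaling of the target explicit. Separating it from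
  \<open>linear_on\<close> permits syntax-directed rules (\<open>hlin_intros\<close>) that settle
  each slot of a long Sweedler expression.\<close>

definition hlin ::
  "('k::field, 'h::ring_1) qthopf => ('k => 'u::ab_group_add => 'u) => ('h => 'u) => bool"
 where "hlin H s f \<longleftrightarrow> (\<forall>x y. f (x + y) = f x + f y) \<and> (\<forall>c x. f (hscale H c x) = s c (f x))"

text \<open>
 Unlike \<open>sw\<close>, which is meaningful only for bilinear summands, \<open>ssum\<close> is an honest finite sum over a
 chosen decomposition into pure tensors, so it commutes with all additive operations.
\<close>

definition ssum ::
  "('k::field, 'h::ring_1) qthopf => ('k, 'h, 'h) tensor => ('h => 'h => 'u::ab_group_add) => 'u"
 where "ssum H t F = (\<Sum>(a, b)\<leftarrow>(SOME ps. t = (\<Sum>(a, b)\<leftarrow>ps. hpure H [a, b])). F a b)"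

lemma ssum_hom:
 assumes "\<And>x y. f (x + y) = f x + f y"
 shows "f (ssum H t F) = ssum H t (%a b. f (F a b))"
proof -
 have "f 0 = 0" using assms[of 0 0] by simp
 then have "f (\<Sum>(a, b)\<leftarrow>ps. F a b) = (\<Sum>(a, b)\<leftarrow>ps. f (F a b))" for ps
  by (induction ps) (auto simp: assms)
 then show ?thesis by (simp add: ssum_def)
qed

lemma ssum_cong: "(\<And>a b. F a b = G a b) ==> ssum H t F = ssum H t G"
 by (simp add: ssum_def)

lemma ssum_apply: "ssum H t F w = ssum H t (%a b. F a b w)"
 by (rule ssum_hom[of "%f. f w"]) simp

lemma ssum_add: "ssum H t (%a b. F a b + G a b) = ssum H t F + ssum H t G"
proof -
 have "(\<Sum>(a, b)\<leftarrow>ps. F a b + G a b) = (\<Sum>(a, b)\<leftarrow>ps. F a b) + (\<Sum>(a, b)\<leftarrow>ps. G a b)" for ps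
  by (induction ps) (auto simp: algebra_simps)
 then show ?thesis by (simp add: ssum_def)
qed

lemma ssum_zero: "ssum H t (%a b. 0) = 0"
 by (simp add: ssum_def case_prod_unfold)

text \<open>Both sides are finite sums over lists that do not depend on the other summation
  variables. Such free exchange is the gain of computing with \<open>ssum\<close> rather than
  \<open>sw\<close>.\<close>

lemma ssum_swap:
 "ssum H t (%a b. ssum H u (%c d. F a b c d)) = ssum H u (%c d. ssum H t (%a b. F a b c d))"
proof -
 have "(\<Sum>(a, b)\<leftarrow>ps. ssum H u (%c d. F a b c d)) = ssum H u (%c d. \<Sum>(a, b)\<leftarrow>ps. F a b c d)" for ps
  by (induction ps) (auto simp: ssum_zero ssum_add)
 then show ?thesis by (simp add: ssum_def[of H t])
qed

lemma hlin_linear_on: "hlin H s f \<longleftrightarrow> linear_on (Halg H) s f"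
 by (simp add: hlin_def linear_on_def Halg_def)

named_theorems hlin_intros

lemma hlin_comp: "hlin H s g ==> hlin H (hscale H) f ==> hlin H s (%x. g (f x))"
 by (simp add: hlin_def)

lemma hlin_fun [hlin_intros]:
 fixes F :: "'h::ring_1 => 'x => 'k::field"
 shows "(\<And>w. hlin H (*) (%x. F x w)) ==> hlin H fscale F"
 by (simp add: hlin_def fun_eq_iff fscale_def)

lemma hlin_id [hlin_intros]: "hlin H (hscale H) (%x. x)"
 by (simp add: hlin_def)

lemma hlin_field_right [hlin_intros]:
 fixes f :: "'h::ring_1 => 'k::field"
 shows "hlin H (*) f ==> hlin H (*) (%x. c * f x)"
 by (simp add: hlin_def algebra_simps)

lemma hlin_ssum [hlin_intros]:
 assumes "vector_space s" "\<And>a b. hlin H s (%x. F x a b)"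
 shows "hlin H s (%x. ssum H t (F x))"
proof -
 interpret vector_space s by fact
 have "s c (ssum H t (F x)) = ssum H t (%a b. s c (F x a b))" for c x
  by (rule ssum_hom) (simp add: scale_right_distrib)
 moreover have "F (x + y) = (%a b. F x a b + F y a b)" "F (hscale H c x) = (%a b. s c (F x a b))" for x y c
  using assms(2) unfolding hlin_def by (blast intro!: ext)+
 ultimately show ?thesis by (simp add: hlin_def ssum_add)
qed

lemma hlin_scale_right [hlin_intros]:
 assumes "vector_space s" "hlin H s f"
 shows "hlin H s (%x. s c (f x))"
proof -
 interpret vector_space s by fact
 show ?thesis using assms(2) by (simp add: hlin_def scale_right_distrib mult.commute)
qed

lemma hlin_scale_left [hlin_intros]:
 assumes "vector_space s" "hlin H (*) f"
 shows "hlin H s (%x. s (f x) v)"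
proof -
 interpret vector_space s by fact
 show ?thesis using assms(2) by (simp add: hlin_def scale_left_distrib)
qed

lemma linear_on_ssum:
 assumes "is_vspace V" "linear_on V s L" "\<And>a b. F a b \<in>: V"
 shows "L (ssum H t F) = ssum H t (%a b. L (F a b))"
 unfolding ssum_def case_prod_unfold by (rule linear_on_sum_list[OF assms])

lemma ssum_closed:
 "is_vspace V ==> (\<And>a b. F a b \<in>: V) ==> ssum H t F \<in>: V"
 unfolding ssum_def case_prod_unfold by (rule is_vspace_sum_list)

lemma linear_on_ssum_fun:
 "vector_space s ==> (\<And>a b. linear_on V s (%v. F v a b)) ==> linear_on V s (%v. ssum H t (F v))"
 unfolding ssum_def case_prod_unfold by (rule linear_on_sum_list_fun)

lemma ssum_scale:
 assumes "vector_space s"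
 shows "s c (ssum H t F) = ssum H t (%a b. s c (F a b))"
proof -
 interpret vector_space s by fact
 show ?thesis by (rule ssum_hom) (simp add: scale_right_distrib)
qed

section \<open>Multilinear functions on tensor powers of H\<close>

definition hmulti ::
  "('k::field, 'h::ring_1) qthopf => nat => ('k => 'u::ab_group_add => 'u) => ('h list => 'u) => bool"
 where "hmulti H m s F \<longleftrightarrow> (\<forall>hs. length hs = m \<longrightarrow> (\<forall>i<m. hlin H s (%x. F (hs[i := x]))))"

lemma hmulti_multilinear:
 "hmulti H m s F \<longleftrightarrow> multilinear (Halg H) (Halg H) 0 m s (%(_, hs). F hs)"
 by (auto simp: hmulti_def multilinear_iff words_def Halg_def hlin_linear_on linear_on_def)

abbreviation hten :: "('k::field, 'h::ring_1) qthopf => nat => ('k, ('k, 'h, 'h) tensor) vspace"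
 where "hten H m \<equiv> tensor (Halg H) (Halg H) 0 m"

lemma vcarrier_hpow [simp]: "vcarrier (hpow H m) = vcarrier (hten H m)"
 by (simp add: hpow_def)

lemma hlift_linear:
 "vector_space s ==> hmulti H m s F ==> linear_on (hten H m) s (hlift H m s F)"
 unfolding hmulti_multilinear hlift_def by (rule tlift_linear)

lemma hlift_pure:
 "vector_space s ==> hmulti H m s F ==> length hs = m ==> hlift H m s F (hpure H hs) = F hs"
 unfolding hmulti_multilinear hlift_def hpure_def
 using tlift_pure[of s "Halg H" "Halg H" 0 m "%(_, hs). F hs" "([], hs)"]
 by (simp add: words_def Halg_def)

lemma hpure_closed: "length hs = m ==> hpure H hs \<in>: hten H m"
 unfolding hpure_def by (auto intro!: pure_closed simp: words_def Halg_def)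

lemma hmulti_hpure: "hmulti H m fscale (hpure H)"
proof -
 have "(case w of (_, hs) => hpure H hs) = pure (Halg H) (Halg H) 0 m w"
  if "w \<in> words (Halg H) (Halg H) 0 m" for w
  using that by (cases w) (auto simp: words_def hpure_def)
 moreover have "multilinear (Halg H) (Halg H) 0 m fscale (pure (Halg H) (Halg H) 0 m)"
  by (rule multilinear_pure)
 ultimately show ?thesis
  unfolding hmulti_multilinear multilinear_iff by (auto simp: linear_on_def words_def Halg_def)
qed

lemma hmulti2I:
 assumes "\<And>b. hlin H s (%a. F a b)" "\<And>a. hlin H s (%b. F a b)"
 shows "hmulti H 2 s (%hs. F (hs ! 0) (hs ! 1))"
 unfolding hmulti_def
proof (intro allI impI)
 fix hs :: "'a list" and i :: nat assume hs: "length hs = 2" and i: "i < 2"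
 then consider "i = 0" | "i = 1" by linarith
 then show "hlin H s (%x. F (hs[i := x] ! 0) (hs[i := x] ! 1))"
  by cases (simp_all add: hs assms)
qed

lemma hmulti3I:
 assumes "\<And>b c. hlin H s (%a. F a b c)" "\<And>a c. hlin H s (%b. F a b c)" "\<And>a b. hlin H s (%c. F a b c)"
 shows "hmulti H 3 s (%hs. F (hs ! 0) (hs ! 1) (hs ! 2))"
 unfolding hmulti_def
proof (intro allI impI)
 fix hs :: "'a list" and i :: nat assume hs: "length hs = 3" and i: "i < 3"
 then consider "i = 0" | "i = 1" | "i = 2" by linarith
 then show "hlin H s (%x. F (hs[i := x] ! 0) (hs[i := x] ! 1) (hs[i := x] ! 2))"
  by cases (simp_all add: hs assms)
qed

lemma hlin_hpure2 [hlin_intros]: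
 shows "hlin H (hscale H) f ==> hlin H fscale (%x. hpure H [f x, b])"
  and "hlin H (hscale H) f ==> hlin H fscale (%x. hpure H [a, f x])"
proof -
 note m = hmulti_hpure[of H 2, unfolded hmulti_def, rule_format]
 show "hlin H (hscale H) f ==> hlin H fscale (%x. hpure H [f x, b])"
  using m[of "[0, b]" 0] by (auto dest: hlin_comp)
 show "hlin H (hscale H) f ==> hlin H fscale (%x. hpure H [a, f x])"
  using m[of "[a, 0]" 1] by (auto dest: hlin_comp)
qed

lemma hlin_hpure3 [hlin_intros]:
 shows "hlin H (hscale H) f ==> hlin H fscale (%x. hpure H [f x, b, c])"
  and "hlin H (hscale H) f ==> hlin H fscale (%x. hpure H [a, f x, c])"
  and "hlin H (hscale H) f ==> hlin H fscale (%x. hpure H [a, b, f x])"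
proof -
 note m = hmulti_hpure[of H 3, unfolded hmulti_def, rule_format]
 show "hlin H (hscale H) f ==> hlin H fscale (%x. hpure H [f x, b, c])"
  using m[of "[0, b, c]" 0] by (auto dest: hlin_comp)
 show "hlin H (hscale H) f ==> hlin H fscale (%x. hpure H [a, f x, c])"
  using m[of "[a, 0, c]" 1] by (auto dest: hlin_comp)
 show "hlin H (hscale H) f ==> hlin H fscale (%x. hpure H [a, b, f x])"
  using m[of "[a, b, 0]" 2] by (auto dest: hlin_comp)
qed

text \<open>Ensures that the list chosen in \<open>ssum\<close> really decomposes \<open>t\<close>.
  A scalar coefficient is absorbed into the first leg, so a list of pairs is enough.\<close>

lemma ssum_pure:
 assumes "t \<in>: hten H 2"
 shows "t = ssum H t (%a b. hpure H [a, b])"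
proof -
 have "\<exists>ps. t = (\<Sum>(a, b)\<leftarrow>ps. hpure H [a, b])"
 proof (rule tensor_induct[OF assms])
  show "\<exists>ps. 0 = (\<Sum>(a, b)\<leftarrow>ps. hpure H [a, b])" by (rule exI[of _ "[]"]) simp
  fix c w Y
  assume w: "w \<in> words (Halg H) (Halg H) 0 2" and "\<exists>ps. Y = (\<Sum>(a, b)\<leftarrow>ps. hpure H [a, b])"
  then obtain ps where ps: "Y = (\<Sum>(a, b)\<leftarrow>ps. hpure H [a, b])" by blast
  obtain a b where "w = ([], [a, b])"
   using w by (auto simp: words_def length_Suc_conv numeral_2_eq_2)
  then have "fscale c (pure (Halg H) (Halg H) 0 2 w) = hpure H [hscale H c a, b]"
   using hlin_hpure2(1)[OF hlin_id, of H b] by (simp add: hlin_def) (simp add: hpure_def numeral_2_eq_2)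
  then have "fscale c (pure (Halg H) (Halg H) 0 2 w) + Y = (\<Sum>(a, b)\<leftarrow>(hscale H c a, b) # ps. hpure H [a, b])"
   by (simp add: ps)
  then show "\<exists>ps. fscale c (pure (Halg H) (Halg H) 0 2 w) + Y = (\<Sum>(a, b)\<leftarrow>ps. hpure H [a, b])" by blast
 qed
 then show ?thesis unfolding ssum_def by (rule someI_ex)
qed

lemma sw_linear:
 assumes "vector_space s" "\<And>b. hlin H s (%a. F a b)" "\<And>a. hlin H s (%b. F a b)"
 shows "linear_on (hten H 2) s (%t. sw H s t F)"
 unfolding sw_def by (rule hlift_linear[OF assms(1) hmulti2I[OF assms(2,3)]])

lemma sw_hpure:
 assumes "vector_space s" "\<And>b. hlin H s (%a. F a b)" "\<And>a. hlin H s (%b. F a b)"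
 shows "sw H s (hpure H [a, b]) F = F a b"
 unfolding sw_def by (subst hlift_pure[OF assms(1) hmulti2I[OF assms(2,3)]]) simp_all

text \<open>The passage from the Sweedler sums of the definitions to finite sums: a bilinear summand
  gives the same value on every decomposition, in particular on the chosen one.\<close>

lemma sw_ssum:
 assumes "vector_space s" "t \<in>: hten H 2"
  "\<And>b. hlin H s (%a. F a b)" "\<And>a. hlin H s (%b. F a b)"
 shows "sw H s t F = ssum H t F"
 using linear_on_ssum[OF is_vspace_tensor sw_linear[OF assms(1,3,4)] hpure_closed,
   of "%a b. [a, b]" H t]
 by (simp add: ssum_pure[OF assms(2), symmetric] sw_hpure[OF assms(1,3,4)])

lemma ssum_linear:
 assumes "vector_space s" "\<And>b. hlin H s (%a. F a b)" "\<And>a. hlin H s (%b. F a b)"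
 shows "linear_on (hten H 2) s (%t. ssum H t F)"
 by (rule linear_on_cong[OF is_vspace_tensor sw_linear[OF assms] sw_ssum[OF assms(1) _ assms(2,3)]])

lemma ssum_hpure:
 assumes "vector_space s" "\<And>b. hlin H s (%a. F a b)" "\<And>a. hlin H s (%b. F a b)"
 shows "ssum H (hpure H [a, b]) F = F a b"
 using sw_ssum[OF assms(1) hpure_closed assms(2,3)] sw_hpure[OF assms] by simp

section \<open>Sweedler sums for the coproduct of a Hopf algebra\<close>

abbreviation dS ::
  "('k::field, 'h::ring_1) qthopf => 'h => ('h => 'h => 'u::ab_group_add) => 'u"
 where "dS H x \<equiv> ssum H (comul H x)"

abbreviation rS ::
  "('k::field, 'h::ring_1) qthopf => ('h => 'h => 'u::ab_group_add) => 'u"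
 where "rS H \<equiv> ssum H (rmat H)"

declare vector_space_fscale [hlin_intros] vector_space_mult [hlin_intros]

context hopf_algebra
begin

lemma vector_space_hscale [hlin_intros]: "vector_space (hscale H)" ..

lemma is_assoc_Halg: "is_assoc_alg (Halg H)"
proof -
 have "is_vspace (Halg H)"
  by (rule is_vspaceI) (simp_all add: Halg_def vector_space_axioms)
 then show ?thesis
  by (auto simp: is_assoc_alg_def is_alg_def bilinear_on_def linear_on_def Halg_def
    algebra_simps scale_mult_left[symmetric] scale_mult_right[symmetric])
qed

lemma is_alg_Halg: "is_alg (Halg H)"
 using is_assoc_Halg by (simp add: is_assoc_alg_def)

lemma is_vspace_Halg: "is_vspace (Halg H)"
 using is_alg_Halg by (rule is_alg_vspace)

lemma hlin_mult_left [hlin_intros]: "hlin H (hscale H) f ==> hlin H (hscale H) (%x. f x * y)"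
 by (simp add: hlin_def algebra_simps scale_mult_left)

lemma hlin_mult_right [hlin_intros]: "hlin H (hscale H) f ==> hlin H (hscale H) (%x. y * f x)"
 by (simp add: hlin_def algebra_simps scale_mult_right)

lemma linear_hlin: "Vector_Spaces.linear (hscale H) s f ==> hlin H s f"
 using module_hom.add[of "hscale H" s f] module_hom.scale[of "hscale H" s f]
 by (simp add: hlin_def Vector_Spaces.linear_def)

lemmas hlin_antipode [hlin_intros] = hlin_comp[OF linear_hlin[OF antipode_linear]]
lemmas hlin_counit [hlin_intros] = hlin_comp[OF linear_hlin[OF counit_linear]]

lemma comul_in: "comul H x \<in>: hten H 2"
 using comul_closed by simp

text \<open>The decomposition chosen for \<open>comul H x\<close> is not linear in \<open>x\<close>,
  but for a bilinear summand the sum depends on the tensor alone, and linearly.\<close>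

lemma hlin_dS:
 assumes "vector_space s" "\<And>b. hlin H s (%a. F a b)" "\<And>a. hlin H s (%b. F a b)"
 shows "hlin H s (%x. dS H x F)"
 using ssum_linear[OF assms, unfolded linear_on_def] linear_hlin[OF comul_linear] comul_in
 by (simp add: hlin_def)

lemmas hlin_dS_comp [hlin_intros] = hlin_comp[OF hlin_dS]

lemma hlin_mono_comp: "hlin H s G ==> G (ssum H t F) = ssum H t (%a b. G (F a b))"
 by (rule ssum_hom) (simp add: hlin_def)

text \<open>The trilinear summand is extended to a linear map on the third tensor power of H, which
  is then applied to the coassociativity axiom.\<close>

lemma dS_coassoc:
 assumes "vector_space s" "\<And>b c. hlin H s (%a. F a b c)" "\<And>a c. hlin H s (%b. F a b c)"
  "\<And>a b. hlin H s (%c. F a b c)"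
 shows "dS H x (%a b. dS H a (%a1 a2. F a1 a2 b)) = dS H x (%a b. dS H b (%b1 b2. F a b1 b2))"
proof -
 define L where "L = hlift H 3 s (%hs. F (hs ! 0) (hs ! 1) (hs ! 2))"
 have m: "hmulti H 3 s (%hs. F (hs ! 0) (hs ! 1) (hs ! 2))" by (rule hmulti3I[OF assms(2-4)])
 note L = hlift_linear[OF assms(1) m, folded L_def]
 have LF: "L (hpure H [a, b, c]) = F a b c" for a b c
  unfolding L_def using hlift_pure[OF assms(1) m, of "[a, b, c]"] by simp
 have cl: "hpure H [a, b, c] \<in>: hten H 3" for a b c by (rule hpure_closed) simp
 have "dS H x (%a b. dS H a (%a1 a2. hpure H [a1, a2, b])) = dS H x (%a b. dS H b (%b1 b2. hpure H [a, b1, b2]))"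
  using coassoc[of x]
  by (simp add: sw_ssum[OF vector_space_fscale comul_in] hlin_hpure3[OF hlin_id] hlin_dS_comp[OF vector_space_fscale _ _ hlin_id]
   hlin_ssum[OF vector_space_fscale])
 then have "L (dS H x (%a b. dS H a (%a1 a2. hpure H [a1, a2, b]))) =
  L (dS H x (%a b. dS H b (%b1 b2. hpure H [a, b1, b2])))" by simp
 then show ?thesis
  by (simp add: linear_on_ssum[OF is_vspace_tensor L] LF cl ssum_closed[OF is_vspace_tensor])
qed

lemma hpow_mult_ssum:
 assumes "vector_space s" "\<And>b. hlin H s (%a. F a b)" "\<And>a. hlin H s (%b. F a b)"
  "X \<in>: hten H 2" "Y \<in>: hten H 2"
 shows "ssum H (amult (hpow H 2) X Y) F = ssum H X (%a b. ssum H Y (%c d. F (a * c) (b * d)))"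
proof -
 let ?m = "amult (hpow H 2)"
 note bil = tensor_alg_mult(1)[OF is_alg_Halg is_alg_Halg, of 0 2, folded hpow_def]
 have p: "?m (hpure H [a, b]) (hpure H [c, d]) = hpure H [a * c, b * d]" for a b c d
  unfolding hpow_def hpure_def using tensor_alg_mult(2)[OF is_alg_Halg is_alg_Halg, of "[]" "[a, b]" 0 2 "[]" "[c, d]"]
  by (simp add: words_def Halg_def numeral_2_eq_2)
 have cl: "hpure H [a, b] \<in>: hten H 2" for a b by (rule hpure_closed) simp
 have m1: "?m X Y = ssum H X (%a b. ?m (hpure H [a, b]) Y)"
  by (subst ssum_pure[OF assms(4)], subst linear_on_ssum[OF is_vspace_tensor bilinear_onD(2)[OF bil assms(5)] cl]) simp
 have m2: "?m (hpure H [a, b]) Y = ssum H Y (%c d. hpure H [a * c, b * d])" for a b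
  by (subst ssum_pure[OF assms(5)], subst linear_on_ssum[OF is_vspace_tensor bilinear_onD(1)[OF bil cl] cl]) (simp add: p)
 show ?thesis
  unfolding m1 m2
  by (simp add: linear_on_ssum[OF is_vspace_tensor ssum_linear[OF assms(1-3)]] cl
    ssum_closed[OF is_vspace_tensor] ssum_hpure[OF assms(1-3)])
qed

lemma aone_hpow2: "aone (hpow H 2) = hpure H [1, 1]"
 by (simp add: hpow_def aone_tensor_alg hpure_def Halg_def numeral_2_eq_2)

lemma dS_mult:
 assumes "vector_space s" "\<And>b. hlin H s (%a. F a b)" "\<And>a. hlin H s (%b. F a b)"
 shows "dS H (x * y) F = dS H x (%a b. dS H y (%c d. F (a * c) (b * d)))"
 unfolding comul_mult by (rule hpow_mult_ssum[OF assms comul_in comul_in])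

lemma dS_one:
 assumes "vector_space s" "\<And>b. hlin H s (%a. F a b)" "\<And>a. hlin H s (%b. F a b)"
 shows "dS H 1 F = F 1 1"
 unfolding comul_one aone_hpow2 by (rule ssum_hpure[OF assms])

text \<open>The axiom is an identity in H; a linear \<open>f\<close> carries it into any surrounding
  expression, with the scalar moved to the target.\<close>

lemma dS_counit_left:
 assumes "hlin H s f"
 shows "dS H x (%a b. s (counit H a) (f b)) = f x"
proof -
 have "dS H x (%a b. hscale H (counit H a) b) = x"
  by (subst sw_ssum[OF vector_space_hscale comul_in, symmetric])
   (auto intro!: hlin_intros simp: counit_left)
 then have "f x = f (dS H x (%a b. hscale H (counit H a) b))" by simp
 also have "\<dots> = dS H x (%a b. s (counit H a) (f b))"
  using assms by (subst hlin_mono_comp[OF assms]) (simp add: hlin_def)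
 finally show ?thesis ..
qed

lemma dS_counit_right:
 assumes "hlin H s f"
 shows "dS H x (%a b. s (counit H b) (f a)) = f x"
proof -
 have "dS H x (%a b. hscale H (counit H b) a) = x"
  by (subst sw_ssum[OF vector_space_hscale comul_in, symmetric])
   (auto intro!: hlin_intros simp: counit_right)
 then have "f x = f (dS H x (%a b. hscale H (counit H b) a))" by simp
 also have "\<dots> = dS H x (%a b. s (counit H b) (f a))"
  using assms by (subst hlin_mono_comp[OF assms]) (simp add: hlin_def)
 finally show ?thesis ..
qed

lemma dS_antipode_left:
 assumes "hlin H s f"
 shows "dS H x (%a b. f (antipode H a * b)) = s (counit H x) (f 1)"
proof -
 have "dS H x (%a b. antipode H a * b) = hscale H (counit H x) 1"
  by (subst sw_ssum[OF vector_space_hscale comul_in, symmetric])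
   (auto intro!: hlin_intros simp: antipode_left)
 then have "f (dS H x (%a b. antipode H a * b)) = f (hscale H (counit H x) 1)" by simp
 then show ?thesis using assms by (subst (asm) hlin_mono_comp[OF assms]) (simp add: hlin_def)
qed

lemma dS_antipode_right:
 assumes "hlin H s f"
 shows "dS H x (%a b. f (a * antipode H b)) = s (counit H x) (f 1)"
proof -
 have "dS H x (%a b. a * antipode H b) = hscale H (counit H x) 1"
  by (subst sw_ssum[OF vector_space_hscale comul_in, symmetric])
   (auto intro!: hlin_intros simp: antipode_right)
 then have "f (dS H x (%a b. a * antipode H b)) = f (hscale H (counit H x) 1)" by simp
 then show ?thesis using assms by (subst (asm) hlin_mono_comp[OF assms]) (simp add: hlin_def)
qed

end

section \<open>Hopf algebras and R-matrices\<close>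

context hopf_algebra
begin

lemma dS3_antipode_right1:
 assumes "vector_space s" "\<And>b. hlin H s (%a. G a b)" "\<And>a. hlin H s (%b. G a b)"
 shows "dS H x (%a t. dS H t (%b c. G a (b * antipode H c))) = G x 1"
 by (simp add: dS_antipode_right[OF assms(3)] dS_counit_right[OF assms(2)])

lemma dS3_antipode_right2:
 assumes "vector_space s" "\<And>b. hlin H s (%a. G a b)" "\<And>a. hlin H s (%b. G a b)"
 shows "dS H x (%a t. dS H t (%b c. G (a * antipode H b) c)) = G 1 x"
proof -
 have "dS H x (%a t. dS H t (%b c. G (a * antipode H b) c)) =
  dS H x (%t c. dS H t (%a b. G (a * antipode H b) c))"
  by (rule dS_coassoc[symmetric, OF assms(1)])
   (intro hlin_intros hlin_comp[OF assms(2)] assms(3))+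
 then show ?thesis by (simp add: dS_antipode_right[OF assms(2)] dS_counit_left[OF assms(3)])
qed

lemma dS3_antipode_left2:
 assumes "vector_space s" "\<And>b. hlin H s (%a. G a b)" "\<And>a. hlin H s (%b. G a b)"
 shows "dS H x (%a t. dS H t (%b c. G (antipode H a * b) c)) = G 1 x"
proof -
 have "dS H x (%a t. dS H t (%b c. G (antipode H a * b) c)) =
  dS H x (%t c. dS H t (%a b. G (antipode H a * b) c))"
  by (rule dS_coassoc[symmetric, OF assms(1)])
   (intro hlin_intros hlin_comp[OF assms(2)] assms(3))+
 then show ?thesis by (simp add: dS_antipode_left[OF assms(2)] dS_counit_left[OF assms(3)])
qed

text \<open>Uniqueness of convolution inverses, written out. The factor x2 (y2 S(y3)) S(x3), which
  reduces to counits, is inserted after S(x1 y1); after rebracketing, S(x1 y1) x2 y2 collapses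
  instead and S(y) S(x) is left.\<close>

lemma antipode_mult: "antipode H (x * y) = antipode H y * antipode H x"
proof -
 let ?S = "antipode H"
 have "?S (x * y) = dS H x (%x1 x'. dS H x' (%x2 x3. dS H y (%y1 y'. dS H y' (%y2 y3.
   ?S (x1 * y1) * (x2 * (y2 * ?S y3)) * ?S x3))))"
 proof -
  have "dS H y (%y1 y'. dS H y' (%y2 y3. ?S (x1 * y1) * (x2 * (y2 * ?S y3)) * ?S x3)) =
   ?S (x1 * y) * (x2 * ?S x3)" for x1 x2 x3
   by (subst dS3_antipode_right1[OF vector_space_hscale])
    ((intro hlin_intros)+, simp add: mult.assoc)
  then show ?thesis
   by simp (subst dS3_antipode_right1[OF vector_space_hscale], (intro hlin_intros)+, simp)
 qed
 also have "\<dots> = dS H x (%x1 x'. dS H x' (%x2 x3. dS H y (%v y3. dS H v (%y1 y2.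
   ?S (x1 * y1) * (x2 * (y2 * ?S y3)) * ?S x3))))"
  by (rule ssum_cong, rule ssum_cong, rule dS_coassoc[symmetric, OF vector_space_hscale]) (intro hlin_intros)+
 also have "\<dots> = dS H x (%u x3. dS H u (%x1 x2. dS H y (%v y3. dS H v (%y1 y2.
   ?S (x1 * y1) * (x2 * (y2 * ?S y3)) * ?S x3))))"
  by (rule dS_coassoc[symmetric, OF vector_space_hscale]) (intro hlin_intros)+
 also have "\<dots> = dS H x (%u x3. dS H y (%v y3. dS H u (%x1 x2. dS H v (%y1 y2.
   ?S (x1 * y1) * (x2 * (y2 * ?S y3)) * ?S x3))))"
  by (intro ssum_cong ssum_swap)
 also have "\<dots> = dS H x (%u x3. dS H y (%v y3. dS H (u * v) (%p q. ?S p * q * (?S y3 * ?S x3))))"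
 proof -
  have "dS H (u * v) (%p q. ?S p * q * z) = dS H u (%x1 x2. dS H v (%y1 y2. ?S (x1 * y1) * (x2 * y2) * z))"
   for u v z by (rule dS_mult[OF vector_space_hscale]) (intro hlin_intros)+
  then show ?thesis by (simp add: mult.assoc)
 qed
 also have "\<dots> = dS H x (%u x3. dS H y (%v y3. hscale H (counit H u) (hscale H (counit H v) (?S y3 * ?S x3))))"
 proof -
  have "dS H w (%p q. ?S p * q * z) = hscale H (counit H w) z" for w z
   using dS_antipode_left[of "hscale H" "%y. y * z" w] by (simp add: hlin_intros)
  then show ?thesis by (simp add: counit_mult)
 qed
 also have "\<dots> = ?S y * ?S x"
 proof -
  have "dS H y (%v y3. hscale H c (hscale H (counit H v) (?S y3 * z))) = hscale H c (?S y * z)" for c z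
   by (subst ssum_scale[OF vector_space_hscale, symmetric], subst dS_counit_left)
    ((intro hlin_intros)+, simp)
  then show ?thesis by simp (rule dS_counit_left, intro hlin_intros)
 qed
 finally show ?thesis .
qed

lemma antipode_one: "antipode H 1 = 1"
 using dS_antipode_left[OF hlin_id, of 1]
 by (subst (asm) dS_one[OF vector_space_hscale]) ((intro hlin_intros)+, simp add: counit_one)

lemma counit_antipode: "counit H (antipode H x) = counit H x"
proof -
 have "counit H x = dS H x (%a b. counit H (antipode H a * b))"
  by (subst dS_antipode_left[of "(*)"]) ((intro hlin_intros)+, simp add: counit_one)
 also have "\<dots> = dS H x (%a b. counit H b * counit H (antipode H a))"
  by (simp add: counit_mult mult.commute)
 also have "\<dots> = counit H (antipode H x)"
  by (rule dS_counit_right) (intro hlin_intros)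
 finally show ?thesis ..
qed

text \<open>The convolution argument again: the coproduct of S(x) and the flipped S \<otimes> S of
  the coproduct of x are both convolution inverse to the coproduct. A trivial factor is inserted in
  each leg after the coproduct of S(x1), and then S(x1) x2 collapses.\<close>

lemma dS_antipode:
 assumes s: "vector_space s" and G: "\<And>b. hlin H s (%a. G a b)" "\<And>a. hlin H s (%b. G a b)"
 shows "dS H (antipode H x) G = dS H x (%a b. G (antipode H b) (antipode H a))"
proof -
 let ?S = "antipode H"
 note G' = hlin_comp[OF G(1)] hlin_comp[OF G(2)] s
 have "dS H (?S x) G = dS H x (%x1 t. s (counit H t) (dS H (?S x1) G))"
  by (rule dS_counit_right[symmetric]) (intro hlin_intros G')+
 also have "\<dots> = dS H x (%x1 t. dS H (?S x1) (%p q. s (counit H t) (G p q)))"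
  by (simp add: ssum_scale[OF s])
 also have "\<dots> = dS H x (%x1 t. dS H (?S x1) (%p q. dS H t (%p' t'. G (p * (p' * ?S t')) q)))"
 proof -
  have "dS H t (%p' t'. G (p * (p' * ?S t')) q) = s (counit H t) (G p q)" for t p q
   using dS_antipode_right[of s "%y. G (p * y) q" t] by (simp add: G' hlin_intros)
  then show ?thesis by simp
 qed
 also have "\<dots> = dS H x (%x1 t. dS H (?S x1) (%p q. dS H t (%p' t'. dS H t' (%q' u. dS H u (%x3 x4.
   G (p * (p' * ?S x4)) (q * (q' * ?S x3)))))))"
 proof -
  have "dS H t' (%q' u. dS H u (%x3 x4. G (p * (p' * ?S x4)) (q * (q' * ?S x3)))) = G (p * (p' * ?S t')) q"
   for p q p' t'
   by (subst dS3_antipode_right2[OF s, of "%y x4. G (p * (p' * ?S x4)) (q * y)"])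
    ((intro hlin_intros G')+, simp)
  then show ?thesis by simp
 qed
 also have "\<dots> = dS H x (%x1 t. dS H (?S x1) (%p q. dS H t (%x2 u. dS H x2 (%p' q'. dS H u (%x3 x4.
   G (p * (p' * ?S x4)) (q * (q' * ?S x3)))))))"
  by (rule ssum_cong, rule ssum_cong, rule dS_coassoc[symmetric, OF s]) (intro hlin_intros G')+
 also have "\<dots> = dS H x (%x1 t. dS H t (%x2 u. dS H (?S x1) (%p q. dS H x2 (%p' q'. dS H u (%x3 x4.
   G (p * p' * ?S x4) (q * q' * ?S x3))))))"
  unfolding mult.assoc by (intro ssum_cong ssum_swap)
 also have "\<dots> = dS H x (%x1 t. dS H t (%x2 u. dS H (?S x1 * x2) (%p q. dS H u (%x3 x4.
   G (p * ?S x4) (q * ?S x3)))))"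
  by (intro ssum_cong dS_mult[OF s, symmetric]) (intro hlin_intros G')+
 also have "\<dots> = dS H 1 (%p q. dS H x (%x3 x4. G (p * ?S x4) (q * ?S x3)))"
  by (rule dS3_antipode_left2[OF s, of "%y u. dS H y (%p q. dS H u (%x3 x4. G (p * ?S x4) (q * ?S x3)))"])
   (intro hlin_intros G')+
 also have "\<dots> = dS H x (%a b. G (?S b) (?S a))"
  by (subst dS_one[OF s]) ((intro hlin_intros G')+, simp)
 finally show ?thesis .
qed

section \<open>The inverse of the antipode\<close>

context
 assumes bij: "bij (antipode H)"
begin

abbreviation "Si \<equiv> inv_into UNIV (antipode H)"

lemma antipode_Si [simp]: "antipode H (Si x) = x"
 using bij by (simp add: bij_is_surj surj_f_inv_f)

lemma Si_antipode [simp]: "Si (antipode H x) = x"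
 using bij by (simp add: bij_is_inj)

lemma hlin_Si: "hlin H (hscale H) Si"
proof -
 have "antipode H (Si x + Si y) = x + y" "antipode H (hscale H c (Si x)) = hscale H c x" for x y c
  using linear_hlin[OF antipode_linear] by (simp_all add: hlin_def)
 then have "Si (x + y) = Si x + Si y" "Si (hscale H c x) = hscale H c (Si x)" for x y c
  using Si_antipode by metis+
 then show ?thesis by (simp add: hlin_def)
qed

lemma Si_mult: "Si (x * y) = Si y * Si x"
 using Si_antipode[of "Si y * Si x"] by (simp add: antipode_mult)

lemma Si_one: "Si 1 = 1"
 using Si_antipode[of 1] by (simp add: antipode_one)

lemma counit_Si: "counit H (Si x) = counit H x"
 using counit_antipode[of "Si x"] by simp

lemma dS_Si:
 assumes s: "vector_space s" and G: "\<And>b. hlin H s (%a. G a b)" "\<And>a. hlin H s (%b. G a b)"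
 shows "dS H (Si x) G = dS H x (%a b. G (Si b) (Si a))"
 using dS_antipode[OF s, of "%a b. G (Si b) (Si a)" "Si x"]
 by (simp add: hlin_comp[OF G(1) hlin_Si] hlin_comp[OF G(2) hlin_Si])

text \<open>Applying the antihomomorphism \<open>Si\<close> to x1 S(x2) reverses the factors and
  moves the inverse antipode to the first component.\<close>

lemma dS_Si_right:
 assumes "hlin H s f"
 shows "dS H x (%a b. f (b * Si a)) = s (counit H x) (f 1)"
 using dS_antipode_right[OF hlin_comp[OF assms hlin_Si], of x] by (simp add: Si_mult Si_one)

end

end

section \<open>Elementary identities for the R-matrix\<close>

context quasitriangular_hopf_algebra
begin

lemma rmat_in: "rmat H \<in>: hten H 2"
 using rmat_closed by simp

lemma hpow3_mult_pure: "amult (hpow H 3) (hpure H [a, b, c]) (hpure H [a', b', c']) = hpure H [a * a', b * b', c * c']"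
 unfolding hpow_def hpure_def
 using tensor_alg_mult(2)[OF is_alg_Halg is_alg_Halg, of "[]" "[a, b, c]" 0 3 "[]" "[a', b', c']"]
 by (simp add: words_def Halg_def numeral_3_eq_3)

lemma hpow3_mult:
 fixes P Q :: "'h => 'h => 'h list"
 assumes "\<And>a b. length (P a b) = 3" "\<And>a b. length (Q a b) = 3"
 shows "amult (hpow H 3) (rS H (%a b. hpure H (P a b))) (rS H (%a b. hpure H (Q a b))) =
  rS H (%a b. rS H (%c d. amult (hpow H 3) (hpure H (P a b)) (hpure H (Q c d))))"
proof -
 note bil = tensor_alg_mult(1)[OF is_alg_Halg is_alg_Halg, of 0 3, folded hpow_def]
 have cl: "hpure H (P a b) \<in>: hten H 3" "hpure H (Q a b) \<in>: hten H 3" for a b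
  using assms by (simp_all add: hpure_closed)
 show ?thesis
  by (subst linear_on_ssum[OF is_vspace_tensor bilinear_onD(2)[OF bil ssum_closed[OF is_vspace_tensor cl(2)]] cl(1)],
   subst linear_on_ssum[OF is_vspace_tensor bilinear_onD(1)[OF bil cl(1)] cl(2)]) (rule refl)
qed

context
 fixes s :: "'k => 'u::ab_group_add => 'u" and F :: "'h => 'h => 'h => 'u"
 assumes s: "vector_space s" and F: "\<And>b c. hlin H s (%a. F a b c)" "\<And>a c. hlin H s (%b. F a b c)"
  "\<And>a b. hlin H s (%c. F a b c)"
begin

text \<open>The axioms with right-hand sides R13 R23 and R13 R12, evaluated on a trilinear function.
  In the second, the copy standing first in the common leg carries the last component of the
  coproduct, hence \<open>F (a * c) d b\<close>.\<close>

lemma rS_comul_left: "rS H (%a b. dS H a (%a1 a2. F a1 a2 b)) = rS H (%a b. rS H (%c d. F a c (b * d)))"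
 and rS_comul_right: "rS H (%a b. dS H b (%b1 b2. F a b1 b2)) = rS H (%a b. rS H (%c d. F (a * c) d b))"
proof -
 define L where "L = hlift H 3 s (%hs. F (hs ! 0) (hs ! 1) (hs ! 2))"
 have m: "hmulti H 3 s (%hs. F (hs ! 0) (hs ! 1) (hs ! 2))" by (rule hmulti3I[OF F])
 note L = hlift_linear[OF s m, folded L_def]
 have LF: "L (hpure H [a, b, c]) = F a b c" for a b c
  unfolding L_def using hlift_pure[OF s m, of "[a, b, c]"] by simp
 have cl: "hpure H [a, b, c] \<in>: hten H 3" for a b c by (rule hpure_closed) simp
 note swr = sw_ssum[OF vector_space_fscale rmat_in] and swd = sw_ssum[OF vector_space_fscale comul_in]
 have R: "R12 H = rS H (%a b. hpure H [a, b, 1])" "R13 H = rS H (%a b. hpure H [a, 1, b])"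
  "R23 H = rS H (%a b. hpure H [1, a, b])"
  unfolding R12_def R13_def R23_def by (rule swr; intro hlin_intros)+
 have "rS H (%a b. dS H a (%a1 a2. hpure H [a1, a2, b])) = rS H (%a b. rS H (%c d. hpure H [a, c, b * d]))"
  using rmat_comul_left unfolding R
  by (simp add: swr swd hlin_intros hlin_hpure3[OF hlin_id] hpow3_mult hpow3_mult_pure)
 then have "L (rS H (%a b. dS H a (%a1 a2. hpure H [a1, a2, b]))) = L (rS H (%a b. rS H (%c d. hpure H [a, c, b * d])))"
  by simp
 then show "rS H (%a b. dS H a (%a1 a2. F a1 a2 b)) = rS H (%a b. rS H (%c d. F a c (b * d)))"
  by (simp add: linear_on_ssum[OF is_vspace_tensor L] LF cl ssum_closed[OF is_vspace_tensor])
 have "rS H (%a b. dS H b (%b1 b2. hpure H [a, b1, b2])) = rS H (%a b. rS H (%c d. hpure H [a * c, d, b]))"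
  using rmat_comul_right unfolding R
  by (simp add: swr swd hlin_intros hlin_hpure3[OF hlin_id] hpow3_mult hpow3_mult_pure)
 then have "L (rS H (%a b. dS H b (%b1 b2. hpure H [a, b1, b2]))) = L (rS H (%a b. rS H (%c d. hpure H [a * c, d, b])))"
  by simp
 then show "rS H (%a b. dS H b (%b1 b2. F a b1 b2)) = rS H (%a b. rS H (%c d. F (a * c) d b))"
  by (simp add: linear_on_ssum[OF is_vspace_tensor L] LF cl ssum_closed[OF is_vspace_tensor])
qed

end

lemma rS_comul:
 assumes s: "vector_space s" and G: "\<And>b. hlin H s (%a. G a b)" "\<And>a. hlin H s (%b. G a b)"
 shows "dS H x (%x1 x2. rS H (%a b. G (a * x1) (b * x2))) = dS H x (%x1 x2. rS H (%a b. G (x2 * a) (x1 * b)))"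
proof -
 have cl: "hpure H [b, a] \<in>: hten H 2" for a b by (rule hpure_closed) simp
 have op: "sumD H fscale x (%a b. hpure H [b, a]) = dS H x (%a b. hpure H [b, a])"
  by (rule sw_ssum[OF vector_space_fscale comul_in]) (intro hlin_intros)+
 have opc: "dS H x (%a b. hpure H [b, a]) \<in>: hten H 2"
  by (rule ssum_closed[OF is_vspace_tensor cl])
 have "rS H (%a b. dS H x (%c d. G (a * c) (b * d))) = ssum H (amult (hpow H 2) (rmat H) (comul H x)) G"
  by (rule hpow_mult_ssum[OF s G rmat_in comul_in, symmetric])
 also have "\<dots> = ssum H (dS H x (%a b. hpure H [b, a])) (%a b. rS H (%c d. G (a * c) (b * d)))"
  unfolding rmat_comul op by (rule hpow_mult_ssum[OF s G opc rmat_in])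
 also have "\<dots> = dS H x (%x1 x2. rS H (%a b. G (x2 * a) (x1 * b)))"
 proof -
  have l: "\<And>b. hlin H s (%a. rS H (%c d. G (a * c) (b * d)))" "\<And>a. hlin H s (%b. rS H (%c d. G (a * c) (b * d)))"
   by (intro hlin_intros s hlin_comp[OF G(1)] hlin_comp[OF G(2)])+
  show ?thesis
   by (simp add: linear_on_ssum[OF is_vspace_tensor ssum_linear[OF s l] cl] ssum_hpure[OF s l])
 qed
 finally show ?thesis by (simp add: ssum_swap[of H "rmat H"])
qed

text \<open>The scaling and the summand are quantified inside, so that one tensor \<open>Q\<close>
  cancels the R-matrix under every bilinear function with values in the given type.\<close>

lemma rS_inverse_ex:
 "\<exists>Q. \<forall>(s :: 'k => 'u::ab_group_add => 'u) G. vector_space s \<longrightarrow>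
   (\<forall>b. hlin H s (%a. G a b)) \<longrightarrow> (\<forall>a. hlin H s (%b. G a b)) \<longrightarrow>
   rS H (%a b. ssum H Q (%p q. G (a * p) (b * q))) = G 1 1"
proof -
 obtain Q where Q: "Q \<in>: hten H 2" "amult (hpow H 2) (rmat H) Q = aone (hpow H 2)"
  using rmat_invertible by auto
 have "rS H (%a b. ssum H Q (%p q. G (a * p) (b * q))) = G 1 1"
  if s: "vector_space s" and G: "\<And>b. hlin H s (%a. G a b)" "\<And>a. hlin H s (%b. G a b)"
  for s :: "'k => 'u => 'u" and G
  using hpow_mult_ssum[OF s G rmat_in Q(1)] by (simp add: Q(2) aone_hpow2 ssum_hpure[OF s G])
 then show ?thesis by blast
qed

text \<open>Put e = (\<epsilon> \<otimes> id)(R). Applying \<epsilon> to the first leg of (\<Delta>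
  \<otimes> id)(R) = R13 R23 gives R = (1 \<otimes> e) R, and cancelling R on the right gives e =
  1.\<close>

lemma rS_counit_left:
 fixes s :: "'k => 'u::ab_group_add => 'u"
 assumes s: "vector_space s" and f: "hlin H s f"
 shows "rS H (%a b. s (counit H a) (f b)) = f 1"
proof -
 interpret sv: vector_space s by fact
 obtain Q where Q: "\<And>G. (\<And>b. hlin H s (%a. G a b)) ==> (\<And>a. hlin H s (%b. G a b)) ==>
   rS H (%a b. ssum H Q (%p q. G (a * p) (b * q))) = G 1 1"
  using rS_inverse_ex[where 'u='u] s by blast
 note f' = hlin_comp[OF f] s
 \<comment> \<open>\<open>F\<close> is \<epsilon> \<otimes> \<open>f\<close> preceded by right
   multiplication with the inverse of R, so summing it over R evaluates \<epsilon> \<otimes>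
   \<open>f\<close> at 1 \<otimes> 1.\<close>
 define F where "F q r = ssum H Q (%p' q'. s (counit H (q * p')) (f (r * q')))" for q r
 have "f 1 = rS H (%a b. F a b)"
  unfolding F_def by (subst Q) ((intro hlin_intros f')+, simp add: counit_one)
 also have "\<dots> = rS H (%a b. dS H a (%a1 a2. s (counit H a1) (F a2 b)))"
  unfolding F_def by (subst dS_counit_left) ((intro hlin_intros f')+, simp)
 also have "\<dots> = rS H (%a b. rS H (%c d. s (counit H a) (F c (b * d))))"
  unfolding F_def by (rule rS_comul_left[OF s]) (intro hlin_intros f')+
 also have "\<dots> = rS H (%a b. s (counit H a) (rS H (%c d. F c (b * d))))"
  by (simp add: ssum_scale[OF s])
 also have "\<dots> = rS H (%a b. s (counit H a) (f b))"
 proof -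
  have "rS H (%c d. F c (b * d)) = f b" for b
   unfolding F_def mult.assoc
   by (subst Q[of "%x y. s (counit H x) (f (b * y))"]) ((intro hlin_intros f')+, simp add: counit_one)
  then show ?thesis by simp
 qed
 finally show ?thesis ..
qed

lemma rS_counit_right:
 fixes s :: "'k => 'u::ab_group_add => 'u"
 assumes s: "vector_space s" and f: "hlin H s f"
 shows "rS H (%a b. s (counit H b) (f a)) = f 1"
proof -
 interpret sv: vector_space s by fact
 obtain Q where Q: "\<And>G. (\<And>b. hlin H s (%a. G a b)) ==> (\<And>a. hlin H s (%b. G a b)) ==>
   rS H (%a b. ssum H Q (%p q. G (a * p) (b * q))) = G 1 1"
  using rS_inverse_ex[where 'u='u] s by blast
 note f' = hlin_comp[OF f] s
 define F where "F q r = ssum H Q (%p' q'. s (counit H (r * q')) (f (q * p')))" for q r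
 have "f 1 = rS H (%a b. F a b)"
  unfolding F_def by (subst Q[of "%x y. s (counit H y) (f x)"]) ((intro hlin_intros f')+, simp add: counit_one)
 also have "\<dots> = rS H (%a b. dS H b (%b1 b2. s (counit H b2) (F a b1)))"
  unfolding F_def by (subst dS_counit_right) ((intro hlin_intros f')+, simp)
 also have "\<dots> = rS H (%a b. rS H (%c d. s (counit H b) (F (a * c) d)))"
  unfolding F_def by (rule rS_comul_right[OF s]) (intro hlin_intros f')+
 also have "\<dots> = rS H (%a b. s (counit H b) (rS H (%c d. F (a * c) d)))"
  by (simp add: ssum_scale[OF s])
 also have "\<dots> = rS H (%a b. s (counit H b) (f a))"
 proof -
  have "rS H (%c d. F (a * c) d) = f a" for a
   unfolding F_def mult.assoc
   by (subst Q[of "%x y. s (counit H y) (f (a * x))"]) ((intro hlin_intros f')+, simp add: counit_one)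
  then show ?thesis by simp
 qed
 finally show ?thesis ..
qed

text \<open>Comes from (id \<otimes> \<Delta>)(R) = R13 R12 and b1 S(b2) = \<epsilon>(b). The two
  copies occur in opposite orders in the two legs, which is why \<open>Yop\<close> below multiplies
  one of its slots on the left.\<close>

lemma rS_antipode:
 assumes s: "vector_space s" and G: "\<And>b. hlin H s (%a. G a b)" "\<And>a. hlin H s (%b. G a b)"
 shows "rS H (%a b. rS H (%c d. G (c * a) (b * antipode H d))) = G 1 1"
proof -
 note G' = hlin_comp[OF G(1)] hlin_comp[OF G(2)] s
 have "rS H (%a b. rS H (%c d. G (c * a) (b * antipode H d))) = rS H (%a b. rS H (%c d. G (a * c) (d * antipode H b)))"
  by (rule ssum_swap)
 also have "\<dots> = rS H (%a b. dS H b (%b1 b2. G a (b1 * antipode H b2)))"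
  by (rule rS_comul_right[symmetric, OF s, of "%a d b. G a (d * antipode H b)"]) (intro hlin_intros G')+
 also have "\<dots> = rS H (%a b. s (counit H b) (G a 1))"
  by (simp add: dS_antipode_right[OF G(2)])
 also have "\<dots> = G 1 1" by (rule rS_counit_right[OF s G(1)])
 finally show ?thesis .
qed

text \<open>The last two factors on the left-hand side merge into (\<Delta> \<otimes> id)(R), past
  which the first factor moves by quasi-cocommutativity.\<close>

lemma rS_yang_baxter:
 assumes s: "vector_space s" and G: "\<And>b c. hlin H s (%a. G a b c)" "\<And>a c. hlin H s (%b. G a b c)"
  "\<And>a b. hlin H s (%c. G a b c)"
 shows "rS H (%a1 b1. rS H (%a2 b2. rS H (%a3 b3. G (a1 * a2) (b1 * a3) (b2 * b3)))) =
  rS H (%a3 b3. rS H (%a2 b2. rS H (%a1 b1. G (a2 * a1) (a3 * b1) (b3 * b2))))"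
proof -
 note G' = hlin_comp[OF G(1)] hlin_comp[OF G(2)] hlin_comp[OF G(3)] s
 have "rS H (%a1 b1. rS H (%a2 b2. rS H (%a3 b3. G (a1 * a2) (b1 * a3) (b2 * b3)))) =
  rS H (%a1 b1. rS H (%a b. dS H a (%x y. G (a1 * x) (b1 * y) b)))"
  by (rule ssum_cong, rule rS_comul_left[symmetric, OF s]) (intro hlin_intros G')+
 also have "\<dots> = rS H (%a b. dS H a (%x y. rS H (%a1 b1. G (a1 * x) (b1 * y) b)))"
  by (subst ssum_swap, intro ssum_cong ssum_swap)
 also have "\<dots> = rS H (%a b. dS H a (%x y. rS H (%a1 b1. G (y * a1) (x * b1) b)))"
  by (rule ssum_cong, rule rS_comul[OF s, of "%p q. G p q b" for b]) (intro hlin_intros G')+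
 also have "\<dots> = rS H (%a2 b2. rS H (%a3 b3. rS H (%a1 b1. G (a3 * a1) (a2 * b1) (b2 * b3))))"
  by (rule rS_comul_left[OF s]) (intro hlin_intros G')+
 finally show ?thesis .
qed

end

text \<open>
 A function \<open>F\<close> of slots \<open>x 0, \<dots>, x (m - 1)\<close> in \<open>H\<close>, linear in each of them, is a linear map on
 \<open>H\<^sup>m\<close>. \<open>Rop H i j\<close> precomposes it with right multiplication by the R-matrix in the slots
 \<open>i\<close> and \<open>j\<close>, so composition of operators is multiplication in \<open>H\<^sup>m\<close>. \<open>Yop\<close> multiplies on the left in
 slot \<open>i\<close> and, through the antipode, on the right in slot \<open>j\<close>: it undoes a factor \<open>Rop H i j\<close>
 that is leftmost in slot \<open>i\<close> and rightmost in slot \<open>j\<close>.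
\<close>

definition mlin ::
  "('k::field, 'h::ring_1) qthopf => nat => ('k => 'u::ab_group_add => 'u) => ((nat => 'h) => 'u) => bool"
 where "mlin H m s F \<longleftrightarrow> (\<forall>x. \<forall>i<m. hlin H s (%y. F (x(i := y))))"

definition Rop ::
  "('k::field, 'h::ring_1) qthopf => nat => nat => ((nat => 'h) => 'u::ab_group_add) => (nat => 'h) => 'u"
 where "Rop H i j F = (%x. rS H (%a b. F (x(i := x i * a, j := x j * b))))"

definition Yop ::
  "('k::field, 'h::ring_1) qthopf => nat => nat => ((nat => 'h) => 'u::ab_group_add) => (nat => 'h) => 'u"
 where "Yop H i j F = (%x. rS H (%a b. F (x(i := a * x i, j := x j * antipode H b))))"

lemma Rop_commute:
 fixes F :: "(nat => 'b::ring_1) => 'u::ab_group_add"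
 assumes "i \<noteq> k" "i \<noteq> l" "j \<noteq> k" "j \<noteq> l"
 shows "Rop H i j (Rop H k l F) = Rop H k l (Rop H i j F)"
proof
 fix x :: "nat => 'b"
 have "x(i := p, j := q, k := r, l := t) = x(k := r, l := t, i := p, j := q)" for p q r t
  using assms by (simp add: fun_upd_twist)
 then show "Rop H i j (Rop H k l F) x = Rop H k l (Rop H i j F) x"
  unfolding Rop_def using assms by (subst ssum_swap) simp
qed

text \<open>Left multiplication in slot \<open>i\<close> commutes with every right multiplication,
  so \<open>i\<close> may be one of \<open>i'\<close>, \<open>j'\<close>. Only slot
  \<open>j\<close>, where both operators multiply on the right, has to be avoided.\<close>

lemma Yop_Rop:
 fixes F :: "(nat => 'b::ring_1) => 'u::ab_group_add"
 assumes "i \<noteq> j" "i' \<noteq> j'" "j \<noteq> i'" "j \<noteq> j'"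
 shows "Yop H i j (Rop H i' j' F) = Rop H i' j' (Yop H i j F)"
proof
 fix x :: "nat => 'b"
 have "(x(i := a * x i, j := x j * e))(i' := (x(i := a * x i, j := x j * e)) i' * c,
    j' := (x(i := a * x i, j := x j * e)) j' * d) =
   (x(i' := x i' * c, j' := x j' * d))(i := a * (x(i' := x i' * c, j' := x j' * d)) i,
    j := (x(i' := x i' * c, j' := x j' * d)) j * e)" for a c d e
  using assms by (auto simp: fun_eq_iff mult.assoc)
 then show "Yop H i j (Rop H i' j' F) x = Rop H i' j' (Yop H i j F) x"
  unfolding Rop_def Yop_def by (subst ssum_swap) (simp only:)
qed

context quasitriangular_hopf_algebra
begin

context
 fixes m :: nat and s :: "'k => 'u::ab_group_add => 'u" and F :: "(nat => 'h) => 'u"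
 assumes s: "vector_space s" and F: "mlin H m s F"
begin

lemma Rop_yang_baxter:
 assumes "i < m" "j < m" "k < m" "i \<noteq> j" "i \<noteq> k" "j \<noteq> k"
 shows "Rop H i j (Rop H i k (Rop H j k F)) = Rop H j k (Rop H i k (Rop H i j F))"
proof
 fix x
 let ?G = "%p q r. F (x(i := x i * p, j := x j * q, k := x k * r))"
 have l: "hlin H s (%y. F (z(l := c * y)))" if "l < m" for z l c
  by (rule hlin_comp[of H s "%y. F (z(l := y))"]) (use F that in \<open>auto simp: mlin_def intro!: hlin_intros\<close>)
 have 1: "hlin H s (%p. ?G p q r)" for q r
  using l[of i "x(j := x j * q, k := x k * r)"] assms by (simp add: fun_upd_twist)
 have 2: "hlin H s (%q. ?G p q r)" for p r
 proof -
  have "x(i := x i * p, j := y, k := x k * r) = (x(i := x i * p, k := x k * r))(j := y)" for y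
   using assms by (auto simp: fun_eq_iff)
  then show ?thesis using l[of j "x(i := x i * p, k := x k * r)"] assms by simp
 qed
 have 3: "hlin H s (%r. ?G p q r)" for p q
  using l[OF assms(3), of "x(i := x i * p, j := x j * q)"] by simp
 have tw: "x(i := p, j := q, i := p', k := r, j := q', k := r') = x(i := p', j := q', k := r')"
   "x(j := q, k := r, i := p, k := r', i := p', j := q') = x(i := p', j := q', k := r')"
   "x(k := r', i := p', j := q') = x(i := p', j := q', k := r')"
  for p q r p' q' r'
  using assms by (auto simp: fun_eq_iff)
 show "Rop H i j (Rop H i k (Rop H j k F)) x = Rop H j k (Rop H i k (Rop H i j F)) x"
  unfolding Rop_def using rS_yang_baxter[OF s, of ?G, OF 1 2 3] assms by (simp add: tw mult.assoc)
qed

lemma mlin_Rop: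
 assumes "i < m" "j < m" "i \<noteq> j"
 shows "mlin H m s (Rop H i j F)"
 unfolding mlin_def Rop_def
proof (intro allI impI hlin_ssum[OF s])
 fix x k a b assume k: "k < m"
 have l: "hlin H s (%y. F (z(l := y)))" if "l < m" for z l
  using F that by (simp add: mlin_def)
 consider "k = i" | "k = j" | "k \<noteq> i" "k \<noteq> j" by blast
 then show "hlin H s (%y. F ((x(k := y))(i := (x(k := y)) i * a, j := (x(k := y)) j * b)))"
 proof cases
  case 1
  show ?thesis
   using hlin_comp[OF l[OF assms(1), of "x(j := x j * b)"] hlin_mult_left[OF hlin_id, of a]] 1 assms
   by (simp add: fun_upd_twist)
 next
  case 2
  show ?thesis
   using hlin_comp[OF l[OF assms(2), of "x(i := x i * a)"] hlin_mult_left[OF hlin_id, of b]] 2 assms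
   by (simp add: fun_upd_twist)
 next
  case 3
  have "(x(k := y))(i := (x(k := y)) i * a, j := (x(k := y)) j * b) = (x(i := x i * a, j := x j * b))(k := y)" for y
   using 3 assms by (auto simp: fun_eq_iff)
  then show ?thesis using l[OF k] by simp
 qed
qed

text \<open>\<open>Rop\<close> writes its leg into slot \<open>i\<close>, which holds 1, and
  \<open>Yop\<close> puts its own leg to the left of it. This produces the opposite orders that
  \<open>rS_antipode\<close> cancels.\<close>

lemma Rop_Yop:
 assumes "i < m" "j < m" "i \<noteq> j" "x i = 1"
 shows "Rop H i j (Yop H i j F) x = F x"
proof -
 let ?G = "%p q. F (x(i := p, j := x j * q))"
 have l: "hlin H s (%y. F (z(l := y)))" if "l < m" for z l
  using F that by (simp add: mlin_def)
 have 1: "hlin H s (%p. ?G p q)" for q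
  using l[OF assms(1), of "x(j := x j * q)"] assms by (simp add: fun_upd_twist)
 have 2: "hlin H s (%q. ?G p q)" for p
  using hlin_comp[OF l[OF assms(2), of "x(i := p)"] hlin_mult_right[OF hlin_id]] assms by simp
 have tw: "x(i := p, j := q, i := p', j := q') = x(i := p', j := q')" for p q p' q'
  using assms by (auto simp: fun_eq_iff)
 have "x(i := 1, j := x j) = x" using assms by auto
 then show ?thesis
  unfolding Rop_def Yop_def using rS_antipode[OF s, of ?G, OF 1 2] assms by (simp add: tw mult.assoc)
qed

end

end

section \<open>The restricted dual\<close>

lemma span_closed:
 assumes "is_vspace V" "vcarrier V = module.span (vscale V) S"
  "linear_on V (vscale U) L" "is_vspace U" "\<And>x. x \<in> S ==> L x \<in>: U" "X \<in>: V"
 shows "L X \<in>: U"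
proof -
 interpret V: vector_space "vscale V" using assms(1) by (rule is_vspace_vector_space)
 have "X \<in>: V \<and> L X \<in>: U"
 proof (rule V.span_induct_alt[OF assms(6)[unfolded assms(2)]])
  show "0 \<in>: V \<and> L 0 \<in>: U"
   using linear_on_0[OF assms(1,3)] is_vspace_zero[OF assms(1)] is_vspace_zero[OF assms(4)] by simp
  fix c x y assume x: "x \<in> S" and y: "y \<in>: V \<and> L y \<in>: U"
  have xV: "x \<in>: V" unfolding assms(2) using x by (rule V.span_base)
  note cx = is_vspace_scale[OF assms(1) xV, of c]
  have "L (vscale V c x + y) = vscale U c (L x) + L y"
   using y by (simp add: linear_on_add[OF assms(3) cx] linear_on_scale[OF assms(3) xV])
  then show "vscale V c x + y \<in>: V \<and> L (vscale V c x + y) \<in>: U"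
   using y assms(5)[OF x] by (simp add: is_vspace_add[OF assms(1) cx] is_vspace_add[OF assms(4) is_vspace_scale[OF assms(4)]])
 qed
 then show ?thesis ..
qed

lemma ssum_sum: "ssum H t (%a b. \<Sum>i\<in>I. F i a b) = (\<Sum>i\<in>I. ssum H t (F i))"
 by (induction I rule: infinite_finite_induct) (simp_all add: ssum_zero ssum_add)

lemma ssum_mult_right: "ssum H t F * c = ssum H t (%a b. F a b * (c :: 'k::field))"
 by (rule ssum_hom) (simp add: algebra_simps)

lemma ssum_mult_left: "c * ssum H t F = ssum H t (%a b. (c :: 'k::field) * F a b)"
 by (rule ssum_hom) (simp add: algebra_simps)

lemma linear_on_fun:
 fixes F :: "'v::ab_group_add => 'x => 'k::field"
 shows "(\<And>w. linear_on V (*) (%v. F v w)) ==> linear_on V fscale F"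
 by (simp add: linear_on_def fun_eq_iff fscale_def)

text \<open>The index r = i d' + j stands for the pair (i, j), as in a Kronecker product of matrices
  of sizes d and d'.\<close>

lemma sum_div_mod:
 fixes f g :: "nat => 'a::comm_semiring_1"
 shows "(\<Sum>r<d * d'. f (r div d') * g (r mod d')) = (\<Sum>i<d. f i) * (\<Sum>j<d'. g j)"
proof -
 have "(\<Sum>r<d * d'. f (r div d') * g (r mod d')) = (\<Sum>m<d. \<Sum>r\<in>{m * d'..<m * d' + d'}. f (r div d') * g (r mod d'))"
  by (rule sum.nat_group[symmetric])
 also have "\<dots> = (\<Sum>m<d. \<Sum>j<d'. f m * g j)"
 proof (rule sum.cong[OF refl])
  fix m
  have "(\<Sum>r\<in>{m * d'..<m * d' + d'}. f (r div d') * g (r mod d')) =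
    (\<Sum>j<d'. f ((m * d' + j) div d') * g ((m * d' + j) mod d'))"
   using sum.shift_bounds_nat_ivl[of "%r. f (r div d') * g (r mod d')" 0 "m * d'" d']
   by (simp add: add.commute lessThan_atLeast0)
  also have "\<dots> = (\<Sum>j<d'. f m * g j)" by (rule sum.cong) auto
  finally show "(\<Sum>r\<in>{m * d'..<m * d' + d'}. f (r div d') * g (r mod d')) = (\<Sum>j<d'. f m * g j)" .
 qed
 also have "\<dots> = (\<Sum>i<d. f i) * (\<Sum>j<d'. g j)" by (simp add: sum_product)
 finally show ?thesis .
qed

lemma scalar_prod_mult_mat_vec:
 fixes M :: "'k::field mat"
 assumes "M \<in> carrier_mat d d" "u \<in> carrier_vec d" "v \<in> carrier_vec d"
 shows "u \<bullet> (M *\<^sub>v v) = (\<Sum>i<d. \<Sum>j<d. u $ i * v $ j * M $$ (i, j))"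
 using assms
 by (auto simp: scalar_prod_def lessThan_atLeast0 sum_distrib_left mult_ac intro!: sum.cong)

lemma hlin_sum [hlin_intros]:
 fixes f :: "'i => 'h::ring_1 => 'k::field"
 shows "(\<And>i. i \<in> I ==> hlin H (*) (f i)) ==> hlin H (*) (%x. \<Sum>i\<in>I. f i x)"
 by (simp add: hlin_def sum.distrib sum_distrib_left)

lemma matrix_rep_entries:
 assumes "matrix_rep H d \<rho>"
 shows "\<rho> x \<in> carrier_mat d d"
  and "i < d ==> j < d ==> hlin H (*) (%x. \<rho> x $$ (i, j))"
  and "i < d ==> j < d ==> \<rho> (x * y) $$ (i, j) = (\<Sum>l<d. \<rho> x $$ (i, l) * \<rho> y $$ (l, j))"
  and "i < d ==> j < d ==> \<rho> 1 $$ (i, j) = (if i = j then 1 else 0)"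
proof -
 have c: "\<rho> x \<in> carrier_mat d d" for x using assms by (simp add: matrix_rep_def)
 then show "\<rho> x \<in> carrier_mat d d" .
 have d: "dim_row (\<rho> x) = d" "dim_col (\<rho> x) = d" for x using c by auto
 show "i < d ==> j < d ==> hlin H (*) (%x. \<rho> x $$ (i, j))"
  using assms by (simp add: matrix_rep_def hlin_def d)
 show "i < d ==> j < d ==> \<rho> 1 $$ (i, j) = (if i = j then 1 else 0)"
  using assms by (simp add: matrix_rep_def)
 have "\<rho> (x * y) = \<rho> x * \<rho> y" using assms by (simp add: matrix_rep_def)
 then show "i < d ==> j < d ==> \<rho> (x * y) $$ (i, j) = (\<Sum>l<d. \<rho> x $$ (i, l) * \<rho> y $$ (l, j))"
  using c[of x] c[of y] by (simp add: scalar_prod_def lessThan_atLeast0)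
qed

lemma vscale_Hdual [simp]: "vscale (Hdual H) = fscale"
 by (simp add: Hdual_def)

lemma Hdual_span: "vcarrier (Hdual H) = module.span fscale (matrix_coefficients H)"
 by (simp add: Hdual_def)

lemma is_vspace_Hdual: "is_vspace (Hdual (H :: ('k::field, 'h::ring_1) qthopf))"
proof -
 interpret f: vector_space "fscale :: 'k => ('h => 'k) => _" by (rule vector_space_fscale)
 show ?thesis by (simp add: is_vspace_def Hdual_def f.vector_space_axioms f.subspace_span)
qed

lemma matrix_coefficients_Hdual:
 fixes H :: "('k::field, 'h::ring_1) qthopf"
 assumes "\<phi> \<in> matrix_coefficients H"
 shows "\<phi> \<in>: Hdual H"
proof -
 interpret f: vector_space "fscale :: 'k => ('h => 'k) => _" by (rule vector_space_fscale)
 show ?thesis unfolding Hdual_span using assms by (rule f.span_base)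
qed

lemma Hdual_hlin:
 assumes "\<phi> \<in>: Hdual H"
 shows "hlin H (*) \<phi>"
proof -
 have cf: "hlin H (*) \<phi>" if \<phi>: "\<phi> \<in> matrix_coefficients H" for \<phi>
 proof -
  obtain d \<rho> u v where r: "matrix_rep H d \<rho>" "u \<in> carrier_vec d" "v \<in> carrier_vec d"
   and \<phi>: "\<phi> = (%x. u \<bullet> (\<rho> x *\<^sub>v v))" using \<phi> by (auto simp: matrix_coefficients_def)
  have "\<phi> = (%x. \<Sum>i<d. \<Sum>j<d. u $ i * v $ j * \<rho> x $$ (i, j))"
   unfolding \<phi> by (rule ext) (rule scalar_prod_mult_mat_vec[OF matrix_rep_entries(1)[OF r(1)] r(2,3)])
  then show ?thesis
   by simp (intro hlin_sum hlin_field_right matrix_rep_entries(2)[OF r(1)]; simp)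
 qed
 note eq = span_linear_eq[OF is_vspace_Hdual, of H "matrix_coefficients H" "(*)" _ _ \<phi>,
   unfolded vscale_Hdual, OF Hdual_span vector_space_mult _ _ _ assms]
 show ?thesis
  unfolding hlin_def
 proof (intro allI conjI)
  show "\<phi> (x + y) = \<phi> x + \<phi> y" for x y
   by (rule eq[of "%\<phi>. \<phi> (x + y)" "%\<phi>. \<phi> x + \<phi> y"])
    (use cf in \<open>auto simp: hlin_def linear_on_def fscale_def algebra_simps\<close>)
  show "\<phi> (hscale H c x) = c * \<phi> x" for c x
   by (rule eq[of "%\<phi>. \<phi> (hscale H c x)" "%\<phi>. c * \<phi> x"])
    (use cf in \<open>auto simp: hlin_def linear_on_def fscale_def algebra_simps\<close>)
 qed
qed

lemma lact_apply [simp]: "(x \<triangleright> \<phi>) h = \<phi> (h * x)"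
 by (simp add: lact_def)

lemma ract_apply [simp]: "(\<phi> \<triangleleft> x) h = \<phi> (x * h)"
 by (simp add: ract_def)

lemma linear_on_lact: "linear_on V fscale (%\<phi>. x \<triangleright> \<phi>)" if "vscale V = fscale"
 using that by (simp add: linear_on_def fscale_def fun_eq_iff)

lemma linear_on_ract: "linear_on V fscale (%\<phi>. \<phi> \<triangleleft> x)" if "vscale V = fscale"
 using that by (simp add: linear_on_def fscale_def fun_eq_iff)

lemma lact_Hdual:
 assumes "\<phi> \<in>: Hdual H"
 shows "x \<triangleright> \<phi> \<in>: Hdual H"
proof (rule span_closed[OF is_vspace_Hdual _ _ is_vspace_Hdual _ assms])
 show "linear_on (Hdual H) (vscale (Hdual H)) (%\<phi>. x \<triangleright> \<phi>)"
  unfolding vscale_Hdual by (rule linear_on_lact) simp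
 fix \<phi> assume "\<phi> \<in> matrix_coefficients H"
 then obtain d \<rho> u v where r: "matrix_rep H d \<rho>" "u \<in> carrier_vec d" "v \<in> carrier_vec d"
   and \<phi>: "\<phi> = (%x. u \<bullet> (\<rho> x *\<^sub>v v))" by (auto simp: matrix_coefficients_def)
 then have "\<rho> (h * x) *\<^sub>v v = \<rho> h *\<^sub>v (\<rho> x *\<^sub>v v)" for h
  unfolding matrix_rep_def by (metis assoc_mult_mat_vec)
 moreover have "\<rho> x *\<^sub>v v \<in> carrier_vec d"
  using matrix_rep_entries(1)[OF r(1)] r(3) by (rule mult_mat_vec_carrier)
 ultimately have "x \<triangleright> \<phi> \<in> matrix_coefficients H"
  using r by (auto simp: \<phi> matrix_coefficients_def lact_def)
 then show "x \<triangleright> \<phi> \<in>: Hdual H" by (rule matrix_coefficients_Hdual)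
qed (simp add: Hdual_span)

text \<open>While the other action replaces the column vector \<open>v\<close>, this one replaces
  the row vector \<open>u\<close> by the transpose of \<rho>(x) applied to it.\<close>

lemma ract_Hdual:
 assumes "\<phi> \<in>: Hdual H"
 shows "\<phi> \<triangleleft> x \<in>: Hdual H"
proof (rule span_closed[OF is_vspace_Hdual _ _ is_vspace_Hdual _ assms])
 show "linear_on (Hdual H) (vscale (Hdual H)) (%\<phi>. \<phi> \<triangleleft> x)"
  unfolding vscale_Hdual by (rule linear_on_ract) simp
 fix \<phi> assume "\<phi> \<in> matrix_coefficients H"
 then obtain d \<rho> u v where r: "matrix_rep H d \<rho>" "u \<in> carrier_vec d" "v \<in> carrier_vec d"
   and \<phi>: "\<phi> = (%x. u \<bullet> (\<rho> x *\<^sub>v v))" by (auto simp: matrix_coefficients_def)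
 have "u \<bullet> (\<rho> (x * h) *\<^sub>v v) = (transpose_mat (\<rho> x) *\<^sub>v u) \<bullet> (\<rho> h *\<^sub>v v)" for h
 proof -
  have c: "\<rho> x \<in> carrier_mat d d" "\<rho> h \<in> carrier_mat d d" using r by (auto simp: matrix_rep_def)
  have w: "\<rho> h *\<^sub>v v \<in> carrier_vec d" using c r by simp
  have "\<rho> (x * h) *\<^sub>v v = \<rho> x *\<^sub>v (\<rho> h *\<^sub>v v)"
   using r c unfolding matrix_rep_def by (metis assoc_mult_mat_vec)
  moreover have "u \<bullet> (\<rho> x *\<^sub>v (\<rho> h *\<^sub>v v)) = (transpose_mat (\<rho> x) *\<^sub>v u) \<bullet> (\<rho> h *\<^sub>v v)"
   using transpose_vec_mult_scalar[OF c(1) w r(2)] r c w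
   by (metis comm_scalar_prod mult_mat_vec_carrier transpose_carrier_mat)
  ultimately show ?thesis by simp
 qed
 moreover have "transpose_mat (\<rho> x) *\<^sub>v u \<in> carrier_vec d"
  using matrix_rep_entries(1)[OF r(1), of x] r(2) by (intro mult_mat_vec_carrier) simp_all
 ultimately have "\<phi> \<triangleleft> x \<in> matrix_coefficients H"
  using r by (auto simp: \<phi> matrix_coefficients_def ract_def)
 then show "\<phi> \<triangleleft> x \<in>: Hdual H" by (rule matrix_coefficients_Hdual)
qed (simp add: Hdual_span)

context hopf_algebra
begin

lemma counit_Hdual: "counit H \<in>: Hdual H"
proof (rule matrix_coefficients_Hdual)
 \<comment> \<open>The trivial representation, on a one-dimensional space.\<close>
 let ?r = "%x. mat 1 1 (%_. counit H x)"
 have "matrix_rep H 1 ?r"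
  using linear_hlin[OF counit_linear]
  by (auto simp: matrix_rep_def hlin_def counit_mult counit_one scalar_prod_def intro!: eq_matI)
 moreover have "counit H = (%x. vec 1 (%_. 1) \<bullet> (?r x *\<^sub>v vec 1 (%_. 1)))"
  by (simp add: scalar_prod_def fun_eq_iff)
 ultimately show "counit H \<in> matrix_coefficients H"
  unfolding matrix_coefficients_def by (intro CollectI exI conjI) auto
qed

lemma star_apply:
 assumes "hlin H (*) \<phi>" "hlin H (*) \<psi>"
 shows "star H \<phi> \<psi> h = dS H h (%a b. \<phi> a * \<psi> b)"
 unfolding star_def by (rule sw_ssum[OF vector_space_mult comul_in]) (intro hlin_intros assms)+

lemma hlin_lact: "hlin H (*) \<phi> ==> hlin H (*) (x \<triangleright> \<phi>)"
 unfolding lact_def by (erule hlin_comp) (intro hlin_intros)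

lemma hlin_ract: "hlin H (*) \<phi> ==> hlin H (*) (\<phi> \<triangleleft> x)"
 unfolding ract_def by (erule hlin_comp) (rule hlin_mult_right[OF hlin_id])

lemma bilinear_star: "bilinear_on (Hdual H) (Hdual H) fscale (star H)"
proof (rule bilinear_onI)
 fix \<phi> assume \<phi>: "\<phi> \<in>: Hdual H"
 have 1: "linear_on (Hdual H) (*) (%\<psi>. \<phi> a * \<psi> b)" and 2: "linear_on (Hdual H) (*) (%\<psi>. \<psi> a * \<phi> b)" for a b
  by (simp_all add: linear_on_def fscale_def algebra_simps)
 have "linear_on (Hdual H) fscale (%\<psi> x. dS H x (%a b. \<phi> a * \<psi> b))"
  "linear_on (Hdual H) fscale (%\<psi> x. dS H x (%a b. \<psi> a * \<phi> b))"
  by (rule linear_on_fun, rule linear_on_ssum_fun[OF vector_space_mult], rule 1 2)+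
 note lin = linear_on_cong[OF is_vspace_Hdual this(1)] linear_on_cong[OF is_vspace_Hdual this(2)]
 show "linear_on (Hdual H) fscale (star H \<phi>)"
  by (rule lin(1)) (simp add: fun_eq_iff star_apply Hdual_hlin \<phi>)
 show "linear_on (Hdual H) fscale (%\<psi>. star H \<psi> \<phi>)"
  by (rule lin(2)) (simp add: fun_eq_iff star_apply Hdual_hlin \<phi>)
qed

text \<open>The product is a coefficient of the tensor product representation, on which x acts
  through its coproduct. Rows and columns are indexed by p, standing for the pair (p div d', p mod
  d'), and \<open>K\<close> gives the matrix entries.\<close>

lemma star_matrix_coefficients:
 assumes "\<phi> \<in> matrix_coefficients H" "\<psi> \<in> matrix_coefficients H"
 shows "star H \<phi> \<psi> \<in> matrix_coefficients H"
proof -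
 obtain d \<rho> u v where r: "matrix_rep H d \<rho>" "u \<in> carrier_vec d" "v \<in> carrier_vec d"
  and \<phi>: "\<phi> = (%x. u \<bullet> (\<rho> x *\<^sub>v v))" using assms(1) by (auto simp: matrix_coefficients_def)
 obtain d' \<rho>' u' v' where r': "matrix_rep H d' \<rho>'" "u' \<in> carrier_vec d'" "v' \<in> carrier_vec d'"
  and \<psi>: "\<psi> = (%x. u' \<bullet> (\<rho>' x *\<^sub>v v'))" using assms(2) by (auto simp: matrix_coefficients_def)
 define P where "P i j x = \<rho> x $$ (i, j)" for i j x
 define P' where "P' i j x = \<rho>' x $$ (i, j)" for i j x
 note P = matrix_rep_entries(2)[OF r(1), folded P_def]
  and Pm = matrix_rep_entries(3)[OF r(1), folded P_def]
  and P1 = matrix_rep_entries(4)[OF r(1), folded P_def]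
 note P' = matrix_rep_entries(2)[OF r'(1), folded P'_def]
  and P'm = matrix_rep_entries(3)[OF r'(1), folded P'_def]
  and P'1 = matrix_rep_entries(4)[OF r'(1), folded P'_def]
 define K where "K p q x = dS H x (%a b. P (p div d') (q div d') a * P' (p mod d') (q mod d') b)" for p q x
 have lt: "p div d' < d" "p mod d' < d'" if "p < d * d'" for p
  using that by (simp_all add: less_mult_imp_div_less) (metis mult_0_right not_less_zero mod_less_divisor neq0_conv)
 have K: "hlin H (*) (K p q)" if "p < d * d'" "q < d * d'" for p q
  unfolding K_def by (rule hlin_dS[OF vector_space_mult]) (intro hlin_intros P P' lt that)+
 have Km: "K p q (x * y) = (\<Sum>l<d * d'. K p l x * K l q y)" if "p < d * d'" "q < d * d'" for p q x y
 proof -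
  have "K p q (x * y) = dS H x (%a b. dS H y (%c e.
    P (p div d') (q div d') (a * c) * P' (p mod d') (q mod d') (b * e)))"
   unfolding K_def by (rule dS_mult[OF vector_space_mult]) (intro hlin_intros P P' lt that)+
  also have "\<dots> = dS H x (%a b. dS H y (%c e. \<Sum>l<d * d'.
    (P (p div d') (l div d') a * P (l div d') (q div d') c) * (P' (p mod d') (l mod d') b * P' (l mod d') (q mod d') e)))"
  proof -
   have "P (p div d') (q div d') (a * c) * P' (p mod d') (q mod d') (b * e) = (\<Sum>l<d * d'.
    (P (p div d') (l div d') a * P (l div d') (q div d') c) * (P' (p mod d') (l mod d') b * P' (l mod d') (q mod d') e))"
    for a b c e
    by (subst sum_div_mod[where f="%i. P (p div d') i a * P i (q div d') c"
       and g="%i. P' (p mod d') i b * P' i (q mod d') e"]) (simp add: Pm P'm lt that)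
   then show ?thesis by simp
  qed
  also have "\<dots> = (\<Sum>l<d * d'. K p l x * K l q y)"
   by (simp add: ssum_sum K_def ssum_mult_left ssum_mult_right mult_ac) (intro sum.cong refl ssum_swap)
  finally show ?thesis .
 qed
 have K1: "K p q 1 = (if p = q then 1 else 0)" if "p < d * d'" "q < d * d'" for p q
 proof -
  have "K p q 1 = P (p div d') (q div d') 1 * P' (p mod d') (q mod d') 1"
   unfolding K_def by (rule dS_one[OF vector_space_mult]) (intro hlin_intros P P' lt that)+
  moreover have "p = q" if "p div d' = q div d'" "p mod d' = q mod d'"
   using that by (metis div_mult_mod_eq)
  ultimately show ?thesis by (auto simp: P1 P'1 lt that)
 qed
 define \<sigma> where "\<sigma> x = mat (d * d') (d * d') (%(p, q). K p q x)" for x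
 have "matrix_rep H (d * d') \<sigma>"
  unfolding matrix_rep_def \<sigma>_def using K
  by (auto intro!: eq_matI simp: Km K1 hlin_def scalar_prod_def lessThan_atLeast0)
 moreover define U where "U = vec (d * d') (%p. u $ (p div d') * u' $ (p mod d'))"
 moreover define V where "V = vec (d * d') (%p. v $ (p div d') * v' $ (p mod d'))"
 moreover have "star H \<phi> \<psi> = (%x. U \<bullet> (\<sigma> x *\<^sub>v V))"
 proof
  fix x
  have h: "hlin H (*) \<phi>" "hlin H (*) \<psi>"
   using assms by (simp_all add: Hdual_hlin matrix_coefficients_Hdual)
  have "\<phi> a = (\<Sum>i<d. \<Sum>j<d. u $ i * v $ j * P i j a)" "\<psi> a = (\<Sum>i<d'. \<Sum>j<d'. u' $ i * v' $ j * P' i j a)" for a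
   using r r' by (simp_all add: \<phi> \<psi> P_def P'_def scalar_prod_mult_mat_vec matrix_rep_def)
  then have "\<phi> a * \<psi> b = (\<Sum>p<d * d'. \<Sum>q<d * d'. (u $ (p div d') * v $ (q div d') * P (p div d') (q div d') a) *
    (u' $ (p mod d') * v' $ (q mod d') * P' (p mod d') (q mod d') b))" for a b
   by (simp only: sum_div_mod[where f="%j. u $ i * v $ j * P i j a" and g="%j. u' $ i' * v' $ j * P' i' j b" for i i']
    sum_div_mod[where f="%i. \<Sum>j<d. u $ i * v $ j * P i j a" and g="%i. \<Sum>j<d'. u' $ i * v' $ j * P' i j b"])
  then have "star H \<phi> \<psi> x = (\<Sum>p<d * d'. \<Sum>q<d * d'. dS H x (%a b. (u $ (p div d') * v $ (q div d') * P (p div d') (q div d') a) *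
    (u' $ (p mod d') * v' $ (q mod d') * P' (p mod d') (q mod d') b)))"
   by (simp add: star_apply[OF h] ssum_sum)
  also have "\<dots> = (\<Sum>p<d * d'. \<Sum>q<d * d'. U $ p * V $ q * K p q x)"
   by (intro sum.cong refl) (simp add: U_def V_def K_def ssum_mult_left mult_ac)
  also have "\<dots> = U \<bullet> (\<sigma> x *\<^sub>v V)"
   by (subst scalar_prod_mult_mat_vec[of _ "d * d'"]) (auto simp: U_def V_def \<sigma>_def)
  finally show "star H \<phi> \<psi> x = U \<bullet> (\<sigma> x *\<^sub>v V)" .
 qed
 ultimately show ?thesis
  unfolding matrix_coefficients_def
  by (intro CollectI exI[of _ "d * d'"] exI[of _ \<sigma>] exI[of _ U] exI[of _ V]) auto
qed

lemma star_Hdual: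
 assumes "\<phi> \<in>: Hdual H" "\<psi> \<in>: Hdual H"
 shows "star H \<phi> \<psi> \<in>: Hdual H"
proof (rule span_closed[OF is_vspace_Hdual _ _ is_vspace_Hdual _ assms(1)])
 show "linear_on (Hdual H) (vscale (Hdual H)) (%\<phi>. star H \<phi> \<psi>)"
  using bilinear_onD(2)[OF bilinear_star assms(2)] by simp
 fix \<phi> assume \<phi>: "\<phi> \<in> matrix_coefficients H"
 show "star H \<phi> \<psi> \<in>: Hdual H"
 proof (rule span_closed[OF is_vspace_Hdual _ _ is_vspace_Hdual _ assms(2)])
  show "linear_on (Hdual H) (vscale (Hdual H)) (star H \<phi>)"
   using bilinear_onD(1)[OF bilinear_star matrix_coefficients_Hdual[OF \<phi>]] by simp
 qed (use \<phi> in \<open>auto simp: Hdual_span intro: star_matrix_coefficients matrix_coefficients_Hdual[unfolded Hdual_span]\<close>)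
qed (simp add: Hdual_span)

end

section \<open>Rewriting rules for Sweedler sums\<close>

lemma ssum_prod:
 "ssum H t (%x y. ssum H u (%a b. f x y a b) * ssum H v (%c d. g x y c d :: 'k::field)) =
  ssum H u (%a b. ssum H v (%c d. ssum H t (%x y. f x y a b * g x y c d)))"
proof -
 have "ssum H t (%x y. ssum H u (%a b. f x y a b) * ssum H v (%c d. g x y c d)) =
  ssum H t (%x y. ssum H u (%a b. ssum H v (%c d. f x y a b * g x y c d)))"
  by (rule ssum_cong, subst ssum_mult_right, rule ssum_cong, rule ssum_mult_left)
 also have "\<dots> = ssum H u (%a b. ssum H t (%x y. ssum H v (%c d. f x y a b * g x y c d)))"
  by (rule ssum_swap)
 also have "\<dots> = ssum H u (%a b. ssum H v (%c d. ssum H t (%x y. f x y a b * g x y c d)))"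
  by (rule ssum_cong, rule ssum_swap)
 finally show ?thesis .
qed

text \<open>The tensor \<open>v c d\<close> may depend on the preceding pair, as in an iterated
  coproduct; an independent sum is moved across both sums at once.\<close>

lemma ssum_swap12:
 "ssum H t (%a b. ssum H u (%c d. ssum H (v c d) (%e f. F a b c d e f))) =
  ssum H u (%c d. ssum H (v c d) (%e f. ssum H t (%a b. F a b c d e f)))"
 by (subst ssum_swap, rule ssum_cong, rule ssum_swap)

lemma ssum_swap21:
 "ssum H u (%c d. ssum H (v c d) (%e f. ssum H t (%a b. F a b c d e f))) =
  ssum H t (%a b. ssum H u (%c d. ssum H (v c d) (%e f. F a b c d e f)))"
 by (rule ssum_swap12[symmetric])

lemma ssum_swap22:
 "ssum H t (%a b. ssum H w (%a' b'. ssum H u (%c d. ssum H v (%e f. F a b a' b' c d e f)))) =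
  ssum H u (%c d. ssum H v (%e f. ssum H t (%a b. ssum H w (%a' b'. F a b a' b' c d e f))))"
proof -
 have "ssum H t (%a b. ssum H w (%a' b'. ssum H u (%c d. ssum H v (%e f. F a b a' b' c d e f)))) =
  ssum H t (%a b. ssum H u (%c d. ssum H v (%e f. ssum H w (%a' b'. F a b a' b' c d e f))))"
  by (rule ssum_cong, rule ssum_swap12)
 also have "\<dots> = ssum H u (%c d. ssum H v (%e f. ssum H t (%a b. ssum H w (%a' b'. F a b a' b' c d e f))))"
  by (rule ssum_swap12)
 finally show ?thesis .
qed

section \<open>Slotwise linearity and moves combining R with iterated coproducts\<close>

lemma mlinI3:
 assumes "\<And>b c. hlin H s (%a. G a b c)" "\<And>a c. hlin H s (%b. G a b c)" "\<And>a b. hlin H s (%c. G a b c)"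
 shows "mlin H 3 s (%x. G (x 0) (x 1) (x 2))"
 unfolding mlin_def
proof (intro allI impI)
 fix x i assume "i < (3 :: nat)"
 then consider "i = 0" | "i = 1" | "i = 2" by linarith
 then show "hlin H s (%y. G ((x(i := y)) 0) ((x(i := y)) 1) ((x(i := y)) 2))"
  by cases (simp_all add: assms)
qed

lemma mlinI4:
 assumes "\<And>b c d. hlin H s (%a. G a b c d)" "\<And>a c d. hlin H s (%b. G a b c d)"
  "\<And>a b d. hlin H s (%c. G a b c d)" "\<And>a b c. hlin H s (%d. G a b c d)"
 shows "mlin H 4 s (%x. G (x 0) (x 1) (x 2) (x 3))"
 unfolding mlin_def
proof (intro allI impI)
 fix x i assume "i < (4 :: nat)"
 then consider "i = 0" | "i = 1" | "i = 2" | "i = 3" by linarith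
 then show "hlin H s (%y. G ((x(i := y)) 0) ((x(i := y)) 1) ((x(i := y)) 2) ((x(i := y)) 3))"
  by cases (simp_all add: assms)
qed

lemma mlinI5:
 assumes "\<And>b c d e. hlin H s (%a. G a b c d e)" "\<And>a c d e. hlin H s (%b. G a b c d e)"
  "\<And>a b d e. hlin H s (%c. G a b c d e)" "\<And>a b c e. hlin H s (%d. G a b c d e)"
  "\<And>a b c d. hlin H s (%e. G a b c d e)"
 shows "mlin H 5 s (%x. G (x 0) (x 1) (x 2) (x 3) (x 4))"
 unfolding mlin_def
proof (intro allI impI)
 fix x i assume "i < (5 :: nat)"
 then consider "i = 0" | "i = 1" | "i = 2" | "i = 3" | "i = 4" by linarith
 then show "hlin H s (%y. G ((x(i := y)) 0) ((x(i := y)) 1) ((x(i := y)) 2) ((x(i := y)) 3) ((x(i := y)) 4))"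
  by cases (simp_all add: assms)
qed

context hopf_algebra
begin

lemma mlin_Yop:
 assumes s: "vector_space s" and F: "mlin H m s F" and "i < m" "j < m" "i \<noteq> j"
 shows "mlin H m s (Yop H i j F)"
 unfolding mlin_def Yop_def
proof (intro allI impI hlin_ssum[OF s])
 fix x k a b assume k: "k < m"
 have l: "hlin H s (%y. F (z(l := y)))" if "l < m" for z l
  using F that by (simp add: mlin_def)
 consider "k = i" | "k = j" | "k \<noteq> i" "k \<noteq> j" by blast
 then show "hlin H s (%y. F ((x(k := y))(i := a * (x(k := y)) i, j := (x(k := y)) j * antipode H b)))"
 proof cases
  case 1
  have "(x(k := y))(i := a * (x(k := y)) i, j := (x(k := y)) j * antipode H b) =
   (x(j := x j * antipode H b))(i := a * y)" for y
   using 1 assms by (auto simp: fun_eq_iff)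
  then show ?thesis
   using hlin_comp[OF l[OF assms(3), of "x(j := x j * antipode H b)"] hlin_mult_right[OF hlin_id, of a]] by simp
 next
  case 2
  have "(x(k := y))(i := a * (x(k := y)) i, j := (x(k := y)) j * antipode H b) =
   (x(i := a * x i))(j := y * antipode H b)" for y
   using 2 assms by (auto simp: fun_eq_iff)
  then show ?thesis
   using hlin_comp[OF l[OF assms(4), of "x(i := a * x i)"] hlin_mult_left[OF hlin_id]] by simp
 next
  case 3
  have "(x(k := y))(i := a * (x(k := y)) i, j := (x(k := y)) j * antipode H b) =
   (x(i := a * x i, j := x j * antipode H b))(k := y)" for y
   using 3 assms by (auto simp: fun_eq_iff)
  then show ?thesis using l[OF k] by simp
 qed
qed

text \<open>Brings the two middle ones of four Sweedler components together as the coproduct of a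
  single element, so that quasi-cocommutativity can exchange them.\<close>

lemma dS4_middle:
 assumes s: "vector_space s" and G: "\<And>q r t. hlin H s (%p. G p q r t)" "\<And>p r t. hlin H s (%q. G p q r t)"
  "\<And>p q t. hlin H s (%r. G p q r t)" "\<And>p q r. hlin H s (%t. G p q r t)"
 shows "dS H h (%u v. dS H u (%p q. dS H v (%r t. G p q r t))) =
  dS H h (%p w. dS H w (%m t. dS H m (%q r. G p q r t)))"
proof -
 have "dS H h (%u v. dS H u (%p q. dS H v (%r t. G p q r t))) =
  dS H h (%p w. dS H w (%q v. dS H v (%r t. G p q r t)))"
  by (rule dS_coassoc[OF s]) (intro hlin_intros G s)+
 also have "\<dots> = dS H h (%p w. dS H w (%m t. dS H m (%q r. G p q r t)))"
  by (rule ssum_cong, rule dS_coassoc[OF s, symmetric]) (intro hlin_intros G s)+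
 finally show ?thesis .
qed

end

context quasitriangular_hopf_algebra
begin

text \<open>Coassociativity exposes the first two of three components as one coproduct,
  quasi-cocommutativity acts on it, and the bracketing is restored.\<close>

lemma dS3_rS_first:
 assumes s: "vector_space s" and G: "\<And>q r. hlin H s (%p. G p q r)" "\<And>p r. hlin H s (%q. G p q r)"
  "\<And>p q. hlin H s (%r. G p q r)"
 shows "dS H t (%p u. dS H u (%q r. rS H (%a b. G (q * a) (p * b) r))) =
  dS H t (%p u. dS H u (%q r. rS H (%a b. G (a * p) (b * q) r)))"
proof -
 note G' = hlin_comp[OF G(1)] hlin_comp[OF G(2)] hlin_comp[OF G(3)] s
 have "dS H t (%p u. dS H u (%q r. rS H (%a b. G (q * a) (p * b) r))) =
  dS H t (%m r. dS H m (%p q. rS H (%a b. G (q * a) (p * b) r)))"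
  by (rule dS_coassoc[OF s, symmetric]) (intro hlin_intros G')+
 also have "\<dots> = dS H t (%m r. dS H m (%p q. rS H (%a b. G (a * p) (b * q) r)))"
  by (rule ssum_cong, rule rS_comul[OF s, of "%x y. G x y r" for r, symmetric]) (intro G)+
 also have "\<dots> = dS H t (%p u. dS H u (%q r. rS H (%a b. G (a * p) (b * q) r)))"
  by (rule dS_coassoc[OF s]) (intro hlin_intros G')+
 finally show ?thesis .
qed

lemma rS_comul_antipode:
 assumes s: "vector_space s" and G: "\<And>b. hlin H s (%a. G a b)" "\<And>a. hlin H s (%b. G a b)"
 shows "dS H x (%r t. rS H (%a b. G (a * antipode H t) (b * antipode H r))) =
  dS H x (%r t. rS H (%a b. G (antipode H r * a) (antipode H t * b)))"
proof -
 note G' = hlin_comp[OF G(1)] hlin_comp[OF G(2)] s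
 have "dS H x (%r t. rS H (%a b. G (a * antipode H t) (b * antipode H r))) =
  dS H (antipode H x) (%y1 y2. rS H (%a b. G (a * y1) (b * y2)))"
  by (rule dS_antipode[OF s, symmetric]) (intro hlin_intros G')+
 also have "\<dots> = dS H (antipode H x) (%y1 y2. rS H (%a b. G (y2 * a) (y1 * b)))"
  by (rule rS_comul[OF s G])
 also have "\<dots> = dS H x (%r t. rS H (%a b. G (antipode H r * a) (antipode H t * b)))"
  by (rule dS_antipode[OF s]) (intro hlin_intros G')+
 finally show ?thesis .
qed

text \<open>A form of quasi-cocommutativity with the antipode in one leg only. The factor S(x1) x2
  is inserted on the left of that leg, R is moved past the coproduct, and the component that now
  meets S on the right cancels.\<close>

lemma rS_slide:
 assumes s: "vector_space s" and G: "\<And>b. hlin H s (%a. G a b)" "\<And>a. hlin H s (%b. G a b)"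
 shows "dS H x (%q r. rS H (%a b. G (b * antipode H r) (q * a))) =
  dS H x (%q r. rS H (%a b. G (antipode H q * b) (a * r)))"
proof -
 let ?S = "antipode H"
 note G' = hlin_comp[OF G(1)] hlin_comp[OF G(2)] s
 have "dS H x (%q r. rS H (%a b. G (b * ?S r) (q * a))) =
   dS H x (%p m. dS H m (%p2 m'. dS H m' (%q r. rS H (%a b. G (?S p * p2 * b * ?S r) (q * a)))))"
  by (subst dS3_antipode_left2[OF s, of "%y m. dS H m (%q r. rS H (%a b. G (y * b * ?S r) (q * a)))"])
   ((intro hlin_intros G')+, simp)
 also have "\<dots> = dS H x (%p m. dS H m (%p2 m'. dS H m' (%q r. rS H (%a b. G (?S p * (p2 * b) * ?S r) (q * a)))))"
  by (simp only: mult.assoc)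
 also have "\<dots> = dS H x (%p m. dS H m (%p2 m'. dS H m' (%q r. rS H (%a b. G (?S p * (b * q) * ?S r) (a * p2)))))"
  by (rule ssum_cong, rule dS3_rS_first[OF s, of "%x y r. G (?S p * y * ?S r) x" for p])
   (intro hlin_intros G')+
 also have "\<dots> = dS H x (%p m. dS H m (%p2 m'. dS H m' (%q r. rS H (%a b. G (?S p * b * (q * ?S r)) (a * p2)))))"
  by (simp only: mult.assoc)
 also have "\<dots> = dS H x (%q r. rS H (%a b. G (?S q * b) (a * r)))"
 proof (rule ssum_cong)
  fix p m
  show "dS H m (%p2 m'. dS H m' (%q r. rS H (%a b. G (?S p * b * (q * ?S r)) (a * p2)))) =
   rS H (%a b. G (?S p * b) (a * m))"
   by (subst dS3_antipode_right1[OF s, of "%p2 y. rS H (%a b. G (?S p * b * y) (a * p2))"])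
    ((intro hlin_intros G')+, simp)
 qed
 finally show ?thesis .
qed

section \<open>The graph algebra of the punctured disc\<close>

lemma sw_rmat:
 assumes "vector_space s" "\<And>b. hlin H s (%a. F a b)" "\<And>a. hlin H s (%b. F a b)"
 shows "sumR H s F = rS H F"
 by (rule sw_ssum[OF assms(1) rmat_in assms(2,3)])

lemma sw_comul:
 assumes "vector_space s" "\<And>b. hlin H s (%a. F a b)" "\<And>a. hlin H s (%b. F a b)"
 shows "sumD H s x F = dS H x F"
 by (rule sw_ssum[OF assms(1) comul_in assms(2,3)])

lemma vspace_L01 [simp]: "vscale (L01 H) = fscale" "vcarrier (L01 H) = vcarrier (Hdual H)" "aone (L01 H) = counit H"
 by (simp_all add: L01_def)

lemma linear_on_L01 [simp]: "linear_on (L01 H) s L \<longleftrightarrow> linear_on (Hdual H) s L"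
 by (simp add: linear_on_def)

lemma L01_mult:
 assumes "hlin H (*) \<phi>" "hlin H (*) \<psi>"
 shows "amult (L01 H) \<phi> \<psi> = rS H (%a1 a2. rS H (%b1 b2. star H (b2 * antipode H a2 \<triangleright> \<phi>) (b1 \<triangleright> \<psi> \<triangleleft> a1)))"
  and "amult (L01 H) \<phi> \<psi> x = rS H (%a1 a2. rS H (%b1 b2. dS H x (%x1 x2.
   \<phi> (x1 * (b2 * antipode H a2)) * \<psi> (a1 * (x2 * b1)))))"
proof -
 note l = hlin_comp[OF assms(1)] hlin_comp[OF assms(2)]
 have st: "star H (b2 * antipode H a2 \<triangleright> \<phi>) (b1 \<triangleright> \<psi> \<triangleleft> a1) =
  (%x. dS H x (%x1 x2. \<phi> (x1 * (b2 * antipode H a2)) * \<psi> (a1 * (x2 * b1))))" for a1 a2 b1 b2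
  by (simp add: fun_eq_iff star_apply hlin_lact hlin_ract assms mult.assoc)
 have 1: "sumR H fscale (%b1 b2. star H (b2 * antipode H a2 \<triangleright> \<phi>) (b1 \<triangleright> \<psi> \<triangleleft> a1)) =
  rS H (%b1 b2. star H (b2 * antipode H a2 \<triangleright> \<phi>) (b1 \<triangleright> \<psi> \<triangleleft> a1))" for a1 a2
  unfolding st by (rule sw_rmat) (intro hlin_intros l)+
 have 2: "sumR H fscale (%a1 a2. rS H (%b1 b2. star H (b2 * antipode H a2 \<triangleright> \<phi>) (b1 \<triangleright> \<psi> \<triangleleft> a1))) =
   rS H (%a1 a2. rS H (%b1 b2. star H (b2 * antipode H a2 \<triangleright> \<phi>) (b1 \<triangleright> \<psi> \<triangleleft> a1)))"
  unfolding st by (rule sw_rmat) (intro hlin_intros l)+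
 show eq: "amult (L01 H) \<phi> \<psi> = rS H (%a1 a2. rS H (%b1 b2. star H (b2 * antipode H a2 \<triangleright> \<phi>) (b1 \<triangleright> \<psi> \<triangleleft> a1)))"
  by (simp add: L01_def 1 2)
 show "amult (L01 H) \<phi> \<psi> x = rS H (%a1 a2. rS H (%b1 b2. dS H x (%x1 x2.
   \<phi> (x1 * (b2 * antipode H a2)) * \<psi> (a1 * (x2 * b1)))))"
  unfolding eq st by (simp add: ssum_apply)
qed

lemma is_alg_L01: "is_alg (L01 H)"
 unfolding is_alg_def
proof (intro conjI ballI)
 show "is_vspace (L01 H)" using is_vspace_Hdual[of H] by (simp add: is_vspace_def)
 show "aone (L01 H) \<in>: L01 H" by (simp add: counit_Hdual)
 show "bilinear_on (L01 H) (L01 H) (vscale (L01 H)) (amult (L01 H))"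
 proof (rule bilinear_onI)
  fix \<phi> assume "\<phi> \<in>: L01 H"
  then have \<phi>: "hlin H (*) \<phi>" by (simp add: Hdual_hlin)
  have 1: "linear_on (Hdual H) (*) (%\<psi>. \<phi> a * \<psi> b)" and 2: "linear_on (Hdual H) (*) (%\<psi>. \<psi> a * \<phi> b)" for a b
   by (simp_all add: linear_on_def fscale_def algebra_simps)
  have "linear_on (Hdual H) fscale (%\<psi> x. rS H (%a1 a2. rS H (%b1 b2. dS H x (%x1 x2.
    \<phi> (x1 * (b2 * antipode H a2)) * \<psi> (a1 * (x2 * b1))))))"
   "linear_on (Hdual H) fscale (%\<psi> x. rS H (%a1 a2. rS H (%b1 b2. dS H x (%x1 x2.
    \<psi> (x1 * (b2 * antipode H a2)) * \<phi> (a1 * (x2 * b1))))))"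
   by (rule linear_on_fun, rule linear_on_ssum_fun[OF vector_space_mult], rule linear_on_ssum_fun[OF vector_space_mult],
    rule linear_on_ssum_fun[OF vector_space_mult], rule 1 2)+
  note lin = linear_on_cong[OF is_vspace_Hdual this(1)] linear_on_cong[OF is_vspace_Hdual this(2)]
  show "linear_on (L01 H) (vscale (L01 H)) (amult (L01 H) \<phi>)"
   unfolding linear_on_L01 vspace_L01 by (rule lin(1)) (simp add: fun_eq_iff L01_mult(2) Hdual_hlin \<phi>)
  show "linear_on (L01 H) (vscale (L01 H)) (%\<psi>. amult (L01 H) \<psi> \<phi>)"
   unfolding linear_on_L01 vspace_L01 by (rule lin(2)) (simp add: fun_eq_iff L01_mult(2) Hdual_hlin \<phi>)
 qed
 fix \<phi> \<psi> assume "\<phi> \<in>: L01 H" "\<psi> \<in>: L01 H"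
 then show "amult (L01 H) \<phi> \<psi> \<in>: L01 H"
  by (simp add: L01_mult(1) Hdual_hlin) (intro ssum_closed is_vspace_Hdual star_Hdual lact_Hdual ract_Hdual)
qed

lemma coad01_sum:
 assumes "hlin H (*) \<phi>"
 shows "coad01 H h \<phi> = dS H h (%h1 h2. antipode H h2 \<triangleright> \<phi> \<triangleleft> h1)"
 unfolding coad01_def lact_def ract_def
 by (rule sw_comul) (intro hlin_intros hlin_comp[OF assms])+

lemma coad01_apply:
 assumes "hlin H (*) \<phi>"
 shows "coad01 H h \<phi> x = dS H h (%p q. \<phi> (p * (x * antipode H q)))"
 by (simp add: coad01_sum[OF assms] ssum_apply mult.assoc)

lemma coad01_Hdual: "\<phi> \<in>: Hdual H ==> coad01 H h \<phi> \<in>: Hdual H"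
 by (simp add: coad01_sum Hdual_hlin) (intro ssum_closed is_vspace_Hdual lact_Hdual ract_Hdual)

lemma linear_coad01: "linear_on (Hdual H) fscale (coad01 H h)"
proof -
 have 1: "linear_on (Hdual H) (*) (%\<phi>. \<phi> a)" for a by (simp add: linear_on_def fscale_def)
 have "linear_on (Hdual H) fscale (%\<phi> x. dS H h (%p q. \<phi> (p * (x * antipode H q))))"
  by (rule linear_on_fun, rule linear_on_ssum_fun[OF vector_space_mult], rule 1)
 then show ?thesis
  by (rule linear_on_cong[OF is_vspace_Hdual]) (simp add: fun_eq_iff coad01_apply Hdual_hlin)
qed

lemma hlin_coad01: 
 assumes "\<phi> \<in>: Hdual H"
 shows "hlin H fscale (%h. coad01 H h \<phi>)"
proof -
 have "(%h. coad01 H h \<phi>) = (%h x. dS H h (%p q. \<phi> (p * (x * antipode H q))))"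
  by (simp add: fun_eq_iff coad01_apply Hdual_hlin assms)
 then show ?thesis by (simp only:) (intro hlin_intros hlin_comp[OF Hdual_hlin[OF assms]])
qed

lemma coad01_one: "coad01 H h (counit H) = fscale (counit H h) (counit H)"
proof
 fix x
 have "coad01 H h (counit H) x = dS H h (%p q. counit H q * (counit H p * counit H x))"
  by (simp add: coad01_apply Hdual_hlin counit_Hdual counit_mult counit_antipode mult_ac)
 also have "\<dots> = counit H h * counit H x"
  by (rule dS_counit_right) (intro hlin_intros)
 finally show "coad01 H h (counit H) x = fscale (counit H h) (counit H) x" by (simp add: fscale_def)
qed

lemma coad01_unit: "\<phi> \<in>: Hdual H ==> coad01 H 1 \<phi> = \<phi>"
proof
 fix x assume \<phi>: "\<phi> \<in>: Hdual H"
 have "coad01 H 1 \<phi> x = \<phi> (1 * (x * antipode H 1))"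
  unfolding coad01_apply[OF Hdual_hlin[OF \<phi>]]
  by (rule dS_one[OF vector_space_mult]) (intro hlin_intros hlin_comp[OF Hdual_hlin[OF \<phi>]])+
 then show "coad01 H 1 \<phi> x = \<phi> x" by (simp add: antipode_one)
qed

text \<open>Both the antipode and the right multiplication reverse the order, which makes the
  coadjoint action a right action: \<open>h\<close> acts first.\<close>

lemma coad01_coad01:
 assumes \<phi>: "\<phi> \<in>: Hdual H"
 shows "coad01 H k (coad01 H h \<phi>) = coad01 H (h * k) \<phi>"
proof
 fix x
 have "coad01 H (h * k) \<phi> x = dS H h (%p q. dS H k (%p' q'. \<phi> (p * p' * (x * antipode H (q * q')))))"
  unfolding coad01_apply[OF Hdual_hlin[OF \<phi>]]
  by (rule dS_mult[OF vector_space_mult]) (intro hlin_intros hlin_comp[OF Hdual_hlin[OF \<phi>]])+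
 then show "coad01 H k (coad01 H h \<phi>) x = coad01 H (h * k) \<phi> x"
  by (simp add: coad01_apply Hdual_hlin coad01_Hdual \<phi> antipode_mult mult.assoc) (rule ssum_swap)
qed

text \<open>The identity behind compatibility of the coadjoint action with the product of
  \<open>L01\<close>, freed from linear forms. The copy \<open>a1\<close>, \<open>a2\<close>
  exchanges the middle Sweedler components; the copy \<open>b1\<close>, \<open>b2\<close> then moves
  the antipodes of the last two to the other side.\<close>

lemma coad_exchange:
 assumes s: "vector_space s" and G: "\<And>q r t. hlin H s (%p. G p q r t)" "\<And>p r t. hlin H s (%q. G p q r t)"
  "\<And>p q t. hlin H s (%r. G p q r t)" "\<And>p q r. hlin H s (%t. G p q r t)"
 shows "dS H h (%u v. dS H u (%p q. dS H v (%r t. rS H (%a1 a2. rS H (%b1 b2.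
   G p (b2 * antipode H a2 * antipode H q) (r * a1) (b1 * antipode H t)))))) =
  dS H h (%u v. dS H u (%p q. dS H v (%r t. rS H (%a1 a2. rS H (%b1 b2.
   G p (antipode H t * b2 * antipode H a2) (a1 * q) (antipode H r * b1))))))"
  (is "?lhs = ?rhs")
proof -
 let ?S = "antipode H"
 note G' = hlin_comp[OF G(1)] hlin_comp[OF G(2)] hlin_comp[OF G(3)] hlin_comp[OF G(4)] s
 have "?lhs = dS H h (%p w. dS H w (%m t. dS H m (%q r. rS H (%a1 a2. rS H (%b1 b2.
   G p (b2 * ?S (q * a2)) (r * a1) (b1 * ?S t))))))"
  unfolding antipode_mult mult.assoc by (rule dS4_middle[OF s]) (intro hlin_intros G')+
 also have "\<dots> = dS H h (%p w. dS H w (%m t. dS H m (%q r. rS H (%a1 a2. rS H (%b1 b2.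
   G p (b2 * ?S (a2 * r)) (a1 * q) (b1 * ?S t))))))"
  by (rule ssum_cong, rule ssum_cong,
   rule rS_comul[OF s, of "%x y. rS H (%b1 b2. G p (b2 * ?S y) x (b1 * ?S t))" for p t, symmetric])
   (intro hlin_intros G')+
 also have "\<dots> = dS H h (%u v. dS H u (%p q. dS H v (%r t. rS H (%a1 a2. rS H (%b1 b2.
   G p (b2 * ?S r * ?S a2) (a1 * q) (b1 * ?S t))))))"
  unfolding antipode_mult mult.assoc by (rule dS4_middle[OF s, symmetric]) (intro hlin_intros G')+
 also have "\<dots> = ?rhs"
 proof (rule ssum_cong, rule ssum_cong)
  fix u v p q
  have "dS H v (%r t. rS H (%b1 b2. G p (b2 * ?S r * ?S a2) (a1 * q) (b1 * ?S t))) =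
    dS H v (%r t. rS H (%b1 b2. G p (?S t * b2 * ?S a2) (a1 * q) (?S r * b1)))" for a1 a2
   by (rule rS_comul_antipode[OF s, of "%x y. G p (y * ?S a2) (a1 * q) x"]) (intro hlin_intros G')+
  then show "dS H v (%r t. rS H (%a1 a2. rS H (%b1 b2. G p (b2 * ?S r * ?S a2) (a1 * q) (b1 * ?S t)))) =
    dS H v (%r t. rS H (%a1 a2. rS H (%b1 b2. G p (?S t * b2 * ?S a2) (a1 * q) (?S r * b1))))"
   by (simp only: ssum_swap[of H "comul H v" "rmat H"])
 qed
 finally show ?thesis .
qed

text \<open>Both sides are evaluated at \<open>x\<close>. The product evaluated at u x S(v) involves
  the coproduct of that element, in which the antipode flips the components of v;
  \<open>coad_exchange\<close> matches this with the product of the transformed forms.\<close>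

lemma coad01_mult:
 assumes "\<phi> \<in>: Hdual H" "\<psi> \<in>: Hdual H"
 shows "coad01 H h (amult (L01 H) \<phi> \<psi>) = dS H h (%u v. amult (L01 H) (coad01 H u \<phi>) (coad01 H v \<psi>))"
proof
 fix x
 let ?S = "antipode H"
 note l = Hdual_hlin[OF assms(1)] Hdual_hlin[OF assms(2)]
 note l' = hlin_comp[OF l(1)] hlin_comp[OF l(2)]
 have m: "hlin H (*) (amult (L01 H) \<phi> \<psi>)"
  using is_alg_closed[OF is_alg_L01] assms by (simp add: Hdual_hlin)
 define G where "G p q r t = dS H x (%x1 x2. \<phi> (p * (x1 * q)) * \<psi> (r * (x2 * t)))" for p q r t
 have G: "hlin H (*) (%p. G p q r t)" "hlin H (*) (%q. G p q r t)" "hlin H (*) (%r. G p q r t)"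
  "hlin H (*) (%t. G p q r t)" for p q r t
  unfolding G_def by (intro hlin_intros l')+
 have "dS H h (%u v. amult (L01 H) (coad01 H u \<phi>) (coad01 H v \<psi>)) x =
  dS H h (%u v. rS H (%a1 a2. rS H (%b1 b2. dS H x (%x1 x2.
   dS H u (%p q. \<phi> (p * (x1 * (b2 * ?S a2) * ?S q))) * dS H v (%r t. \<psi> (r * (a1 * (x2 * b1) * ?S t)))))))"
  by (simp add: ssum_apply L01_mult(2) Hdual_hlin coad01_Hdual assms coad01_apply l)
 also have "\<dots> = dS H h (%u v. rS H (%a1 a2. rS H (%b1 b2. dS H u (%p q. dS H v (%r t.
   G p (b2 * ?S a2 * ?S q) (r * a1) (b1 * ?S t))))))"
  unfolding ssum_prod G_def by (simp only: mult.assoc)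
 also have "\<dots> = dS H h (%u v. dS H u (%p q. dS H v (%r t. rS H (%a1 a2. rS H (%b1 b2.
   G p (b2 * ?S a2 * ?S q) (r * a1) (b1 * ?S t))))))"
  by (rule ssum_cong, rule ssum_swap22)
 also have "\<dots> = dS H h (%u v. dS H u (%p q. dS H v (%r t. rS H (%a1 a2. rS H (%b1 b2.
   G p (?S t * b2 * ?S a2) (a1 * q) (?S r * b1))))))"
  by (rule coad_exchange[OF vector_space_mult G])
 also have "\<dots> = dS H h (%u v. rS H (%a1 a2. rS H (%b1 b2. dS H u (%p q. dS H v (%r t.
   G p (?S t * b2 * ?S a2) (a1 * q) (?S r * b1))))))"
  by (rule ssum_cong, rule ssum_swap22)
 also have "\<dots> = dS H h (%u v. rS H (%a1 a2. rS H (%b1 b2. dS H (u * (x * ?S v)) (%x1 x2.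
   \<phi> (x1 * (b2 * ?S a2)) * \<psi> (a1 * (x2 * b1))))))"
 proof (rule ssum_cong, rule ssum_cong, rule ssum_cong)
  fix u v a1 a2 b1 b2
  let ?K = "%x1 x2. \<phi> (x1 * (b2 * ?S a2)) * \<psi> (a1 * (x2 * b1))"
  have "dS H (u * (x * ?S v)) ?K = dS H u (%p q. dS H (x * ?S v) (%y1 y2. ?K (p * y1) (q * y2)))"
   by (rule dS_mult[OF vector_space_mult]) (intro hlin_intros l')+
  also have "\<dots> = dS H u (%p q. dS H x (%x1 x2. dS H (?S v) (%y1 y2. ?K (p * (x1 * y1)) (q * (x2 * y2)))))"
   by (rule ssum_cong, rule dS_mult[OF vector_space_mult]) (intro hlin_intros l')+
  also have "\<dots> = dS H u (%p q. dS H x (%x1 x2. dS H v (%r t. ?K (p * (x1 * ?S t)) (q * (x2 * ?S r)))))"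
   by (rule ssum_cong, rule ssum_cong, rule dS_antipode[OF vector_space_mult]) (intro hlin_intros l')+
  also have "\<dots> = dS H u (%p q. dS H v (%r t. G p (?S t * b2 * ?S a2) (a1 * q) (?S r * b1)))"
   unfolding G_def mult.assoc by (rule ssum_cong, rule ssum_swap)
  finally show "dS H u (%p q. dS H v (%r t. G p (?S t * b2 * ?S a2) (a1 * q) (?S r * b1))) =
   dS H (u * (x * ?S v)) ?K" ..
 qed
 also have "\<dots> = coad01 H h (amult (L01 H) \<phi> \<psi>) x"
  by (simp add: coad01_apply[OF m] L01_mult(2)[OF l])
 finally show "coad01 H h (amult (L01 H) \<phi> \<psi>) x =
  dS H h (%u v. amult (L01 H) (coad01 H u \<phi>) (coad01 H v \<psi>)) x" ..
qed

end

declare One_nat_def [simp del]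

section \<open>Slot operators for coproducts and one-sided multiplications\<close>

lemma ssum_scale_left:
 assumes "vector_space s"
 shows "s (ssum H t F) v = ssum H t (%a b. s (F a b) v)"
proof -
 interpret vector_space s by fact
 show ?thesis by (rule ssum_hom) (simp add: scale_left_distrib)
qed

lemma fun_upd_const [simp]: "(%_. c)(i := c) = (%_. c)"
 by auto

text \<open>Precomposition with the coproduct. In the applications \<open>k\<close> is one of
  \<open>i\<close>, \<open>j\<close>: the content of slot \<open>k\<close> is distributed over both
  slots and the other one is overwritten.\<close>

definition Spl ::
  "('k::field, 'h::ring_1) qthopf => nat => nat => nat => ((nat => 'h) => 'u::ab_group_add) => (nat => 'h) => 'u"
 where "Spl H k i j F = (%x. dS H (x k) (%p q. F (x(i := p, j := q))))"

text \<open>Left multiplications commute with all right multiplications, so \<open>Lop\<close> can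
  be pulled out of any word in \<open>Rop\<close>; at a slot holding 1 the difference between left
  and right disappears.\<close>

definition Lop ::
  "('k::field, 'h::ring_1) qthopf => nat => nat => ((nat => 'h) => 'u::ab_group_add) => (nat => 'h) => 'u"
 where "Lop H i j F = (%x. rS H (%a b. F (x(i := a * x i, j := b * x j))))"

definition Mop ::
  "('k::field, 'h::ring_1) qthopf => nat => nat => ((nat => 'h) => 'u::ab_group_add) => (nat => 'h) => 'u"
 where "Mop H i j F = (%x. rS H (%a b. F (x(i := a * x i, j := x j * b))))"

lemma Lop_Rop:
 fixes F :: "(nat => 'b::ring_1) => 'u::ab_group_add"
 assumes "i \<noteq> j" "i' \<noteq> j'"
 shows "Lop H i j (Rop H i' j' F) = Rop H i' j' (Lop H i j F)"
proof
 fix x :: "nat => 'b"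
 have "(x(i := a * x i, j := e * x j))(i' := (x(i := a * x i, j := e * x j)) i' * c,
    j' := (x(i := a * x i, j := e * x j)) j' * d) =
   (x(i' := x i' * c, j' := x j' * d))(i := a * (x(i' := x i' * c, j' := x j' * d)) i,
    j := e * (x(i' := x i' * c, j' := x j' * d)) j)" for a c d e
  using assms by (auto simp: fun_eq_iff mult.assoc)
 then show "Lop H i j (Rop H i' j' F) x = Rop H i' j' (Lop H i j F) x"
  unfolding Rop_def Lop_def by (subst ssum_swap) (simp only:)
qed

lemma Mop_Rop:
 fixes F :: "(nat => 'b::ring_1) => 'u::ab_group_add"
 assumes "i \<noteq> j" "i' \<noteq> j'" "j \<noteq> i'" "j \<noteq> j'"
 shows "Mop H i j (Rop H i' j' F) = Rop H i' j' (Mop H i j F)"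
proof
 fix x :: "nat => 'b"
 have "(x(i := a * x i, j := x j * e))(i' := (x(i := a * x i, j := x j * e)) i' * c,
    j' := (x(i := a * x i, j := x j * e)) j' * d) =
   (x(i' := x i' * c, j' := x j' * d))(i := a * (x(i' := x i' * c, j' := x j' * d)) i,
    j := (x(i' := x i' * c, j' := x j' * d)) j * e)" for a c d e
  using assms by (auto simp: fun_eq_iff mult.assoc)
 then show "Mop H i j (Rop H i' j' F) x = Rop H i' j' (Mop H i j F) x"
  unfolding Rop_def Mop_def by (subst ssum_swap) (simp only:)
qed

lemma Rop_Spl_other:
 fixes F :: "(nat => 'b::ring_1) => 'u::ab_group_add"
 assumes "l \<notin> {i, j, k}" "m \<notin> {i, j, k}"
 shows "Rop H l m (Spl H k i j F) = Spl H k i j (Rop H l m F)"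
proof
 fix x :: "nat => 'b"
 have "x(l := a, m := b, i := p, j := q) = x(i := p, j := q, l := a, m := b)" for a b p q
  using assms by (auto simp: fun_eq_iff)
 then show "Rop H l m (Spl H k i j F) x = Spl H k i j (Rop H l m F) x"
  unfolding Rop_def Spl_def using assms by simp (rule ssum_swap)
qed

text \<open>\<open>Spl\<close> makes a function independent of the overwritten slot, so linearity in
  all slots is lost. Linearity in the slots still in use is tracked one slot at a time.\<close>

definition slin ::
  "('k::field, 'h::ring_1) qthopf => ('k => 'u::ab_group_add => 'u) => ((nat => 'h) => 'u) => nat => bool"
 where "slin H s F i \<longleftrightarrow> (\<forall>x. hlin H s (%y. F (x(i := y))))"

locale quasitriangular_bij = quasitriangular_hopf_algebra H
 for H :: "('k::field, 'h::ring_1) qthopf" +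
 assumes bij: "bij (antipode H)"
begin

lemmas hlin_Sinv [hlin_intros] = hlin_comp[OF hlin_Si[OF bij]]

lemma slin_Spl:
 assumes s: "vector_space s"
 shows "slin H s F l ==> l \<notin> {i, j, k} ==> slin H s (Spl H k i j F) l"
  and "slin H s F i ==> slin H s F j ==> k = i \<or> k = j ==> i \<noteq> j ==> slin H s (Spl H k i j F) k"
proof -
 show "slin H s (Spl H k i j F) l" if "slin H s F l" "l \<notin> {i, j, k}"
  unfolding slin_def Spl_def
 proof
  fix x :: "nat => 'h"
  have "x(l := y, i := p, j := q) = x(i := p, j := q, l := y)" for y p q using that(2) by (auto simp: fun_eq_iff)
  then show "hlin H s (%y. dS H ((x(l := y)) k) (%p q. F (x(l := y, i := p, j := q))))"
   using that by (auto simp: slin_def intro!: hlin_ssum s)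
 qed
 show "slin H s (Spl H k i j F) k" if "slin H s F i" "slin H s F j" "k = i \<or> k = j" "i \<noteq> j"
  unfolding slin_def Spl_def
 proof
  fix x :: "nat => 'h"
  have e: "x(k := y, i := p, j := q) = x(i := p, j := q)" for y p q
   using that by (auto simp: fun_eq_iff)
  have 1: "hlin H s (%p. F (x(i := p, j := q)))" for q
   using that(1)[unfolded slin_def, rule_format, of "x(j := q)"] that(4) by (simp add: fun_upd_twist)
  have 2: "hlin H s (%q. F (x(i := p, j := q)))" for p
   using that(2)[unfolded slin_def, rule_format, of "x(i := p)"] by simp
  have "hlin H s (%y. dS H y (%p q. F (x(i := p, j := q))))"
   by (rule hlin_dS[OF s 1 2])
  then show "hlin H s (%y. dS H ((x(k := y)) k) (%p q. F (x(k := y, i := p, j := q))))"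
   by (simp add: e(1))
 qed
qed

lemma mlin_slin: "mlin H N s F ==> i < N ==> slin H s F i"
 by (simp add: mlin_def slin_def)

text \<open>The coproduct rules for R as operator identities: a factor touching the split slot
  becomes two factors. When the split slot carries the second leg, the factor with \<open>j\<close>
  comes before the one with \<open>i\<close>, as in R13 R12.\<close>

lemma Rop_Spl_slin:
 assumes s: "vector_space s" and F: "slin H s F i" "slin H s F j" "slin H s F m" and "k = i \<or> k = j"
  "i \<noteq> j" "m \<noteq> i" "m \<noteq> j"
 shows "Rop H k m (Spl H k i j F) = Spl H k i j (Rop H i m (Rop H j m F))" (is ?A)
  and "Rop H m k (Spl H k i j F) = Spl H k i j (Rop H m j (Rop H m i F))" (is ?B)
proof -
 have l: "hlin H s (%y. F (z(i := y)))" "hlin H s (%y. F (z(j := y)))" "hlin H s (%y. F (z(m := y)))" for z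
  using F by (simp_all add: slin_def)
 have ne: "k \<noteq> m" using assms by auto
 have l3: "hlin H s (%p. F (x(m := r, i := p, j := q)))" "hlin H s (%q. F (x(m := r, i := p, j := q)))"
  "hlin H s (%r. F (x(m := r, i := p, j := q)))" for x p q r
 proof -
  show "hlin H s (%q. F (x(m := r, i := p, j := q)))" using l(2)[of "x(m := r, i := p)"] by simp
  have "x(m := r, i := p, j := q) = (x(m := r, j := q))(i := p)" for p using assms by (auto simp: fun_eq_iff)
  then show "hlin H s (%p. F (x(m := r, i := p, j := q)))" using l(1)[of "x(m := r, j := q)"] by simp
  have "x(m := r, i := p, j := q) = (x(i := p, j := q))(m := r)" for r using assms by (auto simp: fun_eq_iff)
  then show "hlin H s (%r. F (x(m := r, i := p, j := q)))" using l(3)[of "x(i := p, j := q)"] by simp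
 qed
 note l3' = hlin_comp[OF l3(1)] hlin_comp[OF l3(2)] hlin_comp[OF l3(3)]
 have dm: "dS H (y * c) (%p q. F (x(m := r, i := p, j := q))) =
   dS H y (%p q. dS H c (%p' q'. F (x(m := r, i := p * p', j := q * q'))))" for x y c r
  by (rule dS_mult[OF s l3(1,2)])
 have up: "x(k := y, m := r, i := p, j := q) = x(m := r, i := p, j := q)"
  "x(m := r, k := y, i := p, j := q) = x(m := r, i := p, j := q)" for x y r p q
  using assms by (auto simp: fun_eq_iff)
 show ?A
 proof
  fix x
  have "Rop H k m (Spl H k i j F) x = rS H (%a b. dS H (x k) (%p q. dS H a (%p' q'. F (x(m := x m * b, i := p * p', j := q * q')))))"
   unfolding Rop_def Spl_def using ne by (simp add: up dm)
  also have "\<dots> = dS H (x k) (%p q. rS H (%a b. dS H a (%p' q'. F (x(m := x m * b, i := p * p', j := q * q')))))"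
   by (rule ssum_swap)
  also have "\<dots> = dS H (x k) (%p q. rS H (%a b. rS H (%c d. F (x(m := x m * (b * d), i := p * a, j := q * c)))))"
   by (rule ssum_cong, rule rS_comul_left[OF s]) (intro hlin_intros l3')+
  also have "\<dots> = Spl H k i j (Rop H i m (Rop H j m F)) x"
  proof -
   have "x(i := p, j := q, i := p', m := r, j := q', m := r') = x(m := r', i := p', j := q')" for p q p' q' r r'
    using assms by (auto simp: fun_eq_iff)
   then show ?thesis unfolding Rop_def Spl_def using assms by (simp add: mult.assoc)
  qed
  finally show "Rop H k m (Spl H k i j F) x = Spl H k i j (Rop H i m (Rop H j m F)) x" .
 qed
 show ?B
 proof
  fix x
  have "Rop H m k (Spl H k i j F) x = rS H (%a b. dS H (x k) (%p q. dS H b (%p' q'. F (x(m := x m * a, i := p * p', j := q * q')))))"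
   unfolding Rop_def Spl_def using ne by (simp add: up dm)
  also have "\<dots> = dS H (x k) (%p q. rS H (%a b. dS H b (%p' q'. F (x(m := x m * a, i := p * p', j := q * q')))))"
   by (rule ssum_swap)
  also have "\<dots> = dS H (x k) (%p q. rS H (%a b. rS H (%c d. F (x(m := x m * (a * c), i := p * d, j := q * b)))))"
   by (rule ssum_cong, rule rS_comul_right[OF s, of "%a' p' q'. F (x(m := x m * a', i := p * p', j := q * q'))" for p q])
    (intro hlin_intros l3')+
  also have "\<dots> = Spl H k i j (Rop H m j (Rop H m i F)) x"
  proof -
   have "x(i := p, j := q, m := r, j := q', m := r', i := p') = x(m := r', i := p', j := q')" for p q p' q' r r'
    using assms by (auto simp: fun_eq_iff)
   then show ?thesis unfolding Rop_def Spl_def using assms by (simp add: mult.assoc)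
  qed
  finally show "Rop H m k (Spl H k i j F) x = Spl H k i j (Rop H m j (Rop H m i F)) x" .
 qed
qed

lemma Rop_Spl:
 assumes "vector_space s" "mlin H N s F" "i < N" "j < N" "m < N" "k = i \<or> k = j"
  "i \<noteq> j" "m \<noteq> i" "m \<noteq> j"
 shows "Rop H k m (Spl H k i j F) = Spl H k i j (Rop H i m (Rop H j m F))"
  and "Rop H m k (Spl H k i j F) = Spl H k i j (Rop H m j (Rop H m i F))"
 by (rule Rop_Spl_slin; use assms mlin_slin[OF assms(2)] in blast)+

lemma Spl_one:
 assumes s: "vector_space s" and F: "slin H s F i" "slin H s F j" and "i \<noteq> j" "x k = 1"
 shows "Spl H k i j F x = F (x(i := 1, j := 1))"
proof -
 have 1: "hlin H s (%p. F (x(i := p, j := q)))" for q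
  using F(1)[unfolded slin_def, rule_format, of "x(j := q)"] assms(4) by (simp add: fun_upd_twist)
 have 2: "hlin H s (%q. F (x(i := p, j := q)))" for p
  using F(2)[unfolded slin_def, rule_format, of "x(i := p)"] by simp
 show ?thesis unfolding Spl_def assms(5) by (rule dS_one[OF s 1 2])
qed

section \<open>The map \<open>\<Phi>\<^sub>0\<^sub>,\<^sub>1\<close>\<close>

lemma Phi01_sum:
 assumes "hlin H (*) \<phi>"
 shows "Phi01 H \<phi> = rS H (%a1 a2. rS H (%b1 b2. hscale H (\<phi> (a1 * b2)) (a2 * b1)))"
proof -
 note l = hlin_comp[OF assms]
 have 1: "sumR H (hscale H) (%b1 b2. hscale H (\<phi> (a1 * b2)) (a2 * b1)) =
  rS H (%b1 b2. hscale H (\<phi> (a1 * b2)) (a2 * b1))" for a1 a2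
  by (rule sw_rmat) (intro hlin_intros l)+
 show ?thesis unfolding Phi01_def 1 by (rule sw_rmat) (intro hlin_intros l)+
qed

lemma linear_Phi01: "linear_on (Hdual H) (hscale H) (Phi01 H)"
proof -
 have "linear_on (Hdual H) (hscale H) (%\<phi>. hscale H (\<phi> x) y)" for x y
  by (simp add: linear_on_def fscale_def scale_left_distrib)
 then have "linear_on (Hdual H) (hscale H) (%\<phi>. rS H (%a1 a2. rS H (%b1 b2. hscale H (\<phi> (a1 * b2)) (a2 * b1))))"
  by (intro linear_on_ssum_fun vector_space_hscale)
 then show ?thesis
  by (rule linear_on_cong[OF is_vspace_Hdual]) (simp add: Phi01_sum Hdual_hlin)
qed

lemma Phi01_one: "Phi01 H (counit H) = 1"
proof -
 have "Phi01 H (counit H) = rS H (%a1 a2. hscale H (counit H a1) (rS H (%b1 b2. hscale H (counit H b2) (a2 * b1))))"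
  by (simp add: Phi01_sum Hdual_hlin counit_Hdual counit_mult ssum_scale[OF vector_space_hscale])
 also have "\<dots> = rS H (%a1 a2. hscale H (counit H a1) (a2 * 1))"
  by (subst rS_counit_right[OF vector_space_hscale]) ((intro hlin_intros)+, simp)
 also have "\<dots> = 1 * 1"
  by (rule rS_counit_left[OF vector_space_hscale]) (intro hlin_intros)
 finally show ?thesis by simp
qed

text \<open>Five R-matrices and the antipode factor on the left have to become the four of the
  right-hand side. Once the coproduct is resolved, two Yang-Baxter moves carry the factor in slots 1
  and 0 outwards past its neighbours, while \<open>Yop\<close> moves out to meet it, and the two
  cancel.\<close>

lemma Phi01_mult:
 assumes "\<phi> \<in>: Hdual H" "\<psi> \<in>: Hdual H"
 shows "Phi01 H (amult (L01 H) \<phi> \<psi>) = Phi01 H \<phi> * Phi01 H \<psi>"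
proof -
 note l = Hdual_hlin[OF assms(1)] Hdual_hlin[OF assms(2)]
 note l' = hlin_comp[OF l(1)] hlin_comp[OF l(2)]
 have m: "hlin H (*) (amult (L01 H) \<phi> \<psi>)"
  using is_alg_closed[OF is_alg_L01] assms by (simp add: Hdual_hlin)
 let ?s = "hscale H" and ?R = "Rop H"
 note s = vector_space_hscale
 \<comment> \<open>Slots 0 and 1 are the arguments of \<phi> and \<psi>; slot 2 collects the value
   in H.\<close>
 define F where "F x = ?s (\<phi> (x 0) * \<psi> (x 1)) (x 2)" for x :: "nat => 'h"
 have F: "mlin H 3 ?s F"
  unfolding F_def by (rule mlinI3) (intro hlin_intros l')+
 have Y: "mlin H 3 ?s (Yop H 1 0 F)"
  by (rule mlin_Yop[OF s F]) auto
 note R = mlin_Rop[OF s]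
 have "Phi01 H (amult (L01 H) \<phi> \<psi>) = ?R 0 2 (?R 2 0 (Spl H 0 0 1 (?R 1 0 (Yop H 1 0 F)))) (%_. 1)"
  unfolding Phi01_sum[OF m] L01_mult(2)[OF l] ssum_scale_left[OF s] Rop_def Spl_def Yop_def F_def
  by (simp add: mult.assoc, intro ssum_cong, subst ssum_swap12, subst (2) ssum_swap, simp)
 also have "?R 2 0 (Spl H 0 0 1 (?R 1 0 (Yop H 1 0 F))) = Spl H 0 0 1 (?R 2 1 (?R 2 0 (?R 1 0 (Yop H 1 0 F))))"
  by (rule Rop_Spl(2)[OF s R[OF Y]]) auto
 also have "?R 0 2 \<dots> = Spl H 0 0 1 (?R 0 2 (?R 1 2 (?R 2 1 (?R 2 0 (?R 1 0 (Yop H 1 0 F))))))"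
  by (rule Rop_Spl(1)[OF s R[OF R[OF R[OF Y]]]]) auto
 also have "\<dots> (%_. 1) = ?R 0 2 (?R 1 2 (?R 2 1 (?R 2 0 (?R 1 0 (Yop H 1 0 F))))) (%_. 1)"
  by (subst Spl_one[OF s]) (auto intro!: mlin_slin[OF R[OF R[OF R[OF R[OF R[OF Y]]]]]])
 also have "?R 2 1 (?R 2 0 (?R 1 0 (Yop H 1 0 F))) = ?R 1 0 (?R 2 0 (?R 2 1 (Yop H 1 0 F)))"
  by (rule Rop_yang_baxter[OF s Y]) auto
 also have "?R 1 2 (?R 1 0 (?R 2 0 (?R 2 1 (Yop H 1 0 F)))) = ?R 2 0 (?R 1 0 (?R 1 2 (?R 2 1 (Yop H 1 0 F))))"
  by (rule Rop_yang_baxter[OF s R[OF Y]]) auto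
 also have "?R 1 2 (?R 2 1 (Yop H 1 0 F)) = Yop H 1 0 (?R 1 2 (?R 2 1 F))"
  by (simp add: Yop_Rop)
 \<comment> \<open>The two outer factors do not touch slot 1, which therefore still holds 1, as the
   cancellation requires.\<close>
 also have "?R 0 2 (?R 2 0 (?R 1 0 (Yop H 1 0 (?R 1 2 (?R 2 1 F))))) (%_. 1) =
  ?R 0 2 (?R 2 0 (?R 1 2 (?R 2 1 F))) (%_. 1)"
 proof -
  have "?R 1 0 (Yop H 1 0 (?R 1 2 (?R 2 1 F))) x = ?R 1 2 (?R 2 1 F) x" if "x 1 = 1" for x
   by (rule Rop_Yop[OF s R[OF R[OF F]]]) (use that in auto)
  then show ?thesis
   unfolding Rop_def[of H 0 2] Rop_def[of H 2 0] by simp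
 qed
 also have "\<dots> = Phi01 H \<phi> * Phi01 H \<psi>"
 proof -
  have 1: "Phi01 H \<phi> * Phi01 H \<psi> = rS H (%a1 a2. rS H (%b1 b2. ?s (\<phi> (a1 * b2)) (a2 * b1) * Phi01 H \<psi>))"
   using hlin_mono_comp[OF hlin_mult_left[OF hlin_id, of "Phi01 H \<psi>"]] by (simp add: Phi01_sum[OF l(1)])
  have 2: "?s c y * Phi01 H \<psi> = rS H (%a1 a2. rS H (%b1 b2. ?s c y * ?s (\<psi> (a1 * b2)) (a2 * b1)))" for c y
   using hlin_mono_comp[OF hlin_mult_right[OF hlin_id, of "?s c y"]] by (simp add: Phi01_sum[OF l(2)])
  show ?thesis unfolding 1 2
   by (simp add: Rop_def F_def scale_mult_left[symmetric] scale_mult_right[symmetric] mult.assoc mult.commute[of "\<phi> _"])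
 qed
 finally show ?thesis .
qed

text \<open>The components of h are moved past one copy of R and then past the other; after that h2
  stands next to S(h3) in the argument of \<phi> and the two cancel, leaving h on the right.\<close>

lemma Phi01_moment:
 assumes "\<phi> \<in>: Hdual H"
 shows "dS H h (%h1 h2. h1 * Phi01 H (coad01 H h2 \<phi>)) = Phi01 H \<phi> * h"
proof -
 note l = Hdual_hlin[OF assms]
 note l' = hlin_comp[OF l]
 note s = vector_space_hscale
 let ?S = "antipode H" and ?s = "hscale H"
 have "dS H h (%h1 h2. h1 * Phi01 H (coad01 H h2 \<phi>)) =
  dS H h (%h1 k. rS H (%a1 a2. rS H (%b1 b2. dS H k (%h2 h3. ?s (\<phi> (h2 * (a1 * b2 * ?S h3))) (h1 * (a2 * b1))))))"
 proof -
  have "y * Phi01 H (coad01 H k \<phi>) = rS H (%a1 a2. rS H (%b1 b2. y * ?s (coad01 H k \<phi> (a1 * b2)) (a2 * b1)))" for y k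
   using hlin_mono_comp[OF hlin_mult_right[OF hlin_id, of y]] assms
   by (simp add: Phi01_sum Hdual_hlin coad01_Hdual)
  then show ?thesis
   by (simp add: coad01_apply[OF l] ssum_scale_left[OF s] scale_mult_right hlin_mono_comp[OF hlin_mult_right[OF hlin_id]])
 qed
 also have "\<dots> = dS H h (%h1 k. dS H k (%h2 h3. rS H (%a1 a2. rS H (%b1 b2.
   ?s (\<phi> (h2 * a1 * b2 * ?S h3)) (h1 * a2 * b1)))))"
  unfolding mult.assoc by (rule ssum_cong, rule ssum_swap21)
 also have "\<dots> = dS H h (%h1 k. dS H k (%h2 h3. rS H (%a1 a2. rS H (%b1 b2.
   ?s (\<phi> (a1 * h1 * b2 * ?S h3)) (a2 * h2 * b1)))))"
  by (rule dS3_rS_first[OF s, of "%x y h3. rS H (%b1 b2. ?s (\<phi> (x * b2 * ?S h3)) (y * b1))"])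
   (intro hlin_intros l')+
 also have "\<dots> = rS H (%a1 a2. dS H h (%h1 k. dS H k (%h2 h3. rS H (%b1 b2.
   ?s (\<phi> (a1 * (h1 * b2) * ?S h3)) (a2 * (h2 * b1))))))"
  unfolding mult.assoc by (rule ssum_swap21)
 also have "\<dots> = rS H (%a1 a2. dS H h (%h1 k. dS H k (%h2 h3. rS H (%b1 b2.
   ?s (\<phi> (a1 * (b2 * h2) * ?S h3)) (a2 * (b1 * h1))))))"
  by (rule ssum_cong, rule dS3_rS_first[OF s, of "%x y h3. ?s (\<phi> (a1 * y * ?S h3)) (a2 * x)" for a1 a2])
   (intro hlin_intros l')+
 also have "\<dots> = rS H (%a1 a2. rS H (%b1 b2. dS H h (%h1 k. dS H k (%h2 h3.
   ?s (\<phi> (a1 * b2 * (h2 * ?S h3))) (a2 * b1 * h1)))))"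
  unfolding mult.assoc by (rule ssum_cong, rule ssum_swap21)
 also have "\<dots> = rS H (%a1 a2. rS H (%b1 b2. ?s (\<phi> (a1 * b2)) (a2 * b1 * h)))"
  by (subst dS3_antipode_right1[OF s, of "%h1 y. ?s (\<phi> (a1 * b2 * y)) (a2 * b1 * h1)" for a1 b2 a2 b1])
   ((intro hlin_intros l')+, simp)
 also have "\<dots> = Phi01 H \<phi> * h"
  using hlin_mono_comp[OF hlin_mult_left[OF hlin_id, of h]] by (simp add: Phi01_sum[OF l] scale_mult_left)
 finally show ?thesis .
qed

lemma L01_unit:
 assumes "\<phi> \<in>: Hdual H"
 shows "amult (L01 H) (counit H) \<phi> = \<phi>" and "amult (L01 H) \<phi> (counit H) = \<phi>"
proof -
 note l = Hdual_hlin[OF assms] and e = Hdual_hlin[OF counit_Hdual]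
 note l' = hlin_comp[OF l]
 note s = vector_space_mult
 show "amult (L01 H) (counit H) \<phi> = \<phi>"
 proof
  fix x
  have "amult (L01 H) (counit H) \<phi> x = rS H (%a1 a2. rS H (%b1 b2. dS H x (%x1 x2.
    counit H x1 * (counit H b2 * (counit H a2 * \<phi> (a1 * (x2 * b1)))))))"
   by (simp add: L01_mult(2)[OF e l] counit_mult counit_antipode mult.assoc)
  also have "\<dots> = rS H (%a1 a2. rS H (%b1 b2. counit H b2 * (counit H a2 * \<phi> (a1 * (x * b1)))))"
   by (intro ssum_cong dS_counit_left hlin_intros l')
  also have "\<dots> = rS H (%a1 a2. counit H a2 * \<phi> (a1 * (x * 1)))"
   by (intro ssum_cong rS_counit_right hlin_intros l')
  also have "\<dots> = \<phi> (1 * (x * 1))" by (intro rS_counit_right hlin_intros l')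
  finally show "amult (L01 H) (counit H) \<phi> x = \<phi> x" by simp
 qed
 show "amult (L01 H) \<phi> (counit H) = \<phi>"
 proof
  fix x
  have "amult (L01 H) \<phi> (counit H) x = rS H (%a1 a2. rS H (%b1 b2. dS H x (%x1 x2.
    counit H x2 * (counit H b1 * (counit H a1 * \<phi> (x1 * (b2 * antipode H a2)))))))"
   by (simp add: L01_mult(2)[OF l e] counit_mult counit_antipode mult_ac)
  also have "\<dots> = rS H (%a1 a2. rS H (%b1 b2. counit H b1 * (counit H a1 * \<phi> (x * (b2 * antipode H a2)))))"
   by (intro ssum_cong dS_counit_right hlin_intros l')
  also have "\<dots> = rS H (%a1 a2. counit H a1 * \<phi> (x * (1 * antipode H a2)))"
   by (intro ssum_cong rS_counit_left hlin_intros l')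
  also have "\<dots> = \<phi> (x * (1 * antipode H 1))" by (intro rS_counit_left hlin_intros l')
  finally show "amult (L01 H) \<phi> (counit H) x = \<phi> x" by (simp add: antipode_one)
 qed
qed

end

section \<open>The two-sided Heisenberg double\<close>

lemma linear_on_hlin: "hlin H s K ==> linear_on V (hscale H) F ==> linear_on V s (%v. K (F v))"
 by (auto simp: linear_on_def hlin_def)

text \<open>The choice defining \<open>tlift\<close> refers to \<open>F\<close> only through its
  values on words, so the integrand may be rewritten using membership in the carriers.\<close>

lemma tlift_cong:
 "(\<And>w. w \<in> words A B g n ==> F w = G w) ==> tlift A B g n s F = tlift A B g n s G"
 unfolding tlift_def by (rule arg_cong[where f=Eps]) (auto simp: fun_eq_iff)

declare hlin_fun [hlin_intros del]

named_theorems dual_intros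
declare lact_Hdual [dual_intros] ract_Hdual [dual_intros]

abbreviation "Dl H \<equiv> linear_on (Hdual H) fscale"

lemma linear_on_ract_lact: "Dl H (%\<phi>. x \<triangleright> \<phi>)" "Dl H (%\<phi>. \<phi> \<triangleleft> x)"
 by (simp_all add: linear_on_lact linear_on_ract)

lemma hlin_via:
 "linear_on (Hdual H) s K ==> hlin H fscale F ==> (\<And>x. F x \<in>: Hdual H) ==> hlin H s (%x. K (F x))"
 by (simp add: linear_on_def hlin_def)
lemmas Dl_via = linear_on_via[where V="Hdual H" and W="Hdual H" for H, unfolded vscale_Hdual]

lemma hlin_lact_fun [hlin_intros]:
 "hlin H fscale F ==> hlin H fscale (%x. c \<triangleright> F x)"
 "hlin H fscale F ==> hlin H fscale (%x. F x \<triangleleft> c)"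
 by (simp_all add: hlin_def lact_def ract_def fun_eq_iff fscale_def)

lemma HH_simps [simp]:
 "vscale (HH H) = fscale" "vcarrier (HH H) = vcarrier (tensor (Hdual H) (Halg H) 1 2)"
 "aone (HH H) = HHpure H (counit H) 1 1"
 by (simp_all add: HH_def)

lemma words_HH:
 "w \<in> words (Hdual H) (Halg H) 1 2 \<longleftrightarrow> (\<exists>\<phi> x y. w = ([\<phi>], [x, y]) \<and> \<phi> \<in>: Hdual H)"
 by (cases w) (auto simp: words_def Halg_def length_Suc_conv numeral_2_eq_2 One_nat_def)

lemma multilinear_HH:
 assumes "\<And>x y. linear_on (Hdual H) s (%\<phi>. E \<phi> x y)"
  "\<And>\<phi> y. \<phi> \<in>: Hdual H ==> hlin H s (%x. E \<phi> x y)"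
  "\<And>\<phi> x. \<phi> \<in>: Hdual H ==> hlin H s (%y. E \<phi> x y)"
 shows "multilinear (Hdual H) (Halg H) 1 2 s (%(\<phi>s, xs). E (hd \<phi>s) (xs ! 0) (xs ! 1))"
 unfolding multilinear_iff
proof (intro allI impI conjI)
 fix as :: "('a => 'b) list" and bs :: "'a list" and i :: nat
 assume "(as, bs) \<in> words (Hdual H) (Halg H) 1 2"
 then obtain \<phi> x y where w: "as = [\<phi>]" "bs = [x, y]" "\<phi> \<in>: Hdual H" by (auto simp: words_HH)
 show "linear_on (Hdual H) s (%x. case (as[i := x], bs) of (\<phi>s, xs) => E (hd \<phi>s) (xs ! 0) (xs ! 1))"
  if "i < 1" using that assms(1) w by simp
 show "linear_on (Halg H) s (%x. case (as, bs[i := x]) of (\<phi>s, xs) => E (hd \<phi>s) (xs ! 0) (xs ! 1))"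
  if "i < 2"
 proof -
  from that consider "i = 0" | "i = 1" by linarith
  then show ?thesis by cases (use assms(2,3) w in \<open>simp_all add: hlin_linear_on One_nat_def\<close>)
 qed
qed

lemma HHpure_linear:
 shows "linear_on (Hdual H) fscale (%\<phi>. HHpure H \<phi> x y)"
  and "\<phi> \<in>: Hdual H ==> hlin H fscale (%x. HHpure H \<phi> x y)"
  and "\<phi> \<in>: Hdual H ==> hlin H fscale (%y. HHpure H \<phi> x y)"
proof -
 note m = multilinear_pure[of "Hdual H" "Halg H" 1 2, unfolded multilinear_iff, rule_format]
 have 1: "([\<phi>], [x, y]) \<in> words (Hdual H) (Halg H) 1 2" if "\<phi> \<in>: Hdual H" for \<phi> x y
  using that by (auto simp: words_HH)
 show "linear_on (Hdual H) fscale (%\<phi>. HHpure H \<phi> x y)"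
  using m[OF 1[OF is_vspace_zero[OF is_vspace_Hdual]], THEN conjunct1, rule_format, of 0 x y] by (simp add: HHpure_def)
 show "\<phi> \<in>: Hdual H ==> hlin H fscale (%x. HHpure H \<phi> x y)"
  using m[OF 1, THEN conjunct2, rule_format, of \<phi> 0 0 y] by (simp add: HHpure_def hlin_linear_on)
 show "\<phi> \<in>: Hdual H ==> hlin H fscale (%y. HHpure H \<phi> x y)"
  using m[OF 1, THEN conjunct2, rule_format, of \<phi> 1 x 0] by (simp add: HHpure_def hlin_linear_on One_nat_def)
qed

lemma hlin_HHpure [hlin_intros]:
 "hlin H fscale F ==> (\<And>x. F x \<in>: Hdual H) ==> hlin H fscale (%x. HHpure H (F x) y z)"
 "hlin H (hscale H) f ==> \<phi> \<in>: Hdual H ==> hlin H fscale (%x. HHpure H \<phi> (f x) z)"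
 "hlin H (hscale H) f ==> \<phi> \<in>: Hdual H ==> hlin H fscale (%x. HHpure H \<phi> y (f x))"
 using hlin_via[OF HHpure_linear(1)] hlin_comp[OF HHpure_linear(2)] hlin_comp[OF HHpure_linear(3)] by blast+

lemma HHpure_closed: "\<phi> \<in>: Hdual H ==> HHpure H \<phi> x y \<in>: tensor (Hdual H) (Halg H) 1 2"
 unfolding HHpure_def by (rule pure_closed) (simp add: words_HH)

lemma HH_span: "vcarrier (HH H) = module.span (vscale (HH H)) {HHpure H \<phi> x y |\<phi> x y. \<phi> \<in>: Hdual H}"
proof -
 have "pure (Hdual H) (Halg H) 1 2 ` words (Hdual H) (Halg H) 1 2 = {HHpure H \<phi> x y |\<phi> x y. \<phi> \<in>: Hdual H}"
  by (auto simp: HHpure_def words_HH image_iff) blast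
 then show ?thesis by (simp add: vcarrier_tensor_span)
qed

lemma lact_lact: "x \<triangleright> (y \<triangleright> \<phi>) = (x * y :: 'h::ring_1) \<triangleright> \<phi>"
 and ract_ract: "(\<phi> \<triangleleft> x) \<triangleleft> y = \<phi> \<triangleleft> (x * y :: 'h::ring_1)"
 and lact_ract: "x \<triangleright> (\<phi> \<triangleleft> y) = (x \<triangleright> \<phi>) \<triangleleft> (y :: 'h::ring_1)"
 and lact_one: "(1 :: 'h::ring_1) \<triangleright> \<phi> = \<phi>" and ract_one: "\<phi> \<triangleleft> (1 :: 'h::ring_1) = \<phi>"
 by (simp_all add: fun_eq_iff mult.assoc)

context quasitriangular_bij
begin

abbreviation Sinv :: "'h => 'h" where "Sinv \<equiv> inv_into UNIV (antipode H)"

lemma hlin_lact_arg [hlin_intros]: 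
 assumes "hlin H (hscale H) f" "\<phi> \<in>: Hdual H"
 shows "hlin H fscale (%x. f x \<triangleright> \<phi>)" and "hlin H fscale (%x. \<phi> \<triangleleft> f x)"
 unfolding lact_def ract_def by (rule hlin_fun, rule hlin_comp[OF Hdual_hlin[OF assms(2)]], intro hlin_intros assms)+

lemmas [dual_intros] = star_Hdual counit_Hdual coad01_Hdual

lemma L01_closed [dual_intros]:
 "\<phi> \<in>: Hdual H ==> \<psi> \<in>: Hdual H ==> amult (L01 H) \<phi> \<psi> \<in>: Hdual H"
 using is_alg_closed[OF is_alg_L01] by simp

lemma bilinear_L01: "bilinear_on (Hdual H) (Hdual H) fscale (amult (L01 H))"
 using is_alg_bilinear[OF is_alg_L01] by (simp add: bilinear_on_def)

lemmas hlin_star [hlin_intros] =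
 hlin_via[OF bilinear_onD(1)[OF bilinear_star]] hlin_via[OF bilinear_onD(2)[OF bilinear_star]]
lemmas hlin_L01 [hlin_intros] =
 hlin_via[OF bilinear_onD(1)[OF bilinear_L01]] hlin_via[OF bilinear_onD(2)[OF bilinear_L01]]
lemmas hlin_coad01_arg [hlin_intros] = hlin_comp[OF hlin_coad01]
lemmas hlin_coad01_fun [hlin_intros] = hlin_via[OF linear_coad01]
lemmas hlin_Phi01 [hlin_intros] = hlin_via[OF linear_Phi01]

lemma star_assoc:
 assumes "\<phi> \<in>: Hdual H" "\<psi> \<in>: Hdual H" "\<chi> \<in>: Hdual H"
 shows "star H (star H \<phi> \<psi>) \<chi> = star H \<phi> (star H \<psi> \<chi>)"
proof
 fix x
 note l = Hdual_hlin[OF assms(1)] Hdual_hlin[OF assms(2)] Hdual_hlin[OF assms(3)]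
 note l' = hlin_comp[OF l(1)] hlin_comp[OF l(2)] hlin_comp[OF l(3)]
 have "star H (star H \<phi> \<psi>) \<chi> x = dS H x (%a b. dS H a (%a1 a2. \<phi> a1 * (\<psi> a2 * \<chi> b)))"
  by (simp add: star_apply l Hdual_hlin star_Hdual assms ssum_mult_right mult.assoc)
 also have "\<dots> = dS H x (%a b. dS H b (%b1 b2. \<phi> a * (\<psi> b1 * \<chi> b2)))"
  by (rule dS_coassoc[OF vector_space_mult]) (intro hlin_intros l')+
 finally show "star H (star H \<phi> \<psi>) \<chi> x = star H \<phi> (star H \<psi> \<chi>) x"
  by (simp add: star_apply l Hdual_hlin star_Hdual assms ssum_mult_left)
qed

lemma star_unit:
 assumes "\<phi> \<in>: Hdual H"
 shows "star H (counit H) \<phi> = \<phi>" and "star H \<phi> (counit H) = \<phi>"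
 using dS_counit_left[OF Hdual_hlin[OF assms]] dS_counit_right[OF Hdual_hlin[OF assms]]
 by (simp_all add: fun_eq_iff star_apply Hdual_hlin assms counit_Hdual mult.commute)

lemma star_bimodule:
 assumes "\<phi> \<in>: Hdual H" "\<psi> \<in>: Hdual H"
 shows "x \<triangleright> star H \<phi> \<psi> \<triangleleft> w = dS H x (%x1 x2. dS H w (%w1 w2. star H (x1 \<triangleright> \<phi> \<triangleleft> w1) (x2 \<triangleright> \<psi> \<triangleleft> w2)))"
proof
 fix h
 note l = Hdual_hlin[OF assms(1)] Hdual_hlin[OF assms(2)]
 note l' = hlin_comp[OF l(1)] hlin_comp[OF l(2)]
 have "(x \<triangleright> star H \<phi> \<psi> \<triangleleft> w) h = dS H (w * h * x) (%a b. \<phi> a * \<psi> b)"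
  by (simp add: star_apply l)
 also have "\<dots> = dS H (w * h) (%a b. dS H x (%x1 x2. \<phi> (a * x1) * \<psi> (b * x2)))"
  by (rule dS_mult[OF vector_space_mult]) (intro hlin_intros l')+
 also have "\<dots> = dS H w (%w1 w2. dS H h (%a b. dS H x (%x1 x2. \<phi> (w1 * a * x1) * \<psi> (w2 * b * x2))))"
  by (rule dS_mult[OF vector_space_mult]) (intro hlin_intros l')+
 also have "\<dots> = dS H w (%w1 w2. dS H x (%x1 x2. dS H h (%a b. \<phi> (w1 * a * x1) * \<psi> (w2 * b * x2))))"
  by (rule ssum_cong, rule ssum_swap)
 also have "\<dots> = dS H x (%x1 x2. dS H w (%w1 w2. dS H h (%a b. \<phi> (w1 * a * x1) * \<psi> (w2 * b * x2))))"
  by (rule ssum_swap)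
 also have "\<dots> = dS H x (%x1 x2. dS H w (%w1 w2. star H (x1 \<triangleright> \<phi> \<triangleleft> w1) (x2 \<triangleright> \<psi> \<triangleleft> w2))) h"
  by (simp add: ssum_apply star_apply hlin_lact hlin_ract l)
 finally show "(x \<triangleright> star H \<phi> \<psi> \<triangleleft> w) h =
  dS H x (%x1 x2. dS H w (%w1 w2. star H (x1 \<triangleright> \<phi> \<triangleleft> w1) (x2 \<triangleright> \<psi> \<triangleleft> w2))) h" .
qed

text \<open>The summand is multilinear only for linear forms in the restricted dual. On words this
  holds, so the Sweedler sums of the definition can be replaced by \<open>ssum\<close> under both
  extensions.\<close>

lemma HH_mult:
 shows "bilinear_on (HH H) (HH H) fscale (amult (HH H))"
  and "\<phi> \<in>: Hdual H ==> \<psi> \<in>: Hdual H ==>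
   amult (HH H) (HHpure H \<phi> x y) (HHpure H \<psi> z t) =
   dS H x (%x1 x2. dS H y (%y1 y2. HHpure H (star H \<phi> (x1 \<triangleright> \<psi> \<triangleleft> Sinv y2)) (x2 * z) (y1 * t)))"
proof -
 define E where "E = (%\<phi> x y \<psi> z t. dS H x (%x1 x2. dS H y (%y1 y2.
  HHpure H (star H \<phi> (x1 \<triangleright> \<psi> \<triangleleft> Sinv y2)) (x2 * z) (y1 * t))))"
 define E' where "E' = (%\<phi> x y \<psi> z t. sumD H fscale x (%x1 x2. sumD H fscale y (%y1 y2.
  HHpure H (star H \<phi> (x1 \<triangleright> \<psi> \<triangleleft> Sinv y2)) (x2 * z) (y1 * t))))"
 let ?W = "words (Hdual H) (Halg H) 1 2"
 have EE: "E' \<phi> x y \<psi> z t = E \<phi> x y \<psi> z t" if \<phi>: "\<phi> \<in>: Hdual H" "\<psi> \<in>: Hdual H" for \<phi> \<psi> x y z t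
 proof -
  have 1: "sumD H fscale y (%y1 y2. HHpure H (star H \<phi> (x1 \<triangleright> \<psi> \<triangleleft> Sinv y2)) (x2 * z) (y1 * t)) =
    dS H y (%y1 y2. HHpure H (star H \<phi> (x1 \<triangleright> \<psi> \<triangleleft> Sinv y2)) (x2 * z) (y1 * t))" for x1 x2
   by (rule sw_comul) (intro hlin_intros dual_intros \<phi>)+
  show ?thesis unfolding E_def E'_def 1
   by (rule sw_comul) (intro hlin_intros dual_intros \<phi>)+
 qed
 define F where "F = (%(\<phi>s, xs) (\<psi>s, zs). E (hd \<phi>s) (xs ! 0) (xs ! 1) (hd \<psi>s) (zs ! 0) (zs ! 1))"
 have mult: "amult (HH H) = (%X Y. tlift (Hdual H) (Halg H) 1 2 fscale (%w. tlift (Hdual H) (Halg H) 1 2 fscale (F w) Y) X)"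
 proof (intro ext)
  fix X Y :: "('k, 'h) HH_elt" and f
  have "amult (HH H) X Y = tlift (Hdual H) (Halg H) 1 2 fscale (%(\<phi>s, xs). tlift (Hdual H) (Halg H) 1 2 fscale
   (%(\<psi>s, zs). E' (hd \<phi>s) (xs ! 0) (xs ! 1) (hd \<psi>s) (zs ! 0) (zs ! 1)) Y) X"
   by (simp add: HH_def HHlift_def E'_def)
  also have "\<dots> = tlift (Hdual H) (Halg H) 1 2 fscale (%w. tlift (Hdual H) (Halg H) 1 2 fscale (F w) Y) X"
  proof (rule tlift_cong[THEN fun_cong])
   fix w assume w: "w \<in> ?W"
   have "(case w' of (\<psi>s, zs) => E' (hd (fst w)) (snd w ! 0) (snd w ! 1) (hd \<psi>s) (zs ! 0) (zs ! 1)) = F w w'"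
    if "w' \<in> ?W" for w' using w that EE by (auto simp: F_def words_HH)
   from tlift_cong[where A="Hdual H" and B="Halg H" and g=1 and n=2 and s=fscale, OF this]
   show "(case w of (\<phi>s, xs) => tlift (Hdual H) (Halg H) 1 2 fscale
     (%(\<psi>s, zs). E' (hd \<phi>s) (xs ! 0) (xs ! 1) (hd \<psi>s) (zs ! 0) (zs ! 1)) Y) =
    tlift (Hdual H) (Halg H) 1 2 fscale (F w) Y"
    by (simp add: case_prod_unfold)
  qed
  finally show "amult (HH H) X Y f = tlift (Hdual H) (Halg H) 1 2 fscale (%w. tlift (Hdual H) (Halg H) 1 2 fscale (F w) Y) X f"
   by simp
 qed
 have 2: "multilinear (Hdual H) (Halg H) 1 2 fscale (F w)" if w0: "w \<in> ?W" for w
 proof -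
  obtain \<phi> x y where w: "w = ([\<phi>], [x, y])" "\<phi> \<in>: Hdual H" using w0 by (auto simp: words_HH)
  have "multilinear (Hdual H) (Halg H) 1 2 fscale (%(\<psi>s, zs). E \<phi> x y (hd \<psi>s) (zs ! 0) (zs ! 1))"
  proof (rule multilinear_HH)
   show "linear_on (Hdual H) fscale (%\<psi>. E \<phi> x y \<psi> z t)" for z t
    unfolding E_def
    by (intro linear_on_ssum_fun vector_space_fscale Dl_via[OF HHpure_linear(1)]
      Dl_via[OF bilinear_onD(1)[OF bilinear_star w(2)]] dual_intros w(2)
      Dl_via[OF linear_on_ract_lact(2)] linear_on_ract_lact)
   show "hlin H fscale (%z. E \<phi> x y \<psi> z t)" if "\<psi> \<in>: Hdual H" for \<psi> t
    unfolding E_def by (intro hlin_intros dual_intros w(2) that)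
   show "hlin H fscale (%t. E \<phi> x y \<psi> z t)" if "\<psi> \<in>: Hdual H" for \<psi> z
    unfolding E_def by (intro hlin_intros dual_intros w(2) that)
  qed
  then show ?thesis by (simp add: F_def w)
 qed
 have 1: "multilinear (Hdual H) (Halg H) 1 2 fscale (%w. F w w')" if w0: "w' \<in> ?W" for w'
 proof -
  obtain \<psi> z t where w: "w' = ([\<psi>], [z, t])" "\<psi> \<in>: Hdual H" using w0 by (auto simp: words_HH)
  have "multilinear (Hdual H) (Halg H) 1 2 fscale (%(\<phi>s, xs). E (hd \<phi>s) (xs ! 0) (xs ! 1) \<psi> z t)"
  proof (rule multilinear_HH)
   show "linear_on (Hdual H) fscale (%\<phi>. E \<phi> x y \<psi> z t)" for x y
    unfolding E_def
    by (intro linear_on_ssum_fun vector_space_fscale Dl_via[OF HHpure_linear(1)]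
      bilinear_onD(2)[OF bilinear_star] dual_intros w(2))
   show "hlin H fscale (%x. E \<phi> x y \<psi> z t)" if "\<phi> \<in>: Hdual H" for \<phi> y
    unfolding E_def by (intro hlin_intros dual_intros w(2) that)
   show "hlin H fscale (%y. E \<phi> x y \<psi> z t)" if "\<phi> \<in>: Hdual H" for \<phi> x
    unfolding E_def by (intro hlin_intros dual_intros w(2) that)
  qed
  then show ?thesis by (simp add: F_def w case_prod_unfold)
 qed
 show "bilinear_on (HH H) (HH H) fscale (amult (HH H))"
  unfolding mult using tlift_tlift(1)[OF vector_space_fscale 1 2 is_vspace_Hdual is_vspace_Halg]
  by (simp add: bilinear_on_def linear_on_def)
 assume "\<phi> \<in>: Hdual H" "\<psi> \<in>: Hdual H"
 then have "([\<phi>], [x, y]) \<in> ?W" "([\<psi>], [z, t]) \<in> ?W" by (auto simp: words_HH)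
 from tlift_tlift(2)[OF vector_space_fscale 1 2 is_vspace_Hdual is_vspace_Halg this]
 show "amult (HH H) (HHpure H \<phi> x y) (HHpure H \<psi> z t) =
   dS H x (%x1 x2. dS H y (%y1 y2. HHpure H (star H \<phi> (x1 \<triangleright> \<psi> \<triangleleft> Sinv y2)) (x2 * z) (y1 * t)))"
  unfolding mult HHpure_def[of H \<phi>] HHpure_def[of H \<psi>] by (simp add: F_def E_def)
qed

lemma is_vspace_HH: "is_vspace (HH H)"
 using is_vspace_tensor[of "Hdual H" "Halg H" 1 2] by (simp add: is_vspace_def)

lemma is_alg_HH: "is_alg (HH H)"
 unfolding is_alg_def
proof (intro conjI ballI is_vspace_HH)
 show "bilinear_on (HH H) (HH H) (vscale (HH H)) (amult (HH H))" using HH_mult(1) by simp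
 show "aone (HH H) \<in>: HH H" by (simp add: HHpure_closed counit_Hdual)
 fix X Y assume X: "X \<in>: HH H" and Y: "Y \<in>: HH H"
 show "amult (HH H) X Y \<in>: HH H"
 proof (rule span_closed[OF is_vspace_HH HH_span _ is_vspace_HH _ X])
  show "linear_on (HH H) (vscale (HH H)) (%X. amult (HH H) X Y)"
   using bilinear_onD(2)[OF HH_mult(1) Y] by simp
  fix X assume "X \<in> {HHpure H \<phi> x y |\<phi> x y. \<phi> \<in>: Hdual H}"
  then obtain \<phi> x y where X: "X = HHpure H \<phi> x y" "\<phi> \<in>: Hdual H" by blast
  show "amult (HH H) X Y \<in>: HH H"
  proof (rule span_closed[OF is_vspace_HH HH_span _ is_vspace_HH _ Y])
   show "linear_on (HH H) (vscale (HH H)) (amult (HH H) X)"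
    using bilinear_onD(1)[OF HH_mult(1), of X] X by (simp add: HHpure_closed)
   fix Y assume "Y \<in> {HHpure H \<phi> x y |\<phi> x y. \<phi> \<in>: Hdual H}"
   then show "amult (HH H) X Y \<in>: HH H"
    using X by (auto simp: HH_mult(2) simp del: HH_simps(2)
     intro!: ssum_closed is_vspace_HH HHpure_closed[folded HH_simps(2)] dual_intros)
  qed
 qed
qed

lemma HH_mult_sums:
 assumes "\<And>a b. F a b \<in>: HH H" "Y \<in>: HH H"
 shows "amult (HH H) (ssum H t F) Y = ssum H t (%a b. amult (HH H) (F a b) Y)"
  and "amult (HH H) Y (ssum H t F) = ssum H t (%a b. amult (HH H) Y (F a b))"
 by (rule linear_on_ssum[OF is_vspace_HH bilinear_onD(2)[OF HH_mult(1) assms(2)] assms(1)],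
  rule linear_on_ssum[OF is_vspace_HH bilinear_onD(1)[OF HH_mult(1) assms(2)] assms(1)])

lemma HHpure_ssum:
 assumes "\<And>a b. F a b \<in>: Hdual H"
 shows "HHpure H (ssum H t F) x y = ssum H t (%a b. HHpure H (F a b) x y)"
 by (rule linear_on_ssum[OF is_vspace_Hdual HHpure_linear(1) assms])

lemma star_ssum:
 assumes "\<And>a b. F a b \<in>: Hdual H" "\<phi> \<in>: Hdual H"
 shows "star H \<phi> (ssum H t F) = ssum H t (%a b. star H \<phi> (F a b))"
 by (rule linear_on_ssum[OF is_vspace_Hdual bilinear_onD(1)[OF bilinear_star assms(2)] assms(1)])

lemma Sinv_one: "Sinv 1 = 1"
 by (rule Si_one[OF bij])

text \<open>Both bracketings expand to sums of the same terms \<open>Z\<close> over three components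
  of x and of y and two of z and of t. The second copy of H fits because the inverse antipode
  reverses products and coproducts, which together make the flipped coproduct act by a compatible
  right action.\<close>

lemma is_assoc_HH: "is_assoc_alg (HH H)"
proof (rule is_assoc_algI[OF is_alg_HH HH_span])
 let ?S = "{HHpure H \<phi> x y |\<phi> x y. \<phi> \<in>: Hdual H}" and ?m = "amult (HH H)"
 note s = vector_space_fscale
 fix X assume "X \<in> ?S"
 then obtain \<phi> x y where X: "X = HHpure H \<phi> x y" and \<phi>: "\<phi> \<in>: Hdual H" by blast
 show "?m (aone (HH H)) X = X"
  unfolding X HH_simps HH_mult(2)[OF counit_Hdual \<phi>]
  by (subst dS_one[OF s], (intro hlin_intros dual_intros \<phi>)+, subst dS_one[OF s], (intro hlin_intros dual_intros \<phi>)+)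
   (simp add: Sinv_one lact_one ract_one star_unit \<phi>)
 show "?m X (aone (HH H)) = X"
 proof -
  have e: "(x1 \<triangleright> counit H \<triangleleft> Sinv y2) = fscale (counit H x1 * counit H y2) (counit H)" for x1 y2
   by (simp add: fun_eq_iff counit_mult counit_Si[OF bij] fscale_def mult_ac)
  have "HHpure H (star H \<phi> (x1 \<triangleright> counit H \<triangleleft> Sinv y2)) x2 y1 =
   fscale (counit H x1) (fscale (counit H y2) (HHpure H \<phi> x2 y1))" for x1 x2 y1 y2
   using linear_on_scale[OF bilinear_onD(1)[OF bilinear_star \<phi>] counit_Hdual]
    linear_on_scale[OF HHpure_linear(1) \<phi>]
   by (simp add: e star_unit \<phi>) (simp add: fscale_def mult.assoc)
  then have "?m X (aone (HH H)) = dS H x (%x1 x2. fscale (counit H x1) (dS H y (%y1 y2. fscale (counit H y2) (HHpure H \<phi> x2 y1))))"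
   unfolding X HH_simps HH_mult(2)[OF \<phi> counit_Hdual] by (simp add: ssum_scale[OF s])
  also have "\<dots> = dS H x (%x1 x2. fscale (counit H x1) (HHpure H \<phi> x2 y))"
  proof -
   have "dS H y (%y1 y2. fscale (counit H y2) (HHpure H \<phi> x2 y1)) = HHpure H \<phi> x2 y" for x2
    by (rule dS_counit_right) (intro hlin_intros \<phi>)+
   then show ?thesis by simp
  qed
  also have "\<dots> = X" unfolding X
   by (rule dS_counit_left) (intro hlin_intros \<phi>)+
  finally show ?thesis .
 qed
 fix Y W assume "Y \<in> ?S" "W \<in> ?S"
 then obtain \<psi> z t \<chi> u v where Y: "Y = HHpure H \<psi> z t" and W: "W = HHpure H \<chi> u v"
  and \<psi>: "\<psi> \<in>: Hdual H" and \<chi>: "\<chi> \<in>: Hdual H" by blast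
 define Z where "Z x1 x2 x3 y1 y2 y3 z1 z2 t1 t2 =
  HHpure H (star H (star H \<phi> (x1 \<triangleright> \<psi> \<triangleleft> Sinv y3)) ((x2 * z1) \<triangleright> \<chi> \<triangleleft> Sinv (y2 * t2))) (x3 * (z2 * u)) (y1 * (t1 * v))"
  for x1 x2 x3 y1 y2 y3 z1 z2 t1 t2
 note ds = dual_intros \<phi> \<psi> \<chi>
 have "?m (?m X Y) W = dS H x (%x1 m. dS H y (%n y3. dS H (m * z) (%p q. dS H (n * t) (%r w.
   HHpure H (star H (star H \<phi> (x1 \<triangleright> \<psi> \<triangleleft> Sinv y3)) (p \<triangleright> \<chi> \<triangleleft> Sinv w)) (q * u) (r * v)))))"
  unfolding X Y W HH_mult(2)[OF \<phi> \<psi>]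
  by (simp add: HH_mult_sums HH_mult(2) HHpure_closed ds ssum_closed[OF is_vspace_tensor])
 also have "\<dots> = dS H x (%x1 m. dS H y (%n y3. dS H m (%x2 x3. dS H z (%z1 z2. dS H n (%y1 y2. dS H t (%t1 t2.
   Z x1 x2 x3 y1 y2 y3 z1 z2 t1 t2))))))"
 proof -
  have 1: "dS H (n * t) (%r w. HHpure H (star H f (p \<triangleright> \<chi> \<triangleleft> Sinv w)) q (r * v)) =
   dS H n (%y1 y2. dS H t (%t1 t2. HHpure H (star H f (p \<triangleright> \<chi> \<triangleleft> Sinv (y2 * t2))) q (y1 * t1 * v)))"
   if "f \<in>: Hdual H" for n t f p q
   by (rule dS_mult[OF s]) (intro hlin_intros ds that)+
  note 1 = this[unfolded mult.assoc]
  have 2: "dS H (m * z) (%p q. dS H n (%y1 y2. dS H t (%t1 t2. HHpure H (star H f (p \<triangleright> \<chi> \<triangleleft> Sinv (y2 * t2))) (q * u) (y1 * t1 * v)))) =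
   dS H m (%x2 x3. dS H z (%z1 z2. dS H n (%y1 y2. dS H t (%t1 t2. HHpure H (star H f ((x2 * z1) \<triangleright> \<chi> \<triangleleft> Sinv (y2 * t2))) (x3 * z2 * u) (y1 * t1 * v)))))"
   if "f \<in>: Hdual H" for m n f
   by (rule dS_mult[OF s]) (intro hlin_intros ds that)+
  note 2 = this[unfolded mult.assoc]
  show ?thesis by (simp add: 1 2 ds Z_def mult.assoc)
 qed
 also have "\<dots> = dS H z (%z1 z2. dS H t (%t1 t2. dS H x (%x1 m. dS H m (%x2 x3. dS H y (%n y3. dS H n (%y1 y2.
   Z x1 x2 x3 y1 y2 y3 z1 z2 t1 t2))))))"
 proof -
  have "dS H x (%x1 m. dS H y (%n y3. dS H m (%x2 x3. dS H z (%z1 z2. dS H n (%y1 y2. dS H t (%t1 t2. Z x1 x2 x3 y1 y2 y3 z1 z2 t1 t2)))))) =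
   dS H x (%x1 m. dS H y (%n y3. dS H z (%z1 z2. dS H t (%t1 t2. dS H m (%x2 x3. dS H n (%y1 y2. Z x1 x2 x3 y1 y2 y3 z1 z2 t1 t2))))))"
   by (rule ssum_cong, rule ssum_cong, rule trans[OF ssum_cong[OF ssum_cong[OF ssum_swap]] ssum_swap12])
  also have "\<dots> = dS H z (%z1 z2. dS H t (%t1 t2. dS H x (%x1 m. dS H y (%n y3. dS H m (%x2 x3. dS H n (%y1 y2. Z x1 x2 x3 y1 y2 y3 z1 z2 t1 t2))))))"
   by (rule ssum_swap22)
  also have "\<dots> = dS H z (%z1 z2. dS H t (%t1 t2. dS H x (%x1 m. dS H m (%x2 x3. dS H y (%n y3. dS H n (%y1 y2. Z x1 x2 x3 y1 y2 y3 z1 z2 t1 t2))))))"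
   by (rule ssum_cong, rule ssum_cong, rule ssum_cong, rule ssum_swap)
  finally show ?thesis .
 qed
 also have "\<dots> = dS H z (%z1 z2. dS H t (%t1 t2. dS H x (%m x3. dS H m (%x1 x2. dS H y (%y1 n. dS H n (%y2 y3.
   Z x1 x2 x3 y1 y2 y3 z1 z2 t1 t2))))))"
 proof (rule ssum_cong, rule ssum_cong)
  fix z1 z2 t1 t2
  have "dS H y (%n y3. dS H n (%y1 y2. Z x1 x2 x3 y1 y2 y3 z1 z2 t1 t2)) =
   dS H y (%y1 n. dS H n (%y2 y3. Z x1 x2 x3 y1 y2 y3 z1 z2 t1 t2))" for x1 x2 x3
   unfolding Z_def by (rule dS_coassoc[OF s]) (intro hlin_intros ds)+
  moreover have "dS H x (%x1 m. dS H m (%x2 x3. dS H y (%y1 n. dS H n (%y2 y3. Z x1 x2 x3 y1 y2 y3 z1 z2 t1 t2)))) =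
   dS H x (%m x3. dS H m (%x1 x2. dS H y (%y1 n. dS H n (%y2 y3. Z x1 x2 x3 y1 y2 y3 z1 z2 t1 t2))))"
   unfolding Z_def by (rule dS_coassoc[OF s, symmetric]) (intro hlin_intros ds)+
  ultimately show "dS H x (%x1 m. dS H m (%x2 x3. dS H y (%n y3. dS H n (%y1 y2. Z x1 x2 x3 y1 y2 y3 z1 z2 t1 t2)))) =
   dS H x (%m x3. dS H m (%x1 x2. dS H y (%y1 n. dS H n (%y2 y3. Z x1 x2 x3 y1 y2 y3 z1 z2 t1 t2))))"
   by simp
 qed
 also have "\<dots> = dS H z (%z1 z2. dS H t (%t1 t2. dS H x (%m x3. dS H y (%y1 n.
   HHpure H (star H \<phi> (m \<triangleright> (star H \<psi> (z1 \<triangleright> \<chi> \<triangleleft> Sinv t2)) \<triangleleft> Sinv n)) (x3 * (z2 * u)) (y1 * (t1 * v))))))"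
 proof (rule ssum_cong, rule ssum_cong, rule ssum_cong)
  fix z1 z2 t1 t2 m x3
  \<comment> \<open>The flip here is what lets the factor H with opposite coproduct act on a product
    of linear forms.\<close>
  have si: "dS H (Sinv n) G = dS H n (%y2 y3. G (Sinv y3) (Sinv y2))"
   if "\<And>b. hlin H fscale (%a. G a b)" "\<And>a. hlin H fscale (%b. G a b)" for n and G :: "'h => 'h => 'h => 'k"
   by (rule dS_Si[OF bij s that])
  have "m \<triangleright> (star H \<psi> (z1 \<triangleright> \<chi> \<triangleleft> Sinv t2)) \<triangleleft> Sinv n =
   dS H m (%x1 x2. dS H n (%y2 y3. star H (x1 \<triangleright> \<psi> \<triangleleft> Sinv y3) ((x2 * z1) \<triangleright> \<chi> \<triangleleft> Sinv (y2 * t2))))" for n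
   unfolding star_bimodule[OF \<psi> ract_Hdual[OF lact_Hdual[OF \<chi>]]]
   by (subst si, (intro hlin_intros ds)+) (simp add: lact_lact ract_ract lact_ract Si_mult[OF bij])
  then have "HHpure H (star H \<phi> (m \<triangleright> (star H \<psi> (z1 \<triangleright> \<chi> \<triangleleft> Sinv t2)) \<triangleleft> Sinv n)) (x3 * (z2 * u)) (y1 * (t1 * v)) =
   dS H m (%x1 x2. dS H n (%y2 y3. Z x1 x2 x3 y1 y2 y3 z1 z2 t1 t2))" for n y1
   by (simp add: HHpure_ssum star_ssum ds ssum_closed[OF is_vspace_Hdual] Z_def star_assoc)
  then show "dS H m (%x1 x2. dS H y (%y1 n. dS H n (%y2 y3. Z x1 x2 x3 y1 y2 y3 z1 z2 t1 t2))) =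
   dS H y (%y1 n. HHpure H (star H \<phi> (m \<triangleright> (star H \<psi> (z1 \<triangleright> \<chi> \<triangleleft> Sinv t2)) \<triangleleft> Sinv n)) (x3 * (z2 * u)) (y1 * (t1 * v)))"
   by (simp only:) (rule ssum_swap)
 qed
 also have "\<dots> = ?m X (?m Y W)"
  unfolding X Y W HH_mult(2)[OF \<psi> \<chi>]
  by (simp add: HH_mult_sums HH_mult(2) HHpure_closed ds ssum_closed[OF is_vspace_tensor])
 finally show "?m (?m X Y) W = ?m X (?m Y W)" .
qed

end

section \<open>The graph algebra of the handle\<close>

lemma words_11: "w \<in> words A B 1 1 \<longleftrightarrow> (\<exists>a b. w = ([a], [b]) \<and> a \<in>: A \<and> b \<in>: B)"
 by (cases w) (auto simp: words_def One_nat_def length_Suc_conv)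

lemma multilinear_11:
 assumes "bilinear_on A B s E"
 shows "multilinear A B 1 1 s (%(as, bs). E (hd as) (hd bs))"
 unfolding multilinear_iff
proof (intro allI impI)
 fix as bs assume "(as, bs) \<in> words A B 1 1"
 then obtain a b where "as = [a]" "bs = [b]" "a \<in>: A" "b \<in>: B" by (auto simp: words_11)
 then show "(\<forall>i<1. linear_on A s (%x. case (as[i := x], bs) of (as, bs) => E (hd as) (hd bs))) \<and>
  (\<forall>i<1. linear_on B s (%x. case (as, bs[i := x]) of (as, bs) => E (hd as) (hd bs)))"
  using bilinear_onD[OF assms] by simp
qed

lemma pair_closed: "a \<in>: A ==> b \<in>: B ==> pair A B a b \<in>: tensor A B 1 1"
 unfolding pair_def by (rule pure_closed) (simp add: words_11)

lemma pair_span: "vcarrier (tensor A B 1 1) =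
 module.span (vscale (tensor A B 1 1)) {pair A B a b |a b. a \<in>: A \<and> b \<in>: B}"
proof -
 have "pure A B 1 1 ` words A B 1 1 = {pair A B a b |a b. a \<in>: A \<and> b \<in>: B}"
  by (auto simp: pair_def words_11 image_iff) blast
 then show ?thesis by (simp add: vcarrier_tensor_span)
qed

lemma bilinear_pair:
 assumes "is_vspace A" "is_vspace B"
 shows "bilinear_on A B fscale (pair A B)"
proof (rule bilinear_onI)
 note m = multilinear_pure[of A B 1 1, unfolded multilinear_iff, rule_format]
 fix a assume "a \<in>: A"
 then have "([a], [0]) \<in> words A B 1 1" using assms by (simp add: words_11 is_vspace_zero)
 from m[OF this, THEN conjunct2, rule_format, of 0] show "linear_on B fscale (pair A B a)"
  by (simp add: pair_def[abs_def])
next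
 note m = multilinear_pure[of A B 1 1, unfolded multilinear_iff, rule_format]
 fix b assume "b \<in>: B"
 then have "([0], [b]) \<in> words A B 1 1" using assms by (simp add: words_11 is_vspace_zero)
 from m[OF this, THEN conjunct1, rule_format, of 0] show "linear_on A fscale (%a. pair A B a b)"
  by (simp add: pair_def)
qed

lemma tlift2_cong:
 "(\<And>a b. a \<in>: A ==> b \<in>: B ==> E a b = E' a b) ==> tlift2 A B s E = tlift2 A B s E'"
 unfolding tlift2_def by (rule tlift_cong) (auto simp: words_11)

lemma tlift2_linear:
 "vector_space s ==> bilinear_on A B s E ==> linear_on (tensor A B 1 1) s (tlift2 A B s E)"
 unfolding tlift2_def by (rule tlift_linear[OF _ multilinear_11])

lemma tlift2_pair:
 "vector_space s ==> bilinear_on A B s E ==> a \<in>: A ==> b \<in>: B ==>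
  tlift2 A B s E (pair A B a b) = E a b"
 unfolding tlift2_def pair_def by (subst tlift_pure[OF _ multilinear_11]) (auto simp: words_11)

lemma tlift2_tlift2:
 assumes s: "vector_space (s :: 'k::field => 'u::ab_group_add => 'u)" and V: "is_vspace A" "is_vspace B"
  and 1: "\<And>a b. a \<in>: A ==> b \<in>: B ==> bilinear_on A' B' s (E a b)"
  and 2: "\<And>a' b'. a' \<in>: A' ==> b' \<in>: B' ==> bilinear_on A B s (%a b. E a b a' b')"
 shows "bilinear_on (tensor A B 1 1) (tensor A' B' 1 1) s
   (%X Y. tlift2 A B s (%a b. tlift2 A' B' s (E a b) Y) X)"
  and "a \<in>: A ==> b \<in>: B ==> a' \<in>: A' ==> b' \<in>: B' ==>
   tlift2 A B s (%a b. tlift2 A' B' s (E a b) (pair A' B' a' b')) (pair A B a b) = E a b a' b'"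
proof -
 define F where "F = (%(as, bs) (as', bs'). E (hd as) (hd bs) (hd as') (hd bs'))"
 have eq: "tlift2 A B s (%a b. tlift2 A' B' s (E a b) Y) X =
  tlift A B 1 1 s (%w. tlift A' B' 1 1 s (F w) Y) X" for X Y
  by (simp add: tlift2_def F_def case_prod_unfold)
 have m2: "multilinear A' B' 1 1 s (F w)" if w0: "w \<in> words A B 1 1" for w
 proof -
  obtain a b where "w = ([a], [b])" "a \<in>: A" "b \<in>: B" using w0 by (auto simp: words_11)
  then show ?thesis using multilinear_11[OF 1] by (simp add: F_def)
 qed
 have m1: "multilinear A B 1 1 s (%w. F w w')" if w0: "w' \<in> words A' B' 1 1" for w'
 proof -
  obtain a b where "w' = ([a], [b])" "a \<in>: A'" "b \<in>: B'" using w0 by (auto simp: words_11)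
  then show ?thesis using multilinear_11[OF 2] by (simp add: F_def case_prod_unfold)
 qed
 show "bilinear_on (tensor A B 1 1) (tensor A' B' 1 1) s
   (%X Y. tlift2 A B s (%a b. tlift2 A' B' s (E a b) Y) X)"
  unfolding eq by (rule tlift_tlift(1)[OF s m1 m2 V])
 assume "a \<in>: A" "b \<in>: B" "a' \<in>: A'" "b' \<in>: B'"
 then have "([a], [b]) \<in> words A B 1 1" "([a'], [b']) \<in> words A' B' 1 1" by (auto simp: words_11)
 from tlift_tlift(2)[OF s m1 m2 V this]
 show "tlift2 A B s (%a b. tlift2 A' B' s (E a b) (pair A' B' a' b')) (pair A B a b) = E a b a' b'"
  unfolding eq pair_def by (simp add: F_def)
qed

lemma ssum_rot4:
 "ssum H t (%a1 a2. ssum H u (%b1 b2. ssum H v (%c1 c2. ssum H w (%d1 d2. F a1 a2 b1 b2 c1 c2 d1 d2)))) =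
  ssum H u (%b1 b2. ssum H v (%c1 c2. ssum H w (%d1 d2. ssum H t (%a1 a2. F a1 a2 b1 b2 c1 c2 d1 d2))))"
 by (rule trans[OF ssum_swap12 ssum_cong[OF ssum_cong[OF ssum_swap]]])

abbreviation "pr H \<equiv> pair (Hdual H) (Hdual H)"

lemma L10_simps [simp]:
 "vscale (L10 H) = fscale" "vcarrier (L10 H) = vcarrier (tensor (Hdual H) (Hdual H) 1 1)"
 "aone (L10 H) = pr H (counit H) (counit H)"
 by (simp_all add: L10_def)

lemma is_vspace_L10: "is_vspace (L10 H)"
 using is_vspace_tensor[of "Hdual H" "Hdual H" 1 1] by (simp add: is_vspace_def)

lemma L10_span: "vcarrier (L10 H) =
 module.span (vscale (L10 H)) {pr H a b |a b. a \<in>: Hdual H \<and> b \<in>: Hdual H}"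
 using pair_span[of "Hdual H" "Hdual H"] by simp

lemma pr_closed: "a \<in>: Hdual H ==> b \<in>: Hdual H ==> pr H a b \<in>: L10 H"
 by (simp add: pair_closed)

lemmas bilinear_pr = bilinear_pair[OF is_vspace_Hdual is_vspace_Hdual]
lemmas hlin_pr [hlin_intros] =
 hlin_via[OF bilinear_onD(1)[OF bilinear_pr]] hlin_via[OF bilinear_onD(2)[OF bilinear_pr]]

lemma linear_on_L10 [simp]: "linear_on (L10 H) s L \<longleftrightarrow> linear_on (tensor (Hdual H) (Hdual H) 1 1) s L"
 by (simp add: linear_on_def)

context quasitriangular_bij
begin

named_theorems Dl_intros
lemmas [Dl_intros] =
 Dl_via[OF bilinear_onD(1)[OF bilinear_pr]] Dl_via[OF bilinear_onD(2)[OF bilinear_pr]]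
 Dl_via[OF bilinear_onD(1)[OF bilinear_L01]] Dl_via[OF bilinear_onD(2)[OF bilinear_L01]]
 Dl_via[OF linear_on_ract_lact(1)] Dl_via[OF linear_on_ract_lact(2)] Dl_via[OF linear_coad01]
 linear_on_ssum_fun[OF vector_space_fscale]

lemma Dl_id [Dl_intros]: "Dl H (%\<phi>. \<phi>)" by (simp add: linear_on_def)

lemma L10_mult:
 shows "bilinear_on (L10 H) (L10 H) fscale (amult (L10 H))"
  and "\<beta> \<in>: Hdual H ==> \<alpha> \<in>: Hdual H ==> \<beta>' \<in>: Hdual H ==> \<alpha>' \<in>: Hdual H ==>
   amult (L10 H) (pr H \<beta> \<alpha>) (pr H \<beta>' \<alpha>') =
   rS H (%a1 a2. rS H (%b1 b2. rS H (%c1 c2. rS H (%d1 d2.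
    pr H (amult (L01 H) \<beta> (d2 * c1 \<triangleright> \<beta>' \<triangleleft> a1 * b1))
     (amult (L01 H) (c2 * antipode H a2 \<triangleright> \<alpha> \<triangleleft> b2 * d1) \<alpha>')))))"
proof -
 let ?S = "antipode H"
 define X where "X = (%\<beta> \<alpha> \<beta>' \<alpha>' a1 a2 b1 b2 c1 c2 d1 d2. pr H (amult (L01 H) \<beta> (d2 * c1 \<triangleright> \<beta>' \<triangleleft> a1 * b1))
     (amult (L01 H) (c2 * ?S a2 \<triangleright> \<alpha> \<triangleleft> b2 * d1) \<alpha>'))"
 define E where "E = (%\<beta> \<alpha> \<beta>' \<alpha>'. rS H (%a1 a2. rS H (%b1 b2. rS H (%c1 c2. rS H (%d1 d2. X \<beta> \<alpha> \<beta>' \<alpha>' a1 a2 b1 b2 c1 c2 d1 d2)))))"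
 define E' where "E' = (%\<beta> \<alpha> \<beta>' \<alpha>'. sumR H fscale (%a1 a2. sumR H fscale (%b1 b2. sumR H fscale (%c1 c2. sumR H fscale (%d1 d2. X \<beta> \<alpha> \<beta>' \<alpha>' a1 a2 b1 b2 c1 c2 d1 d2)))))"
 let ?D = "vcarrier (Hdual H)"
 have EE: "E' \<beta> \<alpha> \<beta>' \<alpha>' = E \<beta> \<alpha> \<beta>' \<alpha>'" if d: "\<beta> \<in> ?D" "\<alpha> \<in> ?D" "\<beta>' \<in> ?D" "\<alpha>' \<in> ?D" for \<beta> \<alpha> \<beta>' \<alpha>'
 proof -
  have 1: "sumR H fscale (%d1 d2. X \<beta> \<alpha> \<beta>' \<alpha>' a1 a2 b1 b2 c1 c2 d1 d2) = rS H (%d1 d2. X \<beta> \<alpha> \<beta>' \<alpha>' a1 a2 b1 b2 c1 c2 d1 d2)"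
   for a1 a2 b1 b2 c1 c2 unfolding X_def by (rule sw_rmat) (intro hlin_intros dual_intros d)+
  have 2: "sumR H fscale (%c1 c2. rS H (%d1 d2. X \<beta> \<alpha> \<beta>' \<alpha>' a1 a2 b1 b2 c1 c2 d1 d2)) =
   rS H (%c1 c2. rS H (%d1 d2. X \<beta> \<alpha> \<beta>' \<alpha>' a1 a2 b1 b2 c1 c2 d1 d2))"
   for a1 a2 b1 b2 unfolding X_def by (rule sw_rmat) (intro hlin_intros dual_intros d)+
  have 3: "sumR H fscale (%b1 b2. rS H (%c1 c2. rS H (%d1 d2. X \<beta> \<alpha> \<beta>' \<alpha>' a1 a2 b1 b2 c1 c2 d1 d2))) =
   rS H (%b1 b2. rS H (%c1 c2. rS H (%d1 d2. X \<beta> \<alpha> \<beta>' \<alpha>' a1 a2 b1 b2 c1 c2 d1 d2)))"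
   for a1 a2 unfolding X_def by (rule sw_rmat) (intro hlin_intros dual_intros d)+
  show ?thesis unfolding E_def E'_def 1 2 3 unfolding X_def by (rule sw_rmat) (intro hlin_intros dual_intros d)+
 qed
 have mult: "amult (L10 H) = (%Y Z. tlift2 (Hdual H) (Hdual H) fscale (%\<beta> \<alpha>. tlift2 (Hdual H) (Hdual H) fscale (E \<beta> \<alpha>) Z) Y)"
 proof (intro ext)
  fix Y Z :: "('k, 'h) L10_elt" and f
  have "amult (L10 H) Y Z = tlift2 (Hdual H) (Hdual H) fscale (%\<beta> \<alpha>. tlift2 (Hdual H) (Hdual H) fscale (E' \<beta> \<alpha>) Z) Y"
   by (simp add: L10_def E'_def X_def)
  also have "\<dots> = tlift2 (Hdual H) (Hdual H) fscale (%\<beta> \<alpha>. tlift2 (Hdual H) (Hdual H) fscale (E \<beta> \<alpha>) Z) Y"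
   by (rule tlift2_cong[THEN fun_cong], rule tlift2_cong[THEN fun_cong], rule EE)
  finally show "amult (L10 H) Y Z f = tlift2 (Hdual H) (Hdual H) fscale (%\<beta> \<alpha>. tlift2 (Hdual H) (Hdual H) fscale (E \<beta> \<alpha>) Z) Y f"
   by simp
 qed
 have b1: "bilinear_on (Hdual H) (Hdual H) fscale (E \<beta> \<alpha>)" if "\<beta> \<in> ?D" "\<alpha> \<in> ?D" for \<beta> \<alpha>
  unfolding E_def X_def by (rule bilinear_onI) (intro Dl_intros dual_intros that; assumption)+
 have b2: "bilinear_on (Hdual H) (Hdual H) fscale (%\<beta> \<alpha>. E \<beta> \<alpha> \<beta>' \<alpha>')" if "\<beta>' \<in> ?D" "\<alpha>' \<in> ?D" for \<beta>' \<alpha>'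
  unfolding E_def X_def by (rule bilinear_onI) (intro Dl_intros dual_intros that; assumption)+
 show "bilinear_on (L10 H) (L10 H) fscale (amult (L10 H))"
  unfolding mult using tlift2_tlift2(1)[OF vector_space_fscale is_vspace_Hdual is_vspace_Hdual b1 b2]
  by (simp add: bilinear_on_def)
 assume "\<beta> \<in> ?D" "\<alpha> \<in> ?D" "\<beta>' \<in> ?D" "\<alpha>' \<in> ?D"
 from tlift2_tlift2(2)[OF vector_space_fscale is_vspace_Hdual is_vspace_Hdual b1 b2 this]
 show "amult (L10 H) (pr H \<beta> \<alpha>) (pr H \<beta>' \<alpha>') =
   rS H (%a1 a2. rS H (%b1 b2. rS H (%c1 c2. rS H (%d1 d2.
    pr H (amult (L01 H) \<beta> (d2 * c1 \<triangleright> \<beta>' \<triangleleft> a1 * b1))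
     (amult (L01 H) (c2 * antipode H a2 \<triangleright> \<alpha> \<triangleleft> b2 * d1) \<alpha>')))))"
  unfolding mult by (simp add: E_def X_def)
qed

lemma L10_bilinear_eq:
 assumes "vector_space s" "bilinear_on (L10 H) (L10 H) s F" "bilinear_on (L10 H) (L10 H) s G"
  "\<And>\<beta> \<alpha> \<beta>' \<alpha>'. \<beta> \<in>: Hdual H ==> \<alpha> \<in>: Hdual H ==> \<beta>' \<in>: Hdual H ==>
   \<alpha>' \<in>: Hdual H ==> F (pr H \<beta> \<alpha>) (pr H \<beta>' \<alpha>') = G (pr H \<beta> \<alpha>) (pr H \<beta>' \<alpha>')"
  "X \<in>: L10 H" "Y \<in>: L10 H"
 shows "F X Y = G X Y"
 by (rule span_bilinear_eq[OF is_vspace_L10 L10_span is_vspace_L10 L10_span assms(1-3) _ assms(5,6)])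
  (use assms(4) in blast)

lemma L10_linear_eq:
 assumes "vector_space s" "linear_on (L10 H) s F" "linear_on (L10 H) s G"
  "\<And>\<beta> \<alpha>. \<beta> \<in>: Hdual H ==> \<alpha> \<in>: Hdual H ==> F (pr H \<beta> \<alpha>) = G (pr H \<beta> \<alpha>)"
  "X \<in>: L10 H"
 shows "F X = G X"
 by (rule span_linear_eq[OF is_vspace_L10 L10_span assms(1-3) _ assms(5)]) (use assms(4) in blast)

lemma is_alg_L10: "is_alg (L10 H)"
 unfolding is_alg_def
proof (intro conjI ballI is_vspace_L10)
 show "bilinear_on (L10 H) (L10 H) (vscale (L10 H)) (amult (L10 H))" using L10_mult(1) by simp
 show "aone (L10 H) \<in>: L10 H" by (simp add: pair_closed counit_Hdual)
 fix X Y assume X: "X \<in>: L10 H" and Y: "Y \<in>: L10 H"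
 show "amult (L10 H) X Y \<in>: L10 H"
 proof (rule span_closed[OF is_vspace_L10 L10_span _ is_vspace_L10 _ X])
  show "linear_on (L10 H) (vscale (L10 H)) (%X. amult (L10 H) X Y)"
   using bilinear_onD(2)[OF L10_mult(1) Y] by simp
  fix X assume "X \<in> {pr H a b |a b. a \<in>: Hdual H \<and> b \<in>: Hdual H}"
  then obtain \<beta> \<alpha> where X: "X = pr H \<beta> \<alpha>" "\<beta> \<in>: Hdual H" "\<alpha> \<in>: Hdual H" by blast
  show "amult (L10 H) X Y \<in>: L10 H"
  proof (rule span_closed[OF is_vspace_L10 L10_span _ is_vspace_L10 _ Y])
   show "linear_on (L10 H) (vscale (L10 H)) (amult (L10 H) X)"
    using bilinear_onD(1)[OF L10_mult(1), of X] X by (simp add: pair_closed)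
   fix Y assume "Y \<in> {pr H a b |a b. a \<in>: Hdual H \<and> b \<in>: Hdual H}"
   then show "amult (L10 H) X Y \<in>: L10 H"
    using X by (auto simp: L10_mult(2) simp del: L10_simps(2)
     intro!: ssum_closed is_vspace_L10 pr_closed dual_intros)
  qed
 qed
qed

lemma L10_closed: "X \<in>: L10 H ==> Y \<in>: L10 H ==> amult (L10 H) X Y \<in>: L10 H"
 by (rule is_alg_closed[OF is_alg_L10])

lemma coad10_lift:
 shows "linear_on (L10 H) fscale (coad10 H h)"
  and "\<beta> \<in>: Hdual H ==> \<alpha> \<in>: Hdual H ==>
   coad10 H h (pr H \<beta> \<alpha>) = dS H h (%h1 h2. pr H (coad01 H h1 \<beta>) (coad01 H h2 \<alpha>))"
proof -
 let ?E = "%\<beta> \<alpha>. dS H h (%h1 h2. pr H (coad01 H h1 \<beta>) (coad01 H h2 \<alpha>))"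
 have eq: "coad10 H h = tlift2 (Hdual H) (Hdual H) fscale ?E"
  unfolding coad10_def by (intro tlift2_cong sw_comul) (intro hlin_intros dual_intros; assumption)+
 have b: "bilinear_on (Hdual H) (Hdual H) fscale ?E"
  by (rule bilinear_onI) (intro Dl_intros dual_intros; assumption)+
 show "linear_on (L10 H) fscale (coad10 H h)"
  unfolding eq using tlift2_linear[OF vector_space_fscale b] by simp
 show "\<beta> \<in>: Hdual H ==> \<alpha> \<in>: Hdual H ==>
   coad10 H h (pr H \<beta> \<alpha>) = dS H h (%h1 h2. pr H (coad01 H h1 \<beta>) (coad01 H h2 \<alpha>))"
  unfolding eq by (rule tlift2_pair[OF vector_space_fscale b])
qed

lemma coad10_closed: "X \<in>: L10 H ==> coad10 H h X \<in>: L10 H"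
proof (erule span_closed[OF is_vspace_L10 L10_span _ is_vspace_L10, rotated 2])
 show "linear_on (L10 H) (vscale (L10 H)) (coad10 H h)" using coad10_lift(1) by simp
 fix X assume "X \<in> {pr H a b |a b. a \<in>: Hdual H \<and> b \<in>: Hdual H}"
 then show "coad10 H h X \<in>: L10 H"
  by (auto simp: coad10_lift(2) simp del: L10_simps(2) intro!: ssum_closed is_vspace_L10 pr_closed dual_intros)
qed

lemma bilinear_coad10: "bilinear_on (Halg H) (L10 H) fscale (coad10 H)"
proof -
 have "bilinear_on (Halg H) (tensor (Hdual H) (Hdual H) 1 1) fscale (coad10 H)"
 proof (rule linear_on_tensor_param[OF vector_space_fscale is_vspace_Halg])
  show "linear_on (tensor (Hdual H) (Hdual H) 1 1) fscale (coad10 H h)" for h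
   using coad10_lift(1) by simp
  fix w assume "w \<in> words (Hdual H) (Hdual H) 1 1"
  then obtain \<beta> \<alpha> where w: "w = ([\<beta>], [\<alpha>])" "\<beta> \<in>: Hdual H" "\<alpha> \<in>: Hdual H" by (auto simp: words_11)
  have "hlin H fscale (%h. dS H h (%h1 h2. pr H (coad01 H h1 \<beta>) (coad01 H h2 \<alpha>)))"
   by (intro hlin_intros dual_intros w)
  then show "linear_on (Halg H) fscale (%h. coad10 H h (pure (Hdual H) (Hdual H) 1 1 w))"
   using coad10_lift(2)[OF w(2,3)] by (simp add: hlin_linear_on w(1) pair_def)
 qed
 then show ?thesis by (simp add: bilinear_on_def)
qed

lemma hlin_coad10: "X \<in>: L10 H ==> hlin H fscale (%h. coad10 H h X)"
 using bilinear_onD(2)[OF bilinear_coad10] by (simp add: hlin_linear_on)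

lemma coad10_one: "coad10 H h (aone (L10 H)) = fscale (counit H h) (aone (L10 H))"
proof -
 have dd: "fscale d (counit H) \<in>: Hdual H" for d
  using is_vspace_scale[OF is_vspace_Hdual counit_Hdual, of d] by simp
 have "pr H (fscale c (counit H)) (fscale d (counit H)) = fscale c (fscale d (pr H (counit H) (counit H)))" for c d
  using linear_on_scale[OF bilinear_onD(1)[OF bilinear_pr counit_Hdual] counit_Hdual, of d]
   linear_on_scale[OF bilinear_onD(2)[OF bilinear_pr dd] counit_Hdual, of c d] by simp
 then have "coad10 H h (aone (L10 H)) =
   dS H h (%h1 h2. fscale (counit H h1) (fscale (counit H h2) (pr H (counit H) (counit H))))"
  by (simp add: coad10_lift(2) counit_Hdual coad01_one)
 also have "\<dots> = fscale (counit H h) (pr H (counit H) (counit H))"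
  by (rule dS_counit_left) (intro hlin_intros linear_hlin[OF counit_linear])
 finally show ?thesis by simp
qed

lemma coad10_unit: "X \<in>: L10 H ==> coad10 H 1 X = X"
proof (rule L10_linear_eq[OF vector_space_fscale coad10_lift(1)])
 show "linear_on (L10 H) fscale (%X. X)" by (simp add: linear_on_def)
 fix \<beta> \<alpha> assume d: "\<beta> \<in>: Hdual H" "\<alpha> \<in>: Hdual H"
 have "coad10 H 1 (pr H \<beta> \<alpha>) = pr H (coad01 H 1 \<beta>) (coad01 H 1 \<alpha>)"
  unfolding coad10_lift(2)[OF d] by (rule dS_one[OF vector_space_fscale]) (intro hlin_intros dual_intros d)+
 then show "coad10 H 1 (pr H \<beta> \<alpha>) = pr H \<beta> \<alpha>" by (simp add: coad01_unit d)
qed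

lemma coad10_coad10:
 assumes "X \<in>: L10 H"
 shows "coad10 H k (coad10 H h X) = coad10 H (h * k) X"
proof (rule L10_linear_eq[OF vector_space_fscale _ coad10_lift(1) _ assms])
 show "linear_on (L10 H) fscale (%X. coad10 H k (coad10 H h X))"
  by (rule linear_on_via[OF coad10_lift(1), of "L10 H" "coad10 H h"])
   (use coad10_lift(1)[of h] coad10_closed in simp_all)
 fix \<beta> \<alpha> assume d: "\<beta> \<in>: Hdual H" "\<alpha> \<in>: Hdual H"
 have "coad10 H k (coad10 H h (pr H \<beta> \<alpha>)) =
  dS H h (%h1 h2. dS H k (%k1 k2. pr H (coad01 H (h1 * k1) \<beta>) (coad01 H (h2 * k2) \<alpha>)))"
  unfolding coad10_lift(2)[OF d]
  by (subst linear_on_ssum[OF is_vspace_L10 coad10_lift(1) pr_closed])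
   (simp_all add: coad01_Hdual d coad10_lift(2) coad01_coad01)
 also have "\<dots> = coad10 H (h * k) (pr H \<beta> \<alpha>)"
  unfolding coad10_lift(2)[OF d] by (rule dS_mult[OF vector_space_fscale, symmetric]) (intro hlin_intros dual_intros d)+
 finally show "coad10 H k (coad10 H h (pr H \<beta> \<alpha>)) = coad10 H (h * k) (pr H \<beta> \<alpha>)" .
qed

text \<open>Analogue of \<open>coad_exchange\<close> for the four copies of R in the product of
  \<open>L10\<close>. Each is moved past the Sweedler components by its own rule: \<open>a\<close>
  and \<open>b\<close> by quasi-cocommutativity, \<open>c\<close> by its antipode version, and
  \<open>d\<close>, with an antipode in one leg only, by \<open>rS_slide\<close>.\<close>

lemma handle_exchange:
 assumes s: "vector_space s" and G: "\<And>q r t. hlin H s (%p. G p q r t)" "\<And>p r t. hlin H s (%q. G p q r t)"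
  "\<And>p q t. hlin H s (%r. G p q r t)" "\<And>p q r. hlin H s (%t. G p q r t)"
 shows "dS H h (%u v. dS H u (%p q. dS H v (%r t. rS H (%a1 a2. rS H (%b1 b2. rS H (%c1 c2. rS H (%d1 d2.
   G (r * (a1 * b1)) (d2 * c1 * antipode H t) (p * (b2 * d1)) (c2 * antipode H a2 * antipode H q)))))))) =
  dS H h (%u v. dS H u (%p q. dS H v (%r t. rS H (%a1 a2. rS H (%b1 b2. rS H (%c1 c2. rS H (%d1 d2.
   G (a1 * b1 * p) (antipode H q * (d2 * c1)) (b2 * d1 * r) (antipode H t * (c2 * antipode H a2)))))))))"
  (is "?lhs = ?rhs")
proof -
 let ?S = "antipode H"
 note G' = hlin_comp[OF G(1)] hlin_comp[OF G(2)] hlin_comp[OF G(3)] hlin_comp[OF G(4)] s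
 have "?lhs = dS H h (%p w. dS H w (%m t. dS H m (%q r. rS H (%a1 a2. rS H (%b1 b2. rS H (%c1 c2. rS H (%d1 d2.
   G (r * a1 * b1) (d2 * c1 * ?S t) (p * b2 * d1) (c2 * ?S (q * a2)))))))))"
  unfolding antipode_mult mult.assoc by (rule dS4_middle[OF s]) (intro hlin_intros G')+
 also have "\<dots> = dS H h (%p w. dS H w (%m t. dS H m (%q r. rS H (%a1 a2. rS H (%b1 b2. rS H (%c1 c2. rS H (%d1 d2.
   G (a1 * q * b1) (d2 * c1 * ?S t) (p * b2 * d1) (c2 * ?S (a2 * r)))))))))"
  by (rule ssum_cong, rule ssum_cong, rule rS_comul[OF s, of "%x y. rS H (%b1 b2. rS H (%c1 c2. rS H (%d1 d2.
   G (x * b1) (d2 * c1 * ?S t) (p * b2 * d1) (c2 * ?S y))))" for p t, symmetric])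
   (intro hlin_intros G')+
 also have "\<dots> = dS H h (%u v. dS H u (%p q. dS H v (%r t. rS H (%a1 a2. rS H (%b1 b2. rS H (%c1 c2. rS H (%d1 d2.
   G (a1 * (q * b1)) (d2 * c1 * ?S t) (p * b2 * d1) (c2 * ?S r * ?S a2))))))))"
  unfolding antipode_mult mult.assoc by (rule dS4_middle[OF s, symmetric]) (intro hlin_intros G')+
 also have "\<dots> = dS H h (%u v. dS H u (%p q. dS H v (%r t. rS H (%b1 b2. rS H (%c1 c2. rS H (%d1 d2. rS H (%a1 a2.
   G (a1 * (q * b1)) (d2 * c1 * ?S t) (p * b2 * d1) (c2 * ?S r * ?S a2))))))))"
  by (rule ssum_cong, rule ssum_cong, rule ssum_cong, rule ssum_rot4)
 also have "\<dots> = dS H h (%u v. dS H u (%p q. rS H (%b1 b2. dS H v (%r t. rS H (%c1 c2. rS H (%d1 d2. rS H (%a1 a2.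
   G (a1 * (q * b1)) (d2 * c1 * ?S t) (p * b2 * d1) (c2 * ?S r * ?S a2))))))))"
  by (rule ssum_cong, rule ssum_cong, rule ssum_swap)
 also have "\<dots> = dS H h (%u v. dS H u (%p q. rS H (%b1 b2. dS H v (%r t. rS H (%c1 c2. rS H (%d1 d2. rS H (%a1 a2.
   G (a1 * (b1 * p)) (d2 * c1 * ?S t) (b2 * q * d1) (c2 * ?S r * ?S a2))))))))"
  by (rule ssum_cong, rule rS_comul[OF s, of "%x y. dS H v (%r t. rS H (%c1 c2. rS H (%d1 d2. rS H (%a1 a2.
   G (a1 * x) (d2 * c1 * ?S t) (y * d1) (c2 * ?S r * ?S a2)))))" for v, symmetric])
   (intro hlin_intros G')+
 also have "\<dots> = dS H h (%u v. dS H u (%p q. dS H v (%r t. rS H (%b1 b2. rS H (%c1 c2. rS H (%d1 d2. rS H (%a1 a2.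
   G (a1 * (b1 * p)) (d2 * (c1 * ?S t)) (b2 * q * d1) (c2 * ?S r * ?S a2))))))))"
  unfolding mult.assoc by (rule ssum_cong, rule ssum_cong, rule ssum_swap)
 also have "\<dots> = dS H h (%u v. dS H u (%p q. dS H v (%r t. rS H (%c1 c2. rS H (%d1 d2. rS H (%a1 a2. rS H (%b1 b2.
   G (a1 * (b1 * p)) (d2 * (c1 * ?S t)) (b2 * q * d1) (c2 * ?S r * ?S a2))))))))"
  by (rule ssum_cong, rule ssum_cong, rule ssum_cong, rule ssum_rot4)
 also have "\<dots> = dS H h (%u v. dS H u (%p q. dS H v (%r t. rS H (%c1 c2. rS H (%d1 d2. rS H (%a1 a2. rS H (%b1 b2.
   G (a1 * (b1 * p)) (d2 * (?S r * c1)) (b2 * q * d1) (?S t * c2 * ?S a2))))))))"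
  by (rule ssum_cong, rule ssum_cong, rule rS_comul_antipode[OF s, of "%x y. rS H (%d1 d2. rS H (%a1 a2. rS H (%b1 b2.
   G (a1 * (b1 * p)) (d2 * x) (b2 * q * d1) (y * ?S a2))))" for p q])
   (intro hlin_intros G')+
 also have "\<dots> = dS H h (%u v. dS H u (%p q. dS H v (%r t. rS H (%d1 d2. rS H (%a1 a2. rS H (%b1 b2. rS H (%c1 c2.
   G (a1 * (b1 * p)) (d2 * ?S r * c1) (b2 * (q * d1)) (?S t * c2 * ?S a2))))))))"
  unfolding mult.assoc by (rule ssum_cong, rule ssum_cong, rule ssum_cong, rule ssum_rot4)
 also have "\<dots> = dS H h (%p w. dS H w (%m t. dS H m (%q r. rS H (%d1 d2. rS H (%a1 a2. rS H (%b1 b2. rS H (%c1 c2.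
   G (a1 * (b1 * p)) (d2 * ?S r * c1) (b2 * (q * d1)) (?S t * c2 * ?S a2))))))))"
  by (rule dS4_middle[OF s]) (intro hlin_intros G')+
 also have "\<dots> = dS H h (%p w. dS H w (%m t. dS H m (%q r. rS H (%d1 d2. rS H (%a1 a2. rS H (%b1 b2. rS H (%c1 c2.
   G (a1 * (b1 * p)) (?S q * d2 * c1) (b2 * (d1 * r)) (?S t * c2 * ?S a2))))))))"
  by (rule ssum_cong, rule ssum_cong, rule rS_slide[OF s, of "%x y. rS H (%a1 a2. rS H (%b1 b2. rS H (%c1 c2.
   G (a1 * (b1 * p)) (x * c1) (b2 * y) (?S t * c2 * ?S a2))))" for p t])
   (intro hlin_intros G')+
 also have "\<dots> = dS H h (%u v. dS H u (%p q. dS H v (%r t. rS H (%d1 d2. rS H (%a1 a2. rS H (%b1 b2. rS H (%c1 c2.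
   G (a1 * (b1 * p)) (?S q * d2 * c1) (b2 * (d1 * r)) (?S t * c2 * ?S a2))))))))"
  by (rule dS4_middle[OF s, symmetric]) (intro hlin_intros G')+
 also have "\<dots> = ?rhs"
  unfolding mult.assoc by (rule ssum_cong, rule ssum_cong, rule ssum_cong, rule ssum_rot4)
 finally show ?thesis .
qed

text \<open>The action is distributed over the four linear forms. The components acting on \<beta>
  and on \<alpha>' are already in place; those acting on \<beta>' and \<alpha> are interchanged on
  the two sides, and \<open>handle_exchange\<close> accounts for that.\<close>

lemma coad10_mult:
 assumes "X \<in>: L10 H" "Y \<in>: L10 H"
 shows "coad10 H h (amult (L10 H) X Y) = dS H h (%u v. amult (L10 H) (coad10 H u X) (coad10 H v Y))"
proof (rule L10_bilinear_eq[OF vector_space_fscale _ _ _ assms])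
 let ?S = "antipode H"
 have c: "linear_on (L10 H) (vscale (L10 H)) (coad10 H h)" for h using coad10_lift(1) by simp
 have m: "X \<in>: L10 H ==> linear_on (L10 H) (vscale (L10 H)) (amult (L10 H) X)"
  "X \<in>: L10 H ==> linear_on (L10 H) (vscale (L10 H)) (%Y. amult (L10 H) Y X)" for X
  using bilinear_onD[OF L10_mult(1)] by simp_all
 show "bilinear_on (L10 H) (L10 H) fscale (%X Y. coad10 H h (amult (L10 H) X Y))"
  by (intro bilinear_onI linear_on_via[OF coad10_lift(1)] m L10_closed; assumption)
 show "bilinear_on (L10 H) (L10 H) fscale (%X Y. dS H h (%u v. amult (L10 H) (coad10 H u X) (coad10 H v Y)))"
  by (intro bilinear_onI linear_on_ssum_fun vector_space_fscale
    linear_on_via[OF bilinear_onD(1)[OF L10_mult(1)] c] linear_on_via[OF bilinear_onD(2)[OF L10_mult(1)] c]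
    coad10_closed; assumption)
 fix \<beta> \<alpha> \<beta>' \<alpha>'
 assume d: "\<beta> \<in>: Hdual H" "\<alpha> \<in>: Hdual H" "\<beta>' \<in>: Hdual H" "\<alpha>' \<in>: Hdual H"
 note s = vector_space_fscale
 \<comment> \<open>\<open>k1\<close> and \<open>k4\<close> belong to the outer forms \<beta> and
   \<alpha>'. The remaining arguments are the elements acting on \<beta>' and on \<alpha>, which are
   those met by the four R-matrices.\<close>
 define K where "K k1 k4 l' r' l r = pr H (amult (L01 H) (coad01 H k1 \<beta>) (r' \<triangleright> \<beta>' \<triangleleft> l'))
   (amult (L01 H) (r \<triangleright> \<alpha> \<triangleleft> l) (coad01 H k4 \<alpha>'))" for k1 k4 l' r' l r
 have act: "w \<triangleright> coad01 H k \<phi> \<triangleleft> z = dS H k (%r t. w * ?S t \<triangleright> \<phi> \<triangleleft> r * z)" if "\<phi> \<in>: Hdual H" for w z k \<phi>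
  by (rule ext) (simp add: coad01_apply Hdual_hlin that ssum_apply mult.assoc)
 have act': "coad01 H k (w \<triangleright> \<phi> \<triangleleft> z) = dS H k (%r t. ?S t * w \<triangleright> \<phi> \<triangleleft> z * r)" if "\<phi> \<in>: Hdual H" for w z k \<phi>
  by (rule ext) (simp add: coad01_apply hlin_lact hlin_ract Hdual_hlin that ssum_apply mult.assoc)
 have sums: "pr H (amult (L01 H) \<phi> (ssum H t F)) (amult (L01 H) (ssum H u F') \<psi>) =
   ssum H t (%a b. ssum H u (%c e. pr H (amult (L01 H) \<phi> (F a b)) (amult (L01 H) (F' c e) \<psi>)))"
  if "\<phi> \<in>: Hdual H" "\<psi> \<in>: Hdual H" "\<And>a b. F a b \<in>: Hdual H" "\<And>a b. F' a b \<in>: Hdual H"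
  for \<phi> \<psi> t u F F'
 proof -
  have "pr H (amult (L01 H) \<phi> (ssum H t F)) g = ssum H t (%a b. pr H (amult (L01 H) \<phi> (F a b)) g)"
   if "g \<in>: Hdual H" for g
   using linear_on_ssum[OF is_vspace_Hdual Dl_via[OF bilinear_onD(2)[OF bilinear_pr that]
    bilinear_onD(1)[OF bilinear_L01 \<open>\<phi> \<in> _\<close>]], of F] \<open>\<And>a b. F a b \<in> _\<close> L01_closed[OF \<open>\<phi> \<in> _\<close>] by simp
  moreover have "pr H f (amult (L01 H) (ssum H u F') \<psi>) = ssum H u (%a b. pr H f (amult (L01 H) (F' a b) \<psi>))"
   if "f \<in>: Hdual H" for f
   using linear_on_ssum[OF is_vspace_Hdual Dl_via[OF bilinear_onD(1)[OF bilinear_pr that]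
    bilinear_onD(2)[OF bilinear_L01 \<open>\<psi> \<in> _\<close>]], of F'] \<open>\<And>a b. F' a b \<in> _\<close> L01_closed[OF _ \<open>\<psi> \<in> _\<close>] by simp
  ultimately show ?thesis
   using that by (simp add: L01_closed ssum_closed[OF is_vspace_Hdual]) (rule ssum_swap)
 qed
 have "coad10 H h (amult (L10 H) (pr H \<beta> \<alpha>) (pr H \<beta>' \<alpha>')) =
  rS H (%a1 a2. rS H (%b1 b2. rS H (%c1 c2. rS H (%d1 d2. dS H h (%m n. dS H m (%k1 k2. dS H n (%k3 k4.
   pr H (amult (L01 H) (coad01 H k1 \<beta>) (coad01 H k2 (d2 * c1 \<triangleright> \<beta>' \<triangleleft> a1 * b1)))
    (amult (L01 H) (coad01 H k3 (c2 * ?S a2 \<triangleright> \<alpha> \<triangleleft> b2 * d1)) (coad01 H k4 \<alpha>')))))))))"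
 proof -
  have 1: "coad10 H h (rS H F) = rS H (%a b. coad10 H h (F a b))" if "\<And>a b. F a b \<in>: L10 H" for F
   by (rule linear_on_ssum[OF is_vspace_L10 coad10_lift(1) that])
  have 2: "pr H (ssum H m F) (ssum H n G) = ssum H m (%a b. ssum H n (%c e. pr H (F a b) (G c e)))"
   if "\<And>a b. F a b \<in>: Hdual H" "\<And>a b. G a b \<in>: Hdual H" for m n F G
   by (subst linear_on_ssum[OF is_vspace_Hdual bilinear_onD(2)[OF bilinear_pr ssum_closed[OF is_vspace_Hdual that(2)]] that(1)],
    subst linear_on_ssum[OF is_vspace_Hdual bilinear_onD(1)[OF bilinear_pr that(1)] that(2)]) (rule refl)
  show ?thesis
   by (simp add: L10_mult(2) d 1 ssum_closed[OF is_vspace_L10] pr_closed dual_intros coad10_lift(2) coad01_mult 2 del: L10_simps(2))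
 qed
 also have "\<dots> = rS H (%a1 a2. rS H (%b1 b2. rS H (%c1 c2. rS H (%d1 d2. dS H h (%m n. dS H m (%k1 k2. dS H n (%k3 k4.
   dS H k2 (%p q. dS H k3 (%r t. K k1 k4 (a1 * b1 * p) (?S q * (d2 * c1)) (b2 * d1 * r) (?S t * (c2 * ?S a2)))))))))))"
  by (simp add: act' sums d dual_intros K_def)
 also have "\<dots> = dS H h (%m n. dS H m (%k1 k2. dS H n (%k3 k4. dS H k2 (%p q. dS H k3 (%r t.
   rS H (%a1 a2. rS H (%b1 b2. rS H (%c1 c2. rS H (%d1 d2.
   K k1 k4 (a1 * b1 * p) (?S q * (d2 * c1)) (b2 * d1 * r) (?S t * (c2 * ?S a2)))))))))))"
  by (simp only: ssum_swap[of H "rmat H" "comul H _"])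
 also have "\<dots> = dS H h (%k1 w. dS H w (%z k4. dS H z (%k2 k3. dS H k2 (%p q. dS H k3 (%r t.
   rS H (%a1 a2. rS H (%b1 b2. rS H (%c1 c2. rS H (%d1 d2.
   K k1 k4 (a1 * b1 * p) (?S q * (d2 * c1)) (b2 * d1 * r) (?S t * (c2 * ?S a2)))))))))))"
  unfolding K_def by (rule dS4_middle[OF s]) (intro hlin_intros dual_intros d)+
 also have "\<dots> = dS H h (%k1 w. dS H w (%z k4. dS H z (%k2 k3. dS H k2 (%p q. dS H k3 (%r t.
   rS H (%a1 a2. rS H (%b1 b2. rS H (%c1 c2. rS H (%d1 d2.
   K k1 k4 (r * (a1 * b1)) (d2 * c1 * ?S t) (p * (b2 * d1)) (c2 * ?S a2 * ?S q))))))))))"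
  by (rule ssum_cong, rule ssum_cong, rule handle_exchange[OF s, symmetric]) (unfold K_def, (intro hlin_intros dual_intros d)+)
 also have "\<dots> = dS H h (%m n. dS H m (%k1 k2. dS H n (%k3 k4. dS H k2 (%p q. dS H k3 (%r t.
   rS H (%a1 a2. rS H (%b1 b2. rS H (%c1 c2. rS H (%d1 d2.
   K k1 k4 (r * (a1 * b1)) (d2 * c1 * ?S t) (p * (b2 * d1)) (c2 * ?S a2 * ?S q))))))))))"
  unfolding K_def by (rule dS4_middle[OF s, symmetric]) (intro hlin_intros dual_intros d)+
 also have "\<dots> = dS H h (%m n. dS H m (%k1 k2. dS H n (%k3 k4. amult (L10 H)
   (pr H (coad01 H k1 \<beta>) (coad01 H k2 \<alpha>)) (pr H (coad01 H k3 \<beta>') (coad01 H k4 \<alpha>')))))"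
 proof (rule ssum_cong, rule ssum_cong, rule ssum_cong)
  fix m n k1 k2 k3 k4
  have "amult (L10 H) (pr H (coad01 H k1 \<beta>) (coad01 H k2 \<alpha>)) (pr H (coad01 H k3 \<beta>') (coad01 H k4 \<alpha>')) =
   rS H (%a1 a2. rS H (%b1 b2. rS H (%c1 c2. rS H (%d1 d2. dS H k3 (%r t. dS H k2 (%p q.
   K k1 k4 (r * (a1 * b1)) (d2 * c1 * ?S t) (p * (b2 * d1)) (c2 * ?S a2 * ?S q)))))))"
   by (simp add: L10_mult(2) d dual_intros act sums K_def)
  also have "\<dots> = dS H k3 (%r t. dS H k2 (%p q. rS H (%a1 a2. rS H (%b1 b2. rS H (%c1 c2. rS H (%d1 d2.
   K k1 k4 (r * (a1 * b1)) (d2 * c1 * ?S t) (p * (b2 * d1)) (c2 * ?S a2 * ?S q)))))))"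
   by (simp only: ssum_swap[of H "rmat H" "comul H _"])
  also have "\<dots> = dS H k2 (%p q. dS H k3 (%r t. rS H (%a1 a2. rS H (%b1 b2. rS H (%c1 c2. rS H (%d1 d2.
   K k1 k4 (r * (a1 * b1)) (d2 * c1 * ?S t) (p * (b2 * d1)) (c2 * ?S a2 * ?S q)))))))"
   by (rule ssum_swap)
  finally show "dS H k2 (%p q. dS H k3 (%r t. rS H (%a1 a2. rS H (%b1 b2. rS H (%c1 c2. rS H (%d1 d2.
   K k1 k4 (r * (a1 * b1)) (d2 * c1 * ?S t) (p * (b2 * d1)) (c2 * ?S a2 * ?S q))))))) =
   amult (L10 H) (pr H (coad01 H k1 \<beta>) (coad01 H k2 \<alpha>)) (pr H (coad01 H k3 \<beta>') (coad01 H k4 \<alpha>'))" ..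
 qed
 also have "\<dots> = dS H h (%u v. amult (L10 H) (coad10 H u (pr H \<beta> \<alpha>)) (coad10 H v (pr H \<beta>' \<alpha>')))"
 proof -
  have "amult (L10 H) (ssum H m F) (ssum H n G) = ssum H m (%a b. ssum H n (%c e. amult (L10 H) (F a b) (G c e)))"
   if "\<And>a b. F a b \<in>: L10 H" "\<And>a b. G a b \<in>: L10 H" for m n F G
   by (subst linear_on_ssum[OF is_vspace_L10 bilinear_onD(2)[OF L10_mult(1) ssum_closed[OF is_vspace_L10 that(2)]] that(1)],
    subst linear_on_ssum[OF is_vspace_L10 bilinear_onD(1)[OF L10_mult(1) that(1)] that(2)]) (rule refl)
  then show ?thesis by (simp add: coad10_lift(2) d pr_closed dual_intros del: L10_simps(2))
 qed
 finally show "coad10 H h (amult (L10 H) (pr H \<beta> \<alpha>) (pr H \<beta>' \<alpha>')) =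
  dS H h (%u v. amult (L10 H) (coad10 H u (pr H \<beta> \<alpha>)) (coad10 H v (pr H \<beta>' \<alpha>')))" .
qed

lemma lact_ract_counit: "w \<triangleright> counit H \<triangleleft> v = fscale (counit H w * counit H v) (counit H)"
 by (simp add: fun_eq_iff counit_mult fscale_def mult_ac)

lemma pr_scale:
 assumes "\<beta> \<in>: Hdual H" "\<alpha> \<in>: Hdual H"
 shows "pr H (fscale c \<beta>) \<alpha> = fscale c (pr H \<beta> \<alpha>)" and "pr H \<beta> (fscale c \<alpha>) = fscale c (pr H \<beta> \<alpha>)"
 using linear_on_scale[OF bilinear_onD(1)[OF bilinear_pr assms(1)] assms(2)]
  linear_on_scale[OF bilinear_onD(2)[OF bilinear_pr assms(2)] assms(1)] by simp_all

lemma L01_scale: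
 assumes "\<beta> \<in>: Hdual H" "\<alpha> \<in>: Hdual H"
 shows "amult (L01 H) (fscale c \<beta>) \<alpha> = fscale c (amult (L01 H) \<beta> \<alpha>)"
  and "amult (L01 H) \<beta> (fscale c \<alpha>) = fscale c (amult (L01 H) \<beta> \<alpha>)"
 using linear_on_scale[OF bilinear_onD(1)[OF bilinear_L01 assms(1)] assms(2)]
  linear_on_scale[OF bilinear_onD(2)[OF bilinear_L01 assms(2)] assms(1)] by simp_all

lemma fscale_fscale: "fscale c (fscale d f) = fscale (c * d :: 'a::field) f"
 by (simp add: fscale_def mult.assoc)

lemma L10_unit:
 assumes "X \<in>: L10 H"
 shows "amult (L10 H) (aone (L10 H)) X = X" and "amult (L10 H) X (aone (L10 H)) = X"
proof -
 note s = vector_space_fscale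
 note one = is_alg_one[OF is_alg_L10]
 have id: "linear_on (L10 H) fscale (%X. X)" by (simp add: linear_on_def)
 show "amult (L10 H) (aone (L10 H)) X = X"
 proof (rule L10_linear_eq[OF s bilinear_onD(1)[OF L10_mult(1) one] id _ assms])
  fix \<beta> \<alpha> assume d: "\<beta> \<in>: Hdual H" "\<alpha> \<in>: Hdual H"
  have "amult (L10 H) (aone (L10 H)) (pr H \<beta> \<alpha>) = rS H (%a1 a2. fscale (counit H a2) (rS H (%b1 b2. fscale (counit H b2)
   (rS H (%c1 c2. fscale (counit H c2) (rS H (%d1 d2. fscale (counit H d1) (pr H (d2 * c1 \<triangleright> \<beta> \<triangleleft> a1 * b1) \<alpha>))))))))"
   by (simp add: L10_mult(2) counit_Hdual d L01_unit dual_intros lact_ract_counit L01_scale pr_scale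
    counit_mult counit_antipode ssum_scale[OF s] fscale_fscale mult_ac)
  also have "\<dots> = rS H (%a1 a2. fscale (counit H a2) (rS H (%b1 b2. fscale (counit H b2)
   (rS H (%c1 c2. fscale (counit H c2) (pr H (1 * c1 \<triangleright> \<beta> \<triangleleft> a1 * b1) \<alpha>))))))"
  proof -
   have "rS H (%d1 d2. fscale (counit H d1) (pr H (d2 * c1 \<triangleright> \<beta> \<triangleleft> v) \<alpha>)) = pr H (1 * c1 \<triangleright> \<beta> \<triangleleft> v) \<alpha>" for c1 v
    by (rule rS_counit_left[OF s]) (intro hlin_intros dual_intros d)
   then show ?thesis by simp
  qed
  also have "\<dots> = rS H (%a1 a2. fscale (counit H a2) (rS H (%b1 b2. fscale (counit H b2) (pr H (1 * 1 \<triangleright> \<beta> \<triangleleft> a1 * b1) \<alpha>))))"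
  proof -
   have "rS H (%c1 c2. fscale (counit H c2) (pr H (1 * c1 \<triangleright> \<beta> \<triangleleft> v) \<alpha>)) = pr H (1 * 1 \<triangleright> \<beta> \<triangleleft> v) \<alpha>" for v
    by (rule rS_counit_right[OF s]) (intro hlin_intros dual_intros d)
   then show ?thesis by simp
  qed
  also have "\<dots> = rS H (%a1 a2. fscale (counit H a2) (pr H (1 * 1 \<triangleright> \<beta> \<triangleleft> a1 * 1) \<alpha>))"
  proof -
   have "rS H (%b1 b2. fscale (counit H b2) (pr H (1 * 1 \<triangleright> \<beta> \<triangleleft> a1 * b1) \<alpha>)) = pr H (1 * 1 \<triangleright> \<beta> \<triangleleft> a1 * 1) \<alpha>" for a1
    by (rule rS_counit_right[OF s]) (intro hlin_intros dual_intros d)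
   then show ?thesis by simp
  qed
  also have "\<dots> = pr H (1 * 1 \<triangleright> \<beta> \<triangleleft> 1 * 1) \<alpha>"
   by (rule rS_counit_right[OF s]) (intro hlin_intros dual_intros d)
  finally show "amult (L10 H) (aone (L10 H)) (pr H \<beta> \<alpha>) = pr H \<beta> \<alpha>" by (simp add: lact_one ract_one)
 qed
 show "amult (L10 H) X (aone (L10 H)) = X"
 proof (rule L10_linear_eq[OF s bilinear_onD(2)[OF L10_mult(1) one] id _ assms])
  fix \<beta> \<alpha> assume d: "\<beta> \<in>: Hdual H" "\<alpha> \<in>: Hdual H"
  have "amult (L10 H) (pr H \<beta> \<alpha>) (aone (L10 H)) = rS H (%a1 a2. fscale (counit H a1) (rS H (%b1 b2. fscale (counit H b1)
   (rS H (%c1 c2. fscale (counit H c1) (rS H (%d1 d2. fscale (counit H d2) (pr H \<beta> (c2 * antipode H a2 \<triangleright> \<alpha> \<triangleleft> b2 * d1)))))))))"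
   by (simp add: L10_mult(2) counit_Hdual d L01_unit dual_intros lact_ract_counit L01_scale pr_scale
    counit_mult counit_antipode ssum_scale[OF s] fscale_fscale mult_ac)
  also have "\<dots> = rS H (%a1 a2. fscale (counit H a1) (rS H (%b1 b2. fscale (counit H b1)
   (rS H (%c1 c2. fscale (counit H c1) (pr H \<beta> (c2 * antipode H a2 \<triangleright> \<alpha> \<triangleleft> b2 * 1)))))))"
  proof -
   have "rS H (%d1 d2. fscale (counit H d2) (pr H \<beta> (w \<triangleright> \<alpha> \<triangleleft> b2 * d1))) = pr H \<beta> (w \<triangleright> \<alpha> \<triangleleft> b2 * 1)" for w b2
    by (rule rS_counit_right[OF s]) (intro hlin_intros dual_intros d)
   then show ?thesis by simp
  qed
  also have "\<dots> = rS H (%a1 a2. fscale (counit H a1) (rS H (%b1 b2. fscale (counit H b1)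
   (pr H \<beta> (1 * antipode H a2 \<triangleright> \<alpha> \<triangleleft> b2 * 1)))))"
  proof -
   have "rS H (%c1 c2. fscale (counit H c1) (pr H \<beta> (c2 * w \<triangleright> \<alpha> \<triangleleft> v))) = pr H \<beta> (1 * w \<triangleright> \<alpha> \<triangleleft> v)" for w v
    by (rule rS_counit_left[OF s]) (intro hlin_intros dual_intros d)
   then show ?thesis by simp
  qed
  also have "\<dots> = rS H (%a1 a2. fscale (counit H a1) (pr H \<beta> (1 * antipode H a2 \<triangleright> \<alpha> \<triangleleft> 1 * 1)))"
  proof -
   have "rS H (%b1 b2. fscale (counit H b1) (pr H \<beta> (w \<triangleright> \<alpha> \<triangleleft> b2 * 1))) = pr H \<beta> (w \<triangleright> \<alpha> \<triangleleft> 1 * 1)" for w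
    by (rule rS_counit_left[OF s]) (intro hlin_intros dual_intros d)
   then show ?thesis by simp
  qed
  also have "\<dots> = pr H \<beta> (1 * antipode H 1 \<triangleright> \<alpha> \<triangleleft> 1 * 1)"
   by (rule rS_counit_left[OF s]) (intro hlin_intros dual_intros d)
  finally show "amult (L10 H) (pr H \<beta> \<alpha>) (aone (L10 H)) = pr H \<beta> \<alpha>"
   by (simp add: lact_one ract_one antipode_one)
 qed
qed

end

section \<open>The map \<open>\<Phi>\<^sub>1\<^sub>,\<^sub>0\<close>\<close>

context quasitriangular_bij
begin

lemma HH_mult_counit:
 assumes "\<phi> \<in>: Hdual H"
 shows "amult (HH H) (HHpure H \<phi> x y) (HHpure H (counit H) z t) = HHpure H \<phi> (x * z) (y * t)"
proof -
 note s = vector_space_fscale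
 have e: "HHpure H (star H \<phi> (x1 \<triangleright> counit H \<triangleleft> Sinv y2)) u v =
   fscale (counit H x1) (fscale (counit H y2) (HHpure H \<phi> u v))" for x1 y2 u v
  using linear_on_scale[OF bilinear_onD(1)[OF bilinear_star assms] counit_Hdual]
   linear_on_scale[OF HHpure_linear(1) assms]
  by (simp add: lact_ract_counit star_unit assms counit_Si[OF bij] fscale_fscale)
 have "amult (HH H) (HHpure H \<phi> x y) (HHpure H (counit H) z t) =
  dS H x (%x1 x2. fscale (counit H x1) (dS H y (%y1 y2. fscale (counit H y2) (HHpure H \<phi> (x2 * z) (y1 * t)))))"
  by (simp add: HH_mult(2) assms counit_Hdual e ssum_scale[OF s])
 also have "\<dots> = dS H x (%x1 x2. fscale (counit H x1) (HHpure H \<phi> (x2 * z) (y * t)))"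
 proof -
  have "dS H y (%y1 y2. fscale (counit H y2) (HHpure H \<phi> u (y1 * t))) = HHpure H \<phi> u (y * t)" for u
   by (rule dS_counit_right) (intro hlin_intros assms)+
  then show ?thesis by simp
 qed
 also have "\<dots> = HHpure H \<phi> (x * z) (y * t)"
  by (rule dS_counit_left) (intro hlin_intros assms)+
 finally show ?thesis .
qed

lemma HH_mult_left:
 assumes "\<phi> \<in>: Hdual H" "\<psi> \<in>: Hdual H"
 shows "amult (HH H) (HHpure H \<phi> x 1) (HHpure H \<psi> z 1) =
  dS H x (%x1 x2. HHpure H (star H \<phi> (x1 \<triangleright> \<psi>)) (x2 * z) 1)"
proof -
 have "dS H 1 (%y1 y2. HHpure H (star H \<phi> (u \<triangleright> \<psi> \<triangleleft> Sinv y2)) v (y1 * 1)) = HHpure H (star H \<phi> (u \<triangleright> \<psi> \<triangleleft> Sinv 1)) v (1 * 1)" for u v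
  by (rule dS_one[OF vector_space_fscale]) (intro hlin_intros dual_intros assms)+
 then show ?thesis by (simp add: HH_mult(2) assms Sinv_one ract_one)
qed

text \<open>The value of the handle map with the image of \<alpha> replaced by an arbitrary
  \<open>k\<close>. For \<open>k\<close> = 1 it is the image of \<beta> \<otimes> 1, so the two
  tensor factors can be studied separately.\<close>

definition Pb :: "('h => 'k) => 'h => ('k, 'h) HH_elt"
 where "Pb \<beta> k = rS H (%a1 a2. rS H (%b1 b2. rS H (%c1 c2.
  HHpure H (a2 * b2 \<triangleright> \<beta> \<triangleleft> c1 * a1) (c2 * b1 * k) 1)))"

lemma Pb_closed: "\<beta> \<in>: Hdual H ==> Pb \<beta> k \<in>: HH H"
 unfolding Pb_def by (intro ssum_closed is_vspace_HH) (simp add: HHpure_closed dual_intros)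

lemma linear_Pb: "linear_on (Hdual H) fscale (%\<beta>. Pb \<beta> k)"
 unfolding Pb_def by (intro Dl_intros dual_intros Dl_via[OF HHpure_linear(1)]; assumption)

lemma hlin_Pb [hlin_intros]:
 "hlin H (hscale H) f ==> \<beta> \<in>: Hdual H ==> hlin H fscale (%x. Pb \<beta> (f x))"
 unfolding Pb_def by (intro hlin_intros dual_intros)

lemmas hlin_Pb_fun [hlin_intros] = hlin_via[OF linear_Pb]

lemma Pb_mult_right:
 assumes "\<beta> \<in>: Hdual H"
 shows "amult (HH H) (Pb \<beta> k) (HHpure H (counit H) l 1) = Pb \<beta> (k * l)"
 unfolding Pb_def
 by (simp add: HH_mult_sums HH_mult_counit HHpure_closed dual_intros assms ssum_closed[OF is_vspace_tensor] mult.assoc)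

lemma Phi10_lift:
 shows "linear_on (L10 H) fscale (Phi10 H)"
  and "\<beta> \<in>: Hdual H ==> \<alpha> \<in>: Hdual H ==> Phi10 H (pr H \<beta> \<alpha>) = Pb \<beta> (Phi01 H \<alpha>)"
proof -
 have E: "sumR H fscale (%a1 a2. sumR H fscale (%b1 b2. sumR H fscale (%c1 c2.
    HHpure H (a2 * b2 \<triangleright> \<beta> \<triangleleft> c1 * a1) (c2 * b1 * Phi01 H \<alpha>) 1))) = Pb \<beta> (Phi01 H \<alpha>)"
  if d: "\<beta> \<in>: Hdual H" "\<alpha> \<in>: Hdual H" for \<beta> \<alpha>
 proof -
  have 1: "sumR H fscale (%c1 c2. HHpure H (a2 * b2 \<triangleright> \<beta> \<triangleleft> c1 * a1) (c2 * b1 * Phi01 H \<alpha>) 1) =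
   rS H (%c1 c2. HHpure H (a2 * b2 \<triangleright> \<beta> \<triangleleft> c1 * a1) (c2 * b1 * Phi01 H \<alpha>) 1)" for a1 a2 b1 b2
   by (rule sw_rmat) (intro hlin_intros dual_intros d)+
  have 2: "sumR H fscale (%b1 b2. rS H (%c1 c2. HHpure H (a2 * b2 \<triangleright> \<beta> \<triangleleft> c1 * a1) (c2 * b1 * Phi01 H \<alpha>) 1)) =
   rS H (%b1 b2. rS H (%c1 c2. HHpure H (a2 * b2 \<triangleright> \<beta> \<triangleleft> c1 * a1) (c2 * b1 * Phi01 H \<alpha>) 1))" for a1 a2
   by (rule sw_rmat) (intro hlin_intros dual_intros d)+
  show ?thesis unfolding 1 2 Pb_def by (rule sw_rmat) (intro hlin_intros dual_intros d)+
 qed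
 have eq: "Phi10 H = tlift2 (Hdual H) (Hdual H) fscale (%\<beta> \<alpha>. Pb \<beta> (Phi01 H \<alpha>))"
  unfolding Phi10_def by (rule tlift2_cong) (rule E)
 have b: "bilinear_on (Hdual H) (Hdual H) fscale (%\<beta> \<alpha>. Pb \<beta> (Phi01 H \<alpha>))"
  by (rule bilinear_onI[OF linear_on_hlin[OF hlin_Pb[OF hlin_id] linear_Phi01] linear_Pb])
 show "linear_on (L10 H) fscale (Phi10 H)"
  unfolding eq using tlift2_linear[OF vector_space_fscale b] by simp
 show "\<beta> \<in>: Hdual H ==> \<alpha> \<in>: Hdual H ==> Phi10 H (pr H \<beta> \<alpha>) = Pb \<beta> (Phi01 H \<alpha>)"
  unfolding eq by (rule tlift2_pair[OF vector_space_fscale b])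
qed

lemma Phi10_closed: "X \<in>: L10 H ==> Phi10 H X \<in>: HH H"
proof (erule span_closed[OF is_vspace_L10 L10_span _ is_vspace_HH, rotated 2])
 show "linear_on (L10 H) (vscale (HH H)) (Phi10 H)" using Phi10_lift(1) by simp
 fix X assume "X \<in> {pr H a b |a b. a \<in>: Hdual H \<and> b \<in>: Hdual H}"
 then show "Phi10 H X \<in>: HH H" by (auto simp: Phi10_lift(2) simp del: HH_simps intro: Pb_closed)
qed

lemma Phi10_one: "Phi10 H (aone (L10 H)) = aone (HH H)"
proof -
 note s = vector_space_fscale
 have e: "HHpure H (a2 * b2 \<triangleright> counit H \<triangleleft> c1 * a1) z 1 = fscale (counit H a2) (fscale (counit H b2) (fscale (counit H c1)
   (fscale (counit H a1) (HHpure H (counit H) z 1))))" for a1 a2 b2 c1 z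
  using linear_on_scale[OF HHpure_linear(1) counit_Hdual]
  by (simp add: lact_ract_counit counit_mult fscale_fscale mult_ac)
 have "Phi10 H (aone (L10 H)) = Pb (counit H) 1"
  by (simp add: Phi10_lift(2) counit_Hdual Phi01_one)
 also have "\<dots> = rS H (%a1 a2. fscale (counit H a2) (rS H (%b1 b2. fscale (counit H b2) (rS H (%c1 c2. fscale (counit H c1)
   (fscale (counit H a1) (HHpure H (counit H) (c2 * b1 * 1) 1)))))))"
  by (simp add: Pb_def e ssum_scale[OF s])
 also have "\<dots> = rS H (%a1 a2. fscale (counit H a2) (rS H (%b1 b2. fscale (counit H b2)
   (fscale (counit H a1) (HHpure H (counit H) (1 * b1 * 1) 1)))))"
 proof -
  have "rS H (%c1 c2. fscale (counit H c1) (fscale d (HHpure H (counit H) (c2 * b1 * 1) 1))) =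
   fscale d (HHpure H (counit H) (1 * b1 * 1) 1)" for d b1
   by (rule rS_counit_left[OF s]) (intro hlin_intros dual_intros)
  then show ?thesis by simp
 qed
 also have "\<dots> = rS H (%a1 a2. fscale (counit H a2) (fscale (counit H a1) (HHpure H (counit H) (1 * 1 * 1) 1)))"
 proof -
  have "rS H (%b1 b2. fscale (counit H b2) (fscale d (HHpure H (counit H) (1 * b1 * 1) 1))) =
   fscale d (HHpure H (counit H) (1 * 1 * 1) 1)" for d
   by (rule rS_counit_right[OF s]) (intro hlin_intros dual_intros)
  then show ?thesis by simp
 qed
 also have "\<dots> = fscale (counit H 1) (HHpure H (counit H) (1 * 1 * 1) 1)"
  by (rule rS_counit_right[OF s]) (intro hlin_intros linear_hlin[OF counit_linear])
 also have "\<dots> = aone (HH H)" by (simp add: counit_one fscale_def)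
 finally show ?thesis .
qed

end

section \<open>The factors of the handle map: products and the exchange relation\<close>

lemma Rop_ssum:
 "ssum H t (%p q. Rop H i j (F p q) x) = Rop H i j (%x. ssum H t (%p q. F p q x)) x"
 unfolding Rop_def by (rule ssum_swap)

context quasitriangular_bij
begin

text \<open>After a split, linearity survives in the slot that was split and in all slots outside
  the pair; the overwritten slot is excluded.\<close>

lemma mlin_slin_Spl:
 assumes s: "vector_space s" and F: "mlin H N s F" and "i < N" "j < N" "l < N" "i \<noteq> j" "k = i \<or> k = j"
  "l = k \<or> l \<noteq> i \<and> l \<noteq> j"
 shows "slin H s (Spl H k i j F) l"
 using assms(3-) slin_Spl[OF s, of F] mlin_slin[OF F] by (cases "l = k") auto

lemma Pb_ops: "Pb \<gamma> k = rS H (%c1 c2. rS H (%a1 a2. rS H (%b1 b2.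
  HHpure H (a2 * b2 \<triangleright> \<gamma> \<triangleleft> c1 * a1) (c2 * b1 * k) 1)))"
 unfolding Pb_def by (rule ssum_swap21)

lemma HHpure_mult_Pb:
 assumes d: "\<phi> \<in>: Hdual H" "\<beta> \<in>: Hdual H"
 shows "amult (HH H) (HHpure H \<phi> k 1) (Pb \<beta> l) = dS H k (%x1 x2. rS H (%c1 c2. rS H (%a1 a2. rS H (%b1 b2.
  HHpure H (star H \<phi> (x1 * (a2 * b2) \<triangleright> \<beta> \<triangleleft> c1 * a1)) (x2 * (c2 * b1 * l)) 1))))"
proof -
 have "amult (HH H) (HHpure H \<phi> k 1) (Pb \<beta> l) = rS H (%c1 c2. rS H (%a1 a2. rS H (%b1 b2. dS H k (%x1 x2.
  HHpure H (star H \<phi> (x1 * (a2 * b2) \<triangleright> \<beta> \<triangleleft> c1 * a1)) (x2 * (c2 * b1 * l)) 1))))"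
  unfolding Pb_ops
  by (simp add: HH_mult_sums HHpure_closed dual_intros d ssum_closed[OF is_vspace_tensor] HH_mult_left lact_ract lact_lact)
 then show ?thesis by (simp only: ssum_rot4[of H "comul H k"])
qed

text \<open>Both sides are brought to the operator word \<open>?R 0 4 ?X\<close> evaluated at 1. On
  the left only the product of the double contributes a coproduct; on the right there are two, from
  the actions on a product of forms, together with the R-matrices of \<open>L01\<close>, one of
  which has to cancel.\<close>

lemma Pb_mult:
 assumes d: "\<beta> \<in>: Hdual H" "\<beta>' \<in>: Hdual H"
 shows "amult (HH H) (Pb \<beta> 1) (Pb \<beta>' 1) = Pb (amult (L01 H) \<beta> \<beta>') 1"
proof -
 let ?R = "Rop H" and ?S = "antipode H"
 note s = vector_space_fscale
 \<comment> \<open>Slots 0 and 1 act on \<beta> from the right and from the left, slots 2 and 3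
   likewise on \<beta>', and slot 4 is the component in H.\<close>
 define F :: "(nat => 'h) => ('k, 'h) HH_elt"
  where "F x = HHpure H (star H (x 1 \<triangleright> \<beta> \<triangleleft> x 0) (x 3 \<triangleright> \<beta>' \<triangleleft> x 2)) (x 4) 1" for x
 have F: "mlin H 5 fscale F"
  unfolding F_def by (rule mlinI5) (intro hlin_intros dual_intros d)+
 note R = mlin_Rop[OF s] mlin_Yop[OF s]
 let ?X = "?R 0 3 (?R 0 1 (?R 3 1 (?R 4 1 (?R 2 4 (?R 2 3 (?R 4 3 F))))))"
 have "amult (HH H) (Pb \<beta> 1) (Pb \<beta>' 1) = ?R 0 4 (?R 0 1 (?R 4 1 (Spl H 4 3 4 (?R 2 4 (?R 2 3 (?R 4 3 F)))))) (%_. 1)"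
  unfolding Pb_ops[of \<beta>]
  by (simp add: HH_mult_sums Pb_closed[simplified] HHpure_closed dual_intros d ssum_closed[OF is_vspace_tensor] HHpure_mult_Pb)
   (simp add: Rop_def Spl_def F_def lact_ract mult.assoc)
 also have "?R 4 1 (Spl H 4 3 4 (?R 2 4 (?R 2 3 (?R 4 3 F)))) = Spl H 4 3 4 (?R 3 1 (?R 4 1 (?R 2 4 (?R 2 3 (?R 4 3 F)))))"
  by (rule Rop_Spl(1)[OF s, where N = 5]) (auto intro!: R F)
 also have "?R 0 1 \<dots> = Spl H 4 3 4 (?R 0 1 (?R 3 1 (?R 4 1 (?R 2 4 (?R 2 3 (?R 4 3 F))))))"
  by (rule Rop_Spl_other) auto
 also have "?R 0 4 \<dots> = Spl H 4 3 4 (?R 0 4 ?X)"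
  by (rule Rop_Spl(2)[OF s, where N = 5]) (auto intro!: R F)
 also have "\<dots> (%_. 1) = ?R 0 4 ?X (%_. 1)"
  by (subst Spl_one[OF s]) (auto intro!: mlin_slin[where N = 5] R F)
 finally have L: "amult (HH H) (Pb \<beta> 1) (Pb \<beta>' 1) = ?R 0 4 ?X (%_. 1)" .
 let ?Y = "Yop H 2 1"
 let ?Z = "?R 0 3 (?R 0 1 (?R 3 1 (?R 2 1 (?R 4 1 (?R 2 3 (?R 4 3 (?Y F)))))))"
 have m: "amult (L01 H) \<beta> \<beta>' = rS H (%q1 q2. rS H (%p1 p2. star H (q2 * ?S p2 \<triangleright> \<beta>) (q1 \<triangleright> \<beta>' \<triangleleft> p1)))"
  using ssum_swap by (simp add: L01_mult(1) Hdual_hlin d)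
 \<comment> \<open>The two R-matrices in the product of \<open>L01\<close> become
   \<open>Yop H 2 1\<close> and the innermost \<open>?R 3 1\<close>; acting on a product of forms
   splits slots 0 and 1.\<close>
 have "Pb (amult (L01 H) \<beta> \<beta>') 1 =
  ?R 0 4 (?R 0 1 (?R 4 1 (Spl H 0 0 2 (Spl H 1 1 3 (?R 3 1 (?Y F)))))) (%_. 1)"
 proof -
  have "HHpure H (w \<triangleright> amult (L01 H) \<beta> \<beta>' \<triangleleft> v) z 1 =
   dS H v (%v1 v2. dS H w (%w1 w2. rS H (%q1 q2. rS H (%p1 p2.
    HHpure H (star H (w1 * (q2 * ?S p2) \<triangleright> \<beta> \<triangleleft> v1) (w2 * q1 \<triangleright> \<beta>' \<triangleleft> p1 * v2)) z 1))))" for v w z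
  proof -
   have lr: "w \<triangleright> ssum H t f \<triangleleft> v = ssum H t (%a b. w \<triangleright> f a b \<triangleleft> v)" for t f
    using linear_on_ssum by (simp add: ssum_apply fun_eq_iff)
   have "w \<triangleright> amult (L01 H) \<beta> \<beta>' \<triangleleft> v = rS H (%q1 q2. rS H (%p1 p2. dS H w (%w1 w2. dS H v (%v1 v2.
    star H (w1 * (q2 * ?S p2) \<triangleright> \<beta> \<triangleleft> v1) (w2 * q1 \<triangleright> \<beta>' \<triangleleft> p1 * v2)))))"
    by (simp add: m lr star_bimodule dual_intros d lact_lact lact_ract ract_ract)
   also have "\<dots> = dS H w (%w1 w2. dS H v (%v1 v2. rS H (%q1 q2. rS H (%p1 p2.
    star H (w1 * (q2 * ?S p2) \<triangleright> \<beta> \<triangleleft> v1) (w2 * q1 \<triangleright> \<beta>' \<triangleleft> p1 * v2)))))"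
    by (rule ssum_swap22)
   also have "\<dots> = dS H v (%v1 v2. dS H w (%w1 w2. rS H (%q1 q2. rS H (%p1 p2.
    star H (w1 * (q2 * ?S p2) \<triangleright> \<beta> \<triangleleft> v1) (w2 * q1 \<triangleright> \<beta>' \<triangleleft> p1 * v2)))))"
    by (rule ssum_swap)
   finally show ?thesis
    by (simp add: HHpure_ssum dual_intros star_Hdual d ssum_closed[OF is_vspace_Hdual])
  qed
  then show ?thesis unfolding Pb_ops by (simp add: Rop_def Spl_def Yop_def F_def mult.assoc)
 qed
 also have "?R 4 1 (Spl H 0 0 2 (Spl H 1 1 3 (?R 3 1 (?Y F)))) = Spl H 0 0 2 (?R 4 1 (Spl H 1 1 3 (?R 3 1 (?Y F))))"
  by (rule Rop_Spl_other) auto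
 also have "?R 4 1 (Spl H 1 1 3 (?R 3 1 (?Y F))) = Spl H 1 1 3 (?R 4 3 (?R 4 1 (?R 3 1 (?Y F))))"
  by (rule Rop_Spl(2)[OF s, where N = 5]) (auto intro!: R F)
 also have "?R 4 3 (?R 4 1 (?R 3 1 (?Y F))) = ?R 3 1 (?R 4 1 (?R 4 3 (?Y F)))"
  by (rule Rop_yang_baxter[OF s, where m = 5]) (auto intro!: R F)
 \<comment> \<open>Splitting slot 0 doubles the factor in slots 0 and 1. The new factor, in slots 2
   and 1, is the one that Yang-Baxter moves have to bring next to \<open>?Y\<close>.\<close>
 also have "?R 0 1 (Spl H 0 0 2 (Spl H 1 1 3 (?R 3 1 (?R 4 1 (?R 4 3 (?Y F)))))) =
  Spl H 0 0 2 (?R 0 1 (?R 2 1 (Spl H 1 1 3 (?R 3 1 (?R 4 1 (?R 4 3 (?Y F)))))))"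
  by (rule Rop_Spl_slin(1)[OF s]) (auto intro!: mlin_slin_Spl[OF s, where N = 5] R F)
 also have "?R 2 1 (Spl H 1 1 3 (?R 3 1 (?R 4 1 (?R 4 3 (?Y F))))) =
  Spl H 1 1 3 (?R 2 3 (?R 2 1 (?R 3 1 (?R 4 1 (?R 4 3 (?Y F))))))"
  by (rule Rop_Spl(2)[OF s, where N = 5]) (auto intro!: R F)
 also have "?R 2 3 (?R 2 1 (?R 3 1 (?R 4 1 (?R 4 3 (?Y F))))) = ?R 3 1 (?R 2 1 (?R 2 3 (?R 4 1 (?R 4 3 (?Y F)))))"
  by (rule Rop_yang_baxter[OF s, where m = 5]) (auto intro!: R F)
 also have "?R 0 1 (Spl H 1 1 3 (?R 3 1 (?R 2 1 (?R 2 3 (?R 4 1 (?R 4 3 (?Y F))))))) =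
  Spl H 1 1 3 (?R 0 3 (?R 0 1 (?R 3 1 (?R 2 1 (?R 2 3 (?R 4 1 (?R 4 3 (?Y F))))))))"
  by (rule Rop_Spl(2)[OF s, where N = 5]) (auto intro!: R F)
 also have "?R 2 3 (?R 4 1 (?R 4 3 (?Y F))) = ?R 4 1 (?R 2 3 (?R 4 3 (?Y F)))"
  by (rule Rop_commute) auto
 finally have "Pb (amult (L01 H) \<beta> \<beta>') 1 = ?R 0 4 (Spl H 0 0 2 (Spl H 1 1 3
  (?R 0 3 (?R 0 1 (?R 3 1 (?R 2 1 (?R 4 1 (?R 2 3 (?R 4 3 (?Y F)))))))))) (%_. 1)" .
 also have "?R 0 4 (Spl H 0 0 2 (Spl H 1 1 3 ?Z)) = Spl H 0 0 2 (?R 0 4 (?R 2 4 (Spl H 1 1 3 ?Z)))"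
  by (rule Rop_Spl_slin(1)[OF s]) (auto intro!: mlin_slin_Spl[OF s, where N = 5] R F)
 also have "?R 2 4 (Spl H 1 1 3 ?Z) = Spl H 1 1 3 (?R 2 4 ?Z)"
  by (rule Rop_Spl_other) auto
 also have "?R 0 4 (Spl H 1 1 3 (?R 2 4 ?Z)) = Spl H 1 1 3 (?R 0 4 (?R 2 4 ?Z))"
  by (rule Rop_Spl_other) auto
 also have "?R 2 4 ?Z = ?R 0 3 (?R 2 4 (?R 0 1 (?R 3 1 (?R 2 1 (?R 4 1 (?R 2 3 (?R 4 3 (?Y F))))))))"
  by (rule Rop_commute) auto
 also have "?R 2 4 (?R 0 1 (?R 3 1 (?R 2 1 (?R 4 1 (?R 2 3 (?R 4 3 (?Y F))))))) =
  ?R 0 1 (?R 2 4 (?R 3 1 (?R 2 1 (?R 4 1 (?R 2 3 (?R 4 3 (?Y F)))))))"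
  by (rule Rop_commute) auto
 also have "?R 2 4 (?R 3 1 (?R 2 1 (?R 4 1 (?R 2 3 (?R 4 3 (?Y F)))))) =
  ?R 3 1 (?R 2 4 (?R 2 1 (?R 4 1 (?R 2 3 (?R 4 3 (?Y F))))))"
  by (rule Rop_commute) auto
 also have "?R 2 4 (?R 2 1 (?R 4 1 (?R 2 3 (?R 4 3 (?Y F))))) = ?R 4 1 (?R 2 1 (?R 2 4 (?R 2 3 (?R 4 3 (?Y F)))))"
  by (rule Rop_yang_baxter[OF s, where m = 5]) (auto intro!: R F)
 also have "?R 2 4 (?R 2 3 (?R 4 3 (?Y F))) = ?Y (?R 2 4 (?R 2 3 (?R 4 3 F)))"
  by (simp add: Yop_Rop)
 also have "Spl H 0 0 2 (Spl H 1 1 3 (?R 0 4 (?R 0 3 (?R 0 1 (?R 3 1 (?R 4 1 (?R 2 1 (?Y (?R 2 4 (?R 2 3 (?R 4 3 F)))))))))))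
   (%_. 1) = ?R 0 4 (?R 0 3 (?R 0 1 (?R 3 1 (?R 4 1 (?R 2 1 (?Y (?R 2 4 (?R 2 3 (?R 4 3 F))))))))) (%_. 1)"
  by (subst Spl_one[OF s], (auto intro!: mlin_slin_Spl[OF s, where N = 5] R F)[4],
   subst Spl_one[OF s]) (auto intro!: mlin_slin[where N = 5] R F)
 also have "\<dots> = ?R 0 4 ?X (%_. 1)"
 proof -
  \<comment> \<open>None of the five factors further out touches slot 2, so it still holds 1
    here.\<close>
  have "?R 2 1 (?Y (?R 2 4 (?R 2 3 (?R 4 3 F)))) x = ?R 2 4 (?R 2 3 (?R 4 3 F)) x" if "x 2 = 1" for x
   by (rule Rop_Yop[OF s, where m = 5]) (use that in \<open>auto intro!: R F\<close>)
  then show ?thesis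
   unfolding Rop_def[of H 0 4] Rop_def[of H 0 3] Rop_def[of H 0 1] Rop_def[of H 3 1] Rop_def[of H 4 1] by simp
 qed
 finally show ?thesis using L by simp
qed

text \<open>The exchange relation that explains the product of \<open>L10\<close>: its four
  R-matrices express the product of the images of \<alpha> and \<beta>', in this order, through
  products in the reverse order. As operators, the copies interleave with the R-matrices of the two
  images; Yang-Baxter moves disentangle them and the copy with the antipode cancels.\<close>

lemma Pb_cross:
 assumes d: "\<alpha> \<in>: Hdual H" "\<beta>' \<in>: Hdual H"
 shows "rS H (%a1 a2. rS H (%b1 b2. rS H (%c1 c2. rS H (%d1 d2.
   Pb (d2 * c1 \<triangleright> \<beta>' \<triangleleft> a1 * b1) (Phi01 H (c2 * antipode H a2 \<triangleright> \<alpha> \<triangleleft> b2 * d1)))))) =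
  amult (HH H) (HHpure H (counit H) (Phi01 H \<alpha>) 1) (Pb \<beta>' 1)"
proof -
 let ?R = "Rop H" and ?S = "antipode H"
 note s = vector_space_fscale
 note la = hlin_comp[OF Hdual_hlin[OF d(1)]]
 \<comment> \<open>Slots 0 and 1 act on \<beta>' from the right and from the left, slot 2 is the
   argument of \<alpha>, and slot 3 is the component in H.\<close>
 define F :: "(nat => 'h) => ('k, 'h) HH_elt"
  where "F x = fscale (\<alpha> (x 2)) (HHpure H (x 1 \<triangleright> \<beta>' \<triangleleft> x 0) (x 3) 1)" for x
 have F: "mlin H 4 fscale F"
  unfolding F_def by (rule mlinI4) (intro hlin_intros dual_intros d la)+
 note R = mlin_Rop[OF s] mlin_Yop[OF s]
 have Hs: "HHpure H \<gamma> (hscale H c z) 1 = fscale c (HHpure H \<gamma> z 1)" if "\<gamma> \<in>: Hdual H" for c z \<gamma>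
  using hlin_HHpure(2)[OF hlin_id that] by (simp add: hlin_def)
 have HS: "HHpure H \<gamma> (ssum H t G) 1 = ssum H t (%a b. HHpure H \<gamma> (G a b) 1)" if "\<gamma> \<in>: Hdual H" for t G \<gamma>
  by (rule hlin_mono_comp[OF hlin_HHpure(2)[OF hlin_id that]])
 have "amult (HH H) (HHpure H (counit H) (Phi01 H \<alpha>) 1) (Pb \<beta>' 1) =
  ?R 2 3 (?R 3 2 (Spl H 3 1 3 (?R 0 3 (?R 0 1 (?R 3 1 F))))) (%_. 1)"
 proof -
  have "HHpure H (counit H) (Phi01 H \<alpha>) 1 = rS H (%u1 u2. rS H (%v1 v2.
   fscale (\<alpha> (u1 * v2)) (HHpure H (counit H) (u2 * v1) 1)))"
   by (simp add: Phi01_sum Hdual_hlin d HS Hs counit_Hdual)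
  moreover have "amult (HH H) (fscale c (HHpure H (counit H) k 1)) (Pb \<beta>' 1) = fscale c (dS H k (%x1 x2.
    rS H (%c1 c2. rS H (%a1 a2. rS H (%b1 b2.
   HHpure H (x1 * (a2 * b2) \<triangleright> \<beta>' \<triangleleft> c1 * a1) (x2 * (c2 * b1)) 1)))))" for c k
  proof -
   have "amult (HH H) (fscale c (HHpure H (counit H) k 1)) (Pb \<beta>' 1) =
    fscale c (amult (HH H) (HHpure H (counit H) k 1) (Pb \<beta>' 1))"
    using linear_on_scale[OF bilinear_onD(2)[OF HH_mult(1) Pb_closed[OF d(2)]], of "HHpure H (counit H) k 1" c]
     HHpure_closed[OF counit_Hdual] by simp
   then show ?thesis
    by (simp add: HHpure_mult_Pb d counit_Hdual star_unit dual_intros)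
  qed
  moreover have "fscale c (HHpure H (counit H) k 1) \<in>: HH H" for c k
   using is_vspace_scale[OF is_vspace_HH, of "HHpure H (counit H) k 1" c] HHpure_closed[OF counit_Hdual] by simp
  ultimately show ?thesis
   by (simp add: HH_mult_sums Pb_closed[simplified] d ssum_closed[OF is_vspace_tensor])
    (simp add: Rop_def Spl_def F_def mult.assoc ssum_scale[OF s])
 qed
 also have "?R 3 2 (Spl H 3 1 3 (?R 0 3 (?R 0 1 (?R 3 1 F)))) = Spl H 3 1 3 (?R 1 2 (?R 3 2 (?R 0 3 (?R 0 1 (?R 3 1 F)))))"
  by (rule Rop_Spl(1)[OF s, where N = 4]) (auto intro!: R F)
 also have "?R 2 3 \<dots> = Spl H 3 1 3 (?R 2 3 (?R 2 1 (?R 1 2 (?R 3 2 (?R 0 3 (?R 0 1 (?R 3 1 F)))))))"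
  by (rule Rop_Spl(2)[OF s, where N = 4]) (auto intro!: R F)
 also have "\<dots> (%_. 1) = ?R 2 3 (?R 2 1 (?R 1 2 (?R 3 2 (?R 0 3 (?R 0 1 (?R 3 1 F)))))) (%_. 1)"
  by (subst Spl_one[OF s]) (auto intro!: mlin_slin[where N = 4] R F)
 finally have rhs: "amult (HH H) (HHpure H (counit H) (Phi01 H \<alpha>) 1) (Pb \<beta>' 1) = \<dots>" .
 define Fp where "Fp a1 a2 b1 b2 c1 c2 d1 d2 x = fscale (\<alpha> (b2 * (d1 * (x 2 * (c2 * ?S a2)))))
  (HHpure H (x 1 * (d2 * c1) \<triangleright> \<beta>' \<triangleleft> a1 * (b1 * x 0)) (x 3) 1)" for a1 a2 b1 b2 c1 c2 d1 d2 and x :: "nat => 'h"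
 let ?E = "%F. ?R 0 3 (?R 0 1 (?R 3 1 (?R 2 3 (?R 3 2 F))))"
 have "Pb (d2 * c1 \<triangleright> \<beta>' \<triangleleft> a1 * b1) (Phi01 H (c2 * ?S a2 \<triangleright> \<alpha> \<triangleleft> b2 * d1)) =
  ?E (Fp a1 a2 b1 b2 c1 c2 d1 d2) (%_. 1)" for a1 a2 b1 b2 c1 c2 d1 d2
 proof -
  have key: "HHpure H \<gamma> (w * Phi01 H (c2 * ?S a2 \<triangleright> \<alpha> \<triangleleft> b2 * d1)) 1 = rS H (%u1 u2. rS H (%v1 v2.
   fscale (\<alpha> (b2 * d1 * (u1 * v2 * (c2 * ?S a2)))) (HHpure H \<gamma> (w * (u2 * v1)) 1)))" if "\<gamma> \<in>: Hdual H" for w \<gamma>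
  proof -
   have "w * Phi01 H (c2 * ?S a2 \<triangleright> \<alpha> \<triangleleft> b2 * d1) = rS H (%u1 u2. rS H (%v1 v2.
    hscale H (\<alpha> (b2 * d1 * (u1 * v2 * (c2 * ?S a2)))) (w * (u2 * v1))))"
    using hlin_mono_comp[OF hlin_mult_right[OF hlin_id, of w]]
    by (simp add: Phi01_sum Hdual_hlin dual_intros d scale_mult_right[symmetric] mult.assoc)
   then show ?thesis by (simp add: HS Hs that)
  qed
  show ?thesis unfolding Pb_ops
   by (simp add: key dual_intros d) (simp add: Rop_def Fp_def lact_ract lact_lact ract_ract mult.assoc)
 qed
 then have "rS H (%a1 a2. rS H (%b1 b2. rS H (%c1 c2. rS H (%d1 d2.
   Pb (d2 * c1 \<triangleright> \<beta>' \<triangleleft> a1 * b1) (Phi01 H (c2 * antipode H a2 \<triangleright> \<alpha> \<triangleleft> b2 * d1)))))) =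
  ?E (%x. rS H (%a1 a2. rS H (%b1 b2. rS H (%c1 c2. rS H (%d1 d2. Fp a1 a2 b1 b2 c1 c2 d1 d2 x))))) (%_. 1)"
  by (simp only: Rop_ssum)
 \<comment> \<open>The copies \<open>a\<close>, \<open>b\<close>, \<open>c\<close>, \<open>d\<close>
   appear as \<open>Yop H 0 2\<close>, \<open>Lop H 0 2\<close>, \<open>?R 1 2\<close> and
   \<open>Mop H 2 1\<close>.\<close>
 also have "(%x. rS H (%a1 a2. rS H (%b1 b2. rS H (%c1 c2. rS H (%d1 d2. Fp a1 a2 b1 b2 c1 c2 d1 d2 x))))) =
  Mop H 2 1 (Lop H 0 2 (?R 1 2 (Yop H 0 2 F)))"
 proof
  fix x
  have "rS H (%a1 a2. rS H (%b1 b2. rS H (%c1 c2. rS H (%d1 d2. Fp a1 a2 b1 b2 c1 c2 d1 d2 x)))) =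
   rS H (%b1 b2. rS H (%c1 c2. rS H (%d1 d2. rS H (%a1 a2. Fp a1 a2 b1 b2 c1 c2 d1 d2 x))))"
   by (rule ssum_rot4)
  also have "\<dots> = rS H (%d1 d2. rS H (%b1 b2. rS H (%c1 c2. rS H (%a1 a2. Fp a1 a2 b1 b2 c1 c2 d1 d2 x))))"
   by (rule ssum_swap21)
  also have "\<dots> = Mop H 2 1 (Lop H 0 2 (?R 1 2 (Yop H 0 2 F))) x"
   by (simp add: Rop_def Mop_def Lop_def Yop_def Fp_def F_def mult.assoc)
  finally show "rS H (%a1 a2. rS H (%b1 b2. rS H (%c1 c2. rS H (%d1 d2. Fp a1 a2 b1 b2 c1 c2 d1 d2 x)))) =
   Mop H 2 1 (Lop H 0 2 (?R 1 2 (Yop H 0 2 F))) x" .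
 qed
 also have "?R 2 3 (?R 3 2 (Mop H 2 1 (Lop H 0 2 (?R 1 2 (Yop H 0 2 F))))) =
   Mop H 2 1 (?R 2 3 (?R 3 2 (Lop H 0 2 (?R 1 2 (Yop H 0 2 F)))))"
  by (simp add: Mop_Rop)
 \<comment> \<open>\<open>Mop\<close> has been pulled out to a place where slot 2 still holds 1, so
   its left multiplication there becomes a right one. \<open>Lop\<close> is then pulled out
   completely, to where all slots hold 1.\<close>
 also have "?R 0 3 (?R 0 1 (?R 3 1 (Mop H 2 1 (?R 2 3 (?R 3 2 (Lop H 0 2 (?R 1 2 (Yop H 0 2 F)))))))) (%_. 1) =
  ?R 0 3 (?R 0 1 (?R 3 1 (?R 2 1 (?R 2 3 (?R 3 2 (Lop H 0 2 (?R 1 2 (Yop H 0 2 F)))))))) (%_. 1)"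
 proof -
  have "Mop H 2 1 K x = ?R 2 1 K x" if "x 2 = 1" for K :: "(nat => 'h) => ('k, 'h) HH_elt" and x
   using that by (simp add: Mop_def Rop_def)
  then show ?thesis
   unfolding Rop_def[of H 0 3] Rop_def[of H 0 1] Rop_def[of H 3 1] by simp
 qed
 also have "?R 0 3 (?R 0 1 (?R 3 1 (?R 2 1 (?R 2 3 (?R 3 2 (Lop H 0 2 (?R 1 2 (Yop H 0 2 F)))))))) =
  Lop H 0 2 (?R 0 3 (?R 0 1 (?R 3 1 (?R 2 1 (?R 2 3 (?R 3 2 (?R 1 2 (Yop H 0 2 F))))))))"
  by (simp add: Lop_Rop)
 also have "\<dots> (%_. 1) = ?R 0 2 (?R 0 3 (?R 0 1 (?R 3 1 (?R 2 1 (?R 2 3 (?R 3 2 (?R 1 2 (Yop H 0 2 F)))))))) (%_. 1)"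
  unfolding Lop_def Rop_def[of H 0 2] by simp
 also have "?R 3 1 (?R 2 1 (?R 2 3 (?R 3 2 (?R 1 2 (Yop H 0 2 F))))) = ?R 2 3 (?R 2 1 (?R 3 1 (?R 3 2 (?R 1 2 (Yop H 0 2 F)))))"
  by (rule Rop_yang_baxter[OF s, symmetric, where m = 4]) (auto intro!: R F)
 also have "?R 3 1 (?R 3 2 (?R 1 2 (Yop H 0 2 F))) = ?R 1 2 (?R 3 2 (?R 3 1 (Yop H 0 2 F)))"
  by (rule Rop_yang_baxter[OF s, where m = 4]) (auto intro!: R F)
 also have "?R 0 1 (?R 2 3 (?R 2 1 (?R 1 2 (?R 3 2 (?R 3 1 (Yop H 0 2 F)))))) =
  ?R 2 3 (?R 0 1 (?R 2 1 (?R 1 2 (?R 3 2 (?R 3 1 (Yop H 0 2 F))))))"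
  by (rule Rop_commute) auto
 also have "?R 0 2 (?R 0 3 (?R 2 3 (?R 0 1 (?R 2 1 (?R 1 2 (?R 3 2 (?R 3 1 (Yop H 0 2 F)))))))) =
  ?R 2 3 (?R 0 3 (?R 0 2 (?R 0 1 (?R 2 1 (?R 1 2 (?R 3 2 (?R 3 1 (Yop H 0 2 F))))))))"
  by (rule Rop_yang_baxter[OF s, where m = 4]) (auto intro!: R F)
 also have "?R 0 2 (?R 0 1 (?R 2 1 (?R 1 2 (?R 3 2 (?R 3 1 (Yop H 0 2 F)))))) =
  ?R 2 1 (?R 0 1 (?R 0 2 (?R 1 2 (?R 3 2 (?R 3 1 (Yop H 0 2 F))))))"
  by (rule Rop_yang_baxter[OF s, where m = 4]) (auto intro!: R F)
 also have "?R 0 1 (?R 0 2 (?R 1 2 (?R 3 2 (?R 3 1 (Yop H 0 2 F))))) = ?R 1 2 (?R 0 2 (?R 0 1 (?R 3 2 (?R 3 1 (Yop H 0 2 F)))))"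
  by (rule Rop_yang_baxter[OF s, where m = 4]) (auto intro!: R F)
 also have "?R 0 3 (?R 2 1 (?R 1 2 (?R 0 2 (?R 0 1 (?R 3 2 (?R 3 1 (Yop H 0 2 F))))))) =
  ?R 2 1 (?R 0 3 (?R 1 2 (?R 0 2 (?R 0 1 (?R 3 2 (?R 3 1 (Yop H 0 2 F)))))))"
  by (rule Rop_commute) auto
 also have "?R 0 3 (?R 1 2 (?R 0 2 (?R 0 1 (?R 3 2 (?R 3 1 (Yop H 0 2 F)))))) =
  ?R 1 2 (?R 0 3 (?R 0 2 (?R 0 1 (?R 3 2 (?R 3 1 (Yop H 0 2 F))))))"
  by (rule Rop_commute) auto
 also have "?R 0 1 (?R 3 2 (?R 3 1 (Yop H 0 2 F))) = ?R 3 2 (?R 0 1 (?R 3 1 (Yop H 0 2 F)))"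
  by (rule Rop_commute) auto
 also have "?R 0 3 (?R 0 2 (?R 3 2 (?R 0 1 (?R 3 1 (Yop H 0 2 F))))) = ?R 3 2 (?R 0 2 (?R 0 3 (?R 0 1 (?R 3 1 (Yop H 0 2 F)))))"
  by (rule Rop_yang_baxter[OF s, where m = 4]) (auto intro!: R F)
 also have "?R 0 3 (?R 0 1 (?R 3 1 (Yop H 0 2 F))) = Yop H 0 2 (?R 0 3 (?R 0 1 (?R 3 1 F)))"
  by (simp add: Yop_Rop)
 \<comment> \<open>The factor that arose from \<open>Lop\<close> has arrived next to
   \<open>Yop\<close>, and the factors outside it leave slot 0 equal to 1.\<close>
 also have "?R 2 3 (?R 2 1 (?R 1 2 (?R 3 2 (?R 0 2 (Yop H 0 2 (?R 0 3 (?R 0 1 (?R 3 1 F)))))))) (%_. 1) =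
  ?R 2 3 (?R 2 1 (?R 1 2 (?R 3 2 (?R 0 3 (?R 0 1 (?R 3 1 F)))))) (%_. 1)"
 proof -
  have "?R 0 2 (Yop H 0 2 (?R 0 3 (?R 0 1 (?R 3 1 F)))) x = ?R 0 3 (?R 0 1 (?R 3 1 F)) x" if "x 0 = 1" for x
   by (rule Rop_Yop[OF s, where m = 4]) (use that in \<open>auto intro!: R F\<close>)
  then show ?thesis
   unfolding Rop_def[of H 2 3] Rop_def[of H 2 1] Rop_def[of H 1 2] Rop_def[of H 3 2] by simp
 qed
 finally show ?thesis unfolding rhs .
qed

end

section \<open>The handle map as an algebra morphism with a moment map\<close>

context quasitriangular_bij
begin

lemma Phi10_factor:
 assumes "\<beta> \<in>: Hdual H" "\<alpha> \<in>: Hdual H"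
 shows "Phi10 H (pr H \<beta> \<alpha>) = amult (HH H) (Pb \<beta> 1) (HHpure H (counit H) (Phi01 H \<alpha>) 1)"
 by (simp add: Phi10_lift(2) assms Pb_mult_right)

lemma HH_assoc:
 assumes "X \<in>: HH H" "Y \<in>: HH H" "Z \<in>: HH H"
 shows "amult (HH H) (amult (HH H) X Y) Z = amult (HH H) X (amult (HH H) Y Z)"
 using is_assoc_HH assms by (simp add: is_assoc_alg_def)

lemma HH_closed: "X \<in>: HH H ==> Y \<in>: HH H ==> amult (HH H) X Y \<in>: HH H"
 by (rule is_alg_closed[OF is_alg_HH])

text \<open>With \<open>?P\<close> and \<open>?Q\<close> for the two factors, multiplicativity of
  each turns a summand of the product into P(\<beta>) [P(\<gamma>) Q(\<delta>)] Q(\<alpha>'). The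
  four R-matrices only affect the bracket, and by \<open>Pb_cross\<close> its sum is Q(\<alpha>)
  P(\<beta>').\<close>

lemma Phi10_mult:
 assumes "X \<in>: L10 H" "Y \<in>: L10 H"
 shows "Phi10 H (amult (L10 H) X Y) = amult (HH H) (Phi10 H X) (Phi10 H Y)"
proof (rule L10_bilinear_eq[OF vector_space_fscale _ _ _ assms])
 let ?m = "amult (HH H)" and ?Q = "%k. HHpure H (counit H) k 1" and ?P = "%\<beta>. Pb \<beta> 1"
 have P: "linear_on (L10 H) (vscale (HH H)) (Phi10 H)" using Phi10_lift(1) by simp
 have m: "X \<in>: L10 H ==> linear_on (L10 H) (vscale (L10 H)) (amult (L10 H) X)"
  "X \<in>: L10 H ==> linear_on (L10 H) (vscale (L10 H)) (%Y. amult (L10 H) Y X)" for X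
  using bilinear_onD[OF L10_mult(1)] by simp_all
 note mm = bilinear_onD[OF HH_mult(1)]
 show "bilinear_on (L10 H) (L10 H) fscale (%X Y. Phi10 H (amult (L10 H) X Y))"
  by (rule bilinear_onI; rule linear_on_via[OF Phi10_lift(1)]; (rule m | rule is_alg_closed[OF is_alg_L10]); assumption)
 show "bilinear_on (L10 H) (L10 H) fscale (%X Y. ?m (Phi10 H X) (Phi10 H Y))"
  by (rule bilinear_onI, rule linear_on_via[OF mm(1) P Phi10_closed], erule Phi10_closed, assumption,
    rule linear_on_via[OF mm(2) P Phi10_closed], erule Phi10_closed, assumption)
 fix \<beta> \<alpha> \<beta>' \<alpha>'
 assume d: "\<beta> \<in>: Hdual H" "\<alpha> \<in>: Hdual H" "\<beta>' \<in>: Hdual H" "\<alpha>' \<in>: Hdual H"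
 have c: "\<And>\<beta> k. \<beta> \<in>: Hdual H ==> Pb \<beta> k \<in>: HH H" "\<And>k. ?Q k \<in>: HH H"
  using HHpure_closed[OF counit_Hdual] by (simp_all add: Pb_closed[simplified])
 note c' = c HH_closed
 have Q: "?Q (k * l) = ?m (?Q k) (?Q l)" for k l
  by (simp add: HH_mult_counit counit_Hdual)
 have t: "Phi10 H (pr H (amult (L01 H) \<beta> \<gamma>) (amult (L01 H) \<delta> \<alpha>')) = ?m (?P \<beta>) (?m (Pb \<gamma> (Phi01 H \<delta>)) (?Q (Phi01 H \<alpha>')))"
  if g: "\<gamma> \<in>: Hdual H" "\<delta> \<in>: Hdual H" for \<gamma> \<delta>
 proof -
  have "Phi10 H (pr H (amult (L01 H) \<beta> \<gamma>) (amult (L01 H) \<delta> \<alpha>')) =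
   ?m (?m (?P \<beta>) (?P \<gamma>)) (?m (?Q (Phi01 H \<delta>)) (?Q (Phi01 H \<alpha>')))"
   by (subst Phi10_factor) (simp_all only: Pb_mult Phi01_mult Q L01_closed d g)
  also have "\<dots> = ?m (?P \<beta>) (?m (?m (?P \<gamma>) (?Q (Phi01 H \<delta>))) (?Q (Phi01 H \<alpha>')))"
   by (simp only: HH_assoc c' d g)
  also have "?m (?P \<gamma>) (?Q (Phi01 H \<delta>)) = Pb \<gamma> (Phi01 H \<delta>)"
   by (simp add: Pb_mult_right g)
  finally show ?thesis .
 qed
 have "Phi10 H (amult (L10 H) (pr H \<beta> \<alpha>) (pr H \<beta>' \<alpha>')) =
  rS H (%a1 a2. rS H (%b1 b2. rS H (%c1 c2. rS H (%d1 d2.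
   Phi10 H (pr H (amult (L01 H) \<beta> (d2 * c1 \<triangleright> \<beta>' \<triangleleft> a1 * b1))
     (amult (L01 H) (c2 * antipode H a2 \<triangleright> \<alpha> \<triangleleft> b2 * d1) \<alpha>'))))))"
  by (simp add: L10_mult(2) d linear_on_ssum[OF is_vspace_L10 Phi10_lift(1)] ssum_closed[OF is_vspace_tensor]
   pr_closed[simplified] L01_closed dual_intros)
 also have "\<dots> = ?m (?P \<beta>) (?m (rS H (%a1 a2. rS H (%b1 b2. rS H (%c1 c2. rS H (%d1 d2.
   Pb (d2 * c1 \<triangleright> \<beta>' \<triangleleft> a1 * b1) (Phi01 H (c2 * antipode H a2 \<triangleright> \<alpha> \<triangleleft> b2 * d1))))))) (?Q (Phi01 H \<alpha>')))"
  by (simp add: t dual_intros d HH_mult_sums ssum_closed[OF is_vspace_tensor] c[simplified] c'(3)[simplified])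
 also have "\<dots> = ?m (?P \<beta>) (?m (?m (?Q (Phi01 H \<alpha>)) (?P \<beta>')) (?Q (Phi01 H \<alpha>')))"
  by (simp only: Pb_cross d)
 also have "\<dots> = ?m (?m (?P \<beta>) (?Q (Phi01 H \<alpha>))) (?m (?P \<beta>') (?Q (Phi01 H \<alpha>')))"
  by (simp only: HH_assoc c' d)
 finally show "Phi10 H (amult (L10 H) (pr H \<beta> \<alpha>) (pr H \<beta>' \<alpha>')) = ?m (Phi10 H (pr H \<beta> \<alpha>)) (Phi10 H (pr H \<beta>' \<alpha>'))"
  by (simp only: Phi10_factor d)
qed

text \<open>The arguments of \<open>G\<close> are the elements acting on \<beta> from the left and
  from the right and the components in the two copies of H. Moving the Sweedler components past the
  three copies of R brings h3 next to the inverse antipode of h2 in the right action, and then h5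
  next to S(h6) in the left one; both pairs cancel.\<close>

lemma handle_moment:
 assumes s: "vector_space s" and G: "\<And>r m t. hlin H s (%l. G l r m t)" "\<And>l m t. hlin H s (%r. G l r m t)"
  "\<And>l r t. hlin H s (%m. G l r m t)" "\<And>l r m. hlin H s (%t. G l r m t)"
 shows "dS H h (%h1 w1. dS H w1 (%h2 w2. dS H w2 (%h3 w3. dS H w3 (%h4 w4. dS H w4 (%h5 h6.
   rS H (%c1 c2. rS H (%a1 a2. rS H (%b1 b2.
    G (h3 * (a2 * b2) * antipode H h6) (h5 * c1 * a1 * Sinv h2) (h4 * c2 * b1) h1)))))))) =
  dS H h (%h1 w1. rS H (%c1 c2. rS H (%a1 a2. rS H (%b1 b2. G (a2 * b2) (c1 * a1) (c2 * b1 * w1) h1))))"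
proof (rule ssum_cong)
 let ?S = "antipode H"
 fix h1 w1
 note G' = hlin_comp[OF G(1)] hlin_comp[OF G(2)] hlin_comp[OF G(3)] hlin_comp[OF G(4)] s
 have "dS H w1 (%h2 w2. dS H w2 (%h3 w3. dS H w3 (%h4 w4. dS H w4 (%h5 h6.
   rS H (%c1 c2. rS H (%a1 a2. rS H (%b1 b2.
    G (h3 * (a2 * b2) * ?S h6) (h5 * c1 * a1 * Sinv h2) (h4 * c2 * b1) h1))))))) =
  dS H w1 (%h2 w2. dS H w2 (%h3 w3. dS H w3 (%h4 w4. dS H w4 (%h5 h6.
   rS H (%c1 c2. rS H (%a1 a2. rS H (%b1 b2.
    G (h3 * (a2 * b2) * ?S h6) (c1 * h4 * a1 * Sinv h2) (c2 * h5 * b1) h1)))))))"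
  by (rule ssum_cong, rule ssum_cong, rule dS3_rS_first[OF s, where G = "%x y h6. rS H (%a1 a2. rS H (%b1 b2.
    G (h3 * (a2 * b2) * ?S h6) (x * a1 * Sinv h2) (y * b1) h1))" for h2 h3])
   (intro hlin_intros G')+
 also have "\<dots> = dS H w1 (%h2 w2. dS H w2 (%h3 w3. dS H w3 (%h4 w4. rS H (%a1 a2. dS H w4 (%h5 h6.
   rS H (%c1 c2. rS H (%b1 b2.
    G (h3 * a2 * b2 * ?S h6) (c1 * (h4 * a1) * Sinv h2) (c2 * h5 * b1) h1)))))))"
  by (rule ssum_cong, rule ssum_cong, rule ssum_cong, subst ssum_swap21, simp add: mult.assoc)
 also have "\<dots> = dS H w1 (%h2 w2. dS H w2 (%h3 w3. dS H w3 (%h4 w4. rS H (%a1 a2. dS H w4 (%h5 h6.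
   rS H (%c1 c2. rS H (%b1 b2.
    G (a2 * h4 * b2 * ?S h6) (c1 * (a1 * h3) * Sinv h2) (c2 * h5 * b1) h1)))))))"
  by (rule ssum_cong, rule dS3_rS_first[OF s, where G = "%x y w4. dS H w4 (%h5 h6. rS H (%c1 c2. rS H (%b1 b2.
    G (y * b2 * ?S h6) (c1 * x * Sinv h2) (c2 * h5 * b1) h1)))" for h2])
   (intro hlin_intros G')+
 also have "\<dots> = dS H w1 (%u w3. dS H u (%h2 h3. dS H w3 (%h4 w4. rS H (%a1 a2. dS H w4 (%h5 h6.
   rS H (%c1 c2. rS H (%b1 b2.
    G (a2 * h4 * b2 * ?S h6) (c1 * a1 * (h3 * Sinv h2)) (c2 * h5 * b1) h1)))))))"
  unfolding mult.assoc by (rule dS_coassoc[OF s, symmetric]) (intro hlin_intros G')+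
 also have "\<dots> = dS H w1 (%u w3. s (counit H u) (dS H w3 (%h4 w4. rS H (%a1 a2. dS H w4 (%h5 h6.
   rS H (%c1 c2. rS H (%b1 b2.
    G (a2 * h4 * b2 * ?S h6) (c1 * a1 * 1) (c2 * h5 * b1) h1)))))))"
  by (rule ssum_cong, rule dS_Si_right[OF bij, where f = "%z. dS H w3 (%h4 w4. rS H (%a1 a2. dS H w4 (%h5 h6.
   rS H (%c1 c2. rS H (%b1 b2. G (a2 * h4 * b2 * ?S h6) (c1 * a1 * z) (c2 * h5 * b1) h1)))))" for w3])
   (intro hlin_intros G')
 also have "\<dots> = dS H w1 (%h4 w4. rS H (%a1 a2. dS H w4 (%h5 h6.
   rS H (%c1 c2. rS H (%b1 b2. G (a2 * h4 * b2 * ?S h6) (c1 * a1 * 1) (c2 * h5 * b1) h1)))))"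
  by (rule dS_counit_left) (intro hlin_intros G')
 also have "\<dots> = rS H (%a1 a2. dS H w1 (%h4 w4. dS H w4 (%h5 h6.
   rS H (%b1 b2. rS H (%c1 c2. G (a2 * (h4 * b2) * ?S h6) (c1 * a1) (c2 * (h5 * b1)) h1)))))"
  by (subst ssum_swap, subst (4) ssum_swap, simp add: mult.assoc)
 also have "\<dots> = rS H (%a1 a2. dS H w1 (%h4 w4. dS H w4 (%h5 h6.
   rS H (%b1 b2. rS H (%c1 c2. G (a2 * (b2 * h5) * ?S h6) (c1 * a1) (c2 * (b1 * h4)) h1)))))"
  by (rule ssum_cong, rule dS3_rS_first[OF s, where G = "%x y h6. rS H (%c1 c2. G (a2 * y * ?S h6) (c1 * a1) (c2 * x) h1)" for a1 a2])
   (intro hlin_intros G')+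
 also have "\<dots> = rS H (%a1 a2. dS H w1 (%h4 w4. dS H w4 (%h5 h6.
   rS H (%b1 b2. rS H (%c1 c2. G (a2 * b2 * (h5 * ?S h6)) (c1 * a1) (c2 * b1 * h4) h1)))))"
  by (simp add: mult.assoc)
 also have "\<dots> = rS H (%a1 a2. rS H (%b1 b2. rS H (%c1 c2. G (a2 * b2 * 1) (c1 * a1) (c2 * b1 * w1) h1)))"
  by (rule ssum_cong, rule dS3_antipode_right1[OF s, where G = "%x z. rS H (%b1 b2. rS H (%c1 c2. G (a2 * b2 * z) (c1 * a1) (c2 * b1 * x) h1))" for a1 a2])
   (intro hlin_intros G')+
 also have "\<dots> = rS H (%c1 c2. rS H (%a1 a2. rS H (%b1 b2. G (a2 * b2) (c1 * a1) (c2 * b1 * w1) h1)))"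
  by (subst ssum_swap21) simp
 finally show "dS H w1 (%h2 w2. dS H w2 (%h3 w3. dS H w3 (%h4 w4. dS H w4 (%h5 h6.
   rS H (%c1 c2. rS H (%a1 a2. rS H (%b1 b2.
    G (h3 * (a2 * b2) * ?S h6) (h5 * c1 * a1 * Sinv h2) (h4 * c2 * b1) h1))))))) =
  rS H (%c1 c2. rS H (%a1 a2. rS H (%b1 b2. G (a2 * b2) (c1 * a1) (c2 * b1 * w1) h1)))" .
qed

text \<open>The map D for one handle and no puncture: the two copies of H commute and give the unit
  form no further action, so the product of the two factors is a single pure tensor, with h1 in the
  second copy.\<close>

definition D10 :: "'h => ('k, 'h) HH_elt"
 where "D10 h = dS H h (%h1 h2. HHpure H (counit H) h2 h1)"

lemma D10_closed: "D10 h \<in>: HH H"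
 unfolding D10_def by (intro ssum_closed is_vspace_HH) (simp add: HHpure_closed counit_Hdual)

lemma hlin_D10 [hlin_intros]: "hlin H (hscale H) f ==> hlin H fscale (%x. D10 (f x))"
 unfolding D10_def by (intro hlin_intros counit_Hdual)

lemma D10_one: "D10 1 = aone (HH H)"
proof -
 have "D10 1 = HHpure H (counit H) 1 1"
  unfolding D10_def by (rule dS_one[OF vector_space_fscale]) (intro hlin_intros counit_Hdual)+
 then show ?thesis by simp
qed

lemma D10_mult: "D10 (x * y) = amult (HH H) (D10 x) (D10 y)"
proof -
 have "D10 (x * y) = dS H x (%a b. dS H y (%c d. HHpure H (counit H) (b * d) (a * c)))"
  unfolding D10_def by (rule dS_mult[OF vector_space_fscale]) (intro hlin_intros counit_Hdual)+
 also have "\<dots> = dS H y (%c d. dS H x (%a b. HHpure H (counit H) (b * d) (a * c)))"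
  by (rule ssum_swap)
 finally show ?thesis
  unfolding D10_def by (simp add: HH_mult_sums HHpure_closed counit_Hdual ssum_closed[OF is_vspace_tensor] HH_mult_counit)
qed

text \<open>Expanding the products gives six Sweedler components, two of which feed each of the
  first copy, the second copy and the coadjoint action. Coassociativity puts them in the order of
  \<open>handle_moment\<close>.\<close>

lemma Pb_moment:
 assumes d: "\<beta> \<in>: Hdual H"
 shows "dS H h (%u v. amult (HH H) (D10 u) (Pb (coad01 H v \<beta>) 1)) = amult (HH H) (Pb \<beta> 1) (D10 h)"
proof -
 note s = vector_space_fscale
 define G where "G l r m t = HHpure H (l \<triangleright> \<beta> \<triangleleft> r) m t" for l r m t
 have G: "\<And>r m t. hlin H fscale (%l. G l r m t)" "\<And>l m t. hlin H fscale (%r. G l r m t)"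
  "\<And>l r t. hlin H fscale (%m. G l r m t)" "\<And>l r m. hlin H fscale (%t. G l r m t)"
  unfolding G_def by (intro hlin_intros dual_intros d)+
 note G' = hlin_comp[OF G(1)] hlin_comp[OF G(2)] hlin_comp[OF G(3)] hlin_comp[OF G(4)] s
 define K where "K t1 t2 k1 k2 v1 v2 = rS H (%c1 c2. rS H (%a1 a2. rS H (%b1 b2.
  G (k1 * (a2 * b2) * antipode H v2) (v1 * c1 * a1 * Sinv t2) (k2 * c2 * b1) t1)))" for t1 t2 k1 k2 v1 v2
 have K: "hlin H (hscale H) f ==> hlin H fscale (%x. K (f x) t2 k1 k2 v1 v2)"
  "hlin H (hscale H) f ==> hlin H fscale (%x. K t1 (f x) k1 k2 v1 v2)"
  "hlin H (hscale H) f ==> hlin H fscale (%x. K t1 t2 (f x) k2 v1 v2)"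
  "hlin H (hscale H) f ==> hlin H fscale (%x. K t1 t2 k1 (f x) v1 v2)"
  "hlin H (hscale H) f ==> hlin H fscale (%x. K t1 t2 k1 k2 (f x) v2)"
  "hlin H (hscale H) f ==> hlin H fscale (%x. K t1 t2 k1 k2 v1 (f x))" for f t1 t2 k1 k2 v1 v2
  unfolding K_def by (intro hlin_intros G'; assumption)+
 have 1: "amult (HH H) (HHpure H (counit H) k t) (Pb (coad01 H v \<beta>) 1) =
  dS H t (%t1 t2. dS H k (%k1 k2. dS H v (%v1 v2. K t1 t2 k1 k2 v1 v2)))" for k t v
 proof -
  have "Pb (coad01 H v \<beta>) 1 = dS H v (%v1 v2. Pb (antipode H v2 \<triangleright> \<beta> \<triangleleft> v1) 1)"
   unfolding coad01_sum[OF Hdual_hlin[OF d]]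
   by (rule linear_on_ssum[OF is_vspace_Hdual linear_Pb]) (intro dual_intros d)
  moreover have "amult (HH H) (HHpure H (counit H) k t) (Pb (antipode H v2 \<triangleright> \<beta> \<triangleleft> v1) 1) =
   dS H t (%t1 t2. dS H k (%k1 k2. K t1 t2 k1 k2 v1 v2))" for v1 v2
  proof -
   have "amult (HH H) (HHpure H (counit H) k t) (Pb (antipode H v2 \<triangleright> \<beta> \<triangleleft> v1) 1) =
    rS H (%c1 c2. rS H (%a1 a2. rS H (%b1 b2. dS H k (%k1 k2. dS H t (%t1 t2.
    G (k1 * (a2 * b2) * antipode H v2) (v1 * c1 * a1 * Sinv t2) (k2 * c2 * b1) t1)))))"
    unfolding Pb_ops
    by (simp add: HH_mult_sums HHpure_closed dual_intros d counit_Hdual ssum_closed[OF is_vspace_tensor] HH_mult(2) star_unit)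
     (simp add: G_def lact_ract lact_lact ract_ract mult.assoc)
   also have "\<dots> = dS H k (%k1 k2. dS H t (%t1 t2. K t1 t2 k1 k2 v1 v2))"
    unfolding K_def by (simp only: ssum_rot4[of H "comul H k"] ssum_rot4[of H "comul H t"])
   finally show ?thesis by (simp only: ssum_swap[of H "comul H k"])
  qed
  ultimately have "amult (HH H) (HHpure H (counit H) k t) (Pb (coad01 H v \<beta>) 1) =
   dS H v (%v1 v2. dS H t (%t1 t2. dS H k (%k1 k2. K t1 t2 k1 k2 v1 v2)))"
   by (simp add: HH_mult_sums HHpure_closed Pb_closed[simplified] dual_intros d counit_Hdual)
  then show ?thesis by (simp only: ssum_swap12[of H "comul H v"])
 qed
 have "dS H h (%u v. amult (HH H) (D10 u) (Pb (coad01 H v \<beta>) 1)) =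
  dS H h (%u v. dS H u (%t k. dS H t (%t1 t2. dS H k (%k1 k2. dS H v (%v1 v2. K t1 t2 k1 k2 v1 v2)))))"
  unfolding D10_def by (simp add: HH_mult_sums HHpure_closed counit_Hdual Pb_closed[simplified] coad01_Hdual d 1)
 also have "\<dots> = dS H h (%t w. dS H w (%k v. dS H t (%t1 t2. dS H k (%k1 k2. dS H v (%v1 v2. K t1 t2 k1 k2 v1 v2)))))"
  by (rule dS_coassoc[OF s]) (intro hlin_intros s K)+
 also have "\<dots> = dS H h (%t w. dS H t (%t1 t2. dS H w (%k v. dS H k (%k1 k2. dS H v (%v1 v2. K t1 t2 k1 k2 v1 v2)))))"
  by (rule ssum_cong, rule ssum_swap)
 also have "\<dots> = dS H h (%t w. dS H t (%t1 t2. dS H w (%k1 w'. dS H w' (%k2 v. dS H v (%v1 v2. K t1 t2 k1 k2 v1 v2)))))"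
  by (rule ssum_cong, rule ssum_cong, rule dS_coassoc[OF s]) (intro hlin_intros s K)+
 also have "\<dots> = dS H h (%t1 w1. dS H w1 (%t2 w. dS H w (%k1 w'. dS H w' (%k2 v. dS H v (%v1 v2. K t1 t2 k1 k2 v1 v2)))))"
  by (rule dS_coassoc[OF s]) (intro hlin_intros s K)+
 also have "\<dots> = dS H h (%h1 w1. rS H (%c1 c2. rS H (%a1 a2. rS H (%b1 b2. G (a2 * b2) (c1 * a1) (c2 * b1 * w1) h1))))"
  unfolding K_def by (rule handle_moment[OF s G])
 also have "\<dots> = dS H h (%h1 h2. amult (HH H) (Pb \<beta> 1) (HHpure H (counit H) h2 h1))"
  unfolding Pb_ops
  by (simp add: HH_mult_sums HHpure_closed dual_intros d counit_Hdual ssum_closed[OF is_vspace_tensor] HH_mult_counit G_def)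
 also have "\<dots> = amult (HH H) (Pb \<beta> 1) (D10 h)"
  unfolding D10_def by (simp add: HH_mult_sums HHpure_closed counit_Hdual Pb_closed[simplified] d)
 finally show ?thesis .
qed

text \<open>By the factorisation, D is moved past the image of \<beta> and then past that of
  \<alpha>, with coassociativity in between. In the latter move the second copy of H is a spectator
  and the puncture identity is applied in the first copy.\<close>

lemma Phi10_moment:
 assumes "X \<in>: L10 H"
 shows "dS H h (%u v. amult (HH H) (D10 u) (Phi10 H (coad10 H v X))) = amult (HH H) (Phi10 H X) (D10 h)"
proof (rule L10_linear_eq[OF vector_space_fscale _ _ _ assms])
 let ?m = "amult (HH H)" and ?Q = "%k. HHpure H (counit H) k 1"
 note s = vector_space_fscale
 note mm = bilinear_onD[OF HH_mult(1)]
 have P: "linear_on (L10 H) (vscale (HH H)) (Phi10 H)" using Phi10_lift(1) by simp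
 have c10: "linear_on (L10 H) (vscale (L10 H)) (coad10 H v)" for v using coad10_lift(1) by simp
 show "linear_on (L10 H) fscale (%X. dS H h (%u v. ?m (D10 u) (Phi10 H (coad10 H v X))))"
  by (rule linear_on_ssum_fun[OF s], rule linear_on_via[OF mm(1)[OF D10_closed] linear_on_via[OF P c10 coad10_closed] Phi10_closed[OF coad10_closed]])
 show "linear_on (L10 H) fscale (%X. ?m (Phi10 H X) (D10 h))"
  by (rule linear_on_via[OF mm(2)[OF D10_closed] P Phi10_closed])
 fix \<beta> \<alpha> assume d: "\<beta> \<in>: Hdual H" "\<alpha> \<in>: Hdual H"
 have Qc: "?Q k \<in>: HH H" for k using HHpure_closed[OF counit_Hdual] by simp
 have Pc: "Pb (coad01 H v \<beta>) k \<in>: HH H" for v k by (intro Pb_closed coad01_Hdual d)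
 note cc = HH_closed Pc Pb_closed[OF d(1)] Qc D10_closed
 have l1: "hlin H fscale (%v. ?m X (?m (Pb (coad01 H (f v) \<beta>) 1) Y))" if "hlin H (hscale H) f" "X \<in>: HH H" "Y \<in>: HH H" for f X Y
 proof -
  have "hlin H fscale (%v. Pb (coad01 H (f v) \<beta>) 1)" by (intro hlin_intros dual_intros coad01_Hdual d that)
  then show ?thesis using mm(1)[OF that(2)] mm(2)[OF that(3)] Pc HH_closed[OF Pc that(3)] by (simp add: hlin_def linear_on_def)
 qed
 have l2: "hlin H fscale (%v. ?m X (?Q (Phi01 H (coad01 H v \<alpha>))))" if "X \<in>: HH H" for X
 proof -
  have "hlin H fscale (%v. ?Q (Phi01 H (coad01 H v \<alpha>)))" by (intro hlin_intros dual_intros coad01_Hdual counit_Hdual d)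
  then show ?thesis using mm(1)[OF that] Qc by (simp add: hlin_def linear_on_def)
 qed
 have l3: "hlin H fscale (%v. ?m (D10 v) X)" if "X \<in>: HH H" for X
  using hlin_D10[OF hlin_id] mm(2)[OF that] D10_closed by (simp add: hlin_def linear_on_def)
 have q: "dS H h (%w v. ?m (D10 w) (?Q (Phi01 H (coad01 H v \<alpha>)))) = ?m (?Q (Phi01 H \<alpha>)) (D10 h)" for h
 proof -
  have "dS H h (%w v. ?m (D10 w) (?Q (Phi01 H (coad01 H v \<alpha>)))) =
   dS H h (%w v. dS H w (%h1 h2. HHpure H (counit H) (h2 * Phi01 H (coad01 H v \<alpha>)) h1))"
   unfolding D10_def by (simp add: HH_mult_sums HHpure_closed counit_Hdual HH_mult_counit)
  also have "\<dots> = dS H h (%h1 w. dS H w (%h2 v. HHpure H (counit H) (h2 * Phi01 H (coad01 H v \<alpha>)) h1))"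
   by (rule dS_coassoc[OF s]) (intro hlin_intros counit_Hdual coad01_Hdual d)+
  also have "\<dots> = dS H h (%h1 w. HHpure H (counit H) (dS H w (%h2 v. h2 * Phi01 H (coad01 H v \<alpha>))) h1)"
   by (rule ssum_cong, rule hlin_mono_comp[symmetric, OF hlin_HHpure(2)[OF hlin_id counit_Hdual]])
  also have "\<dots> = dS H h (%h1 w. HHpure H (counit H) (Phi01 H \<alpha> * w) h1)"
   by (simp only: Phi01_moment[OF d(2)])
  also have "\<dots> = ?m (?Q (Phi01 H \<alpha>)) (D10 h)"
   unfolding D10_def by (simp add: HH_mult_sums HHpure_closed counit_Hdual HH_mult_counit)
  finally show ?thesis .
 qed
 have "dS H h (%u v. ?m (D10 u) (Phi10 H (coad10 H v (pr H \<beta> \<alpha>)))) =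
  dS H h (%u v. dS H v (%v1 v2. ?m (D10 u) (?m (Pb (coad01 H v1 \<beta>) 1) (?Q (Phi01 H (coad01 H v2 \<alpha>))))))"
 proof (rule ssum_cong)
  fix u v
  have "Phi10 H (coad10 H v (pr H \<beta> \<alpha>)) = dS H v (%v1 v2. ?m (Pb (coad01 H v1 \<beta>) 1) (?Q (Phi01 H (coad01 H v2 \<alpha>))))"
   unfolding coad10_lift(2)[OF d]
   by (subst linear_on_ssum[OF is_vspace_L10 Phi10_lift(1)]) (intro pr_closed coad01_Hdual d, simp only: Phi10_factor coad01_Hdual d)
  then show "?m (D10 u) (Phi10 H (coad10 H v (pr H \<beta> \<alpha>))) =
   dS H v (%v1 v2. ?m (D10 u) (?m (Pb (coad01 H v1 \<beta>) 1) (?Q (Phi01 H (coad01 H v2 \<alpha>)))))"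
   by (simp only: HH_mult_sums(2) cc)
 qed
 also have "\<dots> = dS H h (%w v2. dS H w (%u v1. ?m (D10 u) (?m (Pb (coad01 H v1 \<beta>) 1) (?Q (Phi01 H (coad01 H v2 \<alpha>))))))"
  by (rule dS_coassoc[OF s, symmetric])
   (rule l3 cc | rule l1[OF hlin_id] cc | simp only: HH_assoc[symmetric] cc, rule l2 cc)+
 also have "\<dots> = dS H h (%w v2. ?m (?m (Pb \<beta> 1) (D10 w)) (?Q (Phi01 H (coad01 H v2 \<alpha>))))"
  by (simp only: HH_assoc[symmetric] cc HH_mult_sums(1)[symmetric] Pb_moment[OF d(1)])
 also have "\<dots> = ?m (Pb \<beta> 1) (dS H h (%w v2. ?m (D10 w) (?Q (Phi01 H (coad01 H v2 \<alpha>)))))"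
  by (simp only: HH_assoc cc HH_mult_sums(2))
 also have "\<dots> = ?m (Phi10 H (pr H \<beta> \<alpha>)) (D10 h)"
  by (simp only: q Phi10_factor d HH_assoc cc)
 finally show "dS H h (%u v. ?m (D10 u) (Phi10 H (coad10 H v (pr H \<beta> \<alpha>)))) = ?m (Phi10 H (pr H \<beta> \<alpha>)) (D10 h)" .
qed

end

section \<open>Splitting off a tensor factor\<close>

lemma alg_ssum:
 assumes "is_alg A" "\<And>a b. F a b \<in>: A" "Y \<in>: A"
 shows "amult A (ssum H t F) Y = ssum H t (%a b. amult A (F a b) Y)"
  and "amult A Y (ssum H t F) = ssum H t (%a b. amult A Y (F a b))"
 using linear_on_ssum[OF is_alg_vspace bilinear_onD(2)[OF is_alg_bilinear]]
  linear_on_ssum[OF is_alg_vspace bilinear_onD(1)[OF is_alg_bilinear]] assms by blast+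

lemma hlin_linear:
 "linear_on V s K ==> hlin H (vscale V) F ==> (\<And>x. F x \<in>: V) ==> hlin H s (%x. K (F x))"
 by (simp add: hlin_def linear_on_def)

lemma is_assoc_alg_is_alg: "is_assoc_alg A ==> is_alg A"
 by (simp add: is_assoc_alg_def)

context quasitriangular_bij
begin

text \<open>Records only bilinearity and closure; the unit and composition laws of an action belong
  to \<open>is_modalg\<close>.\<close>

definition is_act :: "('k, 'm::ab_group_add) kalg => ('h => 'm => 'm) => bool"
 where "is_act M act \<longleftrightarrow> (\<forall>h. linear_on M (vscale M) (act h)) \<and>
  (\<forall>m\<in>vcarrier M. hlin H (vscale M) (%h. act h m)) \<and> (\<forall>h. \<forall>m\<in>vcarrier M. act h m \<in>: M)"

lemma is_actD:
 assumes "is_act M act"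
 shows "m \<in>: M ==> act h m \<in>: M" and "linear_on M (vscale M) (act h)"
  and "m \<in>: M ==> hlin H (vscale M) (%h. act h m)"
 using assms by (simp_all add: is_act_def)

text \<open>Right module algebras. The unit laws of the product are listed because
  \<open>is_alg\<close> asks only for a distinguished element.\<close>

definition is_modalg :: "('k, 'm::ab_group_add) kalg => ('h => 'm => 'm) => bool"
 where "is_modalg M act \<longleftrightarrow> is_alg M \<and> is_act M act \<and>
  (\<forall>m\<in>vcarrier M. amult M (aone M) m = m \<and> amult M m (aone M) = m \<and> act 1 m = m \<and>
   (\<forall>h k. act k (act h m) = act (h * k) m)) \<and>
  (\<forall>h. act h (aone M) = vscale M (counit H h) (aone M)) \<and>
  (\<forall>h. \<forall>m\<in>vcarrier M. \<forall>m'\<in>vcarrier M.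
   act h (amult M m m') = dS H h (%u v. amult M (act u m) (act v m')))"

lemma is_modalgD:
 assumes "is_modalg M act"
 shows "is_alg M" and "is_act M act"
  and "m \<in>: M ==> amult M (aone M) m = m" and "m \<in>: M ==> amult M m (aone M) = m"
  and "m \<in>: M ==> act 1 m = m" and "m \<in>: M ==> act k (act h m) = act (h * k) m"
  and "act h (aone M) = vscale M (counit H h) (aone M)"
  and "m \<in>: M ==> m' \<in>: M ==> act h (amult M m m') = dS H h (%u v. amult M (act u m) (act v m'))"
 using assms by (simp_all add: is_modalg_def)

text \<open>
 The last clause says that \<open>D\<close> is a quantum moment map: it implements the action on the image of
 \<open>\<Phi>\<close> by inner multiplications. It is what makes multiplicativity of \<open>\<Phi>\<close> an inductive statement.
\<close>

definition moment_map ::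
  "('k, 'm::ab_group_add) kalg => ('h => 'm => 'm) => ('k, 'b::ab_group_add) kalg =>
   ('m => 'b) => ('h => 'b) => bool"
 where "moment_map M act B \<Phi> D \<longleftrightarrow> is_alg M \<and> is_act M act \<and> is_assoc_alg B \<and>
  linear_on M (vscale B) \<Phi> \<and> (\<forall>m\<in>vcarrier M. \<Phi> m \<in>: B) \<and>
  (\<forall>m\<in>vcarrier M. \<forall>m'\<in>vcarrier M. \<Phi> (amult M m m') = amult B (\<Phi> m) (\<Phi> m')) \<and> \<Phi> (aone M) = aone B \<and>
  hlin H (vscale B) D \<and> (\<forall>h. D h \<in>: B) \<and> (\<forall>h k. D (h * k) = amult B (D h) (D k)) \<and> D 1 = aone B \<and>
  (\<forall>h. \<forall>m\<in>vcarrier M. dS H h (%u v. amult B (D u) (\<Phi> (act v m))) = amult B (\<Phi> m) (D h))"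

lemma moment_mapD:
 assumes "moment_map M act B \<Phi> D"
 shows "is_alg M" and "is_act M act" and "is_assoc_alg B" and "is_alg B"
  and "linear_on M (vscale B) \<Phi>" and "m \<in>: M ==> \<Phi> m \<in>: B"
  and "m \<in>: M ==> m' \<in>: M ==> \<Phi> (amult M m m') = amult B (\<Phi> m) (\<Phi> m')" and "\<Phi> (aone M) = aone B"
  and "hlin H (vscale B) D" and "D h \<in>: B" and "D (h * k) = amult B (D h) (D k)" and "D 1 = aone B"
  and "m \<in>: M ==> dS H h (%u v. amult B (D u) (\<Phi> (act v m))) = amult B (\<Phi> m) (D h)"
 using assms by (simp_all add: moment_map_def is_assoc_algD)

text \<open>The hypotheses list what the splittings for a handle and for a puncture have in common,
  so that one computation serves both. Besides \<open>mult\<close>, the conclusion reproduces the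
  moment identity \<open>mom\<close>, without which the next splitting could not be treated.\<close>

lemma moment_map_step:
 fixes M0 :: "('k, 'm0::ab_group_add) kalg" and M1 :: "('k, 'm1::ab_group_add) kalg"
  and M2 :: "('k, 'm2::ab_group_add) kalg" and B0 :: "('k, 'b0::ab_group_add) kalg"
  and B1 :: "('k, 'b1::ab_group_add) kalg" and B2 :: "('k, 'b2::ab_group_add) kalg"
 assumes ma: "is_modalg M0 act0" and mm0: "moment_map M0 act0 B0 \<Phi>0 D0" and mm1: "moment_map M1 act1 B1 \<Phi>1 D1"
  and C: "tensor_step M0 M1 M2 C" and C': "tensor_step B0 B1 B2 C'"
  and M2: "is_alg M2" and act2: "is_act M2 act2" and B2: "is_assoc_alg B2"
  and MC: "\<And>m n m' n'. m \<in>: M0 ==> n \<in>: M1 ==> m' \<in>: M0 ==> n' \<in>: M1 ==>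
   amult M2 (C m n) (C m' n') = rS H (%a b. C (amult M0 m (act0 a m')) (amult M1 (act1 b n) n'))"
  and BC: "\<And>x t x' t'. x \<in>: B0 ==> t \<in>: B1 ==> x' \<in>: B0 ==> t' \<in>: B1 ==>
   amult B2 (C' x t) (C' x' t') = C' (amult B0 x x') (amult B1 t t')"
  and one: "aone M2 = C (aone M0) (aone M1)" "aone B2 = C' (aone B0) (aone B1)"
  and act2C: "\<And>h m n. m \<in>: M0 ==> n \<in>: M1 ==>
   act2 h (C m n) = dS H h (%u v. C (act0 u m) (act1 v n))"
  and D2: "\<And>h. D2 h = dS H h (%u v. C' (D0 u) (D1 v))"
  and \<Phi>2: "linear_on M2 (vscale B2) \<Phi>2"
  and \<Phi>2C: "\<And>m n. m \<in>: M0 ==> n \<in>: M1 ==>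
   \<Phi>2 (C m n) = rS H (%a b. C' (\<Phi>0 (act0 a m)) (amult B1 (D1 b) (\<Phi>1 n)))"
 shows "moment_map M2 act2 B2 \<Phi>2 D2"
proof -
 note m0 = moment_mapD[OF mm0] and m1 = moment_mapD[OF mm1] and md = is_modalgD[OF ma]
 note al = m0(1) m1(1) M2 m0(4) m1(4) is_assoc_algD(4)[OF B2]
 note V = al[THEN is_alg_vspace]
 note s = V[THEN is_vspace_vector_space]
 note acts = m0(2) m1(2) act2
 note c = acts[THEN is_actD(1)] m0(6,10) m1(6,10) tensor_step_closed[OF C] tensor_step_closed[OF C']
  al[THEN is_alg_closed] al[THEN is_alg_one]
 note bC = tensor_stepD(4)[OF C] and bC' = tensor_stepD(4)[OF C'] and span = tensor_stepD(5)[OF C]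
 note aM0 = al(1) and aB0 = al(4) and aB1 = al(5) and aB2 = al(6) and l\<Phi> = m0(5) m1(5)
 note bl = bC bC' al[THEN is_alg_bilinear]
 note LL = hlin_ssum hlin_dS_comp hlin_id hlin_mult_left hlin_mult_right acts[THEN is_actD(3), THEN hlin_comp]
  m0(9)[THEN hlin_comp] m1(9)[THEN hlin_comp] l\<Phi>[THEN hlin_linear]
  bl[THEN bilinear_onD(1), THEN hlin_linear] bl[THEN bilinear_onD(2), THEN hlin_linear] s c
 have sC'1: "C' (ssum H t F) y = ssum H t (%a b. C' (F a b) y)" if "y \<in>: B1" "\<And>a b. F a b \<in>: B0" for t F y
  by (rule linear_on_ssum[OF V(4) bilinear_onD(2)[OF bC' that(1)] that(2)])
 have sC'2: "C' y (ssum H t F) = ssum H t (%a b. C' y (F a b))" if "y \<in>: B0" "\<And>a b. F a b \<in>: B1" for t F y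
  by (rule linear_on_ssum[OF V(5) bilinear_onD(1)[OF bC' that(1)] that(2)])
 note as1 = is_assoc_algD(1)[OF m1(3)] and un1 = is_assoc_algD(2,3)[OF m1(3)]
 note act0 = md(5,6) and act0_mult = md(8) and \<Phi>m = m0(7) and \<Phi>n = m1(7)
 note Dm = m0(11) m1(11) and mom0 = m0(13) and mom1 = m1(13)
 have c\<Phi>2: "\<Phi>2 m \<in>: B2" if "m \<in>: M2" for m
  by (rule span_closed[OF V(3) span \<Phi>2 V(6) _ that]) (auto simp: \<Phi>2C intro!: ssum_closed V c)
 have cD2: "D2 h \<in>: B2" for h
  unfolding D2 by (intro ssum_closed V c)
 have mult: "\<Phi>2 (amult M2 m m') = amult B2 (\<Phi>2 m) (\<Phi>2 m')" if mm: "m \<in>: M2" "m' \<in>: M2" for m m'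
 proof (rule span_bilinear_eq[OF V(3) span V(3) span s(6) _ _ _ mm])
  show "bilinear_on M2 M2 (vscale B2) (%m m'. \<Phi>2 (amult M2 m m'))"
   by (intro bilinear_onI linear_on_via[OF \<Phi>2] bilinear_onD[OF is_alg_bilinear[OF M2]] c; assumption)
  show "bilinear_on M2 M2 (vscale B2) (%m m'. amult B2 (\<Phi>2 m) (\<Phi>2 m'))"
   by (rule bilinear_onI, rule linear_on_via[OF bilinear_onD(1)[OF is_alg_bilinear[OF aB2]] \<Phi>2 c\<Phi>2], erule c\<Phi>2, assumption,
    rule linear_on_via[OF bilinear_onD(2)[OF is_alg_bilinear[OF aB2]] \<Phi>2 c\<Phi>2], erule c\<Phi>2, assumption)
  fix x y assume "x \<in> {C v w |v w. v \<in>: M0 \<and> w \<in>: M1}" "y \<in> {C v w |v w. v \<in>: M0 \<and> w \<in>: M1}"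
  then obtain m n m' n' where x: "x = C m n" and y: "y = C m' n'"
   and d: "m \<in>: M0" "n \<in>: M1" "m' \<in>: M0" "n' \<in>: M1" by blast
  have "\<Phi>2 (amult M2 x y) = rS H (%p q. \<Phi>2 (C (amult M0 m (act0 p m')) (amult M1 (act1 q n) n')))"
   unfolding x y MC[OF d] by (rule linear_on_ssum[OF V(3) \<Phi>2]) (intro c d)
  \<comment> \<open>\<open>p\<close>, \<open>q\<close> is the copy of R from the braided product and
    \<open>a\<close>, \<open>b\<close> the one from \<open>\<Phi>2\<close>; the action of
    \<open>a\<close> on a product brings in its coproduct.\<close>
  also have "\<dots> = rS H (%p q. rS H (%a b. dS H a (%a1 a2.
    C' (amult B0 (\<Phi>0 (act0 a1 m)) (\<Phi>0 (act0 (p * a2) m'))) (amult B1 (D1 b) (amult B1 (\<Phi>1 (act1 q n)) (\<Phi>1 n'))))))"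
  proof (rule ssum_cong)
   fix p q
   have "\<Phi>0 (act0 a (amult M0 m (act0 p m'))) = dS H a (%a1 a2. amult B0 (\<Phi>0 (act0 a1 m)) (\<Phi>0 (act0 (p * a2) m')))" for a
    by (simp add: act0_mult d c linear_on_ssum[OF V(1) l\<Phi>(1)] \<Phi>m act0)
   then show "\<Phi>2 (C (amult M0 m (act0 p m')) (amult M1 (act1 q n) n')) = rS H (%a b. dS H a (%a1 a2.
    C' (amult B0 (\<Phi>0 (act0 a1 m)) (\<Phi>0 (act0 (p * a2) m'))) (amult B1 (D1 b) (amult B1 (\<Phi>1 (act1 q n)) (\<Phi>1 n')))))"
    by (simp add: \<Phi>2C d c \<Phi>n sC'1)
  qed
  also have "\<dots> = rS H (%p q. rS H (%a b. rS H (%a' b'.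
    C' (amult B0 (\<Phi>0 (act0 a m)) (\<Phi>0 (act0 (p * a') m'))) (amult B1 (D1 (b * b')) (amult B1 (\<Phi>1 (act1 q n)) (\<Phi>1 n'))))))"
   by (rule ssum_cong, rule rS_comul_left[OF s(6)]) (intro LL d)+
  also have "\<dots> = rS H (%a b. rS H (%p q. rS H (%a' b'.
    C' (amult B0 (\<Phi>0 (act0 a m)) (\<Phi>0 (act0 (p * a') m'))) (amult B1 (D1 (b * b')) (amult B1 (\<Phi>1 (act1 q n)) (\<Phi>1 n'))))))"
   by (rule ssum_swap)
  \<comment> \<open>Two copies multiply in the first leg as \<open>p * a'\<close>. They come from a
    single copy whose second leg is split, one component going to \<open>D1\<close> and the other
    acting on \<open>n\<close>: this is the left-hand side of the moment identity of the remaining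
    factor.\<close>
  also have "\<dots> = rS H (%a b. rS H (%p q. dS H q (%q1 q2.
    C' (amult B0 (\<Phi>0 (act0 a m)) (\<Phi>0 (act0 p m'))) (amult B1 (D1 (b * q1)) (amult B1 (\<Phi>1 (act1 q2 n)) (\<Phi>1 n'))))))"
   by (rule ssum_cong, rule rS_comul_right[OF s(6), symmetric, where F = "%p q1 q2.
    C' (amult B0 (\<Phi>0 (act0 a m)) (\<Phi>0 (act0 p m'))) (amult B1 (D1 (b * q1)) (amult B1 (\<Phi>1 (act1 q2 n)) (\<Phi>1 n')))" for a b])
    (intro LL d)+
  also have "\<dots> = rS H (%a b. rS H (%p q.
    C' (amult B0 (\<Phi>0 (act0 a m)) (\<Phi>0 (act0 p m'))) (amult B1 (amult B1 (D1 b) (\<Phi>1 n)) (amult B1 (D1 q) (\<Phi>1 n')))))"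
  proof (intro ssum_cong)
   fix a b p q
   have "dS H q (%q1 q2. amult B1 (D1 (b * q1)) (amult B1 (\<Phi>1 (act1 q2 n)) (\<Phi>1 n'))) =
    amult B1 (D1 b) (amult B1 (dS H q (%q1 q2. amult B1 (D1 q1) (\<Phi>1 (act1 q2 n)))) (\<Phi>1 n'))"
    by (simp add: alg_ssum[OF aB1] ssum_closed[OF V(5)] c d Dm as1)
   also have "\<dots> = amult B1 (amult B1 (D1 b) (\<Phi>1 n)) (amult B1 (D1 q) (\<Phi>1 n'))"
    by (simp add: mom1 c d as1)
   finally show "dS H q (%q1 q2. C' (amult B0 (\<Phi>0 (act0 a m)) (\<Phi>0 (act0 p m'))) (amult B1 (D1 (b * q1)) (amult B1 (\<Phi>1 (act1 q2 n)) (\<Phi>1 n')))) =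
    C' (amult B0 (\<Phi>0 (act0 a m)) (\<Phi>0 (act0 p m'))) (amult B1 (amult B1 (D1 b) (\<Phi>1 n)) (amult B1 (D1 q) (\<Phi>1 n')))"
    by (simp add: sC'2[symmetric] c d)
  qed
  also have "\<dots> = amult B2 (\<Phi>2 x) (\<Phi>2 y)"
   unfolding x y by (simp add: \<Phi>2C d alg_ssum[OF aB2] ssum_closed[OF V(6)] c BC) (rule ssum_swap)
  finally show "\<Phi>2 (amult M2 x y) = amult B2 (\<Phi>2 x) (\<Phi>2 y)" .
 qed
 have \<Phi>one: "\<Phi>2 (aone M2) = aone B2"
 proof -
  have e: "C' (\<Phi>0 (act0 a (aone M0))) y = vscale B2 (counit H a) (C' (aone B0) y)" if "y \<in>: B1" for a y
   using ma mm0 linear_on_scale[OF l\<Phi>(1) is_alg_one[OF aM0]]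
    linear_on_scale[OF bilinear_onD(2)[OF bC' that] is_alg_one[OF aB0]] by (simp add: is_modalg_def moment_map_def)
  have "\<Phi>2 (aone M2) = rS H (%a b. vscale B2 (counit H a) (C' (aone B0) (D1 b)))"
   using mm1 by (simp add: one \<Phi>2C c e un1 moment_map_def)
  also have "\<dots> = C' (aone B0) (D1 1)"
   by (rule rS_counit_left[OF s(6)]) (intro LL)
  also have "\<dots> = aone B2" using mm1 by (simp add: one moment_map_def)
  finally show ?thesis .
 qed
 have hD2: "hlin H (vscale B2) D2"
  unfolding D2 by (intro LL)
 have D2m: "D2 (h * k) = amult B2 (D2 h) (D2 k)" for h k
 proof -
  have "D2 (h * k) = dS H h (%a b. dS H k (%p q. C' (D0 (a * p)) (D1 (b * q))))"
   unfolding D2 by (rule dS_mult[OF s(6)]) (intro LL)+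
  also have "\<dots> = dS H k (%p q. dS H h (%a b. C' (D0 (a * p)) (D1 (b * q))))"
   by (rule ssum_swap)
  finally show ?thesis by (simp add: D2 alg_ssum[OF aB2] ssum_closed[OF V(6)] c BC Dm)
 qed
 have D2o: "D2 1 = aone B2"
 proof -
  have "D2 1 = C' (D0 1) (D1 1)"
   unfolding D2 by (rule dS_one[OF s(6)]) (intro LL)+
  then show ?thesis using mm0 mm1 by (simp add: one moment_map_def)
 qed
 have mom: "dS H h (%u v. amult B2 (D2 u) (\<Phi>2 (act2 v m))) = amult B2 (\<Phi>2 m) (D2 h)" if mm: "m \<in>: M2" for h m
 proof (rule span_linear_eq[OF V(3) span s(6) _ _ _ mm])
  show "linear_on M2 (vscale B2) (%m. dS H h (%u v. amult B2 (D2 u) (\<Phi>2 (act2 v m))))"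
   by (rule linear_on_ssum_fun[OF s(6)], rule linear_on_via[OF bilinear_onD(1)[OF is_alg_bilinear[OF aB2] cD2]
    linear_on_via[OF \<Phi>2]]) (use act2 in \<open>auto simp: is_act_def intro: c\<Phi>2\<close>)
  show "linear_on M2 (vscale B2) (%m. amult B2 (\<Phi>2 m) (D2 h))"
   by (rule linear_on_via[OF bilinear_onD(2)[OF is_alg_bilinear[OF aB2] cD2] \<Phi>2 c\<Phi>2])
  fix x assume "x \<in> {C v w |v w. v \<in>: M0 \<and> w \<in>: M1}"
  then obtain m n where x: "x = C m n" and d: "m \<in>: M0" "n \<in>: M1" by blast
  define G where "G h1 k h3 l h4 = C' (amult B0 (D0 h1) (\<Phi>0 (act0 k m))) (amult B1 (D1 l) (\<Phi>1 (act1 h4 n)))" for h1 k h3 l h4 :: 'h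
  have G: "hlin H (hscale H) f ==> hlin H (vscale B2) (%x. G (f x) k h3 l h4)"
   "hlin H (hscale H) f ==> hlin H (vscale B2) (%x. G h1 (f x) h3 l h4)"
   "hlin H (hscale H) f ==> hlin H (vscale B2) (%x. G h1 k h3 (f x) h4)"
   "hlin H (hscale H) f ==> hlin H (vscale B2) (%x. G h1 k h3 l (f x))" for f h1 k h3 l h4
   unfolding G_def by (intro LL d; assumption)+
  note G' = G hlin_ssum hlin_dS_comp hlin_id hlin_mult_left hlin_mult_right s
  have 1: "amult B2 (C' x0 x1) (\<Phi>2 (act2 v (C m n))) =
   dS H v (%h3 h4. rS H (%a b. C' (amult B0 x0 (\<Phi>0 (act0 (h3 * a) m))) (amult B1 x1 (amult B1 (D1 b) (\<Phi>1 (act1 h4 n))))))"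
   if "x0 \<in>: B0" "x1 \<in>: B1" for x0 x1 v
   by (simp add: act2C d linear_on_ssum[OF V(3) \<Phi>2] c \<Phi>2C alg_ssum[OF aB2] ssum_closed[OF V(6)] BC that act0)
  have "dS H h (%u v. amult B2 (D2 u) (\<Phi>2 (act2 v x))) =
   dS H h (%u v. dS H u (%h1 h2. dS H v (%h3 h4. rS H (%a b. G h1 (h3 * a) 1 (h2 * b) h4))))"
   unfolding x D2
   by (simp add: alg_ssum[OF aB2] ssum_closed[OF V(6)] c d c\<Phi>2 1) (simp add: G_def Dm as1 c d)
  also have "\<dots> = dS H h (%h1 w. dS H w (%h2 v. dS H v (%h3 h4. rS H (%a b. G h1 (h3 * a) 1 (h2 * b) h4))))"
   by (rule dS_coassoc[OF s(6)]) (intro G')+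
  \<comment> \<open>Quasi-cocommutativity exchanges \<open>h2\<close> and \<open>h3\<close>. Then
    \<open>h1\<close>, \<open>h2\<close> and \<open>h3\<close>, \<open>h4\<close> are the pairs that
    occur in the moment identities of the two factors.\<close>
  also have "\<dots> = dS H h (%h1 w. dS H w (%h2 v. dS H v (%h3 h4. rS H (%a b. G h1 (a * h2) 1 (b * h3) h4))))"
   by (rule ssum_cong, rule dS3_rS_first[OF s(6), where G = "%x y h4. G h1 x 1 y h4" for h1]) (intro G')+
  also have "\<dots> = dS H h (%u v. dS H u (%h1 h2. dS H v (%h3 h4. rS H (%a b. G h1 (a * h2) 1 (b * h3) h4))))"
   by (rule dS_coassoc[OF s(6), symmetric]) (intro G')+
  also have "\<dots> = dS H h (%u v. rS H (%a b. dS H u (%h1 h2. dS H v (%h3 h4. G h1 (a * h2) 1 (b * h3) h4))))"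
   by (rule ssum_cong, rule ssum_swap21)
  also have "\<dots> = dS H h (%u v. rS H (%a b. C' (amult B0 (\<Phi>0 (act0 a m)) (D0 u)) (amult B1 (D1 b) (amult B1 (\<Phi>1 n) (D1 v)))))"
  proof (intro ssum_cong)
   fix u v a b
   have "dS H u (%h1 h2. dS H v (%h3 h4. G h1 (a * h2) 1 (b * h3) h4)) =
    C' (dS H u (%h1 h2. amult B0 (D0 h1) (\<Phi>0 (act0 h2 (act0 a m)))))
     (amult B1 (D1 b) (dS H v (%h3 h4. amult B1 (D1 h3) (\<Phi>1 (act1 h4 n)))))"
    by (simp add: sC'1 sC'2 alg_ssum[OF aB1] ssum_closed[OF V(4)] ssum_closed[OF V(5)] c d G_def Dm as1 act0) (rule ssum_swap)
   then show "dS H u (%h1 h2. dS H v (%h3 h4. G h1 (a * h2) 1 (b * h3) h4)) =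
    C' (amult B0 (\<Phi>0 (act0 a m)) (D0 u)) (amult B1 (D1 b) (amult B1 (\<Phi>1 n) (D1 v)))"
    by (simp add: mom0 mom1 c d)
  qed
  also have "\<dots> = amult B2 (\<Phi>2 x) (D2 h)"
   unfolding x D2 by (simp add: \<Phi>2C alg_ssum[OF aB2] ssum_closed[OF V(6)] c d BC as1) (rule ssum_swap)?
  finally show "dS H h (%u v. amult B2 (D2 u) (\<Phi>2 (act2 v x))) = amult B2 (\<Phi>2 x) (D2 h)" .
 qed
 show ?thesis
  unfolding moment_map_def using M2 act2 B2 \<Phi>2 c\<Phi>2 mult \<Phi>one hD2 cD2 D2m D2o mom by blast
qed

end

section \<open>Iterated coproducts\<close>

lemma hmulti_Cons:
 fixes F :: "'h::ring_1 list => 'u::ab_group_add"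
 assumes "\<And>a. hmulti H m s (%hs. F (a # hs))" "\<And>hs. length hs = m ==> hlin H s (%a. F (a # hs))"
 shows "hmulti H (Suc m) s F"
 unfolding hmulti_def
proof (intro allI impI)
 fix hs :: "'h list" and i assume "length hs = Suc m" "i < Suc m"
 then obtain a hs' where "hs = a # hs'" "length hs' = m" by (cases hs) auto
 then show "hlin H s (%x. F (hs[i := x]))"
  using assms(1)[of a] assms(2)[of hs'] \<open>i < Suc m\<close> by (cases i) (auto simp: hmulti_def)
qed

lemma hmulti_tl:
 fixes F :: "'h::ring_1 list => 'u::ab_group_add"
 assumes "hmulti H (Suc m) s F"
 shows "hmulti H m s (%hs. F (a # hs))"
 unfolding hmulti_def
proof (intro allI impI)
 fix hs :: "'h list" and i assume "length hs = m" "i < m"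
 then show "hlin H s (%x. F (a # hs[i := x]))"
  using assms[unfolded hmulti_def, rule_format, of "a # hs" "Suc i"] by simp
qed

lemma hlift_cong:
 "(\<And>hs. length hs = m ==> F hs = G hs) ==> hlift H m s F = hlift H m s G"
 unfolding hlift_def by (rule tlift_cong) (auto simp: words_def)

lemma words_hten: "w \<in> words (Halg H) (Halg H) 0 m \<longleftrightarrow> (\<exists>hs. w = ([], hs) \<and> length hs = m)"
 by (cases w) (auto simp: words_def Halg_def)

lemma hpure_pure: "length hs = m ==> pure (Halg H) (Halg H) 0 m ([], hs) = hpure H hs"
 by (simp add: hpure_def)

lemma hlift_closed:
 assumes "is_vspace W" "hmulti H m (vscale W) F" "\<And>hs. length hs = m ==> F hs \<in>: W" "t \<in>: hten H m"
 shows "hlift H m (vscale W) F t \<in>: W"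
proof (rule linear_on_closed[OF hlift_linear[OF is_vspace_vector_space[OF assms(1)] assms(2)] assms(1) _ assms(4)])
 fix w assume "w \<in> words (Halg H) (Halg H) 0 m"
 then obtain hs where hs: "w = ([], hs)" "length hs = m" by (auto simp: words_hten)
 show "hlift H m (vscale W) F (pure (Halg H) (Halg H) 0 m w) \<in>: W"
  by (simp only: hs(1) hpure_pure[OF hs(2)] hlift_pure[OF is_vspace_vector_space[OF assms(1)] assms(2) hs(2)] assms(3) hs(2))
qed

lemma hlift_linear_map:
 assumes "is_vspace W" "hmulti H m (vscale W) F" "\<And>hs. length hs = m ==> F hs \<in>: W"
  and s: "vector_space (s :: 'k::field => 'u::ab_group_add => 'u)" and L: "linear_on W s L" and t: "t \<in>: hten H m"
 shows "L (hlift H m (vscale W) F t) = hlift H m s (%hs. L (F hs)) t"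
proof -
 note sW = is_vspace_vector_space[OF assms(1)]
 have mL: "hmulti H m s (%hs. L (F hs))"
  using assms(2,3) L unfolding hmulti_def hlin_def linear_on_def by simp
 show ?thesis
 proof (rule tensor_linear_eq[OF s _ hlift_linear[OF s mL] _ t])
  show "linear_on (hten H m) s (%t. L (hlift H m (vscale W) F t))"
   by (rule linear_on_via[OF L hlift_linear[OF sW assms(2)] hlift_closed[OF assms(1-3)]])
  fix w assume "w \<in> words (Halg H) (Halg H) 0 m"
  then obtain hs where hs: "w = ([], hs)" "length hs = m" by (auto simp: words_hten)
  show "L (hlift H m (vscale W) F (pure (Halg H) (Halg H) 0 m w)) = hlift H m s (%hs. L (F hs)) (pure (Halg H) (Halg H) 0 m w)"
   by (simp only: hs(1) hpure_pure[OF hs(2)] hlift_pure[OF sW assms(2) hs(2)] hlift_pure[OF s mL hs(2)])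
 qed
qed

context quasitriangular_bij
begin

text \<open>The Sweedler sum in the recursion can be evaluated only when the previous stage is
  closed and linear, hence one induction for the three facts.\<close>

lemma itcomul_Suc: "itcomul H (Suc m) h = dS H h (%a b. consB (Halg H) (Halg H) m a (itcomul H m b))"
 and itcomul_closed: "itcomul H m h \<in>: hten H m"
 and hlin_itcomul: "hlin H fscale (itcomul H m)"
proof -
 have cons: "hlift H m fscale (%hs. hpure H (a # hs)) t = consB (Halg H) (Halg H) m a t" for m a t
  unfolding hlift_def consB_def by (rule fun_cong[OF tlift_cong]) (auto simp: words_hten hpure_def)
 note bc = bilinear_consB[OF is_vspace_Halg, of "Halg H"]
 have lin: "hlin H fscale (%a. consB (Halg H) (Halg H) m a (itcomul H m b))" "hlin H fscale (%b. consB (Halg H) (Halg H) m a (itcomul H m b))"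
  if "\<And>h. itcomul H m h \<in>: hten H m" "hlin H fscale (itcomul H m)" for a b m
 proof -
  show "hlin H fscale (%a. consB (Halg H) (Halg H) m a (itcomul H m b))"
   using bilinear_onD(2)[OF bc that(1)] by (simp add: hlin_linear_on)
  show "hlin H fscale (%b. consB (Halg H) (Halg H) m a (itcomul H m b))"
   by (rule hlin_linear[OF bilinear_onD(1)[OF bc]]) (use that in \<open>auto simp: Halg_def\<close>)
 qed
 have P: "itcomul H m h \<in>: hten H m \<and> hlin H fscale (itcomul H m) \<and>
  itcomul H (Suc m) h = dS H h (%a b. consB (Halg H) (Halg H) m a (itcomul H m b))" for m h
 proof (induction m arbitrary: h)
  case 0
  have cl: "itcomul H 0 h \<in>: hten H 0" for h
   using is_vspace_scale[OF is_vspace_tensor hpure_closed[of "[]" 0 H], of "counit H h"] by simp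
  have "itcomul H 0 = (%h. fscale (counit H h) (hpure H []))" by (rule ext) simp
  then have hl: "hlin H fscale (itcomul H 0)"
   by (simp only:) (intro hlin_intros vector_space_fscale)
  have "itcomul H (Suc 0) h = sumD H fscale h (%a b. consB (Halg H) (Halg H) 0 a (itcomul H 0 b))"
   by (simp only: itcomul.simps(2) cons)
  also have "\<dots> = dS H h (%a b. consB (Halg H) (Halg H) 0 a (itcomul H 0 b))"
   by (rule sw_comul[OF vector_space_fscale lin[OF cl hl]])
  finally show ?case using cl hl by blast
 next
  case (Suc m)
  have st: "itcomul H (Suc m) h = dS H h (%a b. consB (Halg H) (Halg H) m a (itcomul H m b))" for h using Suc by blast
  have IH: "\<And>h. itcomul H m h \<in>: hten H m" "hlin H fscale (itcomul H m)" using Suc by blast+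
  have cl: "itcomul H (Suc m) h \<in>: hten H (Suc m)" for h
   unfolding st by (intro ssum_closed is_vspace_tensor tensor_step_closed[OF tensor_step_consB[OF is_vspace_Halg]] IH) (simp add: Halg_def)
  have hl: "hlin H fscale (itcomul H (Suc m))"
   unfolding st by (rule hlin_dS_comp[OF vector_space_fscale lin[OF IH] hlin_id])
  have "itcomul H (Suc (Suc m)) h = sumD H fscale h (%a b. consB (Halg H) (Halg H) (Suc m) a (itcomul H (Suc m) b))"
   by (simp only: itcomul.simps(2)[of H "Suc m"] cons)
  also have "\<dots> = dS H h (%a b. consB (Halg H) (Halg H) (Suc m) a (itcomul H (Suc m) b))"
   by (rule sw_comul[OF vector_space_fscale lin[OF cl hl]])
  finally show ?case using cl hl by blast
 qed
 show "itcomul H (Suc m) h = dS H h (%a b. consB (Halg H) (Halg H) m a (itcomul H m b))"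
  and "itcomul H m h \<in>: hten H m" and "hlin H fscale (itcomul H m)"
  using P by blast+
qed

lemma hlift_itcomul_Suc:
 assumes s: "vector_space s" and F: "hmulti H (Suc m) s F"
 shows "hlift H (Suc m) s F (itcomul H (Suc m) h) = dS H h (%a b. hlift H m s (%hs. F (a # hs)) (itcomul H m b))"
proof -
 note st = tensor_step_consB[OF is_vspace_Halg, of "Halg H"]
 have u: "a \<in>: Halg H" for a by (simp add: Halg_def)
 have e: "hlift H (Suc m) s F (consB (Halg H) (Halg H) m a t) = hlift H m s (%hs. F (a # hs)) t"
  if t: "t \<in>: hten H m" for a t
 proof (rule tensor_linear_eq[OF s _ hlift_linear[OF s hmulti_tl[OF F]] _ t])
  show "linear_on (hten H m) s (%t. hlift H (Suc m) s F (consB (Halg H) (Halg H) m a t))"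
  proof (rule linear_on_via[OF hlift_linear[OF s F]])
   show "linear_on (hten H m) (vscale (hten H (Suc m))) (consB (Halg H) (Halg H) m a)"
    using bilinear_onD(1)[OF bilinear_consB[OF is_vspace_Halg] u] by simp
  qed (rule tensor_step_closed[OF st u])
  fix w assume w: "w \<in> words (Halg H) (Halg H) 0 m"
  then obtain hs where hs: "w = ([], hs)" "length hs = m" by (auto simp: words_hten)
  have "consB (Halg H) (Halg H) m a (pure (Halg H) (Halg H) 0 m w) = hpure H (a # hs)"
   using w hs by (simp add: consB_pure u) (simp add: hpure_def)
  then show "hlift H (Suc m) s F (consB (Halg H) (Halg H) m a (pure (Halg H) (Halg H) 0 m w)) =
   hlift H m s (%hs. F (a # hs)) (pure (Halg H) (Halg H) 0 m w)"
   by (simp add: hs hpure_pure hlift_pure[OF s F] hlift_pure[OF s hmulti_tl[OF F]])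
 qed
 have "hlift H (Suc m) s F (itcomul H (Suc m) h) = dS H h (%a b. hlift H (Suc m) s F (consB (Halg H) (Halg H) m a (itcomul H m b)))"
  unfolding itcomul_Suc by (rule linear_on_ssum[OF is_vspace_tensor hlift_linear[OF s F]])
   (rule tensor_step_closed[OF st u itcomul_closed])
 then show ?thesis by (simp add: e itcomul_closed)
qed

lemma hlift_itcomul_0:
 assumes "vector_space s"
 shows "hlift H 0 s F (itcomul H 0 h) = s (counit H h) (F [])"
proof -
 have m: "hmulti H 0 s F" by (simp add: hmulti_def)
 show ?thesis
  using linear_on_scale[OF hlift_linear[OF assms m] hpure_closed[of "[]" 0], of "counit H h"] hlift_pure[OF assms m, of "[]"]
  by simp
qed

lemma hlin_hlift_itcomul:
 assumes "vector_space s" "hmulti H m s F"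
 shows "hlin H s (%h. hlift H m s F (itcomul H m h))"
 by (rule hlin_linear[OF hlift_linear[OF assms]]) (simp_all add: hlin_itcomul itcomul_closed)

section \<open>The maps \<open>D\<^sub>g\<^sub>,\<^sub>n\<close>\<close>

lemma Halg_UNIV: "x \<in>: Halg H"
 by (simp add: Halg_def)

lemma vscale_Halg [simp]: "vscale (Halg H) = hscale H"
 by (simp add: Halg_def)

text \<open>The product of a tilde element with an ordinary one is already carried out. In 0-based
  numbering, the component of even index goes to the second copy of H and its successor to the
  first.\<close>

definition Dword :: "nat => nat => 'h list => ('k, 'h) HH_elt list \<times> 'h list"
 where "Dword g n hs = (map (%i. HHpure H (counit H) (hs ! Suc (2 * i)) (hs ! (2 * i))) [0..<g], drop (2 * g) hs)"

lemma Dword_words: "length hs = 2 * g + n ==> Dword g n hs \<in> words (HH H) (Halg H) g n"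
 by (auto simp: Dword_def words_def Halg_UNIV HHpure_closed counit_Hdual)

lemma Dmap_Dword: "Dmap H g n h = hlift H (2 * g + n) fscale (%hs. Tpure H g n (Dword g n hs)) (itcomul H (2 * g + n) h)"
 unfolding Dmap_def Dword_def by (simp only: HH_mult_counit[OF counit_Hdual] mult_1_left mult_1_right Suc_eq_plus1)

lemma Dword_Suc: "Dword (Suc g) n (a # b # hs) = (HHpure H (counit H) b a # fst (Dword g n hs), snd (Dword g n hs))"
 by (simp add: Dword_def map_upt_Suc del: upt_Suc)

lemma Dpure_SucA:
 assumes "length hs = 2 * g + n"
 shows "Tpure H (Suc g) n (Dword (Suc g) n (a # b # hs)) =
  consA (HH H) (Halg H) g n (HHpure H (counit H) b a) (Tpure H g n (Dword g n hs))"
 using consA_pure[of "HHpure H (counit H) b a" "HH H" "fst (Dword g n hs)" "snd (Dword g n hs)" "Halg H" g n] Dword_words[OF assms]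
 by (simp add: Dword_Suc HHpure_closed counit_Hdual)

lemma Dpure_SucB:
 assumes "length hs = n"
 shows "Tpure H 0 (Suc n) (Dword 0 (Suc n) (a # hs)) = consB (HH H) (Halg H) n a (Tpure H 0 n (Dword 0 n hs))"
 using consB_pure[of a "Halg H" hs "HH H" n] Dword_words[of hs 0 n] assms by (simp add: Dword_def Halg_UNIV)

lemma bilinear_consA_HH:
 shows "t \<in>: tensor (HH H) (Halg H) g n ==> hlin H fscale F ==> (\<And>x. F x \<in>: HH H) ==>
   hlin H fscale (%x. consA (HH H) (Halg H) g n (F x) t)"
  and "y \<in>: HH H ==> hlin H fscale G ==> (\<And>x. G x \<in>: tensor (HH H) (Halg H) g n) ==>
   hlin H fscale (%x. consA (HH H) (Halg H) g n y (G x))"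
 by (rule hlin_linear[OF bilinear_onD(2)[OF bilinear_consA[OF is_vspace_HH]]]; simp)
  (rule hlin_linear[OF bilinear_onD(1)[OF bilinear_consA[OF is_vspace_HH]]]; simp)

lemma bilinear_consB_HH:
 shows "t \<in>: tensor (HH H) (Halg H) 0 n ==> hlin H (hscale H) f ==> hlin H fscale (%x. consB (HH H) (Halg H) n (f x) t)"
  and "hlin H fscale G ==> (\<And>x. G x \<in>: tensor (HH H) (Halg H) 0 n) ==>
   hlin H fscale (%x. consB (HH H) (Halg H) n y (G x))"
 by (rule hlin_linear[OF bilinear_onD(2)[OF bilinear_consB[OF is_vspace_Halg]]]; simp add: Halg_UNIV)
  (rule hlin_linear[OF bilinear_onD(1)[OF bilinear_consB[OF is_vspace_Halg] Halg_UNIV]]; simp)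

lemma hmulti_Dpure: "hmulti H (2 * g + n) fscale (%hs. Tpure H g n (Dword g n hs))"
proof (induction g)
 case 0
 show ?case
 proof (induction n)
  case (Suc n)
  then show ?case
  proof (simp, intro hmulti_Cons)
   have "hlin H fscale (%x. consB (HH H) (Halg H) n a (Tpure H 0 n (Dword 0 n (hs[i := x]))))" if "length hs = n" "i < n" for a hs i
    using Suc[unfolded hmulti_def, rule_format, of hs i] that
    by (intro bilinear_consB_HH(2) pure_closed Dword_words) simp_all
   then show "hmulti H n fscale (%hs. Tpure H 0 (Suc n) (Dword 0 (Suc n) (a # hs)))" for a
    by (simp add: hmulti_def Dpure_SucB)
   show "hlin H fscale (%a. Tpure H 0 (Suc n) (Dword 0 (Suc n) (a # hs)))" if "length hs = n" for hs
    using that by (simp add: Dpure_SucB bilinear_consB_HH(1) hlin_id pure_closed Dword_words)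
  qed
 qed (simp add: hmulti_def)
next
 case (Suc g)
 let ?m = "2 * g + n"
 have cl: "HHpure H (counit H) b a \<in>: HH H" for a b by (simp add: HHpure_closed counit_Hdual)
 have "hmulti H (Suc (Suc ?m)) fscale (%hs. Tpure H (Suc g) n (Dword (Suc g) n hs))"
 proof (intro hmulti_Cons)
  have "hlin H fscale (%x. consA (HH H) (Halg H) g n (HHpure H (counit H) b a) (Tpure H g n (Dword g n (hs[i := x]))))"
   if "length hs = ?m" "i < ?m" for a b hs i
   using Suc[unfolded hmulti_def, rule_format, of hs i] that
   by (intro bilinear_consA_HH(2) cl pure_closed Dword_words) simp_all
  then show "hmulti H ?m fscale (%hs. Tpure H (Suc g) n (Dword (Suc g) n (a # b # hs)))" for a b
   by (simp add: hmulti_def Dpure_SucA)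
  show "hlin H fscale (%b. Tpure H (Suc g) n (Dword (Suc g) n (a # b # hs)))" if "length hs = ?m" for a hs
   unfolding Dpure_SucA[OF that] by (intro bilinear_consA_HH(1) cl pure_closed Dword_words that hlin_intros counit_Hdual)
  fix hs :: "'h list" assume "length hs = Suc ?m"
  then obtain b hs' where hs: "hs = b # hs'" "length hs' = ?m" by (cases hs) auto
  show "hlin H fscale (%a. Tpure H (Suc g) n (Dword (Suc g) n (a # hs)))"
   unfolding hs(1) Dpure_SucA[OF hs(2)] by (intro bilinear_consA_HH(1) cl pure_closed Dword_words hs(2) hlin_intros counit_Hdual)
 qed
 then show ?case by simp
qed

lemma Dmap_closed: "Dmap H g n h \<in>: tensor (HH H) (Halg H) g n"
 using hlift_closed[OF is_vspace_tensor[of "HH H" "Halg H" g n], of H "2 * g + n"] hmulti_Dpure[of g n]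
 by (simp add: Dmap_Dword pure_closed Dword_words itcomul_closed)

lemma hlin_Dmap: "hlin H fscale (Dmap H g n)"
 unfolding Dmap_Dword by (rule hlin_hlift_itcomul[OF vector_space_fscale hmulti_Dpure])

lemma Dmap_0: "Dmap H 0 0 h = fscale (counit H h) (Tpure H 0 0 ([], []))"
 unfolding Dmap_Dword by (simp add: hlift_itcomul_0[OF vector_space_fscale] Dword_def del: itcomul.simps)

lemma Dmap_SucB: "Dmap H 0 (Suc n) h = dS H h (%u v. consB (HH H) (Halg H) n u (Dmap H 0 n v))"
proof -
 note s = vector_space_fscale
 have m: "hmulti H (Suc n) fscale (%hs. Tpure H 0 (Suc n) (Dword 0 (Suc n) hs))" "hmulti H n fscale (%hs. Tpure H 0 n (Dword 0 n hs))"
  using hmulti_Dpure[of 0 "Suc n"] hmulti_Dpure[of 0 n] by simp_all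
 have e: "hlift H n fscale (%hs. Tpure H 0 (Suc n) (Dword 0 (Suc n) (a # hs))) t =
   consB (HH H) (Halg H) n a (hlift H n fscale (%hs. Tpure H 0 n (Dword 0 n hs)) t)" if "t \<in>: hten H n" for a t
 proof -
  have "consB (HH H) (Halg H) n a (hlift H n fscale (%hs. Tpure H 0 n (Dword 0 n hs)) t) =
   hlift H n fscale (%hs. consB (HH H) (Halg H) n a (Tpure H 0 n (Dword 0 n hs))) t"
   by (rule hlift_linear_map[where W = "tensor (HH H) (Halg H) 0 n", unfolded vscale_tensor, OF is_vspace_tensor m(2) _ s
     bilinear_onD(1)[OF bilinear_consB[OF is_vspace_Halg] Halg_UNIV] that]) (simp add: pure_closed Dword_words)
  also have "\<dots> = hlift H n fscale (%hs. Tpure H 0 (Suc n) (Dword 0 (Suc n) (a # hs))) t"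
   by (rule fun_cong[OF hlift_cong]) (simp add: Dpure_SucB)
  finally show ?thesis ..
 qed
 have "Dmap H 0 (Suc n) h = dS H h (%a b. hlift H n fscale (%hs. Tpure H 0 (Suc n) (Dword 0 (Suc n) (a # hs))) (itcomul H n b))"
  using hlift_itcomul_Suc[OF s m(1), of h] by (simp add: Dmap_Dword del: itcomul.simps)
 then show ?thesis by (simp add: e itcomul_closed Dmap_Dword)
qed

text \<open>A handle consumes two Sweedler components. They are split off one after the other, and
  coassociativity regroups them as the coproduct inside \<open>D10\<close>.\<close>

lemma Dmap_SucA: "Dmap H (Suc g) n h = dS H h (%u v. consA (HH H) (Halg H) g n (D10 u) (Dmap H g n v))"
proof -
 note s = vector_space_fscale
 let ?m = "2 * g + n" and ?F = "%hs. Tpure H (Suc g) n (Dword (Suc g) n hs)"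
 let ?c = "consA (HH H) (Halg H) g n"
 have m: "hmulti H (Suc (Suc ?m)) fscale ?F" "hmulti H ?m fscale (%hs. Tpure H g n (Dword g n hs))"
  using hmulti_Dpure[of "Suc g" n] hmulti_Dpure[of g n] by simp_all
 have cl: "HHpure H (counit H) b a \<in>: HH H" for a b by (simp add: HHpure_closed counit_Hdual)
 have e: "hlift H ?m fscale (%hs. ?F (a # b # hs)) t = ?c (HHpure H (counit H) b a) (hlift H ?m fscale (%hs. Tpure H g n (Dword g n hs)) t)"
  if "t \<in>: hten H ?m" for a b t
 proof -
  have "?c (HHpure H (counit H) b a) (hlift H ?m fscale (%hs. Tpure H g n (Dword g n hs)) t) =
   hlift H ?m fscale (%hs. ?c (HHpure H (counit H) b a) (Tpure H g n (Dword g n hs))) t"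
   by (rule hlift_linear_map[where W = "tensor (HH H) (Halg H) g n", unfolded vscale_tensor, OF is_vspace_tensor m(2) _ s
     bilinear_onD(1)[OF bilinear_consA[OF is_vspace_HH] cl] that]) (simp add: pure_closed Dword_words)
  also have "\<dots> = hlift H ?m fscale (%hs. ?F (a # b # hs)) t"
   by (rule fun_cong[OF hlift_cong]) (simp add: Dpure_SucA)
  finally show ?thesis ..
 qed
 have m2: "2 * Suc g + n = Suc (Suc ?m)" by simp
 have "Dmap H (Suc g) n h = dS H h (%a c. dS H c (%b d. hlift H ?m fscale (%hs. ?F (a # b # hs)) (itcomul H ?m d)))"
  unfolding Dmap_Dword m2 hlift_itcomul_Suc[OF s m(1)] hlift_itcomul_Suc[OF s hmulti_tl[OF m(1)]] ..
 also have "\<dots> = dS H h (%a c. dS H c (%b d. ?c (HHpure H (counit H) b a) (Dmap H g n d)))"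
  by (simp only: e itcomul_closed Dmap_Dword)
 also have "\<dots> = dS H h (%u d. dS H u (%a b. ?c (HHpure H (counit H) b a) (Dmap H g n d)))"
  by (rule dS_coassoc[OF s, symmetric])
   (intro bilinear_consA_HH cl Dmap_closed hlin_intros counit_Hdual hlin_Dmap)+
 also have "\<dots> = dS H h (%u d. ?c (D10 u) (Dmap H g n d))"
  unfolding D10_def by (rule ssum_cong, rule linear_on_ssum[symmetric, OF is_vspace_HH bilinear_onD(2)[OF bilinear_consA[OF is_vspace_HH] Dmap_closed]]) (rule cl)
 finally show ?thesis .
qed

end

section \<open>Graph algebras\<close>

text \<open>Linearity in the parameter, known on a spanning set of \<open>U\<close>, passes to all
  of \<open>U\<close> because the defect is linear in \<open>X\<close>.\<close>

lemma span_param: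
 assumes V: "is_vspace V" and U: "is_vspace U" "vcarrier U = module.span (vscale U) S"
  and s: "vector_space (s :: 'k::field => 'u::ab_group_add => 'u)"
  and 1: "\<And>y. y \<in>: V ==> linear_on U s (%X. F X y)" and 2: "\<And>X. X \<in> S ==> linear_on V s (F X)"
  and X: "X \<in>: U"
 shows "linear_on V s (F X)"
proof (rule linear_onI)
 show "F X (x + y) = F X x + F X y" if "x \<in>: V" "y \<in>: V" for x y
  by (rule span_linear_eq[OF U s 1[OF is_vspace_add[OF V that]] linear_on_fun_add[OF s 1[OF that(1)] 1[OF that(2)]] _ X])
   (use linear_on_add[OF 2 that] in simp)
 show "F X (vscale V c x) = s c (F X x)" if "x \<in>: V" for c x
  by (rule span_linear_eq[OF U s 1[OF is_vspace_scale[OF V that]] linear_on_fun_scale[OF s 1[OF that]] _ X])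
   (use linear_on_scale[OF 2 that] in simp)
qed

text \<open>\<open>T\<close> realises the universal property of \<open>C\<close> for target spaces with scaling \<open>s\<close>.\<close>

definition step_lift ::
  "('k::field, 'v::ab_group_add, 'm) vspace_scheme => ('k, 'w::ab_group_add, 'n) vspace_scheme =>
   ('k, 'u::ab_group_add, 'l) vspace_scheme => ('v => 'w => 'u) => ('k => 'x::ab_group_add => 'x) =>
   (('v => 'w => 'x) => 'u => 'x) => bool"
 where "step_lift V W U C s T \<longleftrightarrow> tensor_step V W U C \<and>
  (\<forall>G. bilinear_on V W s G \<longrightarrow> linear_on U s (T G) \<and>
   (\<forall>v\<in>vcarrier V. \<forall>w\<in>vcarrier W. T G (C v w) = G v w))"

section \<open>Actions and products on one more tensor factor\<close>

context quasitriangular_bij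
begin

lemma act_lift:
 fixes M0 :: "('k, 'm0::ab_group_add) kalg" and M1 :: "('k, 'm1::ab_group_add) kalg"
  and M2 :: "('k, 'm2::ab_group_add) kalg"
 assumes T: "step_lift M0 M1 M2 C (vscale M2) T" and i0: "is_act M0 act0" and i1: "is_act M1 act1"
  and act2: "\<And>h. act2 h = T (%m n. dS H h (%a b. C (act0 a m) (act1 b n)))"
 shows "is_act M2 act2"
  and "m \<in>: M0 ==> n \<in>: M1 ==> act2 h (C m n) = dS H h (%a b. C (act0 a m) (act1 b n))"
  and "bilinear_on M0 M1 (vscale M2) (%m n. dS H h (%a b. C (act0 a m) (act1 b n)))"
proof -
 have C: "tensor_step M0 M1 M2 C" using T by (simp add: step_lift_def)
 note V = tensor_stepD(1-3)[OF C] and bC = tensor_stepD(4)[OF C] and span = tensor_stepD(5)[OF C]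
 note s = is_vspace_vector_space[OF V(3)]
 note c = is_actD(1)[OF i0] is_actD(1)[OF i1]
 note l = is_actD(2)[OF i0] is_actD(2)[OF i1]
 note hl = is_actD(3)[OF i0] is_actD(3)[OF i1]
 show G: "bilinear_on M0 M1 (vscale M2) (%m n. dS H h (%a b. C (act0 a m) (act1 b n)))" for h
 proof (rule bilinear_onI; rule linear_on_ssum_fun[OF s])
  show "linear_on M1 (vscale M2) (%n. C (act0 a m) (act1 b n))" if "m \<in>: M0" for m a b
   by (rule linear_on_via[OF bilinear_onD(1)[OF bC c(1)[OF that]] l(2)]) (rule c)
  show "linear_on M0 (vscale M2) (%m. C (act0 a m) (act1 b n))" if "n \<in>: M1" for n a b
   by (rule linear_on_via[OF bilinear_onD(2)[OF bC c(2)[OF that]] l(1)]) (rule c)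
 qed
 have f: "act2 h (C m n) = dS H h (%a b. C (act0 a m) (act1 b n))" if "m \<in>: M0" "n \<in>: M1" for m n h
  using T G[of h] that unfolding step_lift_def act2 by blast
 have l2: "linear_on M2 (vscale M2) (act2 h)" for h
  using T G[of h] unfolding step_lift_def act2 by blast
 have cl: "act2 h x \<in>: M2" if "x \<in>: M2" for h x
  by (rule span_closed[OF V(3) span l2 V(3) _ that]) (auto simp: f intro!: ssum_closed V tensor_step_closed[OF C] c)
 have "hlin H (vscale M2) (%h. act2 h x)" if x: "x \<in>: M2" for x
  unfolding hlin_linear_on
 proof (rule span_param[OF is_vspace_Halg V(3) span s l2 _ x])
  fix X assume "X \<in> {C v w |v w. v \<in>: M0 \<and> w \<in>: M1}"
  then obtain m n where X: "X = C m n" "m \<in>: M0" "n \<in>: M1" by blast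
  have "hlin H (vscale M2) (%h. dS H h (%a b. C (act0 a m) (act1 b n)))"
   by (intro hlin_dS s hlin_linear[OF bilinear_onD(1)[OF bC]] hlin_linear[OF bilinear_onD(2)[OF bC]] hl c X)
  then show "linear_on (Halg H) (vscale M2) (%h. act2 h X)" by (simp add: hlin_linear_on X f)
 qed
 then show "is_act M2 act2" using l2 cl by (simp add: is_act_def)
 show "act2 h (C m n) = dS H h (%a b. C (act0 a m) (act1 b n))" if "m \<in>: M0" "n \<in>: M1"
  by (rule f[OF that])
qed

text \<open>A product given by nested lifts is genuine only if the inner lift is bilinear in the
  outer arguments. For \<open>Y\<close> of the form \<open>C m' n'\<close> this is bilinearity of
  the summand; \<open>span_param\<close> extends it to all \<open>Y\<close>.\<close>

lemma mult_lift:
 fixes M0 :: "('k, 'm0::ab_group_add) kalg" and M1 :: "('k, 'm1::ab_group_add) kalg"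
  and M2 :: "('k, 'm2::ab_group_add) kalg"
 assumes T: "step_lift M0 M1 M2 C (vscale M2) T" and i0: "is_act M0 act0" and i1: "is_act M1 act1"
  and a0: "is_alg M0" and a1: "is_alg M1"
  and mult: "\<And>X Y. X \<in>: M2 ==> Y \<in>: M2 ==> amult M2 X Y = T (%m n. T (%m' n'.
   rS H (%a b. C (amult M0 m (act0 a m')) (amult M1 (act1 b n) n'))) Y) X"
  and one: "aone M2 = C (aone M0) (aone M1)"
 shows "is_alg M2"
  and "m \<in>: M0 ==> n \<in>: M1 ==> m' \<in>: M0 ==> n' \<in>: M1 ==>
   amult M2 (C m n) (C m' n') = rS H (%a b. C (amult M0 m (act0 a m')) (amult M1 (act1 b n) n'))"
proof -
 have C: "tensor_step M0 M1 M2 C" using T by (simp add: step_lift_def)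
 let ?S = "{C v w |v w. v \<in>: M0 \<and> w \<in>: M1}"
 note V = tensor_stepD(1-3)[OF C] and bC = tensor_stepD(4)[OF C] and span = tensor_stepD(5)[OF C]
 note s = is_vspace_vector_space[OF V(3)]
 note c = is_actD(1)[OF i0] is_actD(1)[OF i1]
 note cc = c is_alg_closed[OF a0] is_alg_closed[OF a1] tensor_step_closed[OF C] is_alg_one[OF a0] is_alg_one[OF a1]
 note l = is_actD(2)[OF i0] is_actD(2)[OF i1]
 note b0 = bilinear_onD[OF is_alg_bilinear[OF a0]] and b1 = bilinear_onD[OF is_alg_bilinear[OF a1]]
 define K where "K m n m' n' = rS H (%a b. C (amult M0 m (act0 a m')) (amult M1 (act1 b n) n'))" for m n m' n'
 have K1: "bilinear_on M0 M1 (vscale M2) (K m n)" if "m \<in>: M0" "n \<in>: M1" for m n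
  unfolding K_def
  by (rule bilinear_onI; rule linear_on_ssum_fun[OF s])
   (rule linear_on_via[OF bilinear_onD(1)[OF bC]], (intro cc that b1 | assumption)+,
    rule linear_on_via[OF bilinear_onD(2)[OF bC]], (intro cc that | assumption)+,
    rule linear_on_via[OF b0(1) l(1)], (intro cc that | assumption)+)
 have K2: "bilinear_on M0 M1 (vscale M2) (%m n. K m n m' n')" if "m' \<in>: M0" "n' \<in>: M1" for m' n'
  unfolding K_def
  by (rule bilinear_onI; rule linear_on_ssum_fun[OF s])
   (rule linear_on_via[OF bilinear_onD(1)[OF bC]], (intro cc that | assumption)+,
    rule linear_on_via[OF b1(2) l(2)], (intro cc that | assumption)+,
    rule linear_on_via[OF bilinear_onD(2)[OF bC]], (intro cc that b0 | assumption)+)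
 have TT: "linear_on M2 (vscale M2) (T G)" "\<And>v w. v \<in>: M0 ==> w \<in>: M1 ==> T G (C v w) = G v w"
  if "bilinear_on M0 M1 (vscale M2) G" for G
  using T that unfolding step_lift_def by blast+
 have L: "bilinear_on M0 M1 (vscale M2) (%m n. T (K m n) Y)" if Y: "Y \<in>: M2" for Y
 proof (rule bilinear_onI)
  show "linear_on M1 (vscale M2) (%n. T (K m n) Y)" if m: "m \<in>: M0" for m
  proof (rule span_param[OF V(2) V(3) span s _ _ Y])
   fix Y assume "Y \<in> ?S"
   then obtain m' n' where Y: "Y = C m' n'" "m' \<in>: M0" "n' \<in>: M1" by blast
   show "linear_on M1 (vscale M2) (%n. T (K m n) Y)"
    by (rule linear_on_cong[OF V(2) bilinear_onD(1)[OF K2[OF Y(2,3)] m]]) (simp add: Y TT(2)[OF K1] m)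
  qed (rule TT(1)[OF K1[OF m]])
  show "linear_on M0 (vscale M2) (%m. T (K m n) Y)" if n: "n \<in>: M1" for n
  proof (rule span_param[OF V(1) V(3) span s _ _ Y])
   fix Y assume "Y \<in> ?S"
   then obtain m' n' where Y: "Y = C m' n'" "m' \<in>: M0" "n' \<in>: M1" by blast
   show "linear_on M0 (vscale M2) (%m. T (K m n) Y)"
    by (rule linear_on_cong[OF V(1) bilinear_onD(2)[OF K2[OF Y(2,3)] n]]) (simp add: Y TT(2)[OF K1] n)
  qed (rule TT(1)[OF K1[OF _ n]])
 qed
 have mult': "amult M2 X Y = T (%m n. T (K m n) Y) X" if "X \<in>: M2" "Y \<in>: M2" for X Y
  unfolding K_def by (rule mult[OF that])
 have f: "amult M2 (C m n) Y = T (K m n) Y" if "m \<in>: M0" "n \<in>: M1" "Y \<in>: M2" for m n Y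
  by (simp add: mult' that cc TT(2)[OF L[OF that(3)]])
 have ff: "amult M2 (C m n) (C m' n') = K m n m' n'"
  if "m \<in>: M0" "n \<in>: M1" "m' \<in>: M0" "n' \<in>: M1" for m n m' n'
  by (simp add: f that cc TT(2)[OF K1])
 then show "m \<in>: M0 ==> n \<in>: M1 ==> m' \<in>: M0 ==> n' \<in>: M1 ==>
   amult M2 (C m n) (C m' n') = rS H (%a b. C (amult M0 m (act0 a m')) (amult M1 (act1 b n) n'))"
  unfolding K_def by blast
 have l1: "linear_on M2 (vscale M2) (%X. amult M2 X Y)" if Y: "Y \<in>: M2" for Y
  by (rule linear_on_cong[OF V(3) TT(1)[OF L[OF Y]]]) (simp add: mult' Y)
 have l2: "linear_on M2 (vscale M2) (amult M2 X)" if X: "X \<in>: M2" for X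
 proof (rule span_param[OF V(3) V(3) span s l1 _ X])
  fix X assume "X \<in> ?S"
  then obtain m n where X: "X = C m n" "m \<in>: M0" "n \<in>: M1" by blast
  show "linear_on M2 (vscale M2) (amult M2 X)"
   by (rule linear_on_cong[OF V(3) TT(1)[OF K1[OF X(2,3)]]]) (simp add: X f)
 qed
 have cl1: "amult M2 (C m n) Y \<in>: M2" if mn: "m \<in>: M0" "n \<in>: M1" and Y: "Y \<in>: M2" for m n Y
 proof (rule span_closed[OF V(3) span l2[OF cc(5)[OF mn]] V(3) _ Y])
  fix Y assume "Y \<in> ?S"
  then obtain m' n' where Y: "Y = C m' n'" "m' \<in>: M0" "n' \<in>: M1" by blast
  show "amult M2 (C m n) Y \<in>: M2"
   unfolding Y(1) ff[OF mn Y(2,3)] K_def by (intro ssum_closed V cc mn Y)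
 qed
 have "amult M2 X Y \<in>: M2" if X: "X \<in>: M2" and Y: "Y \<in>: M2" for X Y
  by (rule span_closed[OF V(3) span l1[OF Y] V(3) _ X]) (use cl1 Y in blast)
 then show "is_alg M2"
  unfolding is_alg_def using V(3) bilinear_onI[OF l2 l1] cc one by simp
qed

abbreviation "GA \<equiv> graph_alg H"
abbreviation "Lten \<equiv> tensor (L10 H) (L01 H)"
abbreviation "Lwords \<equiv> words (L10 H) (L01 H)"
abbreviation "Tten \<equiv> tensor (HH H) (Halg H)"

lemma graph_simps [simp]:
 "vscale (GA g n) = fscale" "vcarrier (GA g n) = vcarrier (Lten g n)"
 "amult (GA g n) = graph_mult H g n"
 by (simp_all add: graph_alg_def)

lemma is_vspace_graph: "is_vspace (GA g n)"
 using is_vspace_tensor[of "L10 H" "L01 H" g n] by (simp add: is_vspace_def)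

lemma is_vspace_L01: "is_vspace (L01 H)"
 by (rule is_alg_vspace[OF is_alg_L01])

lemma bilinear_graph: "bilinear_on V (GA g n) s G \<longleftrightarrow> bilinear_on V (Lten g n) s G"
 and linear_graph: "linear_on (GA g n) s F \<longleftrightarrow> linear_on (Lten g n) s F"
 by (simp_all add: bilinear_on_def linear_on_def)

abbreviation "cA \<equiv> consA (L10 H) (L01 H)"
abbreviation "cB \<equiv> consB (L10 H) (L01 H)"

definition liftA where "liftA g n G = Llift H (Suc g) n (%(xs, \<phi>s). G (hd xs) (Lpure H g n (tl xs, \<phi>s)))"
definition liftB where "liftB n G = Llift H 0 (Suc n) (%(_, \<phi>s). G (hd \<phi>s) (Lpure H 0 n ([], tl \<phi>s)))"

text \<open>The scaling enters through an equation so that the rule can be used with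
  \<open>vscale\<close> of the graph algebra or of the target algebra in its place.\<close>

lemma step_liftA:
 assumes s: "s = (fscale :: 'k => ('x => 'k) => _)"
 shows "step_lift (L10 H) (GA g n) (GA (Suc g) n) (cA g n) s (liftA g n)"
proof -
 have "tensor_step (L10 H) (GA g n) (GA (Suc g) n) (cA g n)"
  using tensor_step_consA[OF is_vspace_L10[of H], where B = "L01 H" and g = g and n = n] is_vspace_graph[of "Suc g" n]
  by (simp add: tensor_step_def bilinear_graph is_vspace_graph del: L10_simps)
 then show ?thesis
  unfolding step_lift_def liftA_def bilinear_graph linear_graph graph_simps(2) s
  by (intro conjI allI impI ballI linear_consA_tlift[OF vector_space_fscale] tlift_consA[OF vector_space_fscale is_vspace_L10]) assumption+
qed

lemma step_liftB:
 assumes s: "s = (fscale :: 'k => ('x => 'k) => _)"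
 shows "step_lift (L01 H) (GA 0 n) (GA 0 (Suc n)) (cB n) s (liftB n)"
proof -
 have "tensor_step (L01 H) (GA 0 n) (GA 0 (Suc n)) (cB n)"
  using tensor_step_consB[OF is_vspace_L01, where A = "L10 H" and n = n]
  by (simp add: tensor_step_def bilinear_graph is_vspace_graph del: vspace_L01)
 then show ?thesis
  unfolding step_lift_def liftB_def bilinear_graph linear_graph graph_simps(2) s
  by (intro conjI allI impI ballI linear_consB_tlift[OF vector_space_fscale] tlift_consB[OF vector_space_fscale is_vspace_L01]) assumption+
qed

lemma modalg_L01: "is_modalg (L01 H) (coad01 H)"
 unfolding is_modalg_def is_act_def
 by (simp add: is_alg_L01 linear_coad01 hlin_coad01 coad01_Hdual L01_unit coad01_unit coad01_coad01 coad01_one coad01_mult)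

lemma modalg_L10: "is_modalg (L10 H) (coad10 H)"
proof -
 have "is_act (L10 H) (coad10 H)"
  unfolding is_act_def using coad10_lift(1) hlin_coad10 coad10_closed by simp
 then show ?thesis
  unfolding is_modalg_def using is_alg_L10 L10_unit coad10_unit coad10_coad10 coad10_one coad10_mult by simp
qed

lemma act_L01: "is_act (L01 H) (coad01 H)" and act_L10: "is_act (L10 H) (coad10 H)"
 using modalg_L01 modalg_L10 by (simp_all add: is_modalg_def)

definition cword :: "nat => nat => 'h list => ('k, 'h) L10_elt list \<times> ('h => 'k) list => ('k, 'h) L10_elt list \<times> ('h => 'k) list"
 where "cword g n hs = (%(xs, \<phi>s). (map2 (coad10 H) (take g hs) xs, map2 (coad01 H) (drop g hs) \<phi>s))"

lemma cword_words:
 assumes "w \<in> Lwords g n" "length hs = g + n"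
 shows "cword g n hs w \<in> Lwords g n"
proof -
 obtain xs \<phi>s where w: "w = (xs, \<phi>s)" "length xs = g" "set xs \<subseteq> vcarrier (L10 H)" "length \<phi>s = n" "set \<phi>s \<subseteq> vcarrier (L01 H)"
  using assms(1) by (cases w) (auto simp: words_def simp del: L10_simps vspace_L01)
 have "set (map2 (coad10 H) (take g hs) xs) \<subseteq> vcarrier (L10 H)" "set (map2 (coad01 H) (drop g hs) \<phi>s) \<subseteq> vcarrier (L01 H)"
  by (rule set_map2; use w assms(2) coad10_closed coad01_Hdual in \<open>auto simp del: L10_simps\<close>)+
 then show ?thesis using w assms(2) by (simp add: cword_def words_def)
qed

lemma coad_cword: "coad H g n h = Llift H g n (%w. hlift H (g + n) fscale (%hs. Lpure H g n (cword g n hs w)) (itcomul H (g + n) h))"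
 by (simp add: coad_def cword_def case_prod_beta')

lemma cpure_A:
 assumes "x \<in>: L10 H" "(xs, \<phi>s) \<in> Lwords g n" "length hs = g + n"
 shows "Lpure H (Suc g) n (cword (Suc g) n (a # hs) (x # xs, \<phi>s)) = cA g n (coad10 H a x) (Lpure H g n (cword g n hs (xs, \<phi>s)))"
 using consA_pure[OF coad10_closed[OF assms(1)], of "fst (cword g n hs (xs, \<phi>s))" "snd (cword g n hs (xs, \<phi>s))" "L01 H" g n a]
  cword_words[OF assms(2,3)] by (simp add: cword_def)

lemma cpure_B:
 assumes "\<phi> \<in>: L01 H" "([], \<phi>s) \<in> Lwords 0 n" "length hs = n"
 shows "Lpure H 0 (Suc n) (cword 0 (Suc n) (a # hs) ([], \<phi> # \<phi>s)) = cB n (coad01 H a \<phi>) (Lpure H 0 n (cword 0 n hs ([], \<phi>s)))"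
 using consB_pure[of "coad01 H a \<phi>" "L01 H" "snd (cword 0 n hs ([], \<phi>s))" "L10 H" n]
  cword_words[OF assms(2), of hs] assms(1,3) by (simp add: cword_def coad01_Hdual)

lemma hlin_cA:
 shows "t \<in>: Lten g n ==> hlin H fscale F ==> (\<And>x. F x \<in>: L10 H) ==>
   hlin H fscale (%x. cA g n (F x) t)"
  and "y \<in>: L10 H ==> hlin H fscale G ==> (\<And>x. G x \<in>: Lten g n) ==>
   hlin H fscale (%x. cA g n y (G x))"
 by (rule hlin_linear[OF bilinear_onD(2)[OF bilinear_consA[OF is_vspace_L10]]]; simp)
  (rule hlin_linear[OF bilinear_onD(1)[OF bilinear_consA[OF is_vspace_L10]]]; simp)

lemma hlin_cB:
 shows "t \<in>: Lten 0 n ==> hlin H fscale F ==> (\<And>x. F x \<in>: L01 H) ==>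
   hlin H fscale (%x. cB n (F x) t)"
  and "y \<in>: L01 H ==> hlin H fscale G ==> (\<And>x. G x \<in>: Lten 0 n) ==>
   hlin H fscale (%x. cB n y (G x))"
 by (rule hlin_linear[OF bilinear_onD(2)[OF bilinear_consB[OF is_vspace_L01]]]; simp)
  (rule hlin_linear[OF bilinear_onD(1)[OF bilinear_consB[OF is_vspace_L01]]]; simp)

lemma hmulti_cpure: "w \<in> Lwords g n ==> hmulti H (g + n) fscale (%hs. Lpure H g n (cword g n hs w))"
proof (induction g arbitrary: w)
 case 0
 then show ?case
 proof (induction n arbitrary: w)
  case (Suc n)
  then obtain \<phi> \<phi>s where w: "w = ([], \<phi> # \<phi>s)" "\<phi> \<in>: L01 H" "([], \<phi>s) \<in> Lwords 0 n"
   by (auto simp: words_SucB)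
  note IH = Suc.IH[OF w(3)]
  have "hmulti H (Suc n) fscale (%hs. Lpure H 0 (Suc n) (cword 0 (Suc n) hs w))"
  proof (rule hmulti_Cons)
   have "hlin H fscale (%x. cB n (coad01 H a \<phi>) (Lpure H 0 n (cword 0 n (hs[i := x]) ([], \<phi>s))))" if "length hs = n" "i < n" for a hs i
    using IH[unfolded hmulti_def, rule_format, of hs i] that w
    by (intro hlin_cB(2) pure_closed cword_words w) (simp_all add: coad01_Hdual)
   then show "hmulti H n fscale (%hs. Lpure H 0 (Suc n) (cword 0 (Suc n) (a # hs) w))" for a
    by (simp add: hmulti_def w(1) cpure_B[OF w(2,3)])
   show "hlin H fscale (%a. Lpure H 0 (Suc n) (cword 0 (Suc n) (a # hs) w))" if "length hs = n" for hs
    unfolding w(1) cpure_B[OF w(2,3) that] using w(2)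
    by (intro hlin_cB(1) pure_closed cword_words w) (simp_all add: coad01_Hdual hlin_coad01 that)
  qed
  then show ?case by simp
 qed (simp add: hmulti_def)
next
 case (Suc g)
 then obtain x xs \<phi>s where w: "w = (x # xs, \<phi>s)" "x \<in>: L10 H" "(xs, \<phi>s) \<in> Lwords g n"
  by (auto simp: words_SucA)
 note IH = Suc.IH[OF w(3)]
 have "hmulti H (Suc (g + n)) fscale (%hs. Lpure H (Suc g) n (cword (Suc g) n hs w))"
 proof (rule hmulti_Cons)
  have "hlin H fscale (%y. cA g n (coad10 H a x) (Lpure H g n (cword g n (hs[i := y]) (xs, \<phi>s))))" if "length hs = g + n" "i < g + n" for a hs i
   using IH[unfolded hmulti_def, rule_format, of hs i] that
   by (intro hlin_cA(2) pure_closed cword_words w coad10_closed) simp_all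
  then show "hmulti H (g + n) fscale (%hs. Lpure H (Suc g) n (cword (Suc g) n (a # hs) w))" for a
   by (simp add: hmulti_def w(1) cpure_A[OF w(2,3)])
  show "hlin H fscale (%a. Lpure H (Suc g) n (cword (Suc g) n (a # hs) w))" if "length hs = g + n" for hs
   unfolding w(1) cpure_A[OF w(2,3) that]
   by (intro hlin_cA(1) pure_closed cword_words w coad10_closed hlin_coad10 that)
 qed
 then show ?case by simp
qed

text \<open>The empty word is the only one, so base cases reduce to scalar multiples of a single
  tensor.\<close>

lemma tensor_0: 
 fixes A :: "('k, 'a::ab_group_add, 'm) vspace_scheme" and B :: "('k, 'b::ab_group_add, 'l) vspace_scheme"
 assumes "X \<in>: tensor A B 0 0"
 obtains c where "X = fscale c (pure A B 0 0 ([], []))"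
proof -
 interpret f: vector_space "fscale :: 'k::field => (('a list \<times> 'b list => 'k) => 'k) => _"
  by (rule vector_space_fscale)
 have "\<exists>c. X = fscale c (pure A B 0 0 ([], []))"
 proof (rule tensor_induct[OF assms])
  show "\<exists>c. 0 = fscale c (pure A B 0 0 ([], []))"
   by (rule exI[of _ 0]) (rule f.scale_zero_left[symmetric])
  fix c w Y assume "w \<in> words A B 0 0" "\<exists>d. Y = fscale d (pure A B 0 0 ([], []))"
  then obtain d where "w = ([], [])" "Y = fscale d (pure A B 0 0 ([], []))" by (auto simp: words_0)
  then show "\<exists>d. fscale c (pure A B 0 0 w) + Y = fscale d (pure A B 0 0 ([], []))"
   by (intro exI[of _ "c + d"]) (simp only: f.scale_left_distrib)
 qed
 then show ?thesis using that by blast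
qed

lemma tlift_0:
 fixes A :: "('k, 'a::ab_group_add, 'm) vspace_scheme" and B :: "('k, 'b::ab_group_add, 'l) vspace_scheme"
  and s :: "'k => 'u::ab_group_add => 'u"
 assumes "vector_space s"
 shows "linear_on (tensor A B 0 0) s (tlift A B 0 0 s F)" and "tlift A B 0 0 s F (pure A B 0 0 ([], [])) = F ([], [])"
  and "tlift A B 0 0 s F (fscale c (pure A B 0 0 ([], []))) = s c (F ([], []))"
proof -
 have m: "multilinear A B 0 0 s F" by (simp add: multilinear_iff)
 show l: "linear_on (tensor A B 0 0) s (tlift A B 0 0 s F)" by (rule tlift_linear[OF assms m])
 have w: "([], []) \<in> words A B 0 0" by (simp add: words_0)
 show p: "tlift A B 0 0 s F (pure A B 0 0 ([], [])) = F ([], [])" by (rule tlift_pure[OF assms m w])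
 show "tlift A B 0 0 s F (fscale c (pure A B 0 0 ([], []))) = s c (F ([], []))"
  using linear_on_scale[OF l pure_closed[OF w], of c] by (simp add: p)
qed

lemma coad_0: "coad H 0 0 h (Lpure H 0 0 ([], [])) = fscale (counit H h) (Lpure H 0 0 ([], []))"
 unfolding coad_cword
 by (simp add: tlift_0(2)[OF vector_space_fscale] hlift_itcomul_0[OF vector_space_fscale] cword_def del: itcomul.simps)

text \<open>Evaluating \<open>coad\<close> on pure tensors presupposes multilinearity in the word,
  which \<open>act_lift\<close> supplies one letter at a time from the recursion equations; these in
  turn need the evaluation one step below. All of it is therefore proved in one induction.\<close>

lemma coad_act: "is_act (GA g n) (coad H g n)"
 and coad_SucA: "coad H (Suc g) n h = liftA g n (%m t. dS H h (%a b. cA g n (coad10 H a m) (coad H g n b t)))"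
 and coad_SucB: "coad H 0 (Suc n) h = liftB n (%m t. dS H h (%a b. cB n (coad01 H a m) (coad H 0 n b t)))"
proof -
 note s = vector_space_fscale
 \<comment> \<open>The evaluation on pure tensors that drives the induction.\<close>
 define pp where "pp g n \<longleftrightarrow> (\<forall>w\<in>Lwords g n. \<forall>h. coad H g n h (Lpure H g n w) =
  hlift H (g + n) fscale (%hs. Lpure H g n (cword g n hs w)) (itcomul H (g + n) h))" for g n
 have A: "hlift H (Suc g + n) fscale (%hs. Lpure H (Suc g) n (cword (Suc g) n hs (x # xs, \<phi>s))) (itcomul H (Suc g + n) h) =
   dS H h (%a b. cA g n (coad10 H a x) (coad H g n b (Lpure H g n (xs, \<phi>s))))"
  if p: "pp g n" and w: "x \<in>: L10 H" "(xs, \<phi>s) \<in> Lwords g n" for g n x xs \<phi>s h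
 proof -
  have m: "hmulti H (Suc (g + n)) fscale (%hs. Lpure H (Suc g) n (cword (Suc g) n hs (x # xs, \<phi>s)))"
   using hmulti_cpure[OF words_ConsA[OF w(2,1)]] by simp
  have "hlift H (g + n) fscale (%hs. Lpure H (Suc g) n (cword (Suc g) n (a # hs) (x # xs, \<phi>s))) (itcomul H (g + n) b) =
   cA g n (coad10 H a x) (coad H g n b (Lpure H g n (xs, \<phi>s)))" for a b
  proof -
   have "cA g n (coad10 H a x) (coad H g n b (Lpure H g n (xs, \<phi>s))) =
    cA g n (coad10 H a x) (hlift H (g + n) fscale (%hs. Lpure H g n (cword g n hs (xs, \<phi>s))) (itcomul H (g + n) b))"
    using p w unfolding pp_def by simp
   also have "\<dots> = hlift H (g + n) fscale (%hs. cA g n (coad10 H a x) (Lpure H g n (cword g n hs (xs, \<phi>s)))) (itcomul H (g + n) b)"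
    by (rule hlift_linear_map[where W = "Lten g n", unfolded vscale_tensor, OF is_vspace_tensor hmulti_cpure[OF w(2)] _ s
      bilinear_onD(1)[OF bilinear_consA[OF is_vspace_L10] coad10_closed[OF w(1)]] itcomul_closed]) (intro pure_closed cword_words w)
   also have "\<dots> = hlift H (g + n) fscale (%hs. Lpure H (Suc g) n (cword (Suc g) n (a # hs) (x # xs, \<phi>s))) (itcomul H (g + n) b)"
    by (rule fun_cong[OF hlift_cong]) (simp only: cpure_A[OF w])
   finally show ?thesis ..
  qed
  then show ?thesis using hlift_itcomul_Suc[OF s m, of h] by (simp del: itcomul.simps)
 qed
 have B: "hlift H (Suc n) fscale (%hs. Lpure H 0 (Suc n) (cword 0 (Suc n) hs ([], \<phi> # \<phi>s))) (itcomul H (Suc n) h) =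
   dS H h (%a b. cB n (coad01 H a \<phi>) (coad H 0 n b (Lpure H 0 n ([], \<phi>s))))"
  if p: "pp 0 n" and w: "\<phi> \<in>: L01 H" "([], \<phi>s) \<in> Lwords 0 n" for n \<phi> \<phi>s h
 proof -
  have m: "hmulti H (Suc n) fscale (%hs. Lpure H 0 (Suc n) (cword 0 (Suc n) hs ([], \<phi> # \<phi>s)))"
   and m': "hmulti H n fscale (%hs. Lpure H 0 n (cword 0 n hs ([], \<phi>s)))"
   using hmulti_cpure[OF words_ConsB[OF w(2,1)]] hmulti_cpure[OF w(2)] by simp_all
  have c: "coad01 H a \<phi> \<in>: L01 H" for a using w(1) by (simp add: coad01_Hdual)
  have "hlift H n fscale (%hs. Lpure H 0 (Suc n) (cword 0 (Suc n) (a # hs) ([], \<phi> # \<phi>s))) (itcomul H n b) =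
   cB n (coad01 H a \<phi>) (coad H 0 n b (Lpure H 0 n ([], \<phi>s)))" for a b
  proof -
   have "cB n (coad01 H a \<phi>) (coad H 0 n b (Lpure H 0 n ([], \<phi>s))) =
    cB n (coad01 H a \<phi>) (hlift H n fscale (%hs. Lpure H 0 n (cword 0 n hs ([], \<phi>s))) (itcomul H n b))"
    using p w unfolding pp_def by simp
   also have "\<dots> = hlift H n fscale (%hs. cB n (coad01 H a \<phi>) (Lpure H 0 n (cword 0 n hs ([], \<phi>s)))) (itcomul H n b)"
    by (rule hlift_linear_map[where W = "Lten 0 n", unfolded vscale_tensor, OF is_vspace_tensor m' _ s
      bilinear_onD(1)[OF bilinear_consB[OF is_vspace_L01] c] itcomul_closed]) (simp add: pure_closed cword_words w)
   also have "\<dots> = hlift H n fscale (%hs. Lpure H 0 (Suc n) (cword 0 (Suc n) (a # hs) ([], \<phi> # \<phi>s))) (itcomul H n b)"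
    by (rule fun_cong[OF hlift_cong]) (simp only: cpure_B[OF w])
   finally show ?thesis ..
  qed
  then show ?thesis using hlift_itcomul_Suc[OF s m, of h] by (simp del: itcomul.simps)
 qed
 have SA: "coad H (Suc g) n h = liftA g n (%m t. dS H h (%a b. cA g n (coad10 H a m) (coad H g n b t)))"
  if "pp g n" for g n h
  unfolding coad_cword[of "Suc g"] liftA_def using A[OF that]
  by (intro tlift_cong) (auto simp: words_SucA simp del: itcomul.simps L10_simps)
 have SB: "coad H 0 (Suc n) h = liftB n (%m t. dS H h (%a b. cB n (coad01 H a m) (coad H 0 n b t)))"
  if "pp 0 n" for n h
  unfolding coad_cword[of 0 "Suc n"] liftB_def using B[OF that]
  by (intro tlift_cong) (auto simp: words_SucB simp del: itcomul.simps vspace_L01)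
 have z: "is_act (GA 0 0) (coad H 0 0) \<and> pp 0 0"
 proof
  have l: "linear_on (Lten 0 0) fscale (coad H 0 0 h)" for h
   unfolding coad_cword by (rule tlift_0(1)[OF s])
  have e: "coad H 0 0 h (fscale c (Lpure H 0 0 ([], []))) = fscale c (fscale (counit H h) (Lpure H 0 0 ([], [])))" for h c
   using linear_on_scale[OF l pure_closed, of "([], [])" h c] by (simp add: coad_0 words_0)
  have p: "Lpure H 0 0 ([], []) \<in>: Lten 0 0" by (rule pure_closed) (simp add: words_0)
  have sc: "fscale c X \<in>: Lten 0 0" if "X \<in>: Lten 0 0" for c X
   using is_vspace_scale[OF is_vspace_tensor that, of c] by simp
  show "is_act (GA 0 0) (coad H 0 0)"
   unfolding is_act_def graph_simps linear_graph
  proof (intro conjI allI ballI l)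
   fix X assume "X \<in>: Lten 0 0"
   then obtain c where X: "X = fscale c (Lpure H 0 0 ([], []))" by (rule tensor_0)
   show "hlin H fscale (%h. coad H 0 0 h X)"
    unfolding X e by (intro hlin_intros s)
   show "coad H 0 0 h X \<in>: Lten 0 0" for h
    unfolding X e by (intro sc p)
  qed
  show "pp 0 0"
   unfolding pp_def
   by (simp add: words_0 coad_cword tlift_0(2)[OF s] del: itcomul.simps)
 qed
 have PB: "is_act (GA 0 n) (coad H 0 n) \<and> pp 0 n" for n
 proof (induction n)
  case (Suc n)
  note T = step_liftB[OF graph_simps(1)[of 0 "Suc n"], of n]
  have act: "coad H 0 (Suc n) h = liftB n (%m t. dS H h (%a b. cB n (coad01 H a m) (coad H 0 n b t)))" for h
   using SB Suc by blast
  note lift = act_lift[OF T act_L01 conjunct1[OF Suc], where ?act2.0 = "coad H 0 (Suc n)", OF act]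
  have "pp 0 (Suc n)"
   unfolding pp_def
  proof (intro ballI allI)
   fix w h assume "w \<in> Lwords 0 (Suc n)"
   then obtain \<phi> \<phi>s where w: "w = ([], \<phi> # \<phi>s)" "\<phi> \<in>: L01 H" "([], \<phi>s) \<in> Lwords 0 n"
    by (auto simp: words_SucB)
   have "coad H 0 (Suc n) h (cB n \<phi> (Lpure H 0 n ([], \<phi>s))) = dS H h (%a b. cB n (coad01 H a \<phi>) (coad H 0 n b (Lpure H 0 n ([], \<phi>s))))"
    by (rule lift(2)[OF w(2)]) (simp add: pure_closed w)
   then show "coad H 0 (Suc n) h (Lpure H 0 (Suc n) w) =
    hlift H (0 + Suc n) fscale (%hs. Lpure H 0 (Suc n) (cword 0 (Suc n) hs w)) (itcomul H (0 + Suc n) h)"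
    using B[OF conjunct2[OF Suc] w(2,3)] by (simp add: w(1) consB_pure[OF w(2,3)] del: itcomul.simps)
  qed
  then show ?case using lift(1) by blast
 qed (rule z)
 have P: "is_act (GA g n) (coad H g n) \<and> pp g n" for g n
 proof (induction g)
  case (Suc g)
  note T = step_liftA[OF graph_simps(1)[of "Suc g" n], of g n]
  have act: "coad H (Suc g) n h = liftA g n (%m t. dS H h (%a b. cA g n (coad10 H a m) (coad H g n b t)))" for h
   using SA Suc by blast
  note lift = act_lift[OF T act_L10 conjunct1[OF Suc], where ?act2.0 = "coad H (Suc g) n", OF act]
  have "pp (Suc g) n"
   unfolding pp_def
  proof (intro ballI allI)
   fix w h assume "w \<in> Lwords (Suc g) n"
   then obtain x xs \<phi>s where w: "w = (x # xs, \<phi>s)" "x \<in>: L10 H" "(xs, \<phi>s) \<in> Lwords g n"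
    by (auto simp: words_SucA simp del: L10_simps)
   have "coad H (Suc g) n h (cA g n x (Lpure H g n (xs, \<phi>s))) = dS H h (%a b. cA g n (coad10 H a x) (coad H g n b (Lpure H g n (xs, \<phi>s))))"
    by (rule lift(2)[OF w(2)]) (simp add: pure_closed w)
   then show "coad H (Suc g) n h (Lpure H (Suc g) n w) =
    hlift H (Suc g + n) fscale (%hs. Lpure H (Suc g) n (cword (Suc g) n hs w)) (itcomul H (Suc g + n) h)"
    by (simp only: A[OF conjunct2[OF Suc] w(2,3)] w(1) consA_pure[OF w(2,3)])
  qed
  then show ?case using lift(1) by blast
 qed (rule PB)
 show "is_act (GA g n) (coad H g n)" using P by blast
 show "coad H (Suc g) n h = liftA g n (%m t. dS H h (%a b. cA g n (coad10 H a m) (coad H g n b t)))"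
  using SA P by blast
 show "coad H 0 (Suc n) h = liftB n (%m t. dS H h (%a b. cB n (coad01 H a m) (coad H 0 n b t)))"
  using SB P by blast
qed

end

section \<open>The morphism\<close>

context quasitriangular_bij
begin

lemma phi_lift:
 fixes M0 :: "('k, 'm0::ab_group_add) kalg" and M1 :: "('k, 'm1::ab_group_add) kalg"
  and M2 :: "('k, 'm2::ab_group_add) kalg" and B0 :: "('k, 'b0::ab_group_add) kalg"
  and B1 :: "('k, 'b1::ab_group_add) kalg" and B2 :: "('k, 'b2::ab_group_add) kalg"
 assumes mm0: "moment_map M0 act0 B0 \<Phi>0 D0" and mm1: "moment_map M1 act1 B1 \<Phi>1 D1"
  and T: "step_lift M0 M1 M2 C (vscale B2) T" and C': "tensor_step B0 B1 B2 C'"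
  and \<Phi>2: "\<Phi>2 = T (%m n. rS H (%a b. C' (\<Phi>0 (act0 a m)) (amult B1 (D1 b) (\<Phi>1 n))))"
 shows "linear_on M2 (vscale B2) \<Phi>2"
  and "m \<in>: M0 ==> n \<in>: M1 ==>
   \<Phi>2 (C m n) = rS H (%a b. C' (\<Phi>0 (act0 a m)) (amult B1 (D1 b) (\<Phi>1 n)))"
proof -
 note m0 = moment_mapD[OF mm0] and m1 = moment_mapD[OF mm1]
 note a = is_actD(2,1)[OF m0(2)] m0(5,6) and b = m1(4-6,10)
 note bC = tensor_stepD(4)[OF C'] and V = tensor_stepD(3)[OF C']
 have "bilinear_on M0 M1 (vscale B2) (%m n. rS H (%a b. C' (\<Phi>0 (act0 a m)) (amult B1 (D1 b) (\<Phi>1 n))))"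
 proof (rule bilinear_onI; rule linear_on_ssum_fun[OF is_vspace_vector_space[OF V]])
  show "linear_on M1 (vscale B2) (%n. C' (\<Phi>0 (act0 p m)) (amult B1 (D1 q) (\<Phi>1 n)))" if "m \<in>: M0" for m p q
   by (rule linear_on_via[OF bilinear_onD(1)[OF bC a(4)[OF a(2)[OF that]]]
    linear_on_via[OF bilinear_onD(1)[OF is_alg_bilinear[OF b(1)] b(4)] b(2,3)]]) (assumption | rule is_alg_closed[OF b(1)] b)+
  show "linear_on M0 (vscale B2) (%m. C' (\<Phi>0 (act0 p m)) (amult B1 (D1 q) (\<Phi>1 n)))" if "n \<in>: M1" for n p q
   by (rule linear_on_via[OF bilinear_onD(2)[OF bC is_alg_closed[OF b(1) b(4) b(3)[OF that]]] linear_on_via[OF a(3) a(1)]])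
    (assumption | rule a)+
 qed
 then show "linear_on M2 (vscale B2) \<Phi>2"
  and "m \<in>: M0 ==> n \<in>: M1 ==>
   \<Phi>2 (C m n) = rS H (%a b. C' (\<Phi>0 (act0 a m)) (amult B1 (D1 b) (\<Phi>1 n)))"
  using T unfolding step_lift_def \<Phi>2 by blast+
qed

lemma moment_map_L01: "moment_map (L01 H) (coad01 H) (Halg H) (Phi01 H) (%h. h)"
proof -
 have h: "amult (Halg H) = (*)" "aone (Halg H) = 1" by (simp_all add: Halg_def)
 show ?thesis
  unfolding moment_map_def
  using is_alg_L01 act_L01 is_assoc_Halg linear_Phi01 Phi01_mult Phi01_one Phi01_moment hlin_id
  by (simp add: h Halg_UNIV)
qed

lemma moment_map_L10: "moment_map (L10 H) (coad10 H) (HH H) (Phi10 H) D10"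
 unfolding moment_map_def
 using is_alg_L10 act_L10 is_assoc_HH Phi10_lift(1) Phi10_closed Phi10_mult Phi10_one hlin_D10[OF hlin_id] D10_closed
  D10_mult D10_one Phi10_moment by (simp del: L10_simps(2,3) HH_simps(2-))

abbreviation "TA \<equiv> tensor_alg (HH H) (Halg H)"
abbreviation "tA \<equiv> consA (HH H) (Halg H)"
abbreviation "tB \<equiv> consB (HH H) (Halg H)"

lemmas step_target = step_tensor_alg[OF is_alg_HH is_alg_Halg]

lemma is_assoc_TA: "is_assoc_alg (TA g n)"
 by (rule is_assoc_tensor_alg[OF is_alg_HH is_alg_Halg is_assoc_HH is_assoc_Halg])

lemma Halg_one: "aone (Halg H) = 1"
 by (simp add: Halg_def)

lemma aone_TA: "aone (TA (Suc g) n) = tA g n (aone (HH H)) (aone (TA g n))" "aone (TA 0 (Suc n)) = tB n 1 (aone (TA 0 n))"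
proof -
 have w: "(replicate g (aone (HH H)), replicate n 1) \<in> words (HH H) (Halg H) g n" for g n
  using is_alg_one[OF is_alg_HH] by (auto simp: words_def Halg_UNIV simp del: HH_simps)
 show "aone (TA (Suc g) n) = tA g n (aone (HH H)) (aone (TA g n))"
  unfolding aone_tensor_alg Halg_one using consA_pure[OF is_alg_one[OF is_alg_HH] w] by simp
 have w0: "([], replicate n 1) \<in> words (HH H) (Halg H) 0 n" using w[of 0 n] by simp
 show "aone (TA 0 (Suc n)) = tB n 1 (aone (TA 0 n))"
  unfolding aone_tensor_alg Halg_one using consB_pure[OF Halg_UNIV w0] by simp
qed

lemma aone_graph:
 "aone (GA (Suc g) n) = cA g n (aone (L10 H)) (aone (GA g n))"
 "aone (GA 0 (Suc n)) = cB n (aone (L01 H)) (aone (GA 0 n))"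
proof -
 have w: "(replicate g (aone (L10 H)), replicate n (aone (L01 H))) \<in> Lwords g n" for g n
  using is_alg_one[OF is_alg_L10] is_alg_one[OF is_alg_L01] by (auto simp: words_def simp del: L10_simps vspace_L01)
 show "aone (GA (Suc g) n) = cA g n (aone (L10 H)) (aone (GA g n))"
  unfolding graph_alg_def using consA_pure[OF is_alg_one[OF is_alg_L10] w] by (simp del: L10_simps vspace_L01)
 have w0: "([], replicate n (aone (L01 H))) \<in> Lwords 0 n" using w[of 0 n] by simp
 show "aone (GA 0 (Suc n)) = cB n (aone (L01 H)) (aone (GA 0 n))"
  unfolding graph_alg_def using consB_pure[OF is_alg_one[OF is_alg_L01] w0] by (simp del: L10_simps vspace_L01)
qed

text \<open>Replacing \<open>sumR\<close> by \<open>ssum\<close> needs bilinearity of the product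
  with one factor less. This hypothesis is discharged along the induction in
  \<open>is_alg_graph\<close>.\<close>

lemma graph_multA:
 assumes "is_alg (GA g n)"
 shows "amult (GA (Suc g) n) X Y = liftA g n (%m t. liftA g n (%m' t'.
  rS H (%a b. cA g n (amult (L10 H) m (coad10 H a m')) (amult (GA g n) (coad H g n b t) t'))) Y) X"
 unfolding graph_simps graph_mult.simps liftA_def consA_def[symmetric]
proof (rule fun_cong[OF tlift_cong])
 fix w assume "w \<in> Lwords (Suc g) n"
 then obtain x xs \<phi>s where w: "w = (x # xs, \<phi>s)" "x \<in>: L10 H" "(xs, \<phi>s) \<in> Lwords g n"
  by (auto simp: words_SucA simp del: L10_simps)
 show "(case w of (xs, \<phi>s) => Llift H (Suc g) n (%(ys, \<psi>s). sumR H fscale (%a b.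
   cA g n (amult (L10 H) (hd xs) (coad10 H a (hd ys))) (graph_mult H g n (coad H g n b (Lpure H g n (tl xs, \<phi>s))) (Lpure H g n (tl ys, \<psi>s))))) Y) =
  (case w of (xs, \<phi>s) => Llift H (Suc g) n (%(ys, \<psi>s). rS H (%a b.
   cA g n (amult (L10 H) (hd xs) (coad10 H a (hd ys))) (graph_mult H g n (coad H g n b (Lpure H g n (tl xs, \<phi>s))) (Lpure H g n (tl ys, \<psi>s))))) Y)"
  unfolding w(1) prod.case
 proof (rule fun_cong[OF tlift_cong])
  fix w' assume "w' \<in> Lwords (Suc g) n"
  then obtain y ys \<psi>s where w': "w' = (y # ys, \<psi>s)" "y \<in>: L10 H" "(ys, \<psi>s) \<in> Lwords g n"
   by (auto simp: words_SucA simp del: L10_simps)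
  note p = pure_closed[OF w(3)] pure_closed[OF w'(3)]
  have c: "coad H g n b (Lpure H g n (xs, \<phi>s)) \<in>: GA g n" for b
   using coad_act[of g n] p by (simp add: is_act_def)
  have cc: "graph_mult H g n (coad H g n b (Lpure H g n (xs, \<phi>s))) (Lpure H g n (ys, \<psi>s)) \<in>: Lten g n" for b
   using is_alg_closed[OF assms c] p by simp
  have cm: "amult (L10 H) x (coad10 H a y) \<in>: L10 H" for a
   by (intro is_alg_closed[OF is_alg_L10] coad10_closed w w')
  have h1: "hlin H fscale (%a. amult (L10 H) x (coad10 H a y))"
   using hlin_linear[OF bilinear_onD(1)[OF is_alg_bilinear[OF is_alg_L10] w(2)], of H "%a. coad10 H a y"]
    hlin_coad10[OF w'(2)] coad10_closed[OF w'(2)] by simp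
  have h2: "hlin H fscale (%b. graph_mult H g n (coad H g n b (Lpure H g n (xs, \<phi>s))) (Lpure H g n (ys, \<psi>s)))"
   using hlin_linear[OF bilinear_onD(2)[OF is_alg_bilinear[OF assms], of "Lpure H g n (ys, \<psi>s)"], of H "%b. coad H g n b (Lpure H g n (xs, \<phi>s))"]
    coad_act[of g n] p c by (simp add: is_act_def)
  show "(case w' of (ys, \<psi>s) => sumR H fscale (%a b.
    cA g n (amult (L10 H) (hd (x # xs)) (coad10 H a (hd ys))) (graph_mult H g n (coad H g n b (Lpure H g n (tl (x # xs), \<phi>s))) (Lpure H g n (tl ys, \<psi>s))))) =
   (case w' of (ys, \<psi>s) => rS H (%a b.
    cA g n (amult (L10 H) (hd (x # xs)) (coad10 H a (hd ys))) (graph_mult H g n (coad H g n b (Lpure H g n (tl (x # xs), \<phi>s))) (Lpure H g n (tl ys, \<psi>s)))))"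
   unfolding w'(1) prod.case list.sel
   by (rule sw_rmat[OF vector_space_fscale hlin_cA(1)[OF cc h1 cm] hlin_cA(2)[OF cm h2 cc]])
 qed
qed

lemma graph_multB:
 assumes "is_alg (GA 0 n)"
 shows "amult (GA 0 (Suc n)) X Y = liftB n (%m t. liftB n (%m' t'.
  rS H (%a b. cB n (amult (L01 H) m (coad01 H a m')) (amult (GA 0 n) (coad H 0 n b t) t'))) Y) X"
 unfolding graph_simps graph_mult.simps liftB_def consB_def[symmetric]
proof (rule fun_cong[OF tlift_cong])
 fix w assume "w \<in> Lwords 0 (Suc n)"
 then obtain x \<phi>s where w: "w = ([], x # \<phi>s)" "x \<in>: L01 H" "([], \<phi>s) \<in> Lwords 0 n"
  by (auto simp: words_SucB)
 show "(case w of (_, \<phi>s) => Llift H 0 (Suc n) (%(_, \<psi>s). sumR H fscale (%a b.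
   cB n (amult (L01 H) (hd \<phi>s) (coad01 H a (hd \<psi>s))) (graph_mult H 0 n (coad H 0 n b (Lpure H 0 n ([], tl \<phi>s))) (Lpure H 0 n ([], tl \<psi>s))))) Y) =
  (case w of (_, \<phi>s) => Llift H 0 (Suc n) (%(_, \<psi>s). rS H (%a b.
   cB n (amult (L01 H) (hd \<phi>s) (coad01 H a (hd \<psi>s))) (graph_mult H 0 n (coad H 0 n b (Lpure H 0 n ([], tl \<phi>s))) (Lpure H 0 n ([], tl \<psi>s))))) Y)"
  unfolding w(1) prod.case
 proof (rule fun_cong[OF tlift_cong])
  fix w' assume "w' \<in> Lwords 0 (Suc n)"
  then obtain y \<psi>s where w': "w' = ([], y # \<psi>s)" "y \<in>: L01 H" "([], \<psi>s) \<in> Lwords 0 n"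
   by (auto simp: words_SucB)
  note p = pure_closed[OF w(3)] pure_closed[OF w'(3)]
  have d: "x \<in>: Hdual H" "y \<in>: Hdual H" using w(2) w'(2) by simp_all
  have c: "coad H 0 n b (Lpure H 0 n ([], \<phi>s)) \<in>: GA 0 n" for b
   using coad_act[of 0 n] p by (simp add: is_act_def)
  have cc: "graph_mult H 0 n (coad H 0 n b (Lpure H 0 n ([], \<phi>s))) (Lpure H 0 n ([], \<psi>s)) \<in>: Lten 0 n" for b
   using is_alg_closed[OF assms c] p by simp
  have cm: "amult (L01 H) x (coad01 H a y) \<in>: L01 H" for a
   using d by (simp add: L01_closed coad01_Hdual)
  have h1: "hlin H fscale (%a. amult (L01 H) x (coad01 H a y))"
   by (intro hlin_intros d coad01_Hdual)
  have h2: "hlin H fscale (%b. graph_mult H 0 n (coad H 0 n b (Lpure H 0 n ([], \<phi>s))) (Lpure H 0 n ([], \<psi>s)))"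
   using hlin_linear[OF bilinear_onD(2)[OF is_alg_bilinear[OF assms], of "Lpure H 0 n ([], \<psi>s)"], of H "%b. coad H 0 n b (Lpure H 0 n ([], \<phi>s))"]
    coad_act[of 0 n] p c by (simp add: is_act_def)
  show "(case w' of (_, \<psi>s) => sumR H fscale (%a b.
    cB n (amult (L01 H) (hd (x # \<phi>s)) (coad01 H a (hd \<psi>s))) (graph_mult H 0 n (coad H 0 n b (Lpure H 0 n ([], tl (x # \<phi>s)))) (Lpure H 0 n ([], tl \<psi>s))))) =
   (case w' of (_, \<psi>s) => rS H (%a b.
    cB n (amult (L01 H) (hd (x # \<phi>s)) (coad01 H a (hd \<psi>s))) (graph_mult H 0 n (coad H 0 n b (Lpure H 0 n ([], tl (x # \<phi>s)))) (Lpure H 0 n ([], tl \<psi>s)))))"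
   unfolding w'(1) prod.case list.sel
   by (rule sw_rmat[OF vector_space_fscale hlin_cB(1)[OF cc h1 cm] hlin_cB(2)[OF cm h2 cc]])
 qed
qed

lemma graph_mult_0:
 "graph_mult H 0 0 (fscale c (Lpure H 0 0 ([], []))) (fscale d (Lpure H 0 0 ([], []))) = fscale c (fscale d (Lpure H 0 0 ([], [])))"
 by (simp add: tlift_0(3)[OF vector_space_fscale])

lemma is_alg_graph: "is_alg (GA g n)"
proof -
 have z: "is_alg (GA 0 0)"
 proof -
  let ?e = "Lpure H 0 0 ([], [])" and ?V = "Lten 0 0"
  note s = vector_space_fscale
  have one: "aone (GA 0 0) = ?e" by (simp add: graph_alg_def)
  have p: "?e \<in>: ?V" by (rule pure_closed) (simp add: words_0)
  have sc: "fscale c X \<in>: ?V" if "X \<in>: ?V" for c X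
   using is_vspace_scale[OF is_vspace_tensor that, of c] by simp
  have l1: "linear_on ?V fscale (%X. graph_mult H 0 0 X Y)" for Y
   unfolding graph_mult.simps by (rule tlift_0(1)[OF s])
  have l2: "linear_on ?V fscale (graph_mult H 0 0 X)" if X: "X \<in>: ?V" for X
  proof -
   obtain c where X: "X = fscale c ?e" using X by (rule tensor_0)
   show ?thesis
    unfolding graph_mult.simps X tlift_0(3)[OF s] by (rule linear_on_fun_scale[OF s tlift_0(1)[OF s]])
  qed
  have "graph_mult H 0 0 X Y \<in>: ?V" if XY: "X \<in>: ?V" "Y \<in>: ?V" for X Y
  proof -
   obtain c d where XY: "X = fscale c ?e" "Y = fscale d ?e" using XY by (metis tensor_0)
   show ?thesis unfolding XY graph_mult_0 by (intro sc p)
  qed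
  then show ?thesis
   unfolding is_alg_def graph_simps linear_graph bilinear_graph using is_vspace_graph l1 l2 p one
   by (simp add: bilinear_on_def linear_graph del: graph_mult.simps)
 qed
 have B: "is_alg (GA 0 n)" for n
 proof (induction n)
  case (Suc n)
  show ?case
   by (rule mult_lift(1)[OF step_liftB[OF graph_simps(1)[of 0 "Suc n"], of n] act_L01 coad_act[of 0 n] is_alg_L01 Suc])
    (rule graph_multB[OF Suc], rule aone_graph(2))
 qed (rule z)
 show ?thesis
 proof (induction g)
  case (Suc g)
  show ?case
   by (rule mult_lift(1)[OF step_liftA[OF graph_simps(1)[of "Suc g" n], of g n] act_L10 coad_act[of g n] is_alg_L10 Suc])
    (rule graph_multA[OF Suc], rule aone_graph(1))
 qed (rule B)
qed

lemma graph_mult_cA: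
 assumes "m \<in>: L10 H" "t \<in>: GA g n" "m' \<in>: L10 H" "t' \<in>: GA g n"
 shows "amult (GA (Suc g) n) (cA g n m t) (cA g n m' t') =
  rS H (%a b. cA g n (amult (L10 H) m (coad10 H a m')) (amult (GA g n) (coad H g n b t) t'))"
 by (rule mult_lift(2)[OF step_liftA[OF graph_simps(1)[of "Suc g" n], of g n] act_L10 coad_act[of g n] is_alg_L10 is_alg_graph[of g n] _ _ assms])
  (rule graph_multA[OF is_alg_graph], rule aone_graph(1))

lemma graph_mult_cB:
 assumes "m \<in>: L01 H" "t \<in>: GA 0 n" "m' \<in>: L01 H" "t' \<in>: GA 0 n"
 shows "amult (GA 0 (Suc n)) (cB n m t) (cB n m' t') =
  rS H (%a b. cB n (amult (L01 H) m (coad01 H a m')) (amult (GA 0 n) (coad H 0 n b t) t'))"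
 by (rule mult_lift(2)[OF step_liftB[OF graph_simps(1)[of 0 "Suc n"], of n] act_L01 coad_act[of 0 n] is_alg_L01 is_alg_graph[of 0 n] _ _ assms])
  (rule graph_multB[OF is_alg_graph], rule aone_graph(2))

lemma coad_cA:
 "m \<in>: L10 H ==> t \<in>: GA g n ==>
  coad H (Suc g) n h (cA g n m t) = dS H h (%a b. cA g n (coad10 H a m) (coad H g n b t))"
 by (rule act_lift(2)[OF step_liftA[OF graph_simps(1)[of "Suc g" n], of g n] act_L10 coad_act[of g n]]) (rule coad_SucA)

lemma coad_cB:
 "m \<in>: L01 H ==> t \<in>: GA 0 n ==>
  coad H 0 (Suc n) h (cB n m t) = dS H h (%a b. cB n (coad01 H a m) (coad H 0 n b t))"
 by (rule act_lift(2)[OF step_liftB[OF graph_simps(1)[of 0 "Suc n"], of n] act_L01 coad_act[of 0 n]]) (rule coad_SucB)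

text \<open>The two recursions mirror the clauses of \<open>graph_mult\<close>: handles are split
  off until none is left, then punctures, ending with the identification of the zeroth tensor
  powers.\<close>

primrec PhiB where
 "PhiB 0 = Llift H 0 0 (%_. Tpure H 0 0 ([], []))"
| "PhiB (Suc n) = liftB n (%m t. rS H (%a b. tB n (Phi01 H (coad01 H a m)) (amult (TA 0 n) (Dmap H 0 n b) (PhiB n t))))"

primrec Phi where
 "Phi 0 n = PhiB n"
| "Phi (Suc g) n = liftA g n (%m t. rS H (%a b. tA g n (Phi10 H (coad10 H a m)) (amult (TA g n) (Dmap H g n b) (Phi g n t))))"

text \<open>At the bottom all elements are multiples of the unit, D is the counit, and the moment
  identity is the counit axiom. Punctures and then handles are added by
  \<open>moment_map_step\<close>.\<close>

lemma moment_map_Phi: "moment_map (GA g n) (coad H g n) (TA g n) (Phi g n) (Dmap H g n)"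
proof -
 note s = vector_space_fscale
 have z: "moment_map (GA 0 0) (coad H 0 0) (TA 0 0) (Phi 0 0) (Dmap H 0 0)"
 proof -
  let ?e = "Lpure H 0 0 ([], [])" and ?V = "Lten 0 0"
  let ?f = "Tpure H 0 0 ([], [])" and ?W = "Tten 0 0" and ?m = "amult (TA 0 0)"
  have one: "aone (GA 0 0) = ?e" "aone (TA 0 0) = ?f" by (simp_all add: graph_alg_def aone_tensor_alg)
  have f: "?f \<in>: ?W" by (rule pure_closed) (simp add: words_0)
  have e: "?e \<in>: ?V" by (rule pure_closed) (simp add: words_0)
  have sc: "fscale c X \<in>: ?W" if "X \<in>: ?W" for c X
   using is_vspace_scale[OF is_vspace_tensor that, of c] by simp
  have as: "is_alg (TA 0 0)" by (rule is_assoc_alg_is_alg[OF is_assoc_TA])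
  have mf: "?m (fscale c ?f) (fscale d ?f) = fscale c (fscale d ?f)" for c d
  proof -
   have "?m (fscale c ?f) (fscale d ?f) = fscale c (?m ?f (fscale d ?f))"
    using linear_on_scale[OF bilinear_onD(2)[OF is_alg_bilinear[OF as], of "fscale d ?f"], of ?f c] f sc by simp
   also have "?m ?f (fscale d ?f) = fscale d ?f"
    using is_assoc_TA[of 0 0] sc[OF f] by (simp add: is_assoc_alg_def one)
   finally show ?thesis .
  qed
  have P: "Phi 0 0 (fscale c ?e) = fscale c ?f" for c by (simp add: tlift_0(3)[OF s])
  have ce: "coad H 0 0 h (fscale c ?e) = fscale c (fscale (counit H h) ?e)" for c h
   using coad_act[of 0 0] linear_on_scale[of "GA 0 0" fscale "coad H 0 0 h" ?e c] e by (simp add: is_act_def coad_0)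
  have "dS H h (%u v. ?m (Dmap H 0 0 u) (Phi 0 0 (coad H 0 0 v X))) = ?m (Phi 0 0 X) (Dmap H 0 0 h)" if X: "X \<in>: ?V" for h X
  proof -
   obtain c where X: "X = fscale c ?e" using X by (rule tensor_0)
   have "dS H h (%u v. ?m (Dmap H 0 0 u) (Phi 0 0 (coad H 0 0 v X))) =
    dS H h (%u v. fscale (counit H u) (fscale (c * counit H v) ?f))"
    by (simp add: X ce fscale_fscale P Dmap_0 mf del: Phi.simps)
   also have "\<dots> = fscale (c * counit H h) ?f"
    by (rule dS_counit_left) (intro hlin_intros s)
   finally show ?thesis by (simp add: X P Dmap_0 mf fscale_fscale del: Phi.simps)
  qed
  moreover have "Phi 0 0 X \<in>: ?W" if "X \<in>: ?V" for X
   using that by (rule tensor_0) (simp add: P sc f del: Phi.simps)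
  moreover have "Phi 0 0 (graph_mult H 0 0 X Y) = ?m (Phi 0 0 X) (Phi 0 0 Y)" if XY: "X \<in>: ?V" "Y \<in>: ?V" for X Y
  proof -
   obtain c d where "X = fscale c ?e" "Y = fscale d ?e" using XY by (metis tensor_0)
   then show ?thesis by (simp add: graph_mult_0 fscale_fscale P mf del: Phi.simps graph_mult.simps)
  qed
  moreover have "linear_on ?V fscale (Phi 0 0)" by (simp add: tlift_0(1)[OF s])
  moreover have "Phi 0 0 ?e = ?f" by (simp add: tlift_0(2)[OF s])
  moreover have "Dmap H 0 0 (h * k) = ?m (Dmap H 0 0 h) (Dmap H 0 0 k)" for h k
   by (simp add: Dmap_0 mf counit_mult fscale_fscale)
  moreover have "Dmap H 0 0 1 = ?f" by (simp add: Dmap_0 counit_one fscale_def)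
  ultimately show ?thesis
   unfolding moment_map_def using is_alg_graph[of 0 0] coad_act[of 0 0] is_assoc_TA[of 0 0] hlin_Dmap[of 0 0] Dmap_closed[of 0 0]
   by (simp add: one linear_graph del: Phi.simps graph_mult.simps)
 qed
 have B: "moment_map (GA 0 n) (coad H 0 n) (TA 0 n) (Phi 0 n) (Dmap H 0 n)" for n
 proof (induction n)
  case (Suc n)
  have T: "step_lift (L01 H) (GA 0 n) (GA 0 (Suc n)) (cB n) (vscale (TA 0 (Suc n))) (liftB n)"
   by (rule step_liftB) simp
  have C: "tensor_step (L01 H) (GA 0 n) (GA 0 (Suc n)) (cB n)" using T by (simp add: step_lift_def)
  have P: "Phi 0 (Suc n) = liftB n (%m t. rS H (%a b. tB n (Phi01 H (coad01 H a m)) (amult (TA 0 n) (Dmap H 0 n b) (Phi 0 n t))))"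
   by simp
  have one: "aone (TA 0 (Suc n)) = tB n (aone (Halg H)) (aone (TA 0 n))"
   using aone_TA(2)[of n] by (simp add: Halg_one del: HH_simps)
  have BC: "amult (TA 0 (Suc n)) (tB n x t) (tB n x' t') = tB n (amult (Halg H) x x') (amult (TA 0 n) t t')"
   if "x \<in>: Halg H" "t \<in>: TA 0 n" "x' \<in>: Halg H" "t' \<in>: TA 0 n" for x t x' t'
   using tensor_alg_consB[OF is_alg_HH is_alg_Halg that(1,3), of t n t'] that by simp
  have pl: "linear_on (GA 0 (Suc n)) (vscale (TA 0 (Suc n))) (Phi 0 (Suc n))"
   by (rule phi_lift(1)[OF moment_map_L01 Suc T step_target(2)[of n]]) (rule P)
  have pC: "Phi 0 (Suc n) (cB n m t) = rS H (%a b. tB n (Phi01 H (coad01 H a m)) (amult (TA 0 n) (Dmap H 0 n b) (Phi 0 n t)))"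
   if "m \<in>: L01 H" "t \<in>: GA 0 n" for m t
   by (rule phi_lift(2)[OF moment_map_L01 Suc T step_target(2)[of n] _ that]) (rule P)
  show ?case
   by (rule moment_map_step[OF modalg_L01 moment_map_L01 Suc C step_target(2)[of n] is_alg_graph coad_act is_assoc_TA])
    (rule graph_mult_cB BC aone_graph(2) one coad_cB Dmap_SucB pl pC; assumption?)+
 qed (rule z)
 show ?thesis
 proof (induction g)
  case (Suc g)
  have T: "step_lift (L10 H) (GA g n) (GA (Suc g) n) (cA g n) (vscale (TA (Suc g) n)) (liftA g n)"
   by (rule step_liftA) simp
  have C: "tensor_step (L10 H) (GA g n) (GA (Suc g) n) (cA g n)" using T by (simp add: step_lift_def)
  have P: "Phi (Suc g) n = liftA g n (%m t. rS H (%a b. tA g n (Phi10 H (coad10 H a m)) (amult (TA g n) (Dmap H g n b) (Phi g n t))))"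
   by simp
  have BC: "amult (TA (Suc g) n) (tA g n x t) (tA g n x' t') = tA g n (amult (HH H) x x') (amult (TA g n) t t')"
   if "x \<in>: HH H" "t \<in>: TA g n" "x' \<in>: HH H" "t' \<in>: TA g n" for x t x' t'
   using tensor_alg_consA[OF is_alg_HH is_alg_Halg that(1,3), of t g n t'] that by simp
  have pl: "linear_on (GA (Suc g) n) (vscale (TA (Suc g) n)) (Phi (Suc g) n)"
   by (rule phi_lift(1)[OF moment_map_L10 Suc T step_target(1)[of g n]]) (rule P)
  have pC: "Phi (Suc g) n (cA g n m t) = rS H (%a b. tA g n (Phi10 H (coad10 H a m)) (amult (TA g n) (Dmap H g n b) (Phi g n t)))"
   if "m \<in>: L10 H" "t \<in>: GA g n" for m t
   by (rule phi_lift(2)[OF moment_map_L10 Suc T step_target(1)[of g n] _ that]) (rule P)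
  show ?case
   by (rule moment_map_step[OF modalg_L10 moment_map_L10 Suc C step_target(1)[of g n] is_alg_graph coad_act is_assoc_TA])
    (rule graph_mult_cA BC aone_graph(1) aone_TA(1) coad_cA Dmap_SucA pl pC; assumption?)+
 qed (rule B)
qed

end

section \<open>Tools for uniqueness and for the values on generators\<close>

lemma tlift_eqI:
 assumes "vector_space (s :: 'k::field => 'u::ab_group_add => 'u)" "is_vspace A" "is_vspace B" "linear_on (tensor A B g n) s L"
  "\<And>w. w \<in> words A B g n ==> F w = L (pure A B g n w)" "X \<in>: tensor A B g n"
 shows "tlift A B g n s F X = L X"
proof -
 have "multilinear A B g n s (%w. L (pure A B g n w))"
  by (rule multilinear_linear[where V = "tensor A B g n", OF _ assms(4) pure_closed]) (simp_all add: multilinear_pure)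
 then have "multilinear A B g n s F"
  by (rule multilinear_cong) (simp_all add: assms)
 from tensor_universal(3)[OF assms(1) this assms(4) _ assms(6)] show ?thesis by (simp add: assms(5))
qed

lemma tensor_step_linear_eq:
 assumes "tensor_step V W U C" "vector_space (s :: 'k::field => 'u::ab_group_add => 'u)" "linear_on U s K" "linear_on U s L"
  "\<And>v w. v \<in>: V ==> w \<in>: W ==> K (C v w) = L (C v w)" "X \<in>: U"
 shows "K X = L X"
 by (rule span_linear_eq[of U "{C v w |v w. v \<in>: V \<and> w \<in>: W}", OF _ _ assms(2-4) _ assms(6)])
  (use assms(1,5) in \<open>auto simp: tensor_step_def\<close>)

text \<open>Prefixes \<open>i\<close> copies of one letter. With the unit as letter this is the
  placement of a tensor behind a block of units, built from single splittings so that the recursion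
  of the morphism applies.\<close>

primrec padA where
 "padA A B a g n 0 t = t"
| "padA A B a g n (Suc i) t = consA A B (i + g) n a (padA A B a g n i t)"

primrec padB where
 "padB A B b n 0 t = t"
| "padB A B b n (Suc i) t = consB A B (i + n) b (padB A B b n i t)"

lemma padA:
 fixes A :: "('k::field, 'a::ab_group_add, 'm) vspace_scheme" and B :: "('k, 'b::ab_group_add, 'l) vspace_scheme"
 assumes A: "is_vspace A" and a: "a \<in>: A"
 shows "linear_on (tensor A B g n) fscale (padA A B a g n i)"
  and "t \<in>: tensor A B g n ==> padA A B a g n i t \<in>: tensor A B (i + g) n"
  and "(as, bs) \<in> words A B g n ==> (replicate i a @ as, bs) \<in> words A B (i + g) n"
  and "(as, bs) \<in> words A B g n ==> padA A B a g n i (pure A B g n (as, bs)) = pure A B (i + g) n (replicate i a @ as, bs)"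
proof -
 show c: "t \<in>: tensor A B g n ==> padA A B a g n i t \<in>: tensor A B (i + g) n" for i t
  by (induction i) (simp_all add: tensor_step_closed[OF tensor_step_consA[OF A] a])
 show "linear_on (tensor A B g n) fscale (padA A B a g n i)"
 proof (induction i)
  case (Suc i)
  show ?case
   unfolding padA.simps
   by (rule linear_on_via[OF bilinear_onD(1)[OF bilinear_consA[OF A] a]]) (simp_all add: Suc c)
 qed (simp add: linear_on_def)
 show w: "(as, bs) \<in> words A B g n ==> (replicate i a @ as, bs) \<in> words A B (i + g) n" for i
  using a by (auto simp: words_def)
 show "(as, bs) \<in> words A B g n ==> padA A B a g n i (pure A B g n (as, bs)) = pure A B (i + g) n (replicate i a @ as, bs)"
  by (induction i) (simp_all add: consA_pure[OF a w])
qed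

lemma padB:
 fixes A :: "('k::field, 'a::ab_group_add, 'm) vspace_scheme" and B :: "('k, 'b::ab_group_add, 'l) vspace_scheme"
 assumes B: "is_vspace B" and b: "b \<in>: B"
 shows "linear_on (tensor A B 0 n) fscale (padB A B b n i)"
  and "t \<in>: tensor A B 0 n ==> padB A B b n i t \<in>: tensor A B 0 (i + n)"
  and "([], bs) \<in> words A B 0 n ==> ([], replicate i b @ bs) \<in> words A B 0 (i + n)"
  and "([], bs) \<in> words A B 0 n ==> padB A B b n i (pure A B 0 n ([], bs)) = pure A B 0 (i + n) ([], replicate i b @ bs)"
proof -
 show c: "t \<in>: tensor A B 0 n ==> padB A B b n i t \<in>: tensor A B 0 (i + n)" for i t
  by (induction i) (simp_all add: tensor_step_closed[OF tensor_step_consB[OF B] b])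
 show "linear_on (tensor A B 0 n) fscale (padB A B b n i)"
 proof (induction i)
  case (Suc i)
  show ?case
   unfolding padB.simps
   by (rule linear_on_via[OF bilinear_onD(1)[OF bilinear_consB[OF B] b]]) (simp_all add: Suc c)
 qed (simp add: linear_on_def)
 show w: "([], bs) \<in> words A B 0 n ==> ([], replicate i b @ bs) \<in> words A B 0 (i + n)" for i
  using b by (auto simp: words_def)
 show "([], bs) \<in> words A B 0 n ==> padB A B b n i (pure A B 0 n ([], bs)) = pure A B 0 (i + n) ([], replicate i b @ bs)"
  by (induction i) (simp_all add: consB_pure[OF b w])
qed

lemma alg_hom_cons:
 assumes C: "tensor_step M0 M1 M2 C" and e: "e \<in>: M0" and \<phi>: "alg_hom M2 B \<phi>" and one: "aone M2 = C e (aone M1)"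
  and mult: "\<And>t t'. t \<in>: M1 ==> t' \<in>: M1 ==> amult M2 (C e t) (C e t') = C e (amult M1 t t')"
 shows "alg_hom M1 B (%t. \<phi> (C e t))"
proof -
 note cl = tensor_step_closed[OF C e]
 have "linear_on M1 (vscale B) (%t. \<phi> (C e t))"
  by (rule linear_on_via[OF _ bilinear_onD(1)[OF tensor_stepD(4)[OF C] e] cl]) (use \<phi> in \<open>simp add: alg_hom_def\<close>)
 moreover have "\<phi> (C e (amult M1 t t')) = amult B (\<phi> (C e t)) (\<phi> (C e t'))" if "t \<in>: M1" "t' \<in>: M1" for t t'
  using \<phi> cl[OF that(1)] cl[OF that(2)] unfolding mult[OF that, symmetric] alg_hom_def by blast
 ultimately show ?thesis
  using \<phi> cl one unfolding alg_hom_def by metis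
qed

lemma alg_hom_eq_step:
 assumes C: "tensor_step M0 M1 M2 C" and B: "vector_space (vscale B)" and \<phi>: "alg_hom M2 B \<phi>" and \<psi>: "alg_hom M2 B \<psi>"
  and e: "e \<in>: M0" and X: "X \<in>: M2"
  and j: "\<And>m. m \<in>: M0 ==> j m \<in>: M2" "\<And>m. m \<in>: M0 ==> \<phi> (j m) = \<psi> (j m)"
  and factor: "\<And>m t. m \<in>: M0 ==> t \<in>: M1 ==> amult M2 (j m) (C e t) = C m t"
  and rest: "\<And>t. t \<in>: M1 ==> \<phi> (C e t) = \<psi> (C e t)"
 shows "\<phi> X = \<psi> X"
proof (rule tensor_step_linear_eq[OF C B _ _ _ X])
 show "linear_on M2 (vscale B) \<phi>" "linear_on M2 (vscale B) \<psi>"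
  using \<phi> \<psi> by (simp_all add: alg_hom_def)
 fix m t assume m: "m \<in>: M0" and t: "t \<in>: M1"
 show "\<phi> (C m t) = \<psi> (C m t)"
  unfolding factor[OF m t, symmetric]
  using \<phi> \<psi> j[OF m] tensor_step_closed[OF C e t] rest[OF t] unfolding alg_hom_def by metis
qed

lemma alg_hom_restrict:
 assumes A: "is_alg A" and f: "alg_hom A B f"
 shows "alg_hom A B (restrict f (vcarrier A))"
 using f is_alg_closed[OF A] is_alg_one[OF A] is_vspace_add[OF is_alg_vspace[OF A]] is_vspace_scale[OF is_alg_vspace[OF A]]
 by (simp add: alg_hom_def linear_on_def)

context quasitriangular_bij
begin

text \<open>On a unit the action is by the counit, so in the first equation R disappears by its
  counit rule. In the second it survives, with its second leg inside \<open>D1\<close>; this is the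
  form of the prescribed values.\<close>

lemma phi_units:
 fixes M0 :: "('k, 'm0::ab_group_add) kalg" and M1 :: "('k, 'm1::ab_group_add) kalg"
  and B0 :: "('k, 'b0::ab_group_add) kalg" and B1 :: "('k, 'b1::ab_group_add) kalg" and B2 :: "('k, 'b2::ab_group_add) kalg"
 assumes ma: "is_modalg M0 act0" and mm0: "moment_map M0 act0 B0 \<Phi>0 D0" and mm1: "moment_map M1 act1 B1 \<Phi>1 D1"
  and C': "tensor_step B0 B1 B2 C'"
  and \<Phi>2C: "\<And>m n. m \<in>: M0 ==> n \<in>: M1 ==>
   \<Phi>2 (C m n) = rS H (%a b. C' (\<Phi>0 (act0 a m)) (amult B1 (D1 b) (\<Phi>1 n)))"
 shows "n \<in>: M1 ==> \<Phi>2 (C (aone M0) n) = C' (aone B0) (\<Phi>1 n)"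
  and "m \<in>: M0 ==> \<Phi>2 (C m (aone M1)) = rS H (%a b. C' (\<Phi>0 (act0 a m)) (D1 b))"
proof -
 note m0 = moment_mapD[OF mm0] and m1 = moment_mapD[OF mm1]
 note al = m0(1) m1(1) m0(4) m1(4) and bC' = tensor_stepD(4)[OF C'] and V = tensor_stepD(3)[OF C']
  and D1 = m1(10,9,12) and un = is_assoc_algD(2,3)[OF m1(3)]
 show "\<Phi>2 (C (aone M0) n) = C' (aone B0) (\<Phi>1 n)" if n: "n \<in>: M1"
 proof -
  have \<Phi>n: "\<Phi>1 n \<in>: B1" using mm1 n by (simp add: moment_map_def)
  have e: "C' (\<Phi>0 (act0 a (aone M0))) y = vscale B2 (counit H a) (C' (aone B0) y)" if "y \<in>: B1" for a y
   using ma mm0 linear_on_scale[of M0 "vscale B0" \<Phi>0, OF _ is_alg_one[OF al(1)]]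
    linear_on_scale[OF bilinear_onD(2)[OF bC' that] is_alg_one[OF al(3)]] by (simp add: is_modalg_def moment_map_def)
  have "\<Phi>2 (C (aone M0) n) = rS H (%a b. vscale B2 (counit H a) (C' (aone B0) (amult B1 (D1 b) (\<Phi>1 n))))"
   by (simp add: \<Phi>2C is_alg_one al n e is_alg_closed D1 \<Phi>n)
  also have "\<dots> = C' (aone B0) (amult B1 (D1 1) (\<Phi>1 n))"
   by (rule rS_counit_left[OF is_vspace_vector_space[OF V]])
    (rule hlin_linear[OF bilinear_onD(1)[OF bC' is_alg_one[OF al(3)]]
     hlin_linear[OF bilinear_onD(2)[OF is_alg_bilinear[OF al(4)] \<Phi>n] D1(2,1)]], rule is_alg_closed[OF al(4) D1(1) \<Phi>n])
  finally show ?thesis by (simp add: D1 un \<Phi>n)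
 qed
 show "\<Phi>2 (C m (aone M1)) = rS H (%a b. C' (\<Phi>0 (act0 a m)) (D1 b))" if "m \<in>: M0"
  using mm1 that by (simp add: \<Phi>2C is_alg_one al un D1 moment_map_def)
qed

definition unital_act :: "('k, 'm::ab_group_add) kalg => ('h => 'm => 'm) => bool"
 where "unital_act M act \<longleftrightarrow> (\<forall>h. act h (aone M) = vscale M (counit H h) (aone M)) \<and>
  (\<forall>m\<in>vcarrier M. amult M (aone M) m = m \<and> act 1 m = m)"

text \<open>The braiding is trivial when one of the two elements it acts on is a unit, because the
  action there is by the counit and \<epsilon> applied to either leg of R gives 1.\<close>

lemma unital_step:
 fixes M0 :: "('k, 'm0::ab_group_add) kalg" and M1 :: "('k, 'm1::ab_group_add) kalg"
  and M2 :: "('k, 'm2::ab_group_add) kalg"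
 assumes ma: "is_modalg M0 act0" and i1: "is_act M1 act1" and a1: "is_alg M1" and u1: "unital_act M1 act1"
  and C: "tensor_step M0 M1 M2 C" and M2: "is_alg M2" and act2: "is_act M2 act2"
  and MC: "\<And>m n m' n'. m \<in>: M0 ==> n \<in>: M1 ==> m' \<in>: M0 ==> n' \<in>: M1 ==>
   amult M2 (C m n) (C m' n') = rS H (%a b. C (amult M0 m (act0 a m')) (amult M1 (act1 b n) n'))"
  and one: "aone M2 = C (aone M0) (aone M1)"
  and act2C: "\<And>h m n. m \<in>: M0 ==> n \<in>: M1 ==>
   act2 h (C m n) = dS H h (%u v. C (act0 u m) (act1 v n))"
 shows "unital_act M2 act2"
  and "m \<in>: M0 ==> n \<in>: M1 ==> amult M2 (C m (aone M1)) (C (aone M0) n) = C m n"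
  and "n \<in>: M1 ==> n' \<in>: M1 ==> amult M2 (C (aone M0) n) (C (aone M0) n') = C (aone M0) (amult M1 n n')"
proof -
 note md = is_modalgD[OF ma]
 note a0 = md(1) and i0 = md(2) and V = tensor_stepD(3)[OF C] and bC = tensor_stepD(4)[OF C] and span = tensor_stepD(5)[OF C]
 note s = is_vspace_vector_space[OF V]
 note o0 = is_alg_one[OF a0] and o1 = is_alg_one[OF a1]
 note c = is_actD(1)[OF i0] is_actD(1)[OF i1]
 note hl = is_actD(3)[OF i0] is_actD(3)[OF i1]
 note u0 = md(7) and un = md(3-5)
 have u1': "act1 h (aone M1) = vscale M1 (counit H h) (aone M1)" for h using u1 by (simp add: unital_act_def)
 have un1: "amult M1 (aone M1) m = m" "act1 1 m = m" if "m \<in>: M1" for m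
  using u1 that by (simp_all add: unital_act_def)
 have s1: "amult M1 (vscale M1 k (aone M1)) y = vscale M1 k y" if "y \<in>: M1" for k y
  using linear_on_scale[OF bilinear_onD(2)[OF is_alg_bilinear[OF a1] that] o1] that by (simp add: un1)
 have s0: "amult M0 m (vscale M0 k (aone M0)) = vscale M0 k m" if "m \<in>: M0" for k m
  using linear_on_scale[OF bilinear_onD(1)[OF is_alg_bilinear[OF a0] that] o0] that by (simp add: un)
 note sC = linear_on_scale[OF bilinear_onD(1)[OF bC]] linear_on_scale[OF bilinear_onD(2)[OF bC]]
 note hC = hlin_linear[OF bilinear_onD(1)[OF bC]] hlin_linear[OF bilinear_onD(2)[OF bC]]
 have left: "amult M2 (C m (aone M1)) (C m' n) = C (amult M0 m m') n"
  if "m \<in>: M0" "m' \<in>: M0" "n \<in>: M1" for m m' n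
 proof -
  have "amult M2 (C m (aone M1)) (C m' n) = rS H (%a b. vscale M2 (counit H b) (C (amult M0 m (act0 a m')) n))"
   by (simp add: MC that o1 u1' s1 sC is_alg_closed a0 c)
  also have "\<dots> = C (amult M0 m (act0 1 m')) n"
   by (rule rS_counit_right[OF s])
    (rule hC(2)[OF that(3) hlin_linear[OF bilinear_onD(1)[OF is_alg_bilinear[OF a0] that(1)] hl(1)[OF that(2)] c(1)[OF that(2)]]],
     intro is_alg_closed a0 c that)
  finally show ?thesis by (simp add: un that)
 qed
 show "amult M2 (C m (aone M1)) (C (aone M0) n) = C m n" if "m \<in>: M0" "n \<in>: M1"
  using left[OF that(1) o0 that(2)] that by (simp add: un)
 show "amult M2 (C (aone M0) n) (C (aone M0) n') = C (aone M0) (amult M1 n n')" if "n \<in>: M1" "n' \<in>: M1"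
 proof -
  have "amult M2 (C (aone M0) n) (C (aone M0) n') = rS H (%a b. vscale M2 (counit H a) (C (aone M0) (amult M1 (act1 b n) n')))"
   by (simp add: MC that o0 u0 s0 sC is_alg_closed a1 c)
  also have "\<dots> = C (aone M0) (amult M1 (act1 1 n) n')"
   by (rule rS_counit_left[OF s])
    (rule hC(1)[OF o0 hlin_linear[OF bilinear_onD(2)[OF is_alg_bilinear[OF a1] that(2)] hl(2)[OF that(1)] c(2)[OF that(1)]]],
     intro is_alg_closed a1 c that)
  finally show ?thesis by (simp add: un1 that)
 qed
 have l1: "amult M2 (aone M2) Y = Y" if Y: "Y \<in>: M2" for Y
 proof (rule span_linear_eq[OF V span s bilinear_onD(1)[OF is_alg_bilinear[OF M2] is_alg_one[OF M2]] _ _ Y])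
  fix Y assume "Y \<in> {C v w |v w. v \<in>: M0 \<and> w \<in>: M1}"
  then show "amult M2 (aone M2) Y = Y" by (auto simp: one left o0 un)
 qed (simp add: linear_on_def)
 have l2: "act2 1 Y = Y" if Y: "Y \<in>: M2" for Y
 proof (rule span_linear_eq[OF V span s _ _ _ Y])
  show "linear_on M2 (vscale M2) (act2 1)" using act2 by (simp add: is_act_def)
  fix Y assume "Y \<in> {C v w |v w. v \<in>: M0 \<and> w \<in>: M1}"
  then obtain m n where Y: "Y = C m n" "m \<in>: M0" "n \<in>: M1" by blast
  have "act2 1 (C m n) = C (act0 1 m) (act1 1 n)"
   unfolding act2C[OF Y(2,3)]
   by (rule dS_one[OF s]) (rule hC(2)[OF c(2)[OF Y(3)] hl(1)[OF Y(2)] c(1)[OF Y(2)]], rule hC(1)[OF c(1)[OF Y(2)] hl(2)[OF Y(3)] c(2)[OF Y(3)]])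
  then show "act2 1 Y = Y" by (simp add: Y un un1)
 qed (simp add: linear_on_def)
 have "act2 h (aone M2) = vscale M2 (counit H h) (aone M2)" for h
 proof -
  have sc1: "vscale M1 k (aone M1) \<in>: M1" for k by (rule is_vspace_scale[OF is_alg_vspace[OF a1] o1])
  have "act2 h (aone M2) = dS H h (%u v. vscale M2 (counit H u) (vscale M2 (counit H v) (C (aone M0) (aone M1))))"
   by (simp add: one act2C o0 o1 u0 u1' sC sc1)
  also have "\<dots> = vscale M2 (counit H h) (aone M2)"
   unfolding one by (rule dS_counit_left) (intro hlin_intros s)
  finally show ?thesis .
 qed
 then show "unital_act M2 act2" using l1 l2 by (simp add: unital_act_def)
qed

lemma step_graph:
 "tensor_step (L10 H) (GA g n) (GA (Suc g) n) (cA g n)"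
 "tensor_step (L01 H) (GA 0 n) (GA 0 (Suc n)) (cB n)"
 using step_liftA[OF graph_simps(1)[of "Suc g" n], of g n] step_liftB[OF graph_simps(1)[of 0 "Suc n"], of n]
 by (simp_all add: step_lift_def)

lemma unital_graph: "unital_act (GA g n) (coad H g n)"
proof -
 have z: "unital_act (GA 0 0) (coad H 0 0)"
 proof -
  let ?e = "Lpure H 0 0 ([], [])"
  have one: "aone (GA 0 0) = ?e" by (simp add: graph_alg_def)
  have f1: "fscale 1 X = X" for X :: "('k, 'h) graph_elt" by (simp add: fscale_def)
  have "graph_mult H 0 0 ?e X = X \<and> coad H 0 0 1 X = X" if "X \<in>: Lten 0 0" for X
  proof -
   obtain c where X: "X = fscale c ?e" using \<open>X \<in> _\<close> by (rule tensor_0)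
   have "?e \<in>: GA 0 0" using is_alg_one[OF is_alg_graph, of 0 0] one by simp
   then have "coad H 0 0 1 (fscale c ?e) = fscale c (coad H 0 0 1 ?e)"
    using coad_act[of 0 0] linear_on_scale[of "GA 0 0" fscale "coad H 0 0 1" ?e c] by (simp add: is_act_def)
   then show ?thesis using graph_mult_0[of 1 c] by (simp add: X f1 coad_0 counit_one del: graph_mult.simps)
  qed
  then show ?thesis by (simp add: unital_act_def one coad_0 del: graph_mult.simps)
 qed
 have B: "unital_act (GA 0 n) (coad H 0 n)" for n
 proof (induction n)
  case (Suc n)
  show ?case
   by (rule unital_step(1)[OF modalg_L01 coad_act is_alg_graph Suc step_graph(2) is_alg_graph coad_act])
    (rule graph_mult_cB aone_graph(2) coad_cB; assumption?)+
 qed (rule z)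
 show ?thesis
 proof (induction g)
  case (Suc g)
  show ?case
   by (rule unital_step(1)[OF modalg_L10 coad_act is_alg_graph Suc step_graph(1) is_alg_graph coad_act])
    (rule graph_mult_cA aone_graph(1) coad_cA; assumption?)+
 qed (rule B)
qed

lemma graph_mult_units_A:
 shows "m \<in>: L10 H ==> t \<in>: GA g n ==>
   amult (GA (Suc g) n) (cA g n m (aone (GA g n))) (cA g n (aone (L10 H)) t) = cA g n m t"
  and "t \<in>: GA g n ==> t' \<in>: GA g n ==>
   amult (GA (Suc g) n) (cA g n (aone (L10 H)) t) (cA g n (aone (L10 H)) t') =
   cA g n (aone (L10 H)) (amult (GA g n) t t')"
proof -
 note u = modalg_L10 coad_act[of g n] is_alg_graph[of g n] unital_graph[of g n] step_graph(1)[of g n] is_alg_graph coad_act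
 show "m \<in>: L10 H ==> t \<in>: GA g n ==>
   amult (GA (Suc g) n) (cA g n m (aone (GA g n))) (cA g n (aone (L10 H)) t) = cA g n m t"
  by (rule unital_step(2)[OF u]) (rule graph_mult_cA aone_graph(1) coad_cA; assumption?)+
 show "t \<in>: GA g n ==> t' \<in>: GA g n ==>
   amult (GA (Suc g) n) (cA g n (aone (L10 H)) t) (cA g n (aone (L10 H)) t') =
   cA g n (aone (L10 H)) (amult (GA g n) t t')"
  by (rule unital_step(3)[OF u]) (rule graph_mult_cA aone_graph(1) coad_cA; assumption?)+
qed

lemma graph_mult_units_B:
 shows "m \<in>: L01 H ==> t \<in>: GA 0 n ==>
   amult (GA 0 (Suc n)) (cB n m (aone (GA 0 n))) (cB n (aone (L01 H)) t) = cB n m t"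
  and "t \<in>: GA 0 n ==> t' \<in>: GA 0 n ==>
   amult (GA 0 (Suc n)) (cB n (aone (L01 H)) t) (cB n (aone (L01 H)) t') =
   cB n (aone (L01 H)) (amult (GA 0 n) t t')"
proof -
 note u = modalg_L01 coad_act[of 0 n] is_alg_graph[of 0 n] unital_graph[of 0 n] step_graph(2)[of n] is_alg_graph coad_act
 show "m \<in>: L01 H ==> t \<in>: GA 0 n ==>
   amult (GA 0 (Suc n)) (cB n m (aone (GA 0 n))) (cB n (aone (L01 H)) t) = cB n m t"
  by (rule unital_step(2)[OF u]) (rule graph_mult_cB aone_graph(2) coad_cB; assumption?)+
 show "t \<in>: GA 0 n ==> t' \<in>: GA 0 n ==>
   amult (GA 0 (Suc n)) (cB n (aone (L01 H)) t) (cB n (aone (L01 H)) t') =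
   cB n (aone (L01 H)) (amult (GA 0 n) t t')"
  by (rule unital_step(3)[OF u]) (rule graph_mult_cB aone_graph(2) coad_cB; assumption?)+
qed

lemma Phi_cA:
 assumes "m \<in>: L10 H" "t \<in>: GA g n"
 shows "Phi (Suc g) n (cA g n m t) = rS H (%a b. tA g n (Phi10 H (coad10 H a m)) (amult (TA g n) (Dmap H g n b) (Phi g n t)))"
proof -
 have T: "step_lift (L10 H) (GA g n) (GA (Suc g) n) (cA g n) (vscale (TA (Suc g) n)) (liftA g n)"
  by (rule step_liftA) simp
 show ?thesis
  by (rule phi_lift(2)[OF moment_map_L10 moment_map_Phi T step_target(1) _ assms]) simp
qed

lemma Phi_cB:
 assumes "m \<in>: L01 H" "t \<in>: GA 0 n"
 shows "Phi 0 (Suc n) (cB n m t) = rS H (%a b. tB n (Phi01 H (coad01 H a m)) (amult (TA 0 n) (Dmap H 0 n b) (Phi 0 n t)))"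
proof -
 have T: "step_lift (L01 H) (GA 0 n) (GA 0 (Suc n)) (cB n) (vscale (TA 0 (Suc n))) (liftB n)"
  by (rule step_liftB) simp
 show ?thesis
  by (rule phi_lift(2)[OF moment_map_L01 moment_map_Phi T step_target(2) _ assms]) simp
qed

lemma Phi_units_A:
 shows "t \<in>: GA g n ==> Phi (Suc g) n (cA g n (aone (L10 H)) t) = tA g n (aone (HH H)) (Phi g n t)"
  and "m \<in>: L10 H ==> Phi (Suc g) n (cA g n m (aone (GA g n))) =
   rS H (%a b. tA g n (Phi10 H (coad10 H a m)) (Dmap H g n b))"
proof -
 note u = modalg_L10 moment_map_L10 moment_map_Phi[of g n] step_target(1)[of g n]
 show "t \<in>: GA g n ==> Phi (Suc g) n (cA g n (aone (L10 H)) t) = tA g n (aone (HH H)) (Phi g n t)"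
  by (rule phi_units(1)[OF u, where C = "cA g n"]) (rule Phi_cA)
 show "m \<in>: L10 H ==> Phi (Suc g) n (cA g n m (aone (GA g n))) =
   rS H (%a b. tA g n (Phi10 H (coad10 H a m)) (Dmap H g n b))"
  by (rule phi_units(2)[OF u, where C = "cA g n"]) (rule Phi_cA)
qed

lemma Phi_units_B:
 shows "t \<in>: GA 0 n ==> Phi 0 (Suc n) (cB n (aone (L01 H)) t) = tB n (aone (Halg H)) (Phi 0 n t)"
  and "m \<in>: L01 H ==> Phi 0 (Suc n) (cB n m (aone (GA 0 n))) =
   rS H (%a b. tB n (Phi01 H (coad01 H a m)) (Dmap H 0 n b))"
proof -
 note u = modalg_L01 moment_map_L01 moment_map_Phi[of 0 n] step_target(2)[of n]
 show "t \<in>: GA 0 n ==> Phi 0 (Suc n) (cB n (aone (L01 H)) t) = tB n (aone (Halg H)) (Phi 0 n t)"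
  by (rule phi_units(1)[OF u, where C = "cB n"]) (rule Phi_cB)
 show "m \<in>: L01 H ==> Phi 0 (Suc n) (cB n m (aone (GA 0 n))) =
   rS H (%a b. tB n (Phi01 H (coad01 H a m)) (Dmap H 0 n b))"
  by (rule phi_units(2)[OF u, where C = "cB n"]) (rule Phi_cB)
qed

lemma ones_words: "(replicate g (aone (L10 H)), replicate n (aone (L01 H))) \<in> Lwords g n"
 using is_alg_one[OF is_alg_L10] is_alg_one[OF is_alg_L01] by (auto simp: words_def simp del: L10_simps vspace_L01)

lemma handle_words:
 "x \<in>: L10 H ==> k \<in> {1..g} ==>
  (replicate (k - 1) (aone (L10 H)) @ x # replicate (g - k) (aone (L10 H)), replicate n (aone (L01 H))) \<in> Lwords g n"
 using ones_words[of g n] is_alg_one[OF is_alg_L10] by (auto simp: words_def simp del: L10_simps vspace_L01)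

lemma puncture_words:
 "x \<in>: L01 H ==> l \<in> {1..n} ==>
  (replicate g (aone (L10 H)), replicate (l - 1) (aone (L01 H)) @ x # replicate (n - l) (aone (L01 H))) \<in> Lwords g n"
 using ones_words[of g n] is_alg_one[OF is_alg_L01] by (auto simp: words_def simp del: L10_simps vspace_L01)

lemma j_first:
 shows "x \<in>: L10 H ==> j_handle H (Suc g) n 1 x = cA g n x (aone (GA g n))"
  and "y \<in>: L01 H ==> j_puncture H 0 (Suc n) 1 y = cB n y (aone (GA 0 n))"
 using consA_pure[OF _ ones_words[of g n]] consB_pure[OF _ ones_words[of 0 n, simplified replicate_0]]
 by (simp_all add: j_handle_def j_puncture_def graph_alg_def del: L10_simps vspace_L01)

lemma j_next:
 shows "x \<in>: L10 H ==> k \<in> {1..g} ==> cA g n (aone (L10 H)) (j_handle H g n k x) = j_handle H (Suc g) n (Suc k) x"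
  and "y \<in>: L01 H ==> l \<in> {1..n} ==> cA g n (aone (L10 H)) (j_puncture H g n l y) = j_puncture H (Suc g) n l y"
  and "y \<in>: L01 H ==> l \<in> {1..n} ==> cB n (aone (L01 H)) (j_puncture H 0 n l y) = j_puncture H 0 (Suc n) (Suc l) y"
proof -
 show "cA g n (aone (L10 H)) (j_handle H g n k x) = j_handle H (Suc g) n (Suc k) x" if xk: "x \<in>: L10 H" "k \<in> {1..g}"
 proof -
  obtain i where "k = Suc i" using xk(2) by (cases k) auto
  then show ?thesis
   using consA_pure[OF is_alg_one[OF is_alg_L10] handle_words[OF xk]] by (simp add: j_handle_def del: L10_simps vspace_L01)
 qed
 show "cA g n (aone (L10 H)) (j_puncture H g n l y) = j_puncture H (Suc g) n l y" if "y \<in>: L01 H" "l \<in> {1..n}"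
  using consA_pure[OF is_alg_one[OF is_alg_L10] puncture_words[OF that]] by (simp add: j_puncture_def del: L10_simps vspace_L01)
 show "cB n (aone (L01 H)) (j_puncture H 0 n l y) = j_puncture H 0 (Suc n) (Suc l) y" if yl: "y \<in>: L01 H" "l \<in> {1..n}"
 proof -
  obtain i where "l = Suc i" using yl(2) by (cases l) auto
  then show ?thesis
   using consB_pure[OF is_alg_one[OF is_alg_L01] puncture_words[OF yl, of 0, simplified replicate_0]]
   by (simp add: j_puncture_def del: L10_simps vspace_L01)
 qed
qed

lemma j_closed:
 shows "x \<in>: L10 H ==> k \<in> {1..g} ==> j_handle H g n k x \<in>: GA g n"
  and "y \<in>: L01 H ==> l \<in> {1..n} ==> j_puncture H g n l y \<in>: GA g n"
 unfolding j_handle_def j_puncture_def graph_simps by (intro pure_closed handle_words puncture_words; assumption)+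

section \<open>Generators determine the morphism\<close>

definition gens_agree :: "nat => nat => (('k, 'h) graph_elt => 'b) => (('k, 'h) graph_elt => 'b) => bool"
 where "gens_agree g n \<phi> \<psi> \<longleftrightarrow>
  (\<forall>l\<in>{1..n}. \<forall>y\<in>vcarrier (L01 H). \<phi> (j_puncture H g n l y) = \<psi> (j_puncture H g n l y)) \<and>
  (\<forall>k\<in>{1..g}. \<forall>x\<in>vcarrier (L10 H). \<phi> (j_handle H g n k x) = \<psi> (j_handle H g n k x))"

text \<open>Quantified over all pairs of morphisms into \<open>B\<close>, so that the induction
  hypothesis applies to their restrictions to the remaining factors, where the first letter is a
  unit.\<close>

definition determined :: "nat => nat => ('k, 'b::ab_group_add) kalg => bool"
 where "determined g n B \<longleftrightarrow> (\<forall>\<phi> \<psi>. alg_hom (GA g n) B \<phi> \<longrightarrow> alg_hom (GA g n) B \<psi> \<longrightarrow>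
  gens_agree g n \<phi> \<psi> \<longrightarrow> (\<forall>X\<in>vcarrier (GA g n). \<phi> X = \<psi> X))"

lemma determined_A:
 fixes B :: "('k, 'b::ab_group_add) kalg"
 assumes B: "vector_space (vscale B)" and IH: "determined g n B"
 shows "determined (Suc g) n B"
 unfolding determined_def
proof (intro allI impI)
 fix \<phi> \<psi>
 assume \<phi>: "alg_hom (GA (Suc g) n) B \<phi>" and \<psi>: "alg_hom (GA (Suc g) n) B \<psi>"
  and gens: "gens_agree (Suc g) n \<phi> \<psi>"
 let ?o = "aone (L10 H)" and ?j = "j_handle H (Suc g) n 1"
 note o = is_alg_one[OF is_alg_L10]
 have hom: "alg_hom (GA g n) B (%t. \<chi> (cA g n ?o t))" if "alg_hom (GA (Suc g) n) B \<chi>" for \<chi>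
 proof (rule alg_hom_cons[where C = "cA g n" and e = ?o and \<phi> = \<chi>, OF step_graph(1) o that aone_graph(1)])
  show "amult (GA (Suc g) n) (cA g n ?o t) (cA g n ?o t') = cA g n ?o (amult (GA g n) t t')"
   if "t \<in>: GA g n" "t' \<in>: GA g n" for t t'
   by (rule graph_mult_units_A(2)[OF that])
 qed
 show "\<forall>X\<in>vcarrier (GA (Suc g) n). \<phi> X = \<psi> X"
 proof (rule ballI, rule alg_hom_eq_step[where j = ?j, OF step_graph(1) B \<phi> \<psi> o])
  show "?j m \<in>: GA (Suc g) n" if "m \<in>: L10 H" for m
   using j_closed(1)[OF that, of 1 "Suc g" n] by simp
  show "\<phi> (?j m) = \<psi> (?j m)" if "m \<in>: L10 H" for m
   using gens that by (simp add: gens_agree_def del: L10_simps)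
  show "amult (GA (Suc g) n) (?j m) (cA g n ?o t) = cA g n m t"
   if "m \<in>: L10 H" "t \<in>: GA g n" for m t
   by (simp only: j_first(1)[OF that(1)] graph_mult_units_A(1)[OF that])
  have "gens_agree g n (%t. \<phi> (cA g n ?o t)) (%t. \<psi> (cA g n ?o t))"
   using gens by (simp add: gens_agree_def j_next del: L10_simps vspace_L01)
  then show "\<phi> (cA g n ?o t) = \<psi> (cA g n ?o t)" if "t \<in>: GA g n" for t
   by (rule IH[unfolded determined_def, rule_format, where \<phi> = "%t. \<phi> (cA g n ?o t)" and \<psi> = "%t. \<psi> (cA g n ?o t)", OF hom[OF \<phi>] hom[OF \<psi>] _ that])
 qed
qed

lemma determined_B:
 fixes B :: "('k, 'b::ab_group_add) kalg"
 assumes B: "vector_space (vscale B)" and IH: "determined 0 n B"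
 shows "determined 0 (Suc n) B"
 unfolding determined_def
proof (intro allI impI)
 fix \<phi> \<psi>
 assume \<phi>: "alg_hom (GA 0 (Suc n)) B \<phi>" and \<psi>: "alg_hom (GA 0 (Suc n)) B \<psi>"
  and gens: "gens_agree 0 (Suc n) \<phi> \<psi>"
 let ?o = "aone (L01 H)" and ?j = "j_puncture H 0 (Suc n) 1"
 note o = is_alg_one[OF is_alg_L01]
 have hom: "alg_hom (GA 0 n) B (%t. \<chi> (cB n ?o t))" if "alg_hom (GA 0 (Suc n)) B \<chi>" for \<chi>
 proof (rule alg_hom_cons[where C = "cB n" and e = ?o and \<phi> = \<chi>, OF step_graph(2) o that aone_graph(2)])
  show "amult (GA 0 (Suc n)) (cB n ?o t) (cB n ?o t') = cB n ?o (amult (GA 0 n) t t')"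
   if "t \<in>: GA 0 n" "t' \<in>: GA 0 n" for t t'
   by (rule graph_mult_units_B(2)[OF that])
 qed
 show "\<forall>X\<in>vcarrier (GA 0 (Suc n)). \<phi> X = \<psi> X"
 proof (rule ballI, rule alg_hom_eq_step[where j = ?j, OF step_graph(2) B \<phi> \<psi> o])
  show "?j m \<in>: GA 0 (Suc n)" if "m \<in>: L01 H" for m
   using j_closed(2)[OF that, of 1 "Suc n" 0] by simp
  show "\<phi> (?j m) = \<psi> (?j m)" if "m \<in>: L01 H" for m
   using gens that by (simp add: gens_agree_def del: vspace_L01)
  show "amult (GA 0 (Suc n)) (?j m) (cB n ?o t) = cB n m t"
   if "m \<in>: L01 H" "t \<in>: GA 0 n" for m t
   by (simp only: j_first(2)[OF that(1)] graph_mult_units_B(1)[OF that])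
  have "gens_agree 0 n (%t. \<phi> (cB n ?o t)) (%t. \<psi> (cB n ?o t))"
   using gens by (simp add: gens_agree_def j_next del: L10_simps vspace_L01)
  then show "\<phi> (cB n ?o t) = \<psi> (cB n ?o t)" if "t \<in>: GA 0 n" for t
   by (rule IH[unfolded determined_def, rule_format, where \<phi> = "%t. \<phi> (cB n ?o t)" and \<psi> = "%t. \<psi> (cB n ?o t)", OF hom[OF \<phi>] hom[OF \<psi>] _ that])
 qed
qed

lemma determined_graph:
 fixes B :: "('k, 'b::ab_group_add) kalg"
 assumes B: "vector_space (vscale B)"
 shows "determined g n B"
proof (induction g)
 case 0
 show ?case
 proof (induction n)
  case 0
  have e: "aone (GA 0 0) = Lpure H 0 0 ([], [])" by (simp add: graph_alg_def)
  have "\<chi> (fscale c (Lpure H 0 0 ([], []))) = vscale B c (aone B)" if "alg_hom (GA 0 0) B \<chi>" for \<chi> c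
   using that linear_on_scale[of "GA 0 0" "vscale B" \<chi> "aone (GA 0 0)" c] is_alg_one[OF is_alg_graph[of 0 0]]
   by (simp add: alg_hom_def e)
  then show ?case
   unfolding determined_def graph_simps(2) by (metis tensor_0)
 qed (rule determined_B[OF B])
qed (rule determined_A[OF B])

section \<open>Values of the constructed map on the generators\<close>

abbreviation "tpA \<equiv> padA (HH H) (Halg H) (aone (HH H))"
abbreviation "tpB \<equiv> padB (HH H) (Halg H) 1"

text \<open>The index k is \<open>i + 1\<close> and \<open>g\<close> counts the handles after it,
  which avoids subtraction. Each of the \<open>i\<close> units in front is peeled off by
  \<open>Phi_units_A\<close> and reappears as a unit in the target.\<close>

lemma Phi_handle:
 assumes x: "x \<in>: L10 H"
 shows "Phi (i + Suc g) n (j_handle H (i + Suc g) n (Suc i) x) =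
  rS H (%a b. tpA (Suc g) n i (tA g n (Phi10 H (coad10 H a x)) (Dmap H g n b)))"
proof (induction i)
 case 0
 show ?case using Phi_units_A(2)[OF x, of g n] j_first(1)[OF x, of g n] by (simp add: One_nat_def del: Phi.simps)
next
 case (Suc i)
 have "Phi (Suc (i + Suc g)) n (j_handle H (Suc (i + Suc g)) n (Suc (Suc i)) x) =
  tA (i + Suc g) n (aone (HH H)) (Phi (i + Suc g) n (j_handle H (i + Suc g) n (Suc i) x))"
 proof -
  have j: "j_handle H (Suc (i + Suc g)) n (Suc (Suc i)) x = cA (i + Suc g) n (aone (L10 H)) (j_handle H (i + Suc g) n (Suc i) x)"
   by (rule j_next(1)[OF x, symmetric]) simp
  show ?thesis unfolding j by (rule Phi_units_A(1)[OF j_closed(1)[OF x]]) simp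
 qed
 also have "\<dots> = rS H (%a b. tA (i + Suc g) n (aone (HH H)) (tpA (Suc g) n i (tA g n (Phi10 H (coad10 H a x)) (Dmap H g n b))))"
  unfolding Suc
  by (rule linear_on_ssum[OF is_vspace_tensor bilinear_onD(1)[OF bilinear_consA[OF is_vspace_HH] is_alg_one[OF is_alg_HH]]])
   (intro padA(2)[OF is_vspace_HH is_alg_one[OF is_alg_HH]] tensor_step_closed[OF tensor_step_consA[OF is_vspace_HH]] Phi10_closed coad10_closed x Dmap_closed)
 finally show ?case by simp
qed

text \<open>The inner induction peels off the units of earlier punctures and the outer one those of
  the handles, corresponding to the two kinds of padding.\<close>

lemma Phi_puncture:
 assumes x: "x \<in>: L01 H"
 shows "Phi g (i + Suc n) (j_puncture H g (i + Suc n) (Suc i) x) =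
  rS H (%a b. tpA 0 (i + Suc n) g (tpB (Suc n) i
   (tB n (Phi01 H (coad01 H a x)) (Dmap H 0 n b))))"
proof (induction g)
 case 0
 show ?case
 proof (induction i)
  case 0
  show ?case using Phi_units_B(2)[OF x, of n] j_first(2)[OF x, of n] by (simp add: One_nat_def del: Phi.simps)
 next
  case (Suc i)
  have "Phi 0 (Suc (i + Suc n)) (j_puncture H 0 (Suc (i + Suc n)) (Suc (Suc i)) x) =
   tB (i + Suc n) 1 (Phi 0 (i + Suc n) (j_puncture H 0 (i + Suc n) (Suc i) x))"
  proof -
   have j: "j_puncture H 0 (Suc (i + Suc n)) (Suc (Suc i)) x = cB (i + Suc n) (aone (L01 H)) (j_puncture H 0 (i + Suc n) (Suc i) x)"
    by (rule j_next(3)[OF x, symmetric]) simp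
   show ?thesis unfolding j by (rule Phi_units_B(1)[OF j_closed(2)[OF x], unfolded Halg_one]) simp
  qed
  also have "\<dots> = rS H (%a b. tB (i + Suc n) 1 (tpB (Suc n) i (tB n (Phi01 H (coad01 H a x)) (Dmap H 0 n b))))"
   unfolding Suc padA.simps
   by (rule linear_on_ssum[OF is_vspace_tensor bilinear_onD(1)[OF bilinear_consB[OF is_vspace_Halg] Halg_UNIV]])
    (intro padB(2)[OF is_vspace_Halg] tensor_step_closed[OF tensor_step_consB[OF is_vspace_Halg]] Halg_UNIV Dmap_closed)
  finally show ?case by simp
 qed
next
 case (Suc g)
 have cl: "tpA 0 (i + Suc n) g (tpB (Suc n) i t) \<in>: Tten g (i + Suc n)"
  if "t \<in>: Tten 0 (Suc n)" for t
  using padA(2)[OF is_vspace_HH is_alg_one[OF is_alg_HH] padB(2)[OF is_vspace_Halg Halg_UNIV that, of 1 i], of g] by simp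
 have "Phi (Suc g) (i + Suc n) (j_puncture H (Suc g) (i + Suc n) (Suc i) x) =
  tA g (i + Suc n) (aone (HH H)) (Phi g (i + Suc n) (j_puncture H g (i + Suc n) (Suc i) x))"
 proof -
  have j: "j_puncture H (Suc g) (i + Suc n) (Suc i) x = cA g (i + Suc n) (aone (L10 H)) (j_puncture H g (i + Suc n) (Suc i) x)"
   by (rule j_next(2)[OF x, symmetric]) simp
  show ?thesis unfolding j by (rule Phi_units_A(1)[OF j_closed(2)[OF x]]) simp
 qed
 also have "\<dots> = rS H (%a b. tA g (i + Suc n) (aone (HH H)) (tpA 0 (i + Suc n) g (tpB (Suc n) i
   (tB n (Phi01 H (coad01 H a x)) (Dmap H 0 n b)))))"
  unfolding Suc
  by (rule linear_on_ssum[OF is_vspace_tensor bilinear_onD(1)[OF bilinear_consA[OF is_vspace_HH] is_alg_one[OF is_alg_HH]]])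
   (intro cl tensor_step_closed[OF tensor_step_consB[OF is_vspace_Halg]] Halg_UNIV Dmap_closed)
 finally show ?case by simp
qed

lemma linear_pad:
 "linear_on (Tten 0 n) fscale (%t. tpA 0 (i + n) g (tpB n i t))"
 by (rule linear_on_via[where W = "Tten 0 (i + n)" and K = "tpA 0 (i + n) g"
   and F = "tpB n i", unfolded vscale_tensor])
  (rule padA(1)[OF is_vspace_HH is_alg_one[OF is_alg_HH]], rule padB(1)[OF is_vspace_Halg Halg_UNIV], rule padB(2)[OF is_vspace_Halg Halg_UNIV])

lemma place_handle_pad:
 assumes y: "y \<in>: HH H" and t: "t \<in>: Tten g n"
 shows "place_handle H (i + Suc g) n (Suc i) y t = tpA (Suc g) n i (tA g n y t)"
proof -
 note o = is_alg_one[OF is_alg_HH]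
 have "place_handle H (i + Suc g) n (Suc i) y t =
  Tlift H g n (%(ys, hs). Tpure H (i + Suc g) n (replicate i (aone (HH H)) @ y # ys, hs)) t"
  by (simp add: place_handle_def)
 also have "\<dots> = tpA (Suc g) n i (tA g n y t)"
 proof (rule tlift_eqI[OF vector_space_fscale is_vspace_HH is_vspace_Halg _ _ t])
  show "linear_on (Tten g n) fscale (%t. tpA (Suc g) n i (tA g n y t))"
   by (rule linear_on_via[where F = "tA g n y", OF padA(1)[OF is_vspace_HH o], unfolded vscale_tensor])
    (rule bilinear_onD(1)[OF bilinear_consA[OF is_vspace_HH] y], rule tensor_step_closed[OF tensor_step_consA[OF is_vspace_HH] y])
  fix w assume "w \<in> words (HH H) (Halg H) g n"
  then obtain ys hs where w: "w = (ys, hs)" "(ys, hs) \<in> words (HH H) (Halg H) g n" by (cases w) simp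
  show "(case w of (ys, hs) => Tpure H (i + Suc g) n (replicate i (aone (HH H)) @ y # ys, hs)) =
   tpA (Suc g) n i (tA g n y (Tpure H g n w))"
   by (simp only: w(1) prod.case consA_pure[OF y w(2)] padA(4)[OF is_vspace_HH o words_ConsA[OF w(2) y]])
 qed
 finally show ?thesis .
qed

lemma place_puncture_pad:
 assumes t: "t \<in>: Tten 0 n"
 shows "place_puncture H g (i + Suc n) (Suc i) y t =
  tpA 0 (i + Suc n) g (tpB (Suc n) i (tB n y t))"
proof -
 note o = is_alg_one[OF is_alg_HH]
 have "place_puncture H g (i + Suc n) (Suc i) y t =
  Tlift H 0 n (%(_, hs). Tpure H g (i + Suc n) (replicate g (aone (HH H)), replicate i 1 @ y # hs)) t"
  by (simp add: place_puncture_def)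
 also have "\<dots> = tpA 0 (i + Suc n) g (tpB (Suc n) i (tB n y t))"
 proof (rule tlift_eqI[OF vector_space_fscale is_vspace_HH is_vspace_Halg _ _ t])
  show "linear_on (Tten 0 n) fscale (%t. tpA 0 (i + Suc n) g (tpB (Suc n) i (tB n y t)))"
   by (rule linear_on_via[where W = "Tten 0 (Suc n)" and F = "tB n y", OF linear_pad, unfolded vscale_tensor])
    (rule bilinear_onD(1)[OF bilinear_consB[OF is_vspace_Halg] Halg_UNIV], rule tensor_step_closed[OF tensor_step_consB[OF is_vspace_Halg] Halg_UNIV])
  fix w assume w0: "w \<in> words (HH H) (Halg H) 0 n"
  then obtain hs where w: "w = ([], hs)" "([], hs) \<in> words (HH H) (Halg H) 0 n" by (auto dest: words_0D)
  show "(case w of (_, hs) => Tpure H g (i + Suc n) (replicate g (aone (HH H)), replicate i 1 @ y # hs)) =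
   tpA 0 (i + Suc n) g (tpB (Suc n) i (tB n y (Tpure H 0 n w)))"
   by (simp only: w(1) prod.case consB_pure[OF Halg_UNIV w(2)] padB(4)[OF is_vspace_Halg Halg_UNIV words_ConsB[OF w(2) Halg_UNIV]]
    padA(4)[OF is_vspace_HH o padB(3)[OF is_vspace_Halg Halg_UNIV words_ConsB[OF w(2) Halg_UNIV]]] append_Nil2 add_0_right)
 qed
 finally show ?thesis .
qed

lemma Phi_j_handle:
 assumes k: "k \<in> {1..g}" and x: "x \<in>: L10 H"
 shows "Phi g n (j_handle H g n k x) = sumR H fscale (%a b. place_handle H g n k (Phi10 H (coad10 H a x)) (Dmap H (g - k) n b))"
proof -
 define i where "i = k - 1"
 define g' where "g' = g - k"
 have e: "k = Suc i" "g = i + Suc g'" "g - k = g'" using k by (simp_all add: i_def g'_def One_nat_def)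
 note o = is_alg_one[OF is_alg_HH]
 have c: "Phi10 H (coad10 H a x) \<in>: HH H" for a by (intro Phi10_closed coad10_closed x)
 have h: "hlin H fscale (%a. Phi10 H (coad10 H a x))"
  using hlin_linear[OF Phi10_lift(1), of H "%a. coad10 H a x"] hlin_coad10[OF x] coad10_closed[OF x] by simp
 note pl = hlin_linear[OF padA(1)[OF is_vspace_HH o], unfolded vscale_tensor]
 have "sumR H fscale (%a b. place_handle H g n k (Phi10 H (coad10 H a x)) (Dmap H (g - k) n b)) =
  sumR H fscale (%a b. tpA (Suc g') n i (tA g' n (Phi10 H (coad10 H a x)) (Dmap H g' n b)))"
  unfolding e(3) by (simp only: e(1,2) place_handle_pad c Dmap_closed)
 also have "\<dots> = rS H (%a b. tpA (Suc g') n i (tA g' n (Phi10 H (coad10 H a x)) (Dmap H g' n b)))"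
  by (rule sw_rmat[OF vector_space_fscale pl pl])
   (intro bilinear_consA_HH tensor_step_closed[OF tensor_step_consA[OF is_vspace_HH]] c h hlin_Dmap Dmap_closed)+
 also have "\<dots> = Phi g n (j_handle H g n k x)"
  unfolding e(1,2) by (rule Phi_handle[OF x, symmetric])
 finally show ?thesis ..
qed

lemma Phi_j_puncture:
 assumes l: "l \<in> {1..n}" and x: "x \<in>: L01 H"
 shows "Phi g n (j_puncture H g n l x) = sumR H fscale (%a b. place_puncture H g n l (Phi01 H (coad01 H a x)) (Dmap H 0 (n - l) b))"
proof -
 define i where "i = l - 1"
 define n' where "n' = n - l"
 have e: "l = Suc i" "n = i + Suc n'" "n - l = n'" using l by (simp_all add: i_def n'_def One_nat_def)
 note o = is_alg_one[OF is_alg_HH]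
 let ?p = "%t. tpA 0 (i + Suc n') g (tpB (Suc n') i t)"
 have h: "hlin H (hscale H) (%a. Phi01 H (coad01 H a x))"
  using x by (intro hlin_intros coad01_Hdual) simp_all
 note pl = hlin_linear[OF linear_pad, unfolded vscale_tensor]
 have "sumR H fscale (%a b. place_puncture H g n l (Phi01 H (coad01 H a x)) (Dmap H 0 (n - l) b)) =
  sumR H fscale (%a b. ?p (tB n' (Phi01 H (coad01 H a x)) (Dmap H 0 n' b)))"
  unfolding e(3) by (simp only: e(1,2) place_puncture_pad Dmap_closed)
 also have "\<dots> = rS H (%a b. ?p (tB n' (Phi01 H (coad01 H a x)) (Dmap H 0 n' b)))"
  by (rule sw_rmat[OF vector_space_fscale pl pl])
   (intro bilinear_consB_HH tensor_step_closed[OF tensor_step_consB[OF is_vspace_Halg]] Halg_UNIV h hlin_Dmap Dmap_closed)+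
 also have "\<dots> = Phi g n (j_puncture H g n l x)"
  unfolding e(1,2) by (rule Phi_puncture[OF x, symmetric])
 finally show ?thesis ..
qed

lemma alg_hom_Phi: "alg_hom (GA g n) (TA g n) (Phi g n)"
 using moment_map_Phi[of g n] by (simp add: moment_map_def alg_hom_def)

end

theorem theorem5p3:
  fixes H :: "('k::field, 'h::ring_1) qthopf" and g n :: nat
  assumes "quasitriangular_hopf_algebra H" and "bij (antipode H)"
  shows "\<exists>!\<Phi>. \<Phi> \<in> extensional (vcarrier (graph_alg H g n)) \<and>
    alg_hom (graph_alg H g n) (tensor_alg (HH H) (Halg H) g n) \<Phi> \<and>
    (\<forall>l\<in>{1..n}. \<forall>\<phi>\<in>vcarrier (L01 H).
      \<Phi> (j_puncture H g n l \<phi>) =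
        sumR H fscale (\<lambda>a b.
          place_puncture H g n l (Phi01 H (coad01 H a \<phi>)) (Dmap H 0 (n - l) b))) \<and>
    (\<forall>k\<in>{1..g}. \<forall>x\<in>vcarrier (L10 H).
      \<Phi> (j_handle H g n k x) =
        sumR H fscale (\<lambda>a b.
          place_handle H g n k (Phi10 H (coad10 H a x)) (Dmap H (g - k) n b)))"
    (is "\<exists>!\<Phi>. ?P \<Phi>")
proof -
  interpret quasitriangular_bij H
    using assms by (simp add: quasitriangular_bij_def quasitriangular_bij_axioms_def)
  show ?thesis
  proof (rule ex1I)
    \<comment> \<open>The recursive map also has values outside the carrier. Restricting it selects
      the extensional representative, for which uniqueness is equality of functions.\<close>
    let ?r = "restrict (Phi g n) (vcarrier (graph_alg H g n))"
    have p: "?r (j_puncture H g n l \<phi>) = sumR H fscale (\<lambda>a b. place_puncture H g n l (Phi01 H (coad01 H a \<phi>)) (Dmap H 0 (n - l) b))"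
      if "l \<in> {1..n}" "\<phi> \<in> vcarrier (L01 H)" for l \<phi>
      unfolding Phi_j_puncture[OF that, symmetric] using j_closed(2)[OF that(2,1)] by (rule restrict_apply')
    have h: "?r (j_handle H g n k x) = sumR H fscale (\<lambda>a b. place_handle H g n k (Phi10 H (coad10 H a x)) (Dmap H (g - k) n b))"
      if "k \<in> {1..g}" "x \<in> vcarrier (L10 H)" for k x
      unfolding Phi_j_handle[OF that, symmetric] using j_closed(1)[OF that(2,1)] by (rule restrict_apply')
    show "?P ?r"
      by (intro conjI ballI restrict_extensional alg_hom_restrict[OF is_alg_graph alg_hom_Phi]) (rule p h; assumption)+
    fix \<Psi> assume \<Psi>: "?P \<Psi>"
    show "\<Psi> = restrict (Phi g n) (vcarrier (graph_alg H g n))"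
    proof (rule extensionalityI)
      show "\<Psi> \<in> extensional (vcarrier (graph_alg H g n))" using \<Psi> by blast
      fix X assume X: "X \<in> vcarrier (graph_alg H g n)"
      have "gens_agree g n \<Psi> (Phi g n)"
        unfolding gens_agree_def
      proof (intro conjI ballI)
        show "\<Psi> (j_puncture H g n l y) = Phi g n (j_puncture H g n l y)" if "l \<in> {1..n}" "y \<in> vcarrier (L01 H)" for l y
          unfolding Phi_j_puncture[OF that] using \<Psi> that by blast
        show "\<Psi> (j_handle H g n k x) = Phi g n (j_handle H g n k x)" if "k \<in> {1..g}" "x \<in> vcarrier (L10 H)" for k x
          unfolding Phi_j_handle[OF that] using \<Psi> that by blast
      qed
      moreover have "determined g n (TA g n)" by (rule determined_graph) (simp add: vector_space_fscale)
      ultimately have "\<Psi> X = Phi g n X"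
        using \<Psi> alg_hom_Phi X unfolding determined_def by blast
      then show "\<Psi> X = restrict (Phi g n) (vcarrier (graph_alg H g n)) X" using X by simp
    qed (rule restrict_extensional)
  qed
qed

end
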